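(* Let $C=\operatorname{Spec}A_0$ be a smooth affine curve over $\mathbb{C}$, $D_+,D_-$ $\mathbb{Q}$-divisors on $C$ with $D_++D_-\le0$, and $A=A_0[D_+,D_-]$, $V=\operatorname{Spec}A$. With the points $a_1,\dots,a_k,b_1,\dots,b_l\in C$, the integers $e_i,m_i,e_j^\pm,m_j^\pm$ and the curves $O_i,\bar O_j^\pm\subseteq V$ as defined in the context, the divisor class group $\operatorname{Cl}A$ of $A$ is the group $$\pi^*(\operatorname{Cl}A_0)\oplus\bigoplus_{i=1}^k\mathbb{Z}[O_i]\oplus\bigoplus_{j=1}^l\left(\mathbb{Z}[\bar O_j^+]\oplus\mathbb{Z}[\bar O_j^-]\right)$$ modulo the relations $$\begin{array}{rcl}\pi^*(a_i)&=&m_i[O_i],\quad i=1,\ldots,k,\\ \pi^*(b_j)&=&m_j^+[\bar O_j^+]-m_j^-[\bar O_j^-],\quad j=1,\ldots,l,\\ 0&=&\sum_{i=1}^ke_i[O_i]+\sum_{j=1}^l\left(e_j^+[\bar O_j^+]-e_j^-[\bar O_j^-]\right).\end{array}$$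
   Context: For a $\mathbb{Q}$-divisor $D=\sum D(a)\,a$ on $C$, $\lfloor D\rfloor=\sum\lfloor D(a)\rfloor a$. The normal graded $A_0$-algebra $A_0[D_+,D_-]=\bigoplus_{n\in\mathbb{Z}}A_n\subseteq\operatorname{Frac}(A_0)[u,u^{-1}]$ ($\deg u=1$) is defined by $A_n=H^0(C,\mathcal{O}_C(\lfloor nD_+\rfloor))\cdot u^n$, $A_{-n}=H^0(C,\mathcal{O}_C(\lfloor nD_-\rfloor))\cdot u^{-n}$ for $n\ge0$; $\pi:V\to C$ is induced by $A_0\subseteq A$, and the grading gives a $\mathbb{C}^*$-action on $V$. Let $a_1,\ldots,a_k$ be the points $a\in C$ with $D_+(a)=-D_-(a)\ne0$ and $b_1,\ldots,b_l$ the points $b\in C$ with $D_+(b)+D_-(b)<0$. Write $D_\pm(a_i)=\mp\frac{e_i}{m_i}$, $D_+(b_j)=-\frac{e_j^+}{m_j^+}$, $D_-(b_j)=\frac{e_j^-}{m_j^-}$ with integers satisfying $m_i>0$, $m_j^+>0$, $m_j^-<0$, $\gcd(e_i,m_i)=\gcd(e_j^+,m_j^+)=\gcd(e_j^-,m_j^-)=1$ (so $m_j^+=1$ if $D_+(b_j)=0$ and $m_j^-=-1$ if $D_-(b_j)=0$). The fiber $\pi^{-1}(a_i)$ is a single $\mathbb{C}^*$-orbit $O_i$, and $\pi^{-1}(b_j)=\bar O_j^+\cup\bar O_j^-$ is a union of two orbit closures, with $\pi^*(a_i)=m_iO_i$, $\pi^*(b_j)=m_j^+\bar O_j^+-m_j^-\bar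 O_j^-$ as divisors on $V$; the labelling $\pm$ is such that $\bar O_j^\pm$ appears with coefficient $\mp e_j^\pm$ in the divisor $\operatorname{div}u$ on $V$ (explicitly, the orbit $O_j^\pm$ is the one on which homogeneous elements of $A$ of positive, respectively negative, degree do not all vanish). In the presentation, $\pi^*(\operatorname{Cl}A_0)$ denotes a copy of $\operatorname{Cl}A_0$, and $\pi^*(a)$, for $a\in C$, the element of it corresponding to the class of the point $a$. *)

theory Defs
  imports
    Complex_Main
    "HOL-Algebra.Algebraic_Closure_Type"
    "HOL-Algebra.Free_Abelian_Groups"
    "HOL-Algebra.Generated_Rings"
    "HOL-Computational_Algebra.Formal_Laurent_Series"
begin

text \<open>Integral domains are represented as subrings \<open>R\<close> of a field (a type of class
  \<^class>\<open>field\<close>); the field of fractions of \<open>R\<close> and the local rings of \<open>R\<close> are then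
  subsets of that field.\<close>

abbreviation subring_of_field :: "'f::field set \<Rightarrow> 'f ring" where
  "subring_of_field R \<equiv> ring_of_type_algebra\<lparr>carrier := R\<rparr>"

definition fraction_set :: "'f::field set \<Rightarrow> 'f set" where
  "fraction_set R = {a / b | a b. a \<in> R \<and> b \<in> R \<and> b \<noteq> 0}"

definition closed_points :: "'f::field set \<Rightarrow> 'f set set" where
  "closed_points R = {M. maximalideal M (subring_of_field R)}"

definition height_one_primes :: "'f::field set \<Rightarrow> 'f set set" where
  "height_one_primes R =
     {P. primeideal P (subring_of_field R) \<and> P \<noteq> {0} \<and>
         (\<forall>Q. primeideal Q (subring_of_field R) \<and> Q \<subseteq> P \<longrightarrow> Q = {0} \<or> Q = P)}"

definition local_ring :: "'f::field set \<Rightarrow> 'f set \<Rightarrow> 'f set" where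
  "local_ring R P = {a / s | a s. a \<in> R \<and> s \<in> R - P}"

definition local_maximal_ideal :: "'f::field set \<Rightarrow> 'f set \<Rightarrow> 'f set" where
  "local_maximal_ideal R P = {a / s | a s. a \<in> P \<and> s \<in> R - P}"

definition local_units :: "'f::field set \<Rightarrow> 'f set \<Rightarrow> 'f set" where
  "local_units R P = {a / s | a s. a \<in> R - P \<and> s \<in> R - P}"

definition uniformizer :: "'f::field set \<Rightarrow> 'f set \<Rightarrow> 'f \<Rightarrow> bool" where
  "uniformizer R P t \<longleftrightarrow> local_maximal_ideal R P = (\<lambda>x. t * x) ` local_ring R P"

text \<open>The normalized discrete valuation of the local ring at \<open>P\<close>, when that local ring is a
  discrete valuation ring; only meaningful at nonzero arguments.\<close>

definition valuation_at :: "'f::field set \<Rightarrow> 'f set \<Rightarrow> 'f \<Rightarrow> int" where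
  "valuation_at R P x =
     (THE n. \<exists>t w. uniformizer R P t \<and> w \<in> local_units R P \<and> x = w * t powi n)"

abbreviation divisor_group :: "'f::field set \<Rightarrow> ('f set \<Rightarrow>\<^sub>0 int) monoid" where
  "divisor_group R \<equiv> free_Abelian_group (height_one_primes R)"

definition principal_divisors :: "'f::field set \<Rightarrow> ('f set \<Rightarrow>\<^sub>0 int) set" where
  "principal_divisors R =
     {c \<in> carrier (divisor_group R).
        \<exists>x \<in> fraction_set R - {0}.
          \<forall>P \<in> height_one_primes R. Poly_Mapping.lookup c P = valuation_at R P x}"

definition class_group :: "'f::field set \<Rightarrow> ('f set \<Rightarrow>\<^sub>0 int) set monoid" where
  "class_group R = divisor_group R Mod principal_divisors R"

definition divisor_class :: "'f::field set \<Rightarrow> ('f set \<Rightarrow>\<^sub>0 int) \<Rightarrow> ('f set \<Rightarrow>\<^sub>0 int) set" where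
  "divisor_class R c = principal_divisors R #>\<^bsub>divisor_group R\<^esub> c"


text \<open>\<open>\<iota>\<close> is the structure map of the \<open>\<complex>\<close>-algebra \<open>A0\<close>, whose field of fractions is the whole
  type. Smoothness over \<open>\<complex>\<close> means that all local rings are regular, which in dimension one
  says that their maximal ideals are generated by one element.\<close>

definition smooth_affine_curve :: "(complex \<Rightarrow> 'k::field) \<Rightarrow> 'k set \<Rightarrow> bool" where
  "smooth_affine_curve \<iota> A0 \<longleftrightarrow>
     \<iota> \<in> ring_hom ring_of_type_algebra ring_of_type_algebra \<and>
     (\<exists>S. finite S \<and> A0 = generate_ring ring_of_type_algebra (range \<iota> \<union> S)) \<and>
     fraction_set A0 = UNIV \<and>
     (\<exists>P. primeideal P (subring_of_field A0) \<and> P \<noteq> {0}) \<and>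
     (\<forall>P. primeideal P (subring_of_field A0) \<and> P \<noteq> {0}
            \<longrightarrow> maximalideal P (subring_of_field A0)) \<and>
     (\<forall>p \<in> closed_points A0. \<exists>t. uniformizer A0 p t)"


text \<open>A divisor with rational coefficients on \<open>Spec A0\<close> is a finitely supported function whose
  support consists of closed points of \<open>A0\<close>.\<close>

definition global_sections :: "'k::field set \<Rightarrow> ('k set \<Rightarrow> int) \<Rightarrow> 'k set" where
  "global_sections A0 E =
     {f. f = 0 \<or> (\<forall>p \<in> closed_points A0. valuation_at A0 p f + E p \<ge> 0)}"

definition graded_coeffs ::
  "'k::field set \<Rightarrow> ('k set \<Rightarrow>\<^sub>0 rat) \<Rightarrow> ('k set \<Rightarrow>\<^sub>0 rat) \<Rightarrow> int \<Rightarrow> 'k set" where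
  "graded_coeffs A0 Dp Dm n =
     global_sections A0
       (\<lambda>p. if n \<ge> 0 then \<lfloor>of_int n * Poly_Mapping.lookup Dp p\<rfloor>
            else \<lfloor>of_int (- n) * Poly_Mapping.lookup Dm p\<rfloor>)"

text \<open>The Laurent polynomial ring in \<open>u\<close> over the field \<open>'k\<close> is viewed inside the field of formal
  Laurent series, with \<open>u = fls_X\<close>: it consists of the series with finitely many nonzero
  coefficients. The embedding of \<open>'k\<close> is \<^const>\<open>fls_const\<close>.\<close>

definition DPD_algebra ::
  "'k::field set \<Rightarrow> ('k set \<Rightarrow>\<^sub>0 rat) \<Rightarrow> ('k set \<Rightarrow>\<^sub>0 rat) \<Rightarrow> 'k fls set" where
  "DPD_algebra A0 Dp Dm =
     {F. finite {n. fls_nth F n \<noteq> 0} \<and> (\<forall>n. fls_nth F n \<in> graded_coeffs A0 Dp Dm n)}"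

definition homogeneous_part ::
  "'k::field set \<Rightarrow> ('k set \<Rightarrow>\<^sub>0 rat) \<Rightarrow> ('k set \<Rightarrow>\<^sub>0 rat) \<Rightarrow> int \<Rightarrow> 'k fls set" where
  "homogeneous_part A0 Dp Dm n =
     {fls_const f * fls_X_intpow n | f. f \<in> graded_coeffs A0 Dp Dm n}"


text \<open>The points of \<open>V = Spec A\<close> are the maximal ideals of \<open>A\<close>; \<open>\<pi>\<close> contracts an ideal of \<open>A\<close>
  to \<open>A0\<close>.\<close>

definition contraction :: "'k::field set \<Rightarrow> 'k fls set \<Rightarrow> 'k set" where
  "contraction A0 M = {f \<in> A0. fls_const f \<in> M}"

definition fiber :: "'k::field set \<Rightarrow> 'k fls set \<Rightarrow> 'k set \<Rightarrow> 'k fls set set" where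
  "fiber A0 A p = {M \<in> closed_points A. contraction A0 M = p}"

text \<open>\<open>\<lambda> \<in> \<complex>\<^sup>*\<close> acts on \<open>A\<close> by multiplication with \<open>\<lambda>\<^sup>n\<close> in degree \<open>n\<close>, and on points by taking
  images of maximal ideals.\<close>

definition torus_act ::
  "(complex \<Rightarrow> 'k::field) \<Rightarrow> 'k fls set \<Rightarrow> complex \<Rightarrow> 'k fls set \<Rightarrow> 'k fls set" where
  "torus_act \<iota> A l M = {F \<in> A. \<exists>G \<in> M. \<forall>n. fls_nth F n = \<iota> l powi n * fls_nth G n}"

definition torus_orbit ::
  "(complex \<Rightarrow> 'k::field) \<Rightarrow> 'k fls set \<Rightarrow> 'k fls set \<Rightarrow> 'k fls set set" where
  "torus_orbit \<iota> A M = {torus_act \<iota> A l M | l. l \<noteq> 0}"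

text \<open>Used where \<open>Dp(b) + Dm(b) < 0\<close>, for \<open>N\<close> the positive or the negative integers: the fiber over
  \<open>b\<close> then consists of a fixed point and two further orbits, and exactly one of these is not in
  the zero locus of the homogeneous elements with degree in \<open>N\<close>.\<close>

definition orbit_over ::
  "(complex \<Rightarrow> 'k::field) \<Rightarrow> 'k set \<Rightarrow> ('k set \<Rightarrow>\<^sub>0 rat) \<Rightarrow> ('k set \<Rightarrow>\<^sub>0 rat)
     \<Rightarrow> int set \<Rightarrow> 'k set \<Rightarrow> 'k fls set set" where
  "orbit_over \<iota> A0 Dp Dm N b =
     (THE \<Omega>. (\<exists>M \<in> fiber A0 (DPD_algebra A0 Dp Dm) b.
                \<Omega> = torus_orbit \<iota> (DPD_algebra A0 Dp Dm) M) \<and>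
             (\<exists>n \<in> N. \<exists>F \<in> homogeneous_part A0 Dp Dm n. \<exists>M \<in> \<Omega>. F \<notin> M))"

text \<open>The ideal of functions vanishing on a set of points, that is, the ideal of its Zariski
  closure. If this closure is an irreducible curve on the surface \<open>V\<close>, the ideal is the prime of
  height one corresponding to it.\<close>

definition vanishing_ideal :: "'f::field set \<Rightarrow> 'f set set \<Rightarrow> 'f set" where
  "vanishing_ideal R S = {F \<in> R. \<forall>M \<in> S. F \<in> M}"

text \<open>Used where \<open>Dp(a) = - Dm(a) \<noteq> 0\<close>: the fiber over \<open>a\<close> is then itself a single orbit.\<close>

definition curve_O ::
  "'k::field set \<Rightarrow> ('k set \<Rightarrow>\<^sub>0 rat) \<Rightarrow> ('k set \<Rightarrow>\<^sub>0 rat) \<Rightarrow> 'k set \<Rightarrow> 'k fls set" where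
  "curve_O A0 Dp Dm a =
     vanishing_ideal (DPD_algebra A0 Dp Dm) (fiber A0 (DPD_algebra A0 Dp Dm) a)"

definition curve_Op ::
  "(complex \<Rightarrow> 'k::field) \<Rightarrow> 'k set \<Rightarrow> ('k set \<Rightarrow>\<^sub>0 rat) \<Rightarrow> ('k set \<Rightarrow>\<^sub>0 rat)
     \<Rightarrow> 'k set \<Rightarrow> 'k fls set" where
  "curve_Op \<iota> A0 Dp Dm b =
     vanishing_ideal (DPD_algebra A0 Dp Dm) (orbit_over \<iota> A0 Dp Dm {0<..} b)"

definition curve_Om ::
  "(complex \<Rightarrow> 'k::field) \<Rightarrow> 'k set \<Rightarrow> ('k set \<Rightarrow>\<^sub>0 rat) \<Rightarrow> ('k set \<Rightarrow>\<^sub>0 rat)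
     \<Rightarrow> 'k set \<Rightarrow> 'k fls set" where
  "curve_Om \<iota> A0 Dp Dm b =
     vanishing_ideal (DPD_algebra A0 Dp Dm) (orbit_over \<iota> A0 Dp Dm {..<0} b)"

text \<open>The divisor \<open>\<pi>\<^sup>*(p)\<close>: a local equation of \<open>p\<close> on the curve, pulled back to \<open>V\<close>, is a local
  equation near the fiber over \<open>p\<close>.\<close>

definition pullback_divisor ::
  "'k::field set \<Rightarrow> 'k fls set \<Rightarrow> 'k set \<Rightarrow> ('k fls set \<Rightarrow>\<^sub>0 int)" where
  "pullback_divisor A0 A p =
     Abs_poly_mapping
       (\<lambda>P. if P \<in> height_one_primes A \<and> contraction A0 P = p
            then valuation_at A P (fls_const (SOME t. uniformizer A0 p t)) else 0)"


definition a_points :: "'k::field set \<Rightarrow> ('k set \<Rightarrow>\<^sub>0 rat) \<Rightarrow> ('k set \<Rightarrow>\<^sub>0 rat) \<Rightarrow> 'k set set" where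
  "a_points A0 Dp Dm =
     {a \<in> closed_points A0. Poly_Mapping.lookup Dp a = - Poly_Mapping.lookup Dm a
                            \<and> Poly_Mapping.lookup Dp a \<noteq> 0}"

definition b_points :: "'k::field set \<Rightarrow> ('k set \<Rightarrow>\<^sub>0 rat) \<Rightarrow> ('k set \<Rightarrow>\<^sub>0 rat) \<Rightarrow> 'k set set" where
  "b_points A0 Dp Dm =
     {b \<in> closed_points A0. Poly_Mapping.lookup Dp b + Poly_Mapping.lookup Dm b < 0}"

text \<open>The generators are indexed by the points \<open>a\<^sub>i\<close>, \<open>b\<^sub>j\<close> themselves instead of by \<open>i\<close>, \<open>j\<close>.\<close>

datatype 'p orbit_symbol = SymO 'p | SymOp 'p | SymOm 'p

definition free_presentation ::
  "'k::field set \<Rightarrow> 'k set set \<Rightarrow> 'k set set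
     \<Rightarrow> (('k set \<Rightarrow>\<^sub>0 int) set \<times> ('k set orbit_symbol \<Rightarrow>\<^sub>0 int)) monoid" where
  "free_presentation A0 as bs =
     class_group A0 \<times>\<times> free_Abelian_group (SymO ` as \<union> SymOp ` bs \<union> SymOm ` bs)"

text \<open>A relation \<open>x = y\<close> with \<open>x\<close> in the first summand and \<open>y\<close> in the second is recorded as the
  element \<open>x - y\<close>.\<close>

definition class_relations ::
  "'k::field set \<Rightarrow> 'k set set \<Rightarrow> 'k set set \<Rightarrow> ('k set \<Rightarrow> int) \<Rightarrow> ('k set \<Rightarrow> int)
     \<Rightarrow> ('k set \<Rightarrow> int) \<Rightarrow> ('k set \<Rightarrow> int) \<Rightarrow> ('k set \<Rightarrow> int) \<Rightarrow> ('k set \<Rightarrow> int)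
     \<Rightarrow> (('k set \<Rightarrow>\<^sub>0 int) set \<times> ('k set orbit_symbol \<Rightarrow>\<^sub>0 int)) set" where
  "class_relations A0 as bs e m ep mp em mm =
     {(divisor_class A0 (frag_of a), - frag_cmul (m a) (frag_of (SymO a))) | a. a \<in> as}
     \<union> {(divisor_class A0 (frag_of b),
          - (frag_cmul (mp b) (frag_of (SymOp b)) - frag_cmul (mm b) (frag_of (SymOm b))))
         | b. b \<in> bs}
     \<union> {(\<one>\<^bsub>class_group A0\<^esub>,
          (\<Sum>a\<in>as. frag_cmul (e a) (frag_of (SymO a)))
          + (\<Sum>b\<in>bs. frag_cmul (ep b) (frag_of (SymOp b)) - frag_cmul (em b) (frag_of (SymOm b))))}"

end

theory Submission
  imports Defs
    "HOL-Analysis.Continuum_Not_Denumerable"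
    "HOL-Computational_Algebra.Fundamental_Theorem_Algebra"
    "HOL-Computational_Algebra.Polynomial_Factorial"
begin

text \<open>Both \<open>A0\<close> and \<open>A\<close> are intersections of discrete valuation rings \<open>{v\<^sub>j \<ge> 0}\<close> in their fields of
  fractions, with finitely many \<open>v\<^sub>j x \<noteq> 0\<close> for each \<open>x\<close>. If moreover no center \<open>{v\<^sub>j > 0}\<close> contains
  another one, the centers are exactly the primes of height one. For \<open>A\<close> there are two kinds of
  valuations. Those trivial on the field \<open>K\<close> of \<open>C\<close> come from the irreducible polynomials in
  \<open>K[u]\<close> other than \<open>u\<close>. The others lie over a point \<open>p\<close>: for \<open>d \<in> {D\<^sub>+(p), - D\<^sub>-(p)}\<close>, written
  \<open>d = w / m\<close> in lowest terms, \<open>v(\<Sum>f\<^sub>i u\<^sup>i) = min (m v\<^sub>p(f\<^sub>i) + w i)\<close>.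

  A prime of the first kind is generated in \<open>K[u, 1/u]\<close> by its polynomial, so modulo principal
  divisors it is a combination of primes over points. A principal divisor supported on primes over
  points belongs to a unit \<open>f u\<^sup>n\<close> of \<open>K[u, 1/u]\<close>; its coefficients \<open>m v\<^sub>p(f) + w n\<close> give the
  relations. The prime over \<open>p\<close> of slope \<open>d\<close> is the ideal of an orbit because, after inverting one
  homogeneous element \<open>zeta\<close>, the quotient of \<open>A\<close> by it is \<open>\<complex>[zeta, 1/zeta]\<close>.\<close>

section \<open>Subrings of fields and valuations\<close>

text \<open>The route through valuations does not ask whether \<open>A\<close> is noetherian: that
  the centers exhaust the primes of height one follows from finite products alone. Chain conditions
  enter only for \<open>A0\<close>, to bound the zeros of a function and to place a function regular
  at every point in \<open>A0\<close>. The coefficients of the presentation are weights. On the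
  prime of slope \<open>w / m\<close> a uniformizer of the point has value \<open>m\<close> and
  \<open>u\<close> has value \<open>w\<close>, so \<open>m\<close> is the multiplicity in the fiber
  and \<open>w\<close> the coefficient in the divisor of \<open>u\<close>; as \<open>w\<close> is
  \<open>- e a\<close>, \<open>- ep b\<close> or \<open>em b\<close>, the last relation is the
  divisor of \<open>1/u\<close>. Where both divisors vanish, \<open>m = 1\<close> and
  \<open>w = 0\<close>: the prime is the pulled back point itself and gets no generator. One
  relation beyond those of the fibers suffices because a unit of \<open>K[u, 1/u]\<close> is given
  by some \<open>f\<close> in \<open>K\<close>, whose divisor is already zero in
  \<open>Cl A0\<close>, and the exponent of \<open>u\<close>. For the orbits, the residue field at a
  point of the curve must be the complex numbers; the source of this is the countable dimension of
  \<open>A0\<close> over an uncountable field.\<close>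

locale field_subring =
  fixes R :: "'f::field set"
  assumes one_closed: "1 \<in> R"
    and diff_closed: "\<And>x y. x \<in> R \<Longrightarrow> y \<in> R \<Longrightarrow> x - y \<in> R"
    and mult_closed: "\<And>x y. x \<in> R \<Longrightarrow> y \<in> R \<Longrightarrow> x * y \<in> R"
begin

lemma zero_closed: "0 \<in> R"
  using diff_closed[OF one_closed one_closed] by simp

lemma uminus_closed: "x \<in> R \<Longrightarrow> - x \<in> R"
  using diff_closed[OF zero_closed] by fastforce

lemma add_closed: "x \<in> R \<Longrightarrow> y \<in> R \<Longrightarrow> x + y \<in> R"
  using diff_closed[OF _ uminus_closed] by fastforce

lemma power_closed: "x \<in> R \<Longrightarrow> x ^ n \<in> R"
  by (induction n) (auto intro: one_closed mult_closed)

lemma sum_closed: "(\<And>i. i \<in> I \<Longrightarrow> f i \<in> R) \<Longrightarrow> sum f I \<in> R"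
  by (induction I rule: infinite_finite_induct) (auto intro: zero_closed add_closed)

lemma prod_closed: "(\<And>i. i \<in> I \<Longrightarrow> f i \<in> R) \<Longrightarrow> prod f I \<in> R"
  by (induction I rule: infinite_finite_induct) (auto intro: one_closed mult_closed)

lemmas ring_closed = zero_closed one_closed diff_closed mult_closed uminus_closed add_closed
  power_closed

lemma cring: "cring (subring_of_field R)"
proof (rule cringI)
  show "abelian_group (subring_of_field R)"
  proof (rule abelian_groupI)
    fix x assume "x \<in> carrier (subring_of_field R)"
    then show "\<exists>y\<in>carrier (subring_of_field R).
        y \<oplus>\<^bsub>subring_of_field R\<^esub> x = \<zero>\<^bsub>subring_of_field R\<^esub>"
      by (intro bexI[of _ "- x"]) (auto simp: ring_of_type_algebra_def uminus_closed)
  qed (auto simp: ring_of_type_algebra_def intro: ring_closed)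
  show "Group.comm_monoid (subring_of_field R)"
    by (rule comm_monoidI) (auto simp: ring_of_type_algebra_def intro: ring_closed)
qed (auto simp: ring_of_type_algebra_def algebra_simps)

lemma idealD:
  assumes "ideal I (subring_of_field R)"
  shows "I \<subseteq> R" "0 \<in> I" "\<And>x y. x \<in> I \<Longrightarrow> y \<in> I \<Longrightarrow> x + y \<in> I"
    "\<And>x r. x \<in> I \<Longrightarrow> r \<in> R \<Longrightarrow> r * x \<in> I"
    "\<And>x. x \<in> I \<Longrightarrow> - x \<in> I" "\<And>x y. x \<in> I \<Longrightarrow> y \<in> I \<Longrightarrow> x - y \<in> I"
proof -
  interpret I: ideal I "subring_of_field R" by fact
  show 1: "I \<subseteq> R" using I.a_subset by auto
  show "0 \<in> I"
    using additive_subgroup.zero_closed[OF I.additive_subgroup_axioms]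
    by (simp add: ring_of_type_algebra_def)
  show 2: "\<And>x y. x \<in> I \<Longrightarrow> y \<in> I \<Longrightarrow> x + y \<in> I"
    using additive_subgroup.a_closed[OF I.additive_subgroup_axioms]
    by (simp add: ring_of_type_algebra_def)
  show 3: "\<And>x r. x \<in> I \<Longrightarrow> r \<in> R \<Longrightarrow> r * x \<in> I"
    using I.I_l_closed by (simp add: ring_of_type_algebra_def)
  show 4: "\<And>x. x \<in> I \<Longrightarrow> - x \<in> I"
    using 3[OF _ uminus_closed[OF one_closed]] by fastforce
  show "\<And>x y. x \<in> I \<Longrightarrow> y \<in> I \<Longrightarrow> x - y \<in> I"
    using 2[OF _ 4] by fastforce
qed

lemma idealI:
  assumes "I \<subseteq> R" "0 \<in> I" "\<And>x y. x \<in> I \<Longrightarrow> y \<in> I \<Longrightarrow> x + y \<in> I"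
    "\<And>x r. x \<in> I \<Longrightarrow> r \<in> R \<Longrightarrow> r * x \<in> I"
  shows "ideal I (subring_of_field R)"
proof (rule Ideal.idealI)
  show "ring (subring_of_field R)" using cring by (simp add: cring_def)
  interpret S: cring "subring_of_field R" by (rule cring)
  show "subgroup I (add_monoid (subring_of_field R))"
  proof (rule S.add.subgroupI)
    fix a assume a: "a \<in> I"
    have ma: "- a \<in> I" using assms(4)[OF a uminus_closed[OF one_closed]] by simp
    have aR: "a \<in> R" using a assms(1) by auto
    have "a \<oplus>\<^bsub>subring_of_field R\<^esub> (- a) = \<zero>\<^bsub>subring_of_field R\<^esub>"
      "(- a) \<oplus>\<^bsub>subring_of_field R\<^esub> a = \<zero>\<^bsub>subring_of_field R\<^esub>"
      by (auto simp: ring_of_type_algebra_def)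
    then have "\<ominus>\<^bsub>subring_of_field R\<^esub> a = - a"
      using aR by (intro S.minus_equality) (auto simp: uminus_closed)
    then show "\<ominus>\<^bsub>subring_of_field R\<^esub> a \<in> I" using ma by simp
  qed (use assms in \<open>auto simp: ring_of_type_algebra_def\<close>)
qed (use assms in \<open>auto simp: ring_of_type_algebra_def mult.commute\<close>)

text \<open>The ideal \<open>I + x R\<close>. Whether it contains 1, or is larger than
  \<open>I\<close>, is how maximality is tested below.\<close>

lemma ideal_adjoin:
  assumes I: "ideal I (subring_of_field R)" and x: "x \<in> R"
  shows "ideal {m + x * y | m y. m \<in> I \<and> y \<in> R} (subring_of_field R)" (is "ideal ?J _")
    and "I \<subseteq> {m + x * y | m y. m \<in> I \<and> y \<in> R}"
    and "x \<in> {m + x * y | m y. m \<in> I \<and> y \<in> R}"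
proof -
  note ID = idealD[OF I]
  show "ideal ?J (subring_of_field R)"
  proof (rule idealI)
    show "?J \<subseteq> R" using x ID(1) by (auto intro!: add_closed mult_closed)
    show "0 \<in> ?J" using ID(2) zero_closed by (intro CollectI exI[of _ 0]) auto
    fix a assume "a \<in> ?J"
    then obtain m y where a: "a = m + x * y" "m \<in> I" "y \<in> R" by auto
    show "a + b \<in> ?J" if "b \<in> ?J" for b
    proof -
      from that obtain m' y' where "b = m' + x * y'" "m' \<in> I" "y' \<in> R" by auto
      then have "a + b = (m + m') + x * (y + y')" "m + m' \<in> I" "y + y' \<in> R"
        using a ID(3) add_closed by (auto simp: algebra_simps)
      then show ?thesis by blast
    qed
    show "r * a \<in> ?J" if "r \<in> R" for r
    proof -
      have "r * a = r * m + x * (r * y)" "r * m \<in> I" "r * y \<in> R"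
        using a ID(4) mult_closed that by (auto simp: algebra_simps)
      then show ?thesis by blast
    qed
  qed
  show "I \<subseteq> ?J"
  proof
    fix m assume "m \<in> I"
    then show "m \<in> ?J" using zero_closed by (intro CollectI exI[of _ m] exI[of _ 0]) auto
  qed
  show "x \<in> ?J" using ID(2) one_closed by (intro CollectI exI[of _ 0] exI[of _ 1]) auto
qed

lemma primeideal_iff:
  "primeideal P (subring_of_field R) \<longleftrightarrow> ideal P (subring_of_field R) \<and> 1 \<notin> P \<and>
     (\<forall>x\<in>R. \<forall>y\<in>R. x * y \<in> P \<longrightarrow> x \<in> P \<or> y \<in> P)"
proof
  assume "primeideal P (subring_of_field R)"
  then interpret P: primeideal P "subring_of_field R" .
  have "1 \<notin> P"
    using P.one_imp_carrier P.I_notcarr by (auto simp: ring_of_type_algebra_def)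
  then show "ideal P (subring_of_field R) \<and> 1 \<notin> P \<and>
     (\<forall>x\<in>R. \<forall>y\<in>R. x * y \<in> P \<longrightarrow> x \<in> P \<or> y \<in> P)"
    using P.ideal_axioms P.I_prime by (auto simp: ring_of_type_algebra_def)
next
  assume *: "ideal P (subring_of_field R) \<and> 1 \<notin> P \<and>
     (\<forall>x\<in>R. \<forall>y\<in>R. x * y \<in> P \<longrightarrow> x \<in> P \<or> y \<in> P)"
  show "primeideal P (subring_of_field R)"
    by (rule primeidealI) (use * one_closed cring in \<open>auto simp: ring_of_type_algebra_def\<close>)
qed

lemma primeidealD:
  assumes "primeideal P (subring_of_field R)"
  shows "ideal P (subring_of_field R)" "1 \<notin> P"
    "\<And>x y. x \<in> R \<Longrightarrow> y \<in> R \<Longrightarrow> x * y \<in> P \<Longrightarrow> x \<in> P \<or> y \<in> P"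
  using assms by (auto simp: primeideal_iff)

lemma primeideal_powerD:
  assumes "primeideal P (subring_of_field R)" "x \<in> R" "x ^ n \<in> P"
  shows "x \<in> P"
  using assms(3)
proof (induction n)
  case 0
  then show ?case using primeidealD(2)[OF assms(1)] by simp
next
  case (Suc n)
  then show ?case
    using primeidealD(3)[OF assms(1) assms(2) power_closed[OF assms(2)], of n] by auto
qed

lemma primeideal_prodD:
  assumes "primeideal P (subring_of_field R)" "finite I" "\<And>i. i \<in> I \<Longrightarrow> f i \<in> R" "prod f I \<in> P"
  shows "\<exists>i\<in>I. f i \<in> P"
  using assms(2-4)
proof (induction I rule: finite_induct)
  case empty
  then show ?case using primeidealD(2)[OF assms(1)] by simp
next
  case (insert i I)
  then show ?case
    using primeidealD(3)[OF assms(1), of "f i" "prod f I"] prod_closed[of I f] by auto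
qed

text \<open>The quotient is a field: \<open>y\<close> inverts \<open>x\<close> modulo
  \<open>M\<close>. In this form no quotient ring has to be built. The inverse is read off from 1
  being an element of \<open>M + x R\<close>.\<close>

lemma maximalideal_iff:
  "maximalideal M (subring_of_field R) \<longleftrightarrow> ideal M (subring_of_field R) \<and> 1 \<notin> M \<and>
     (\<forall>x\<in>R - M. \<exists>y\<in>R. x * y - 1 \<in> M)"
proof
  assume "maximalideal M (subring_of_field R)"
  then interpret M: maximalideal M "subring_of_field R" .
  have M: "ideal M (subring_of_field R)" by (rule M.ideal_axioms)
  note MD = idealD[OF M]
  have 1: "1 \<notin> M"
    using M.one_imp_carrier M.I_notcarr by (auto simp: ring_of_type_algebra_def)
  have "\<exists>y\<in>R. x * y - 1 \<in> M" if x: "x \<in> R - M" for x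
  proof -
    define I where "I = {m + x * y | m y. m \<in> M \<and> y \<in> R}"
    have I: "ideal I (subring_of_field R)" "M \<subseteq> I" "x \<in> I"
      using ideal_adjoin[OF M, of x] x by (auto simp: I_def)
    have "I = carrier (subring_of_field R)"
      using M.I_maximal[OF I(1)] idealD(1)[OF I(1)] I(2,3) x by auto
    then have "1 \<in> I" using one_closed by simp
    then obtain m y where "1 = m + x * y" "m \<in> M" "y \<in> R" by (auto simp: I_def)
    then have "x * y - 1 = - m" by (simp add: algebra_simps)
    then show ?thesis using MD(5)[OF \<open>m \<in> M\<close>] \<open>y \<in> R\<close> by metis
  qed
  then show "ideal M (subring_of_field R) \<and> 1 \<notin> M \<and>
     (\<forall>x\<in>R - M. \<exists>y\<in>R. x * y - 1 \<in> M)" using M 1 by auto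
next
  assume *: "ideal M (subring_of_field R) \<and> 1 \<notin> M \<and>
     (\<forall>x\<in>R - M. \<exists>y\<in>R. x * y - 1 \<in> M)"
  show "maximalideal M (subring_of_field R)"
  proof (rule maximalidealI)
    show "carrier (subring_of_field R) \<noteq> M" using * one_closed by auto
    fix J assume J: "ideal J (subring_of_field R)" "M \<subseteq> J" "J \<subseteq> carrier (subring_of_field R)"
    show "J = M \<or> J = carrier (subring_of_field R)"
    proof (rule disjCI)
      assume "J \<noteq> carrier (subring_of_field R)"
      note JD = idealD[OF J(1)]
      have "1 \<notin> J"
        using \<open>J \<noteq> _\<close> JD(1) JD(4)[of 1] by auto
      show "J = M"
      proof (rule ccontr)
        assume "J \<noteq> M"
        then obtain x where x: "x \<in> J" "x \<notin> M" using J(2) by auto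
        then have "x \<in> R - M" using JD(1) by auto
        then obtain y where y: "y \<in> R" "x * y - 1 \<in> M" using * by auto
        have "y * x - (x * y - 1) \<in> J"
          by (rule JD(6)) (use JD(4)[OF x(1) y(1)] y(2) J(2) in auto)
        then show False using \<open>1 \<notin> J\<close> by (simp add: mult.commute)
      qed
    qed
  qed (use * in auto)
qed

lemma maximalideal_imp_primeideal:
  "maximalideal M (subring_of_field R) \<Longrightarrow> primeideal M (subring_of_field R)"
  using cring cring.maximalideal_prime by blast

lemma fraction_setI: "a \<in> R \<Longrightarrow> b \<in> R \<Longrightarrow> b \<noteq> 0 \<Longrightarrow> a / b \<in> fraction_set R"
  by (auto simp: fraction_set_def)

lemma subset_fraction_set: "R \<subseteq> fraction_set R"
proof
  fix x assume "x \<in> R"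
  then show "x \<in> fraction_set R" using fraction_setI[OF _ one_closed, of x] by simp
qed

lemma fraction_setE:
  assumes "x \<in> fraction_set R"
  obtains a b where "x = a / b" "a \<in> R" "b \<in> R" "b \<noteq> 0"
  using assms by (auto simp: fraction_set_def)

lemma field_subring_fraction_set: "field_subring (fraction_set R)"
proof
  show "1 \<in> fraction_set R" using subset_fraction_set one_closed by auto
  fix x y assume "x \<in> fraction_set R" "y \<in> fraction_set R"
  then obtain a b c d where *: "x = a / b" "a \<in> R" "b \<in> R" "b \<noteq> 0"
    "y = c / d" "c \<in> R" "d \<in> R" "d \<noteq> 0"
    by (elim fraction_setE)
  have "x - y = (a * d - c * b) / (b * d)" "x * y = (a * c) / (b * d)"
    using * by (auto simp: field_simps)
  then show "x - y \<in> fraction_set R" "x * y \<in> fraction_set R"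
    using * by (auto intro!: fraction_setI ring_closed)
qed

lemma inverse_fraction_set: "x \<in> fraction_set R \<Longrightarrow> inverse x \<in> fraction_set R"
proof -
  assume "x \<in> fraction_set R"
  then obtain a b where *: "x = a / b" "a \<in> R" "b \<in> R" "b \<noteq> 0" by (rule fraction_setE)
  show "inverse x \<in> fraction_set R"
  proof (cases "a = 0")
    case True
    then show ?thesis using * subset_fraction_set zero_closed by auto
  next
    case False
    then have "inverse x = b / a" using * by simp
    then show ?thesis using * False fraction_setI by auto
  qed
qed

lemma divide_fraction_set:
  "x \<in> fraction_set R \<Longrightarrow> y \<in> fraction_set R \<Longrightarrow> x / y \<in> fraction_set R"
  using field_subring.mult_closed[OF field_subring_fraction_set] inverse_fraction_set
  by (simp add: divide_inverse)

end

text \<open>Values are integers, so 0 has no infinite value and \<open>v 0\<close> stays arbitrary.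
  This is the source of the side conditions \<open>x \<noteq> 0\<close> and of phrases such as
  \<open>x = 0 \<or> v x > 0\<close>.\<close>

definition valuation_on :: "'f::field set \<Rightarrow> ('f \<Rightarrow> int) \<Rightarrow> bool" where
  "valuation_on S v \<longleftrightarrow>
     (\<forall>x\<in>S - {0}. \<forall>y\<in>S - {0}. v (x * y) = v x + v y) \<and>
     (\<forall>x\<in>S - {0}. \<forall>y\<in>S - {0}. x + y \<noteq> 0 \<longrightarrow> v (x + y) \<ge> min (v x) (v y))"

lemma valuation_on_mult:
  "valuation_on S v \<Longrightarrow> x \<in> S \<Longrightarrow> y \<in> S \<Longrightarrow> x \<noteq> 0 \<Longrightarrow> y \<noteq> 0 \<Longrightarrow> v (x * y) = v x + v y"
  by (auto simp: valuation_on_def)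

lemma valuation_on_add:
  "valuation_on S v \<Longrightarrow> x \<in> S \<Longrightarrow> y \<in> S \<Longrightarrow> x \<noteq> 0 \<Longrightarrow> y \<noteq> 0 \<Longrightarrow> x + y \<noteq> 0 \<Longrightarrow>
     v (x + y) \<ge> min (v x) (v y)"
  by (auto simp: valuation_on_def)

lemma valuation_on_subset: "valuation_on S v \<Longrightarrow> T \<subseteq> S \<Longrightarrow> valuation_on T v"
  unfolding valuation_on_def by (meson Diff_mono order_refl subset_iff)

definition extend_valuation :: "'f::field set \<Rightarrow> ('f \<Rightarrow> int) \<Rightarrow> 'f \<Rightarrow> int" where
  "extend_valuation S v x =
     (THE n. \<exists>a\<in>S - {0}. \<exists>b\<in>S - {0}. x = a / b \<and> n = v a - v b)"

context field_subring
begin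

lemma valuation_on_one:
  assumes "valuation_on R v" shows "v 1 = 0"
  using valuation_on_mult[OF assms one_closed one_closed] by simp

lemma valuation_on_uminus:
  assumes "valuation_on R v" "x \<in> R" "x \<noteq> 0" shows "v (- x) = v x"
proof -
  have "v (- 1) + v (- 1) = 0"
    using valuation_on_mult[OF assms(1), of "-1" "-1"] valuation_on_one[OF assms(1)]
      uminus_closed[OF one_closed] by simp
  then show ?thesis
    using valuation_on_mult[OF assms(1), of "-1" x] uminus_closed[OF one_closed] assms by simp
qed

lemma valuation_on_power:
  assumes "valuation_on R v" "x \<in> R" "x \<noteq> 0" shows "v (x ^ n) = int n * v x"
proof (induction n)
  case (Suc n)
  then show ?case
    using valuation_on_mult[OF assms(1) assms(2) power_closed[OF assms(2)], of n] assms(3)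
    by (simp add: algebra_simps)
qed (use valuation_on_one[OF assms(1)] in simp)

lemma valuation_on_prod:
  assumes "valuation_on R v" "\<And>i. i \<in> I \<Longrightarrow> f i \<in> R - {0}"
  shows "v (prod f I) = (\<Sum>i\<in>I. v (f i))"
  using assms(2)
proof (induction I rule: infinite_finite_induct)
  case (insert i I)
  then show ?case
    using valuation_on_mult[OF assms(1), of "f i" "prod f I"] prod_closed[of I f] by auto
qed (use valuation_on_one[OF assms(1)] in auto)

lemma valuation_on_sum:
  assumes v: "valuation_on R v" and "\<And>i. i \<in> I \<Longrightarrow> f i \<in> R"
    "\<And>i. i \<in> I \<Longrightarrow> f i \<noteq> 0 \<Longrightarrow> v (f i) \<ge> k" "sum f I \<noteq> 0"
  shows "v (sum f I) \<ge> k"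
  using assms(2-)
proof (induction I rule: infinite_finite_induct)
  case (insert i I)
  have R: "sum f I \<in> R" "f i \<in> R" using insert sum_closed[of I f] by auto
  consider "f i = 0" | "sum f I = 0" | "f i \<noteq> 0" "sum f I \<noteq> 0" by auto
  then show ?case
  proof cases
    case 3
    then have "min (v (f i)) (v (sum f I)) \<le> v (sum f (insert i I))"
      using valuation_on_add[OF v R(2,1)] insert by simp
    moreover have "v (f i) \<ge> k" "v (sum f I) \<ge> k" using insert 3 by auto
    ultimately show ?thesis by linarith
  qed (use insert in auto)
qed auto

text \<open>From \<open>x = (x + y) + (- y)\<close> one gets
  \<open>v x \<ge> min (v (x + y)) (v y)\<close>; since \<open>v y\<close> exceeds
  \<open>v x\<close>, the minimum must be \<open>v (x + y)\<close>.\<close>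

lemma valuation_on_add_eq:
  assumes v: "valuation_on R v" and xy: "x \<in> R" "y \<in> R" "x \<noteq> 0"
    and less: "y = 0 \<or> v x < v y"
  shows "x + y \<noteq> 0 \<and> v (x + y) = v x"
proof (cases "y = 0")
  case False
  then have l: "v x < v y" using less by auto
  have ne: "x + y \<noteq> 0"
    using valuation_on_uminus[OF v xy(2) False] l by (auto simp: add_eq_0_iff2)
  have "v x \<ge> min (v (x + y)) (v (- y))"
    using valuation_on_add[OF v add_closed[OF xy(1,2)] uminus_closed[OF xy(2)] ne] False xy(3)
    by simp
  moreover have "v (x + y) \<ge> min (v x) (v y)" using valuation_on_add[OF v xy(1,2,3) False ne] .
  ultimately show ?thesis using l ne valuation_on_uminus[OF v xy(2) False] by auto
qed (use xy in auto)

lemma extend_valuation_divide: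
  assumes v: "valuation_on R v" and "a \<in> R" "b \<in> R" "a \<noteq> 0" "b \<noteq> 0"
  shows "extend_valuation R v (a / b) = v a - v b"
  unfolding extend_valuation_def
proof (rule the_equality)
  show "\<exists>c\<in>R - {0}. \<exists>d\<in>R - {0}. a / b = c / d \<and> v a - v b = v c - v d"
    using assms by auto
  fix n assume "\<exists>c\<in>R - {0}. \<exists>d\<in>R - {0}. a / b = c / d \<and> n = v c - v d"
  then obtain c d where cd: "c \<in> R - {0}" "d \<in> R - {0}" "a / b = c / d" "n = v c - v d" by auto
  then have "a * d = c * b" using assms by (simp add: frac_eq_eq)
  then have "v a + v d = v c + v b"
    using valuation_on_mult[OF v, of a d] valuation_on_mult[OF v, of c b] assms cd by auto
  then show "n = v a - v b" using cd by simp
qed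

lemma extend_valuation_eq:
  assumes "valuation_on R v" "a \<in> R" "a \<noteq> 0"
  shows "extend_valuation R v a = v a"
  using extend_valuation_divide[OF assms(1,2) one_closed] valuation_on_one[OF assms(1)] assms(3)
  by simp

lemma valuation_on_extend_valuation:
  assumes v: "valuation_on R v"
  shows "valuation_on (fraction_set R) (extend_valuation R v)"
  unfolding valuation_on_def
proof (intro conjI ballI impI)
  fix x y assume xy: "x \<in> fraction_set R - {0}" "y \<in> fraction_set R - {0}"
  then obtain a b c d where *: "x = a / b" "a \<in> R" "b \<in> R" "b \<noteq> 0"
    "y = c / d" "c \<in> R" "d \<in> R" "d \<noteq> 0"
    by (auto elim!: fraction_setE)
  have nz: "a \<noteq> 0" "c \<noteq> 0" using xy * by auto
  have ex: "extend_valuation R v x = v a - v b" and ey: "extend_valuation R v y = v c - v d"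
    using extend_valuation_divide[OF v] * nz by auto
  have "x * y = (a * c) / (b * d)" using * by simp
  then show "extend_valuation R v (x * y) = extend_valuation R v x + extend_valuation R v y"
    using extend_valuation_divide[OF v, of "a * c" "b * d"] * nz ex ey
    by (simp add: valuation_on_mult[OF v] mult_closed)
  assume ne: "x + y \<noteq> 0"
  have eq: "x + y = (a * d + c * b) / (b * d)" using * by (simp add: field_simps)
  have ne': "a * d + c * b \<noteq> 0" using ne eq by auto
  have "min (v (a * d)) (v (c * b)) \<le> v (a * d + c * b)"
    using valuation_on_add[OF v, of "a * d" "c * b"] * nz ne' mult_closed by auto
  moreover have "extend_valuation R v (x + y) = v (a * d + c * b) - v (b * d)"
    unfolding eq using * ne' by (intro extend_valuation_divide[OF v] ring_closed) auto
  ultimately show "min (extend_valuation R v x) (extend_valuation R v y)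
      \<le> extend_valuation R v (x + y)"
    using * nz ex ey by (simp add: valuation_on_mult[OF v])
qed

text \<open>The largest \<open>n\<close> for which \<open>t ^ n\<close> divides \<open>x\<close> in
  \<open>R\<close>: the first power that fails is \<open>t ^ Suc n\<close>. It is meaningful for
  \<open>x\<close> in \<open>R\<close> that some power of \<open>t\<close> does not divide.\<close>

definition order_at :: "'f \<Rightarrow> 'f \<Rightarrow> int" where
  "order_at t x = int (LEAST n. x \<notin> (\<lambda>y. t ^ Suc n * y) ` R)"

lemma order_at_decomp:
  assumes sep: "\<exists>n. x \<notin> (\<lambda>y. t ^ n * y) ` R" and x: "x \<in> R"
  obtains n y where "order_at t x = int n" "y \<in> R" "y \<notin> (\<lambda>y. t * y) ` R" "x = t ^ n * y"
proof -
  obtain n where n: "x \<notin> (\<lambda>y. t ^ n * y) ` R" using sep by auto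
  have "n \<noteq> 0"
  proof
    assume "n = 0"
    then show False using n x by auto
  qed
  then have ex: "\<exists>n. x \<notin> (\<lambda>y. t ^ Suc n * y) ` R" using n by (metis not0_implies_Suc)
  define k where "k = (LEAST n. x \<notin> (\<lambda>y. t ^ Suc n * y) ` R)"
  have k: "x \<notin> (\<lambda>y. t ^ Suc k * y) ` R" unfolding k_def by (rule LeastI_ex[OF ex])
  have "x \<in> (\<lambda>y. t ^ k * y) ` R"
  proof (cases k)
    case 0
    then show ?thesis using x by (auto simp: image_iff)
  next
    case (Suc m)
    then show ?thesis using not_less_Least[of m "\<lambda>n. x \<notin> (\<lambda>y. t ^ Suc n * y) ` R"] k_def by auto
  qed
  then obtain y where y: "y \<in> R" "x = t ^ k * y" by auto
  have "y \<notin> (\<lambda>y. t * y) ` R"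
    using k y by (auto simp: algebra_simps)
  then show ?thesis using that[of k y] y unfolding order_at_def k_def by auto
qed

lemma order_at_eqI:
  assumes "t \<noteq> 0" "t \<in> R" "y \<in> R" "y \<notin> (\<lambda>y. t * y) ` R" "x = t ^ n * y"
  shows "order_at t x = int n"
proof -
  have "(LEAST n. x \<notin> (\<lambda>y. t ^ Suc n * y) ` R) = n"
  proof (rule Least_equality)
    show "x \<notin> (\<lambda>y. t ^ Suc n * y) ` R"
      using assms(1,4,5) by (auto simp: algebra_simps)
    fix m assume m: "x \<notin> (\<lambda>y. t ^ Suc m * y) ` R"
    show "n \<le> m"
    proof (rule ccontr)
      assume "\<not> n \<le> m"
      then have "t ^ n = t ^ Suc m * t ^ (n - Suc m)"
        by (subst power_add[symmetric]) simp
      then have "x = t ^ Suc m * (t ^ (n - Suc m) * y)" using assms(5) by simp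
      then show False using m assms(2,3) mult_closed power_closed by blast
    qed
  qed
  then show ?thesis by (simp add: order_at_def)
qed

text \<open>Split off the exact powers of \<open>t\<close>. The cofactors lie outside the ideal
  \<open>t R\<close>, and its primality keeps their product outside as well. Applied to the local
  ring of a point with its uniformizer and to \<open>K[u]\<close> with an irreducible
  polynomial.\<close>

lemma valuation_on_order_at:
  assumes t: "t \<in> R" "t \<noteq> 0"
    and prime: "\<And>x y. x \<in> R \<Longrightarrow> y \<in> R \<Longrightarrow> x * y \<in> (\<lambda>y. t * y) ` R \<Longrightarrow>
      x \<in> (\<lambda>y. t * y) ` R \<or> y \<in> (\<lambda>y. t * y) ` R"
    and sep: "\<And>x. x \<in> R \<Longrightarrow> x \<noteq> 0 \<Longrightarrow> \<exists>n. x \<notin> (\<lambda>y. t ^ n * y) ` R"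
  shows "valuation_on R (order_at t)"
  unfolding valuation_on_def
proof (intro conjI ballI impI)
  fix x y assume xy: "x \<in> R - {0}" "y \<in> R - {0}"
  obtain n x' where x: "order_at t x = int n" "x' \<in> R" "x' \<notin> (\<lambda>y. t * y) ` R" "x = t ^ n * x'"
    using order_at_decomp[of x t] sep[of x] xy by auto
  obtain k y' where y: "order_at t y = int k" "y' \<in> R" "y' \<notin> (\<lambda>y. t * y) ` R" "y = t ^ k * y'"
    using order_at_decomp[of y t] sep[of y] xy by auto
  have "order_at t (x * y) = int (n + k)"
    using prime[OF x(2) y(2)] x y t mult_closed
    by (intro order_at_eqI[of t "x' * y'"]) (auto simp: power_add)
  then show "order_at t (x * y) = order_at t x + order_at t y" using x y by simp
  assume ne: "x + y \<noteq> 0"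
  then obtain l z where z: "order_at t (x + y) = int l" "z \<in> R" "z \<notin> (\<lambda>y. t * y) ` R"
    "x + y = t ^ l * z"
    using order_at_decomp[of "x + y" t] sep[of "x + y"] xy add_closed by auto
  show "min (order_at t x) (order_at t y) \<le> order_at t (x + y)"
  proof (rule ccontr)
    assume "\<not> ?thesis"
    then have l: "l < n" "l < k" using x y z by auto
    have "t ^ n = t ^ l * (t * t ^ (n - Suc l))" "t ^ k = t ^ l * (t * t ^ (k - Suc l))"
      using l by (simp_all flip: power_add power_Suc add: Suc_diff_Suc)
    then have "t ^ l * z = t ^ l * (t * (t ^ (n - Suc l) * x' + t ^ (k - Suc l) * y'))"
      using x(4) y(4) z(4) by (simp add: algebra_simps)
    then have "z = t * (t ^ (n - Suc l) * x' + t ^ (k - Suc l) * y')" using t(2) by simp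
    moreover have "t ^ (n - Suc l) * x' + t ^ (k - Suc l) * y' \<in> R"
      using x(2) y(2) t(1) by (intro add_closed mult_closed power_closed)
    ultimately show False using z(3) by blast
  qed
qed

end

section \<open>Families of discrete valuations\<close>

context field_subring
begin

text \<open>Elements of \<open>R\<close> outside \<open>P\<close> have value 0, so a fraction with
  such a denominator has the value of its numerator. Conversely \<open>loc\<close> writes every
  element of nonnegative value as such a fraction.\<close>

lemma
  assumes val: "valuation_on (fraction_set R) v"
    and nonneg: "\<And>x. x \<in> R - {0} \<Longrightarrow> v x \<ge> 0"
    and P: "P = {x \<in> R. x = 0 \<or> v x > 0}"
    and loc: "\<And>x. x \<in> fraction_set R - {0} \<Longrightarrow> v x \<ge> 0 \<Longrightarrow> \<exists>s\<in>R - P. s * x \<in> R"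
  shows local_ring_eq: "local_ring R P = {x \<in> fraction_set R. x = 0 \<or> v x \<ge> 0}"
    and local_maximal_ideal_eq: "local_maximal_ideal R P = {x \<in> fraction_set R. x = 0 \<or> v x > 0}"
    and local_units_eq: "local_units R P = {x \<in> fraction_set R. x \<noteq> 0 \<and> v x = 0}"
proof -
  interpret F: field_subring "fraction_set R" by (rule field_subring_fraction_set)
  have unit: "s \<noteq> 0" "v s = 0" if "s \<in> R - P" for s
    using that nonneg[of s] zero_closed by (auto simp: P)
  have vdiv: "v (a / s) = v a" if "s \<in> R - P" "a \<in> R" "a \<noteq> 0" for a s
  proof -
    have "a = a / s * s" using unit that by simp
    then have "v a = v (a / s) + v s"
      using valuation_on_mult[OF val, of "a / s" s] that unit[OF that(1)]
        fraction_setI[of a s] subset_fraction_set by auto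
    then show ?thesis using unit that by simp
  qed
  have fr: "\<exists>a\<in>R. \<exists>s\<in>R - P. x = a / s \<and> a \<noteq> 0" if x: "x \<in> fraction_set R" "x \<noteq> 0" "v x \<ge> 0" for x
  proof -
    obtain s where s: "s \<in> R - P" "s * x \<in> R" using loc[of x] x by auto
    then show ?thesis using unit[OF s(1)] x by (intro bexI[of _ "s * x"] bexI[of _ s]) auto
  qed
  show "local_ring R P = {x \<in> fraction_set R. x = 0 \<or> v x \<ge> 0}" (is "?L = ?R")
  proof (intro equalityI subsetI)
    fix x assume "x \<in> ?L"
    then obtain a s where *: "x = a / s" "a \<in> R" "s \<in> R - P" by (auto simp: local_ring_def)
    then show "x \<in> ?R" using unit[OF *(3)] vdiv[of s a] nonneg[of a] fraction_setI[of a s]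
      by (cases "a = 0") auto
  next
    fix x assume "x \<in> ?R"
    then consider "x = 0" | "x \<in> fraction_set R" "x \<noteq> 0" "v x \<ge> 0" by auto
    then show "x \<in> ?L"
    proof cases
      case 1
      have "1 \<in> R - P" using one_closed F.valuation_on_one[OF val] by (auto simp: P)
      then show ?thesis unfolding local_ring_def using 1 zero_closed
        by (intro CollectI exI[of _ 0] exI[of _ 1]) auto
    next
      case 2
      then show ?thesis using fr[of x] unfolding local_ring_def by blast
    qed
  qed
  show "local_maximal_ideal R P = {x \<in> fraction_set R. x = 0 \<or> v x > 0}" (is "?L = ?R")
  proof (intro equalityI subsetI)
    fix x assume "x \<in> ?L"
    then obtain a s where *: "x = a / s" "a \<in> P" "s \<in> R - P" by (auto simp: local_maximal_ideal_def)
    then show "x \<in> ?R" using unit[OF *(3)] vdiv[of s a] fraction_setI[of a s]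
      by (cases "a = 0") (auto simp: P)
  next
    fix x assume "x \<in> ?R"
    then consider "x = 0" | "x \<in> fraction_set R" "x \<noteq> 0" "v x > 0" by auto
    then show "x \<in> ?L"
    proof cases
      case 1
      have "1 \<in> R - P" using one_closed F.valuation_on_one[OF val] by (auto simp: P)
      then show ?thesis unfolding local_maximal_ideal_def using 1 zero_closed
        by (intro CollectI exI[of _ 0] exI[of _ 1]) (auto simp: P)
    next
      case 2
      then obtain a s where *: "a \<in> R" "s \<in> R - P" "x = a / s" "a \<noteq> 0" using fr[of x] by auto
      then have "a \<in> P" using 2 vdiv[of s a] by (auto simp: P)
      then show ?thesis using * unfolding local_maximal_ideal_def by blast
    qed
  qed
  show "local_units R P = {x \<in> fraction_set R. x \<noteq> 0 \<and> v x = 0}" (is "?L = ?R")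
  proof (intro equalityI subsetI)
    fix x assume "x \<in> ?L"
    then obtain a s where *: "x = a / s" "a \<in> R - P" "s \<in> R - P" by (auto simp: local_units_def)
    then show "x \<in> ?R"
      using unit[OF *(3)] unit[OF *(2)] vdiv[of s a] fraction_setI[of a s] by auto
  next
    fix x assume "x \<in> ?R"
    then obtain a s where *: "a \<in> R" "s \<in> R - P" "x = a / s" "a \<noteq> 0" "v x = 0"
      using fr[of x] by auto
    then have "a \<in> R - P" using vdiv[of s a] by (auto simp: P)
    then show "x \<in> ?L" using * unfolding local_units_def by blast
  qed
qed

text \<open>The bridge between a valuation \<open>v\<close> constructed by hand and
  \<open>valuation_at\<close>, which is defined through all uniformizers at once. An element of
  value 1 is a multiple of any generator of the maximal ideal, with cofactor of nonnegative value;
  so generators have value exactly 1, and the exponent in \<open>valuation_at\<close> can only be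
  \<open>v x\<close>.\<close>

lemma
  assumes val: "valuation_on (fraction_set R) v"
    and nonneg: "\<And>x. x \<in> R - {0} \<Longrightarrow> v x \<ge> 0"
    and P: "P = {x \<in> R. x = 0 \<or> v x > 0}"
    and loc: "\<And>x. x \<in> fraction_set R - {0} \<Longrightarrow> v x \<ge> 0 \<Longrightarrow> \<exists>s\<in>R - P. s * x \<in> R"
    and normalized: "\<exists>t\<in>fraction_set R - {0}. v t = 1"
  shows uniformizer_iff: "uniformizer R P t \<longleftrightarrow> t \<in> fraction_set R - {0} \<and> v t = 1"
    and valuation_at_eq: "x \<in> fraction_set R - {0} \<Longrightarrow> valuation_at R P x = v x"
proof -
  interpret F: field_subring "fraction_set R" by (rule field_subring_fraction_set)
  note loc_eqs = local_ring_eq[OF val nonneg P loc] local_maximal_ideal_eq[OF val nonneg P loc]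
    local_units_eq[OF val nonneg P loc]
  have vdiv: "v (x / y) = v x - v y" if "x \<in> fraction_set R - {0}" "y \<in> fraction_set R - {0}" for x y
    using valuation_on_mult[OF val, of "x / y" y] divide_fraction_set that by auto
  show unif: "uniformizer R P t \<longleftrightarrow> t \<in> fraction_set R - {0} \<and> v t = 1" for t
  proof
    assume "uniformizer R P t"
    then have eq: "{x \<in> fraction_set R. x = 0 \<or> v x > 0} =
        (\<lambda>x. t * x) ` {x \<in> fraction_set R. x = 0 \<or> v x \<ge> 0}"
      using loc_eqs by (simp add: uniformizer_def)
    have "t * 1 \<in> (\<lambda>x. t * x) ` {x \<in> fraction_set R. x = 0 \<or> v x \<ge> 0}"
      using F.one_closed F.valuation_on_one[OF val] by (intro imageI) auto
    then have t: "t \<in> fraction_set R" "t = 0 \<or> v t > 0" unfolding eq[symmetric] by auto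
    obtain t0 where t0: "t0 \<in> fraction_set R - {0}" "v t0 = 1" using normalized by auto
    then have "t0 \<in> {x \<in> fraction_set R. x = 0 \<or> v x > 0}" by auto
    then obtain y where y: "t0 = t * y" "y \<in> fraction_set R" "y = 0 \<or> v y \<ge> 0" unfolding eq by auto
    have "t \<noteq> 0" "y \<noteq> 0" using t0 y by auto
    then have "1 = v t + v y" using t0 y t valuation_on_mult[OF val, of t y] by auto
    then show "t \<in> fraction_set R - {0} \<and> v t = 1" using t y \<open>t \<noteq> 0\<close> \<open>y \<noteq> 0\<close> by auto
  next
    assume t: "t \<in> fraction_set R - {0} \<and> v t = 1"
    have "{x \<in> fraction_set R. x = 0 \<or> v x > 0} =
        (\<lambda>x. t * x) ` {x \<in> fraction_set R. x = 0 \<or> v x \<ge> 0}" (is "?L = ?R")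
    proof (intro equalityI subsetI)
      fix x assume x: "x \<in> ?L"
      then have "x = t * (x / t)" "x / t \<in> {x \<in> fraction_set R. x = 0 \<or> v x \<ge> 0}"
        using t vdiv[of x t] divide_fraction_set[of x t] by (cases "x = 0"; auto)+
      then show "x \<in> ?R" by (rule image_eqI)
    next
      fix x assume "x \<in> ?R"
      then obtain y where "x = t * y" "y \<in> fraction_set R" "y = 0 \<or> v y \<ge> 0" by auto
      then show "x \<in> ?L" using t valuation_on_mult[OF val, of t y] F.mult_closed[of t y]
        by (cases "y = 0") auto
    qed
    then show "uniformizer R P t" using loc_eqs by (simp add: uniformizer_def)
  qed
  assume x: "x \<in> fraction_set R - {0}"
  have vpow: "t powi n \<in> fraction_set R - {0} \<and> v (t powi n) = n"
    if t: "t \<in> fraction_set R - {0}" "v t = 1" for t n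
  proof (cases "n \<ge> 0")
    case True
    then show ?thesis using t F.power_closed F.valuation_on_power[OF val, of t] by (auto simp: power_int_def)
  next
    case False
    then have "t powi n = 1 / t ^ nat (- n)" using False by (simp add: power_int_def field_simps)
    moreover have "t ^ nat (- n) \<in> fraction_set R - {0}" "1 \<in> fraction_set R - {0}"
      using t F.power_closed F.one_closed by auto
    ultimately show ?thesis
      using t F.valuation_on_power[OF val, of t "nat (- n)"] False vdiv[of 1 "t ^ nat (- n)"]
        F.valuation_on_one[OF val] divide_fraction_set[of 1 "t ^ nat (- n)"]
      by auto
  qed
  show "valuation_at R P x = v x"
    unfolding valuation_at_def
  proof (rule the_equality)
    obtain t where t: "t \<in> fraction_set R - {0}" "v t = 1" using normalized by auto
    note tp = vpow[OF t, of "v x"]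
    define w where "w = x / t powi v x"
    have "w \<in> fraction_set R - {0}" "v w = 0" "x = w * t powi v x"
      using x t tp vdiv[of x "t powi v x"] divide_fraction_set[of x "t powi v x"]
      by (auto simp: w_def)
    then show "\<exists>t w. uniformizer R P t \<and> w \<in> local_units R P \<and> x = w * t powi v x"
      using t unif loc_eqs(3) by auto
  next
    fix n assume "\<exists>t w. uniformizer R P t \<and> w \<in> local_units R P \<and> x = w * t powi n"
    then obtain t w where "t \<in> fraction_set R - {0}" "v t = 1" "w \<in> fraction_set R - {0}" "v w = 0"
      "x = w * t powi n" using unif loc_eqs(3) by auto
    then show "n = v x" using valuation_on_mult[OF val, of w "t powi n"] vpow[of t n] by auto
  qed
qed

text \<open>Multiply the separating elements, the one for \<open>k\<close> raised to the power
  \<open>nat (N k)\<close>. All factors have value 0 at \<open>j\<close>; at \<open>k\<close> its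
  own factor already contributes \<open>N k\<close>, and the others contribute nothing
  negative.\<close>

lemma approximation:
  assumes val: "\<And>k. k \<in> insert j T \<Longrightarrow> valuation_on R (v k)"
    and nonneg: "\<And>k x. k \<in> T \<Longrightarrow> x \<in> R - {0} \<Longrightarrow> v k x \<ge> 0"
    and sep: "\<And>k. k \<in> T \<Longrightarrow> \<exists>s\<in>R - {0}. v j s = 0 \<and> v k s > 0"
    and fin: "finite T"
  shows "\<exists>s\<in>R - {0}. v j s = 0 \<and> (\<forall>k\<in>T. v k s \<ge> N k)"
proof -
  obtain s where s: "\<And>k. k \<in> T \<Longrightarrow> s k \<in> R - {0} \<and> v j (s k) = 0 \<and> v k (s k) > 0"
    using sep by metis
  define x where "x = (\<Prod>i\<in>T. s i ^ nat (N i))"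
  have R: "s i ^ nat (N i) \<in> R - {0}" if "i \<in> T" for i using s[OF that] power_closed by auto
  have xR: "x \<in> R - {0}" using R fin unfolding x_def by (auto intro!: prod_closed)
  have vx: "v k x = (\<Sum>i\<in>T. int (nat (N i)) * v k (s i))" if "k \<in> insert j T" for k
    unfolding x_def using valuation_on_prod[OF val[OF that], of T "\<lambda>i. s i ^ nat (N i)"] R
      valuation_on_power[OF val[OF that]] s by (auto intro!: sum.cong)
  have "v j x = 0" using vx[of j] s by simp
  moreover have "v k x \<ge> N k" if k: "k \<in> T" for k
  proof -
    have "int (nat (N k)) * v k (s k) \<le> (\<Sum>i\<in>T. int (nat (N i)) * v k (s i))"
      by (rule member_le_sum[OF k]) (use fin s nonneg[OF k] in auto)
    then have "int (nat (N k)) * v k (s k) \<le> v k x" using vx[of k] k by simp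
    moreover have "int (nat (N k)) * 1 \<le> int (nat (N k)) * v k (s k)"
      using s[OF k] by (intro mult_left_mono) auto
    ultimately show ?thesis by linarith
  qed
  ultimately show ?thesis using xR by blast
qed

end

text \<open>A Krull domain with an irredundant defining family: \<open>separated\<close> yields an
  element in the center of \<open>j'\<close> but not in that of \<open>j\<close>. Together with
  \<open>mem_iff\<close> and \<open>finite_support\<close> this makes each \<open>v j\<close> the
  valuation of a localization of \<open>R\<close>.\<close>

locale krull_family = field_subring R for R :: "'f::field set" +
  fixes J :: "'j set" and v :: "'j \<Rightarrow> 'f \<Rightarrow> int"
  assumes valuation: "j \<in> J \<Longrightarrow> valuation_on (fraction_set R) (v j)"
    and normalized: "j \<in> J \<Longrightarrow> \<exists>t\<in>fraction_set R - {0}. v j t = 1"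
    and mem_iff: "x \<in> fraction_set R - {0} \<Longrightarrow> x \<in> R \<longleftrightarrow> (\<forall>j\<in>J. v j x \<ge> 0)"
    and finite_support: "x \<in> fraction_set R - {0} \<Longrightarrow> finite {j \<in> J. v j x \<noteq> 0}"
    and separated: "j \<in> J \<Longrightarrow> j' \<in> J \<Longrightarrow> j \<noteq> j' \<Longrightarrow> \<exists>s\<in>R - {0}. v j s = 0 \<and> v j' s > 0"
begin

sublocale F: field_subring "fraction_set R" by (rule field_subring_fraction_set)

definition center :: "'j \<Rightarrow> 'f set" where
  "center j = {x \<in> R. x = 0 \<or> v j x > 0}"

lemma nonneg: "j \<in> J \<Longrightarrow> x \<in> R - {0} \<Longrightarrow> v j x \<ge> 0"
  using mem_iff[of x] subset_fraction_set by auto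

lemma valuation_ring: "j \<in> J \<Longrightarrow> valuation_on R (v j)"
  using valuation_on_subset[OF valuation subset_fraction_set] .

lemma valuation_divide:
  "j \<in> J \<Longrightarrow> x \<in> fraction_set R - {0} \<Longrightarrow> y \<in> fraction_set R - {0} \<Longrightarrow> v j (x / y) = v j x - v j y"
  using valuation_on_mult[OF valuation, of j "x / y" y] divide_fraction_set by auto

lemma family_approximation:
  assumes "j \<in> J" "T \<subseteq> J - {j}" "finite T"
  shows "\<exists>s\<in>R - {0}. v j s = 0 \<and> (\<forall>k\<in>T. v k s \<ge> N k)"
  by (rule approximation)
    (use assms valuation_ring nonneg separated[OF assms(1)] in \<open>auto simp: subset_iff\<close>)

text \<open>Only finitely many members of the family take negative values at \<open>x\<close>.
  Approximation gives an element of value 0 at \<open>j\<close> that cancels all these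
  poles.\<close>

lemma localization:
  assumes j: "j \<in> J" and x: "x \<in> fraction_set R - {0}" "v j x \<ge> 0"
  shows "\<exists>s\<in>R - center j. s * x \<in> R"
proof -
  define T where "T = {k \<in> J. v k x < 0}"
  have "finite T" using finite_support[OF x(1)] by (rule rev_finite_subset) (auto simp: T_def)
  moreover have "T \<subseteq> J - {j}" using x by (auto simp: T_def)
  ultimately obtain s where s: "s \<in> R - {0}" "v j s = 0" "\<And>k. k \<in> T \<Longrightarrow> v k s \<ge> - v k x"
    using family_approximation[OF j, of T "\<lambda>k. - v k x"] by auto
  have sF: "s \<in> fraction_set R" using s subset_fraction_set by auto
  have "v k (s * x) \<ge> 0" if "k \<in> J" for k
    using valuation_on_mult[OF valuation[OF that], of s x] s(1) x(1) sF s(3)[of k]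
      nonneg[OF that s(1)] that by (cases "k \<in> T") (auto simp: T_def)
  then have "s * x \<in> R" using mem_iff[of "s * x"] F.mult_closed[OF sF] s x by auto
  then show ?thesis using s by (auto simp: center_def)
qed

lemma valuation_at_center:
  assumes "j \<in> J" "x \<in> fraction_set R - {0}"
  shows "valuation_at R (center j) x = v j x"
  by (rule valuation_at_eq[OF valuation nonneg center_def localization normalized]) (use assms in auto)

lemma center_prime:
  assumes j: "j \<in> J"
  shows "primeideal (center j) (subring_of_field R)"
  unfolding primeideal_iff
proof (intro conjI ballI impI idealI)
  note val = valuation_ring[OF j]
  show "center j \<subseteq> R" "0 \<in> center j" using zero_closed by (auto simp: center_def)
  show "1 \<notin> center j" using valuation_on_one[OF val] by (auto simp: center_def)
  fix x y assume xy: "x \<in> R" "y \<in> R" "x * y \<in> center j"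
  then show "x \<in> center j \<or> y \<in> center j"
    using valuation_on_mult[OF val xy(1,2)] nonneg[OF j, of x] nonneg[OF j, of y]
    by (cases "x = 0"; cases "y = 0") (auto simp: center_def)
next
  note val = valuation_ring[OF j]
  fix x y assume "x \<in> center j" "y \<in> center j"
  then show "x + y \<in> center j"
    using valuation_on_add[OF val, of x y] add_closed[of x y]
    by (cases "x = 0"; cases "y = 0"; cases "x + y = 0") (auto simp: center_def)
next
  note val = valuation_ring[OF j]
  fix x r assume "x \<in> center j" "r \<in> R"
  then show "r * x \<in> center j"
    using valuation_on_mult[OF val, of r x] mult_closed nonneg[OF j, of r]
    by (cases "x = 0"; cases "r = 0") (auto simp: center_def zero_closed)
qed

text \<open>A fraction of value 1, made integral by a factor of value 0, is a nonzero element of the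
  center.\<close>

lemma center_nonzero:
  assumes j: "j \<in> J"
  shows "center j \<noteq> {0}"
proof -
  obtain t where t: "t \<in> fraction_set R - {0}" "v j t = 1" using normalized[OF j] by auto
  then obtain s where s: "s \<in> R - center j" "s * t \<in> R" using localization[OF j, of t] by auto
  have "s \<noteq> 0" "v j s = 0" using s nonneg[OF j, of s] zero_closed by (auto simp: center_def)
  moreover have "s \<in> fraction_set R" using s subset_fraction_set by auto
  ultimately have "v j (s * t) = 1" using valuation_on_mult[OF valuation[OF j], of s t] t by simp
  then have "s * t \<in> center j" using s(2) unfolding center_def by simp
  moreover have "s * t \<noteq> 0" using t \<open>s \<noteq> 0\<close> by simp
  ultimately show ?thesis by (metis singletonD)
qed

text \<open>Let \<open>q\<close> be a nonzero element of \<open>Q\<close> and \<open>x\<close> an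
  element of the center. A high power of \<open>x\<close> is divisible by \<open>q\<close> in the
  valuation ring of \<open>j\<close>. The denominator of the quotient is outside the center, hence
  outside \<open>Q\<close>, so primality moves the power of \<open>x\<close> into
  \<open>Q\<close>.\<close>

lemma prime_subset_center:
  assumes j: "j \<in> J" and Q: "primeideal Q (subring_of_field R)" "Q \<subseteq> center j" "Q \<noteq> {0}"
  shows "Q = center j"
proof (intro equalityI subsetI)
  note QD = idealD[OF primeidealD(1)[OF Q(1)]]
  obtain q where q: "q \<in> Q" "q \<noteq> 0" using QD(2) Q(3) by blast
  have qF: "q \<in> fraction_set R - {0}" using q QD(1) subset_fraction_set by auto
  fix x assume x: "x \<in> center j"
  show "x \<in> Q"
  proof (cases "x = 0")
    case False
    then have xR: "x \<in> R" "v j x > 0" using x by (auto simp: center_def)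
    then have xF: "x \<in> fraction_set R" using subset_fraction_set by auto
    define n where "n = nat (v j q)"
    have xn: "x ^ n \<in> fraction_set R - {0}" using F.power_closed xF False by auto
    have "v j (x ^ n) = int n * v j x" using F.valuation_on_power[OF valuation[OF j] xF False] .
    moreover have "int n * 1 \<le> int n * v j x" using xR by (intro mult_left_mono) auto
    moreover have "v j q \<le> int n" by (simp add: n_def)
    ultimately have "v j (x ^ n / q) \<ge> 0"
      using valuation_divide[OF j xn qF] by linarith
    then obtain s where s: "s \<in> R - center j" "s * (x ^ n / q) \<in> R"
      using localization[OF j, of "x ^ n / q"] divide_fraction_set[of "x ^ n" q] xn qF by auto
    have "s * (x ^ n / q) * q \<in> Q" using QD(4)[OF q(1) s(2)] .
    then have "s * x ^ n \<in> Q" using q by simp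
    then have "x ^ n \<in> Q" using primeidealD(3)[OF Q(1), of s "x ^ n"] s Q(2) power_closed xR by auto
    then show ?thesis using primeideal_powerD[OF Q(1) xR(1)] by auto
  qed (use QD in auto)
qed (use Q in auto)

text \<open>If no center lay in \<open>Q\<close>, each would contain some \<open>x j\<close> outside
  \<open>Q\<close>. For \<open>q\<close> in \<open>Q\<close> the product of the \<open>x j\<close>
  to the power \<open>v j q\<close>, over the finitely many \<open>j\<close> with
  \<open>v j q \<noteq> 0\<close>, is a multiple of \<open>q\<close>; it would lie in
  \<open>Q\<close> without any of its factors doing so.\<close>

lemma prime_contains_center:
  assumes Q: "primeideal Q (subring_of_field R)" "Q \<noteq> {0}"
  shows "\<exists>j\<in>J. center j \<subseteq> Q"
proof (rule ccontr)
  assume "\<not> ?thesis"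
  then have "\<forall>j\<in>J. \<exists>x\<in>center j. x \<notin> Q" by auto
  then obtain x where x: "\<And>j. j \<in> J \<Longrightarrow> x j \<in> center j \<and> x j \<notin> Q" by metis
  note QD = idealD[OF primeidealD(1)[OF Q(1)]]
  obtain q where q: "q \<in> Q" "q \<noteq> 0" using QD(2) Q(2) by blast
  have qF: "q \<in> fraction_set R - {0}" using q QD(1) subset_fraction_set by auto
  define T where "T = {j \<in> J. v j q \<noteq> 0}"
  have T: "finite T" "T \<subseteq> J" using finite_support[OF qF] by (auto simp: T_def)
  have xR: "x j \<in> R - {0}" "v j (x j) > 0" if "j \<in> J" for j
    using x[OF that] QD(2) by (auto simp: center_def)
  define y where "y = (\<Prod>j\<in>T. x j ^ nat (v j q))"
  have R: "x i ^ nat (v i q) \<in> R - {0}" if "i \<in> T" for i using xR[of i] that T power_closed by auto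
  have yR: "y \<in> R - {0}" using R T(1) unfolding y_def by (auto intro!: prod_closed)
  have val: "v k y = (\<Sum>i\<in>T. int (nat (v i q)) * v k (x i))" if "k \<in> J" for k
    unfolding y_def
    using valuation_on_prod[OF valuation_ring[OF that], of T "\<lambda>i. x i ^ nat (v i q)"] R
      valuation_on_power[OF valuation_ring[OF that]] xR T(2) by (auto intro!: sum.cong)
  have yF: "y \<in> fraction_set R - {0}" using yR subset_fraction_set by auto
  have "v k (y / q) \<ge> 0" if k: "k \<in> J" for k
  proof (cases "k \<in> T")
    case True
    have "int (nat (v k q)) * v k (x k) \<le> v k y"
      unfolding val[OF k]
    proof (rule member_le_sum[OF True])
      fix i assume "i \<in> T - {k}"
      then show "0 \<le> int (nat (v i q)) * v k (x i)" using nonneg[OF k, of "x i"] xR[of i] T by auto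
    qed (use T in auto)
    moreover have "int (nat (v k q)) * 1 \<le> int (nat (v k q)) * v k (x k)"
      using xR(2)[OF k] by (intro mult_left_mono) auto
    ultimately show ?thesis using valuation_divide[OF k yF qF] by linarith
  next
    case False
    then show ?thesis using valuation_divide[OF k yF qF] nonneg[OF k yR] k by (auto simp: T_def)
  qed
  then have "y / q \<in> R" using mem_iff[of "y / q"] divide_fraction_set[of y q] yF qF by auto
  then have "y / q * q \<in> Q" using QD(4)[OF q(1)] by blast
  then have "y \<in> Q" using q by simp
  then obtain i where "i \<in> T" "x i ^ nat (v i q) \<in> Q"
    using primeideal_prodD[OF Q(1) T(1), of "\<lambda>i. x i ^ nat (v i q)"] R unfolding y_def by auto
  then show False using primeideal_powerD[OF Q(1), of "x i"] x[of i] xR[of i] T by auto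
qed

lemma height_one_primes_eq: "height_one_primes R = center ` J"
proof (intro equalityI subsetI)
  fix P assume "P \<in> height_one_primes R"
  then have P: "primeideal P (subring_of_field R)" "P \<noteq> {0}"
    "\<And>Q. primeideal Q (subring_of_field R) \<Longrightarrow> Q \<subseteq> P \<Longrightarrow> Q = {0} \<or> Q = P"
    by (auto simp: height_one_primes_def)
  obtain j where "j \<in> J" "center j \<subseteq> P" using prime_contains_center[OF P(1,2)] by auto
  then show "P \<in> center ` J" using P(3)[OF center_prime] center_nonzero by auto
next
  fix P assume "P \<in> center ` J"
  then show "P \<in> height_one_primes R"
    using center_prime center_nonzero prime_subset_center by (auto simp: height_one_primes_def)
qed

lemma inj_on_center: "inj_on center J"
proof (rule inj_onI, rule ccontr)
  fix i j assume ij: "i \<in> J" "j \<in> J" "center i = center j" "i \<noteq> j"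
  then obtain s where "s \<in> R - {0}" "v i s = 0" "v j s > 0" using separated by blast
  then show False using ij(3) by (auto simp: center_def)
qed

end

section \<open>Noetherian rings and residue fields\<close>

definition noetherian_subring :: "'f::field set \<Rightarrow> bool" where
  "noetherian_subring R \<longleftrightarrow>
     (\<forall>I :: nat \<Rightarrow> 'f set. (\<forall>n. ideal (I n) (subring_of_field R)) \<and> (\<forall>n. I n \<subseteq> I (Suc n)) \<longrightarrow>
        (\<exists>N. \<forall>n\<ge>N. I n = I N))"

definition adjoin :: "'f::field set \<Rightarrow> 'f \<Rightarrow> 'f set" where
  "adjoin R s = {poly p s | p. \<forall>i. coeff p i \<in> R}"

lemma adjoinI: "(\<And>i. coeff p i \<in> R) \<Longrightarrow> x = poly p s \<Longrightarrow> x \<in> adjoin R s"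
  by (auto simp: adjoin_def)

context field_subring
begin

lemma field_subring_adjoin: "field_subring (adjoin R s)"
proof
  show "1 \<in> adjoin R s"
    by (rule adjoinI[of "[:1:]"]) (auto simp: coeff_pCons ring_closed split: nat.split)
  fix x y assume "x \<in> adjoin R s" "y \<in> adjoin R s"
  then obtain p q where *: "x = poly p s" "y = poly q s" "\<And>i. coeff p i \<in> R" "\<And>i. coeff q i \<in> R"
    by (auto simp: adjoin_def)
  show "x - y \<in> adjoin R s"
    by (rule adjoinI[of "p - q"]) (use * diff_closed in auto)
  show "x * y \<in> adjoin R s"
    by (rule adjoinI[of "p * q"]) (use * in \<open>auto simp: coeff_mult intro!: sum_closed mult_closed\<close>)
qed

lemma subset_adjoin: "R \<subseteq> adjoin R s" "s \<in> adjoin R s"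
proof -
  show "R \<subseteq> adjoin R s"
  proof
    fix x assume "x \<in> R"
    then show "x \<in> adjoin R s"
      by (intro adjoinI[of "[:x:]"]) (auto simp: coeff_pCons zero_closed split: nat.split)
  qed
  show "s \<in> adjoin R s"
    by (rule adjoinI[of "[:0, 1:]"]) (auto simp: coeff_pCons ring_closed split: nat.split)
qed

text \<open>\<open>s\<close> may be algebraic over \<open>R\<close>, so elements of
  \<open>R[s]\<close> have no degree. The definition therefore runs over all polynomials of degree
  at most \<open>n\<close> that represent an element of \<open>I\<close>, and takes their
  coefficient at \<open>n\<close> even where it is 0.\<close>

definition leading_ideal :: "'f \<Rightarrow> nat \<Rightarrow> 'f set \<Rightarrow> 'f set" where
  "leading_ideal s n I = {coeff p n | p. degree p \<le> n \<and> (\<forall>i. coeff p i \<in> R) \<and> poly p s \<in> I}"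

lemma ideal_leading_ideal:
  assumes I: "ideal I (subring_of_field (adjoin R s))"
  shows "ideal (leading_ideal s n I) (subring_of_field R)"
proof (rule idealI)
  note ID = field_subring.idealD[OF field_subring_adjoin I]
  show "leading_ideal s n I \<subseteq> R" by (auto simp: leading_ideal_def)
  show "0 \<in> leading_ideal s n I"
    unfolding leading_ideal_def by (rule CollectI, rule exI[of _ 0]) (use ID zero_closed in auto)
  fix x assume "x \<in> leading_ideal s n I"
  then obtain p where p: "x = coeff p n" "degree p \<le> n" "\<And>i. coeff p i \<in> R" "poly p s \<in> I"
    by (auto simp: leading_ideal_def)
  show "x + y \<in> leading_ideal s n I" if "y \<in> leading_ideal s n I" for y
  proof -
    from that obtain q where "y = coeff q n" "degree q \<le> n" "\<And>i. coeff q i \<in> R" "poly q s \<in> I"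
      by (auto simp: leading_ideal_def)
    then show ?thesis
      unfolding leading_ideal_def
      by (intro CollectI exI[of _ "p + q"]) (use p ID add_closed degree_add_le in auto)
  qed
  show "r * x \<in> leading_ideal s n I" if "r \<in> R" for r
    unfolding leading_ideal_def
    by (intro CollectI exI[of _ "smult r p"])
      (use p ID(4)[OF p(4), of r] that subset_adjoin mult_closed degree_smult_le[of r p]
        in \<open>auto intro: order_trans\<close>)
qed

lemma leading_ideal_Suc:
  assumes I: "ideal I (subring_of_field (adjoin R s))"
  shows "leading_ideal s n I \<subseteq> leading_ideal s (Suc n) I"
proof
  note ID = field_subring.idealD[OF field_subring_adjoin I]
  fix x assume "x \<in> leading_ideal s n I"
  then obtain p where p: "x = coeff p n" "degree p \<le> n" "\<And>i. coeff p i \<in> R" "poly p s \<in> I"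
    by (auto simp: leading_ideal_def)
  show "x \<in> leading_ideal s (Suc n) I"
    unfolding leading_ideal_def
    by (intro CollectI exI[of _ "pCons 0 p"])
      (use p ID(4)[OF p(4) subset_adjoin(2)] zero_closed in \<open>auto simp: coeff_pCons split: nat.split\<close>)
qed

lemma leading_ideal_mono: "I \<subseteq> I' \<Longrightarrow> leading_ideal s n I \<subseteq> leading_ideal s n I'"
  by (auto simp: leading_ideal_def)

text \<open>Induction on a bound for the degree: an element of \<open>I'\<close> has the same top
  coefficient as some element of \<open>I\<close>, and the difference is in \<open>I'\<close> with a
  smaller bound. Bounding by vanishing coefficients makes the zero polynomial the case
  \<open>n = 0\<close>.\<close>

lemma eq_if_leading_ideal_eq:
  assumes I: "ideal I (subring_of_field (adjoin R s))"
    and I': "ideal I' (subring_of_field (adjoin R s))"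
    and sub: "I \<subseteq> I'" and eq: "\<And>n. leading_ideal s n I = leading_ideal s n I'"
  shows "I = I'"
proof -
  note ID = field_subring.idealD[OF field_subring_adjoin I]
  note ID' = field_subring.idealD[OF field_subring_adjoin I']
  have *: "\<forall>p. (\<forall>i\<ge>n. coeff p i = 0) \<longrightarrow> (\<forall>i. coeff p i \<in> R) \<longrightarrow> poly p s \<in> I' \<longrightarrow> poly p s \<in> I" for n
  proof (induction n)
    case 0
    then show ?case using ID(2) by (auto simp: poly_eq_iff[of _ 0, simplified, symmetric])
  next
    case (Suc n)
    show ?case
    proof (intro allI impI)
      fix p assume p: "\<forall>i\<ge>Suc n. coeff p i = 0" "\<forall>i. coeff p i \<in> R" "poly p s \<in> I'"
      then have "degree p \<le> n" by (intro degree_le) auto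
      then have "coeff p n \<in> leading_ideal s n I'" using p by (auto simp: leading_ideal_def)
      then have "coeff p n \<in> leading_ideal s n I" using eq by simp
      then obtain q where q: "coeff p n = coeff q n" "degree q \<le> n" "\<And>i. coeff q i \<in> R" "poly q s \<in> I"
        by (auto simp: leading_ideal_def)
      have "\<forall>i\<ge>n. coeff (p - q) i = 0"
      proof (intro allI impI)
        fix i assume "i \<ge> n"
        then consider "i = n" | "i > n" by linarith
        then show "coeff (p - q) i = 0"
          by cases (use p q in \<open>auto simp: coeff_eq_0\<close>)
      qed
      moreover have "\<forall>i. coeff (p - q) i \<in> R" using p q diff_closed by auto
      moreover have "poly (p - q) s \<in> I'" using p q ID'(6) sub by auto
      ultimately have "poly (p - q) s \<in> I" using Suc by blast
      then have "poly (p - q) s + poly q s \<in> I" using ID(3) q by blast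
      then show "poly p s \<in> I" by simp
    qed
  qed
  have "x \<in> I" if x: "x \<in> I'" for x
  proof -
    obtain p where p: "x = poly p s" "\<And>i. coeff p i \<in> R" using x ID'(1) by (auto simp: adjoin_def)
    then show ?thesis using *[of "Suc (degree p)"] x by (auto simp: coeff_eq_0)
  qed
  then show ?thesis using sub by auto
qed

text \<open>Hilbert's basis theorem. For a chain of ideals \<open>I\<^sub>k\<close> the ideals of leading coefficients
  \<open>L n k\<close> increase in both arguments, so the diagonal bounds all of them with \<open>n\<close> large, and
  the finitely many remaining rows stabilise separately.\<close>

lemma noetherian_adjoin:
  assumes noeth: "noetherian_subring R"
  shows "noetherian_subring (adjoin R s)"
  unfolding noetherian_subring_def
proof (intro allI impI, elim conjE)
  fix I assume id: "\<forall>n. ideal (I n) (subring_of_field (adjoin R s))" and suc: "\<forall>n. I n \<subseteq> I (Suc n)"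
  define L where "L n k = leading_ideal s n (I k)" for n k
  have idL: "ideal (L n k) (subring_of_field R)" for n k
    unfolding L_def using id ideal_leading_ideal by blast
  have L1: "L n k \<subseteq> L (Suc n) k" and L2: "L n k \<subseteq> L n (Suc k)" for n k
    unfolding L_def using id suc leading_ideal_Suc leading_ideal_mono by blast+
  have mono1: "L n k \<subseteq> L n' k" if "n \<le> n'" for n n' k
    using lift_Suc_mono_le[of "\<lambda>n. L n k"] L1 that by auto
  have mono2: "L n k \<subseteq> L n k'" if "k \<le> k'" for n k k'
    using lift_Suc_mono_le[of "\<lambda>k. L n k"] L2 that by auto
  have stab: "\<exists>N. \<forall>k\<ge>N. f k = f N"
    if "\<And>k. ideal (f k) (subring_of_field R)" "\<And>k. f k \<subseteq> f (Suc k)" for f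
    using noeth that unfolding noetherian_subring_def by blast
  have "\<exists>N. \<forall>k\<ge>N. L k k = L N N"
    using stab[of "\<lambda>k. L k k"] idL L1 L2 by (meson order_trans)
  then obtain N where N: "\<And>k. k \<ge> N \<Longrightarrow> L k k = L N N" by blast
  have "\<forall>n. \<exists>M. \<forall>k\<ge>M. L n k = L n M" using stab[of "L _"] idL L2 by blast
  then obtain M where M: "\<And>n k. k \<ge> M n \<Longrightarrow> L n k = L n (M n)" by metis
  define K where "K = Max (insert N (M ` {..N}))"
  have K: "K \<ge> N" "\<And>n. n \<le> N \<Longrightarrow> K \<ge> M n" unfolding K_def by (rule Max_ge; simp)+
  have "I k = I K" if k: "k \<ge> K" for k
  proof (rule sym, rule eq_if_leading_ideal_eq)
    show "I K \<subseteq> I k" using lift_Suc_mono_le[of I] suc k by auto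
    show "leading_ideal s n (I K) = leading_ideal s n (I k)" for n
    proof (cases "n \<le> N")
      case True
      then have "M n \<le> K" by (rule K(2))
      then show ?thesis using M[of n k] M[of n K] k by (simp add: L_def)
    next
      case False
      define m where "m = max n k"
      have "L N N \<subseteq> L n N" "L n N \<subseteq> L n K" "L n K \<subseteq> L n k" "L n k \<subseteq> L m k" "L m k \<subseteq> L m m"
        using False K(1) k by (auto simp: m_def intro!: mono1 mono2 del: subsetI)
      moreover have "L m m = L N N" using N[of m] False by (auto simp: m_def)
      ultimately have "L n K = L n k" by (metis subset_antisym subset_trans)
      then show ?thesis by (simp add: L_def)
    qed
  qed (use id in auto)
  then show "\<exists>N. \<forall>n\<ge>N. I n = I N" by blast
qed

text \<open>Otherwise dependent choice builds a strictly increasing chain. The lower bound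
  \<open>I0\<close> is carried along the chain so that the maximal member can be required to contain
  it.\<close>

lemma noetherian_maximal:
  assumes noeth: "noetherian_subring R"
    and S: "I0 \<in> S" "\<And>I. I \<in> S \<Longrightarrow> ideal I (subring_of_field R)"
  shows "\<exists>I\<in>S. I0 \<subseteq> I \<and> (\<forall>K\<in>S. I \<subseteq> K \<longrightarrow> K = I)"
proof (rule ccontr)
  assume contra: "\<not> ?thesis"
  have larger: "\<exists>K\<in>S. I \<subseteq> K \<and> K \<noteq> I" if "I \<in> S" "I0 \<subseteq> I" for I
    using contra that by meson
  have "\<exists>f. \<forall>n. (f n \<in> S \<and> I0 \<subseteq> f n) \<and> f n \<subset> f (Suc n)"
  proof (rule dependent_nat_choice)
    show "\<exists>x. x \<in> S \<and> I0 \<subseteq> x" using S by auto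
    fix I assume I: "I \<in> S \<and> I0 \<subseteq> I"
    then obtain K where "K \<in> S" "I \<subseteq> K" "K \<noteq> I" using larger by meson
    then show "\<exists>y. (y \<in> S \<and> I0 \<subseteq> y) \<and> I \<subset> y"
      using I by (intro exI[of _ K]) (simp add: psubset_eq order_trans[of I0 I K])
  qed
  then obtain f where f: "\<And>n. f n \<in> S" "\<And>n. f n \<subset> f (Suc n)" by blast
  have "\<exists>N. \<forall>n\<ge>N. f n = f N"
    using noeth f S(2) unfolding noetherian_subring_def by (meson psubset_imp_subset)
  then obtain N where "\<forall>n\<ge>N. f n = f N" by blast
  then have "f (Suc N) = f N" by (meson le_Suc_eq order_refl)
  then show False using f(2)[of N] by auto
qed

lemma noetherian_exists_maximalideal:
  assumes noeth: "noetherian_subring R" and I: "ideal I (subring_of_field R)" "1 \<notin> I"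
  shows "\<exists>M. maximalideal M (subring_of_field R) \<and> I \<subseteq> M"
proof -
  let ?S = "{I. ideal I (subring_of_field R) \<and> 1 \<notin> I}"
  have "\<exists>M\<in>?S. I \<subseteq> M \<and> (\<forall>K\<in>?S. M \<subseteq> K \<longrightarrow> K = M)"
    by (rule noetherian_maximal[OF noeth]) (use I in simp_all)
  then obtain M where "M \<in> ?S" "\<forall>K\<in>?S. M \<subseteq> K \<longrightarrow> K = M" "I \<subseteq> M"
    by (elim bexE conjE)
  then have M: "ideal M (subring_of_field R)" "1 \<notin> M" "I \<subseteq> M"
    "\<And>K. ideal K (subring_of_field R) \<Longrightarrow> 1 \<notin> K \<Longrightarrow> M \<subseteq> K \<Longrightarrow> K = M"
    by simp_all
  have "\<exists>y\<in>R. x * y - 1 \<in> M" if x: "x \<in> R - M" for x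
  proof -
    define K where "K = {m + x * y | m y. m \<in> M \<and> y \<in> R}"
    have K: "ideal K (subring_of_field R)" "M \<subseteq> K" "x \<in> K"
      using ideal_adjoin[OF M(1), of x] x by (auto simp: K_def)
    then have "1 \<in> K" using M(4)[OF K(1)] x by auto
    then obtain m y where "1 = m + x * y" "m \<in> M" "y \<in> R" by (auto simp: K_def)
    then have "x * y - 1 = - m" by (simp add: algebra_simps)
    then show ?thesis using idealD(5)[OF M(1) \<open>m \<in> M\<close>] \<open>y \<in> R\<close> by metis
  qed
  then show ?thesis using M unfolding maximalideal_iff by blast
qed

text \<open>Noetherian induction: take an ideal \<open>I\<close> containing \<open>f\<close>,
  maximal among those with infinitely many maximal ideals above. It is not maximal itself, so in
  dimension one it is not prime. If \<open>x y\<close> is in \<open>I\<close>, every maximal ideal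
  over \<open>I\<close> lies over \<open>I + x R\<close> or \<open>I + y R\<close>, and each of
  these has only finitely many.\<close>

lemma finite_maximalideals_over:
  assumes noeth: "noetherian_subring R"
    and dim: "\<And>P. primeideal P (subring_of_field R) \<Longrightarrow> P \<noteq> {0} \<Longrightarrow> maximalideal P (subring_of_field R)"
    and f: "f \<in> R" "f \<noteq> 0"
  shows "finite {M. maximalideal M (subring_of_field R) \<and> f \<in> M}"
proof (rule ccontr)
  define V where "V I = {M. maximalideal M (subring_of_field R) \<and> I \<subseteq> M}" for I
  assume inf: "infinite {M. maximalideal M (subring_of_field R) \<and> f \<in> M}"
  \<comment> \<open>The principal ideal of \<open>f\<close>, in the shape that
    \<open>ideal_adjoin\<close> produces from the zero ideal.\<close>
  define I0 where "I0 = {m + f * y | m y. m \<in> {0} \<and> y \<in> R}"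
  have zero: "ideal {0} (subring_of_field R)"
    by (rule idealI) (auto simp: zero_closed)
  have I0: "ideal I0 (subring_of_field R)" "f \<in> I0"
    using ideal_adjoin[OF zero f(1)] by (auto simp: I0_def)
  have sub: "m + x * y \<in> M" if "maximalideal M (subring_of_field R)" "x \<in> M" "m \<in> M" "y \<in> R" for M x y m
    using idealD(3)[of M m "x * y"] idealD(4)[of M x y] that by (auto simp: maximalideal_iff mult.commute)
  have "{M. maximalideal M (subring_of_field R) \<and> f \<in> M} \<subseteq> V I0"
    using sub[of _ f 0] idealD(2) by (fastforce simp: V_def I0_def maximalideal_iff)
  then have "infinite (V I0)" using inf finite_subset by blast
  let ?S = "{I. ideal I (subring_of_field R) \<and> infinite (V I)}"
  have "\<exists>I\<in>?S. I0 \<subseteq> I \<and> (\<forall>K\<in>?S. I \<subseteq> K \<longrightarrow> K = I)"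
    by (rule noetherian_maximal[OF noeth]) (use I0 \<open>infinite (V I0)\<close> in simp_all)
  then obtain I where "I \<in> ?S" "\<forall>K\<in>?S. I \<subseteq> K \<longrightarrow> K = I" "I0 \<subseteq> I"
    by (elim bexE conjE)
  then have I: "ideal I (subring_of_field R)" "infinite (V I)" "I0 \<subseteq> I"
    "\<And>K. ideal K (subring_of_field R) \<Longrightarrow> infinite (V K) \<Longrightarrow> I \<subseteq> K \<Longrightarrow> K = I"
    by simp_all
  have notmax: "\<not> maximalideal I (subring_of_field R)"
  proof
    assume m: "maximalideal I (subring_of_field R)"
    have "M = I" if M: "M \<in> V I" for M
    proof (rule ccontr)
      assume "M \<noteq> I"
      then obtain x where x: "x \<in> M" "x \<notin> I" using M by (auto simp: V_def)
      have Mi: "ideal M (subring_of_field R)" "1 \<notin> M" using M by (auto simp: V_def maximalideal_iff)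
      obtain y where y: "y \<in> R" "x * y - 1 \<in> I"
        using m x idealD(1)[OF Mi(1)] by (auto simp: maximalideal_iff)
      have "y * x \<in> M" using idealD(4)[OF Mi(1) x(1) y(1)] .
      moreover have "x * y - 1 \<in> M" using y M by (auto simp: V_def)
      ultimately have "y * x - (x * y - 1) \<in> M" using idealD(6)[OF Mi(1)] by blast
      then show False using Mi by (simp add: mult.commute)
    qed
    then have "V I \<subseteq> {I}" by auto
    then show False using I(2) finite_subset by blast
  qed
  have "I \<noteq> {0}" using I0(2) I(3) f(2) by auto
  then have "\<not> primeideal I (subring_of_field R)" using dim notmax by blast
  moreover have "1 \<notin> I"
  proof
    assume "1 \<in> I"
    then have "V I = {}" by (auto simp: V_def maximalideal_iff)
    then show False using I(2) by simp
  qed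
  ultimately obtain x y where xy: "x \<in> R" "y \<in> R" "x * y \<in> I" "x \<notin> I" "y \<notin> I"
    using I(1) unfolding primeideal_iff by blast
  define K where "K z = {m + z * y | m y. m \<in> I \<and> y \<in> R}" for z
  have K: "ideal (K z) (subring_of_field R)" "I \<subseteq> K z" "z \<in> K z" if "z \<in> R" for z
    using ideal_adjoin[OF I(1) that] by (auto simp: K_def)
  have "finite (V (K x))" "finite (V (K y))"
    using I(4)[OF K(1)] K xy by blast+
  moreover have "V I \<subseteq> V (K x) \<union> V (K y)"
  proof
    fix M assume M: "M \<in> V I"
    then have "primeideal M (subring_of_field R)" using maximalideal_imp_primeideal by (auto simp: V_def)
    then have "x \<in> M \<or> y \<in> M" using primeidealD(3) xy M by (auto simp: V_def)
    then show "M \<in> V (K x) \<union> V (K y)" using sub M by (auto simp: V_def K_def)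
  qed
  ultimately show False using I(2) finite_subset by blast
qed

end

section \<open>Complex scalars, evaluation of complex polynomials, and residue fields\<close>

locale complex_scalars =
  fixes h :: "complex \<Rightarrow> 'f::field"
  assumes hom: "h \<in> ring_hom ring_of_type_algebra ring_of_type_algebra"
begin

lemma hom_add: "h (x + y) = h x + h y"
  using ring_hom_add[OF hom, of x y] by (simp add: ring_of_type_algebra_def)

lemma hom_mult: "h (x * y) = h x * h y"
  using ring_hom_mult[OF hom, of x y] by (simp add: ring_of_type_algebra_def)

lemma hom_1 [simp]: "h 1 = 1"
  using ring_hom_one[OF hom] by (simp add: ring_of_type_algebra_def)

lemma hom_0 [simp]: "h 0 = 0"
  using hom_add[of 0 0] by (metis add.right_neutral add_left_cancel)

lemma hom_uminus: "h (- x) = - h x"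
  using hom_add[of x "- x"] by (simp add: eq_neg_iff_add_eq_0 add.commute)

lemma hom_diff: "h (x - y) = h x - h y"
  using hom_add[of x "- y"] hom_uminus by simp

lemma hom_eq_0_iff [simp]: "h x = 0 \<longleftrightarrow> x = 0"
proof
  assume "h x = 0"
  then show "x = 0" using hom_mult[of x "inverse x"] by (cases "x = 0") auto
qed auto

lemma hom_inverse: "h (inverse x) = inverse (h x)"
  using hom_mult[of x "inverse x"] by (cases "x = 0") (auto intro: inverse_unique[symmetric])

definition heval :: "complex poly \<Rightarrow> 'f \<Rightarrow> 'f" where
  "heval q x = poly (map_poly h q) x"

lemma heval_0 [simp]: "heval 0 x = 0"
  by (simp add: heval_def)

lemma heval_pCons: "heval (pCons a q) x = h a + x * heval q x"
  by (simp add: heval_def map_poly_pCons)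

lemma heval_add: "heval (p + q) x = heval p x + heval q x"
proof -
  have "map_poly h (p + q) = map_poly h p + map_poly h q"
    by (rule poly_eqI) (simp add: coeff_map_poly hom_add)
  then show ?thesis by (simp add: heval_def)
qed

lemma heval_smult: "heval (smult c p) x = h c * heval p x"
proof -
  have "map_poly h (smult c p) = smult (h c) (map_poly h p)"
    by (rule poly_eqI) (simp add: coeff_map_poly hom_mult)
  then show ?thesis by (simp add: heval_def)
qed

lemma heval_mult: "heval (p * q) x = heval p x * heval q x"
proof (induction p)
  case (pCons a p)
  then show ?case by (simp add: mult_pCons_left heval_add heval_smult heval_pCons algebra_simps)
qed simp

lemma heval_1 [simp]: "heval 1 x = 1"
  using heval_pCons[of 1 0 x] by (simp add: one_pCons)

lemma heval_uminus: "heval (- p) x = - heval p x"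
  using heval_smult[of "-1" p x] hom_uminus[of 1] by simp

lemma heval_diff: "heval (p - q) x = heval p x - heval q x"
  using heval_add[of p "- q" x] heval_uminus[of q x] by simp

lemma heval_sum: "heval (sum f A) x = (\<Sum>a\<in>A. heval (f a) x)"
  by (induction A rule: infinite_finite_induct) (auto simp: heval_add)

lemma heval_prod: "heval (prod f A) x = (\<Prod>a\<in>A. heval (f a) x)"
  by (induction A rule: infinite_finite_induct) (auto simp: heval_mult)

lemma heval_monom: "heval (monom c n) x = h c * x ^ n"
  by (simp add: heval_def map_poly_monom poly_monom)

end

locale complex_subalgebra = complex_scalars h + field_subring R
  for h :: "complex \<Rightarrow> 'f::field" and R :: "'f set" +
  assumes range_subset: "range h \<subseteq> R"
begin

lemma heval_closed: "x \<in> R \<Longrightarrow> heval q x \<in> R"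
proof (induction q)
  case (pCons a q)
  have "h a + x * heval q x \<in> R"
    by (intro add_closed mult_closed) (use pCons range_subset in auto)
  then show ?case by (simp add: heval_pCons)
qed (auto simp: zero_closed)

lemma primeideal_no_scalar:
  assumes P: "primeideal P (subring_of_field R)" and "c \<noteq> 0"
  shows "h c \<notin> P"
proof
  assume "h c \<in> P"
  then have "h (inverse c) * h c \<in> P"
    using idealD(4)[OF primeidealD(1)[OF P]] range_subset by blast
  then show False using hom_mult[of "inverse c" c] primeidealD(2)[OF P] assms(2) by simp
qed

text \<open>Over the algebraically closed scalars \<open>q\<close> splits into linear factors, and
  the prime must contain one of their values; the constant that remains in the end is a
  unit.\<close>

lemma root_of_heval_in_prime:
  assumes P: "primeideal P (subring_of_field R)" and x: "x \<in> R"
    and q: "q \<noteq> 0" "heval q x \<in> P"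
  shows "\<exists>r. poly q r = 0 \<and> x - h r \<in> P"
  using q
proof (induction "degree q" arbitrary: q)
  case 0
  then obtain c where "q = [:c:]" using degree_eq_zeroE by metis
  then show ?case using 0 primeideal_no_scalar[OF P, of c] by (auto simp: heval_pCons)
next
  case (Suc n)
  then have "degree q > 0" by simp
  then obtain z where z: "poly q z = 0" using alg_closed_imp_poly_has_root by blast
  then obtain q' where q': "q = [:- z, 1:] * q'" by (auto simp: poly_eq_0_iff_dvd dvd_def)
  have "q' \<noteq> 0" using Suc(3) q' by auto
  then have deg: "degree q' = n" using Suc(2) q' by (subst (asm) q', subst (asm) degree_mult_eq) auto
  have eq: "heval q x = (x - h z) * heval q' x"
    unfolding q' heval_mult by (simp add: heval_pCons hom_uminus)
  have "x - h z \<in> R" "heval q' x \<in> R" using x range_subset diff_closed heval_closed by auto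
  then consider "x - h z \<in> P" | "heval q' x \<in> P" using primeidealD(3)[OF P] Suc(4) eq by metis
  then show ?case
  proof cases
    case 1
    then show ?thesis using z by auto
  next
    case 2
    then obtain r where "poly q' r = 0" "x - h r \<in> P" using Suc(1)[of q'] deg \<open>q' \<noteq> 0\<close> by auto
    then show ?thesis using q' by auto
  qed
qed

definition scale :: "complex \<Rightarrow> 'f \<Rightarrow> 'f" where
  "scale c x = h c * x"

lemma vector_space_scale: "vector_space scale"
  by unfold_locales (auto simp: scale_def hom_add hom_mult algebra_simps)

text \<open>Zariski's lemma by counting: if no \<open>x - c\<close> lay in \<open>M\<close>, the inverses of the \<open>x - c\<close> modulo
  \<open>M\<close> would be uncountably many elements of a space of countable dimension, and a linear
  relation between finitely many of them is an algebraic equation for \<open>x\<close> modulo \<open>M\<close>.\<close>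

lemma residue_exists:
  assumes M: "maximalideal M (subring_of_field R)" and x: "x \<in> R"
    and B: "countable B" "R \<subseteq> module.span scale B"
  shows "\<exists>r. x - h r \<in> M"
proof (rule ccontr)
  assume no: "\<not> ?thesis"
  interpret vs: vector_space scale by (rule vector_space_scale)
  have P: "primeideal M (subring_of_field R)" using M by (rule maximalideal_imp_primeideal)
  note MD = idealD[OF primeidealD(1)[OF P]]
  have xc: "x - h c \<in> R - M" for c using no x range_subset diff_closed by auto
  then have "\<forall>c. \<exists>y\<in>R. (x - h c) * y - 1 \<in> M" using M unfolding maximalideal_iff by blast
  then obtain y where y: "\<And>c. y c \<in> R" "\<And>c. (x - h c) * y c - 1 \<in> M" by metis
  have "\<exists>T. finite T \<and> T \<subseteq> B \<and> y c \<in> vs.span T" for c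
  proof -
    have "y c \<in> vs.span B" using y B by auto
    then obtain t r where t: "finite t" "t \<subseteq> B" "y c = (\<Sum>a\<in>t. scale (r a) a)"
      by (auto simp: vs.span_explicit)
    have "y c \<in> vs.span t" unfolding t(3) by (intro vs.span_sum vs.span_scale vs.span_base)
    then show ?thesis using t by blast
  qed
  then obtain T where T: "\<And>c. finite (T c) \<and> T c \<subseteq> B \<and> y c \<in> vs.span (T c)" by metis
  have "\<exists>t. finite t \<and> infinite {c. y c \<in> vs.span t}"
  proof (rule ccontr)
    assume "\<not> ?thesis"
    then have fin: "\<And>t. finite t \<Longrightarrow> finite {c. y c \<in> vs.span t}" by auto
    have "countable (\<Union>t\<in>{t. finite t \<and> t \<subseteq> B}. {c. y c \<in> vs.span t})"
      using fin countable_Collect_finite_subset[OF B(1)] by (intro countable_UN) (auto intro: countable_finite)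
    moreover have "(\<Union>t\<in>{t. finite t \<and> t \<subseteq> B}. {c. y c \<in> vs.span t}) = UNIV" using T by blast
    ultimately show False using uncountable_UNIV_complex by simp
  qed
  then obtain t where t: "finite t" "infinite {c. y c \<in> vs.span t}" by blast
  define C where "C = {c. y c \<in> vs.span t}"
  \<comment> \<open>If \<open>y c = y d\<close> with \<open>c \<noteq> d\<close>, subtracting the
    two congruences puts \<open>(d - c) y c\<close> into \<open>M\<close>, hence \<open>y c\<close>
    itself, which is absurd for an inverse modulo \<open>M\<close>.\<close>
  have inj: "inj_on y C"
  proof (rule inj_onI, rule ccontr)
    fix c d assume cd: "y c = y d" "c \<noteq> d"
    have "((x - h c) * y c - 1) - ((x - h d) * y d - 1) \<in> M" using y MD(6) by blast
    then have *: "h (d - c) * y c \<in> M" using cd by (simp add: algebra_simps hom_diff)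
    have "h (inverse (d - c)) * (h (d - c) * y c) \<in> M" using MD(4)[OF *] range_subset by blast
    moreover have "h (inverse (d - c)) * (h (d - c) * y c) = y c"
      using cd(2) by (simp add: mult.assoc[symmetric] hom_mult[symmetric])
    ultimately have "y c \<in> M" by simp
    then have "(x - h c) * y c \<in> M" using MD(4) xc by blast
    then have "(x - h c) * y c - ((x - h c) * y c - 1) \<in> M" using MD(6) y by blast
    then show False using primeidealD(2)[OF P] by simp
  qed
  then have "infinite (y ` C)" using t finite_imageD unfolding C_def by blast
  moreover have "y ` C \<subseteq> vs.span t" by (auto simp: C_def)
  ultimately have "vs.dependent (y ` C)" using vs.independent_span_bound[OF t(1)] by blast
  then obtain U u where U: "finite U" "U \<subseteq> y ` C" "(\<Sum>v\<in>U. scale (u v) v) = 0" "\<exists>v\<in>U. u v \<noteq> 0"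
    unfolding vs.dependent_explicit by blast
  define D where "D = {c \<in> C. y c \<in> U}"
  have UD: "U = y ` D" using U(2) by (auto simp: D_def)
  have injD: "inj_on y D" using inj by (rule inj_on_subset) (auto simp: D_def)
  have finD: "finite D" using U(1) UD injD finite_imageD by blast
  define a where "a c = u (y c)" for c
  have rel: "(\<Sum>c\<in>D. h (a c) * y c) = 0"
    using U(3) unfolding UD by (simp add: sum.reindex[OF injD] a_def scale_def)
  obtain c0 where c0: "c0 \<in> D" "a c0 \<noteq> 0" using U(4) unfolding UD a_def by auto
  \<comment> \<open>Multiplying the linear relation by the product of all \<open>x - d\<close> turns
    \<open>y c\<close> into the partial product \<open>g c\<close>, modulo \<open>M\<close>. The
    resulting polynomial \<open>q\<close> is nonzero because at \<open>c0\<close> only the term of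
    \<open>c0\<close> survives.\<close>
  define g where "g c = (\<Prod>d\<in>D - {c}. [:- d, 1:])" for c
  define q where "q = (\<Sum>c\<in>D. smult (a c) (g c))"
  have "poly q c0 = (\<Sum>c\<in>D. a c * poly (g c) c0)" by (simp add: q_def poly_sum)
  also have "\<dots> = (\<Sum>c\<in>{c0}. a c * poly (g c) c0)"
    by (rule sum.mono_neutral_right) (use finD c0 in \<open>auto simp: g_def poly_prod\<close>)
  also have "\<dots> \<noteq> 0" using c0 finD by (auto simp: g_def poly_prod)
  finally have q0: "q \<noteq> 0" by auto
  have gR: "heval (g c) x \<in> R" for c using heval_closed x by blast
  have step: "h (a c) * heval (g c) x - (\<Prod>d\<in>D. x - h d) * (h (a c) * y c) \<in> M" if c: "c \<in> D" for c
  proof -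
    have "heval (g c) x = (\<Prod>d\<in>D - {c}. x - h d)"
      by (simp add: g_def heval_prod heval_pCons hom_uminus)
    then have eq: "(\<Prod>d\<in>D. x - h d) = (x - h c) * heval (g c) x"
      using prod.remove[OF finD c, of "\<lambda>d. x - h d"] by simp
    have "h (a c) * heval (g c) x - (\<Prod>d\<in>D. x - h d) * (h (a c) * y c) =
        (- h (a c) * heval (g c) x) * ((x - h c) * y c - 1)"
      unfolding eq by (simp add: algebra_simps)
    moreover have "- h (a c) * heval (g c) x \<in> R"
      using gR range_subset by (intro mult_closed uminus_closed) auto
    ultimately show ?thesis using MD(4)[OF y(2)[of c]] by metis
  qed
  have sumM: "sum f S \<in> M" if "\<And>c. c \<in> S \<Longrightarrow> f c \<in> M" for S :: "complex set" and f
    using that by (induction S rule: infinite_finite_induct) (auto intro: MD)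
  have "(\<Sum>c\<in>D. h (a c) * heval (g c) x - (\<Prod>d\<in>D. x - h d) * (h (a c) * y c)) \<in> M"
    using step by (rule sumM)
  then have "(\<Sum>c\<in>D. h (a c) * heval (g c) x) - (\<Prod>d\<in>D. x - h d) * (\<Sum>c\<in>D. h (a c) * y c) \<in> M"
    by (simp add: sum_subtractf sum_distrib_left)
  then have "heval q x \<in> M" by (simp add: rel q_def heval_sum heval_smult)
  then show False using root_of_heval_in_prime[OF P x q0] no by blast
qed

lemma countable_span_adjoin:
  assumes B: "countable B" "R \<subseteq> module.span scale B"
  shows "\<exists>B'. countable B' \<and> adjoin R s \<subseteq> module.span scale B'"
proof (intro exI conjI)
  interpret vs: vector_space scale by (rule vector_space_scale)
  define B' where "B' = (\<lambda>(b, i). b * s ^ i) ` (B \<times> (UNIV :: nat set))"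
  show "countable B'" using B by (auto simp: B'_def)
  have *: "b * s ^ i \<in> vs.span B'" if "b \<in> vs.span B" for b i
    using that
  proof (induction rule: vs.span_induct_alt)
    case (step c x y)
    have "x * s ^ i \<in> B'" using step by (force simp: B'_def)
    then have "scale c (x * s ^ i) + y * s ^ i \<in> vs.span B'"
      using step(2) by (rule vs.span_add[OF vs.span_scale[OF vs.span_base]])
    moreover have "scale c (x * s ^ i) + y * s ^ i = (scale c x + y) * s ^ i"
      by (simp add: scale_def algebra_simps)
    ultimately show ?case by (simp only:)
  qed (simp add: vs.span_zero)
  show "adjoin R s \<subseteq> vs.span B'"
  proof
    fix x assume "x \<in> adjoin R s"
    then obtain p where p: "x = poly p s" "\<And>i. coeff p i \<in> R" by (auto simp: adjoin_def)
    then show "x \<in> vs.span B'" using B by (auto simp: poly_altdef intro!: vs.span_sum *)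
  qed
qed

end

text \<open>Adjoining one generator at a time preserves the chain condition and countable dimension.
  The minimality clause is what later identifies \<open>R\<close> with the ring generated by scalars
  and generators.\<close>

lemma (in complex_scalars) finitely_generated_subalgebra:
  assumes "finite S"
  shows "\<exists>R B. complex_subalgebra h R \<and> S \<subseteq> R \<and> noetherian_subring R \<and>
    countable B \<and> R \<subseteq> module.span (\<lambda>c x. h c * x) B \<and>
    (\<forall>T. complex_subalgebra h T \<and> S \<subseteq> T \<longrightarrow> R \<subseteq> T)"
  using assms
proof (induction S rule: finite_induct)
  case empty
  interpret C: complex_subalgebra h "range h"
  proof
    show "1 \<in> range h" using hom_1 by (metis rangeI)
    fix x y assume "x \<in> range h" "y \<in> range h"
    then show "x - y \<in> range h" "x * y \<in> range h"
      by (auto simp flip: hom_diff hom_mult)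
  qed auto
  have sc: "C.scale = (\<lambda>c x. h c * x)" by (auto simp: C.scale_def fun_eq_iff)
  interpret vs: vector_space C.scale by (rule C.vector_space_scale)
  have "range h \<subseteq> vs.span {1}"
  proof
    fix x assume "x \<in> range h"
    then obtain c where "x = C.scale c 1" by (auto simp: C.scale_def)
    then show "x \<in> vs.span {1}" using vs.span_scale vs.span_base by blast
  qed
  moreover have "noetherian_subring (range h)"
    unfolding noetherian_subring_def
  proof (intro allI impI, elim conjE)
    fix I :: "nat \<Rightarrow> 'f set"
    assume id: "\<forall>n. ideal (I n) (subring_of_field (range h))" and suc: "\<forall>n. I n \<subseteq> I (Suc n)"
    \<comment> \<open>\<open>range h\<close> is a field: an ideal with a nonzero element is
      everything, so a chain can jump at most once.\<close>
    have "I n = {0} \<or> I n = range h" for n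
    proof (rule disjCI)
      note ID = C.idealD[OF id[rule_format, of n]]
      assume "I n \<noteq> range h"
      have "x = 0" if x: "x \<in> I n" for x
      proof (rule ccontr)
        assume "x \<noteq> 0"
        obtain c where c: "x = h c" using x ID(1) by auto
        have "h (z * inverse c) * x \<in> I n" for z using ID(4)[OF x] by blast
        moreover have "h (z * inverse c) * x = h z" for z
          using c \<open>x \<noteq> 0\<close> by (simp add: hom_mult[symmetric] mult.assoc)
        ultimately have "h z \<in> I n" for z by metis
        then show False using ID(1) \<open>I n \<noteq> range h\<close> by auto
      qed
      then show "I n = {0}" using ID(2) by auto
    qed
    note dich = this
    have mono: "I n \<subseteq> I k" if "n \<le> k" for n k using lift_Suc_mono_le[of I] suc that by auto
    show "\<exists>N. \<forall>n\<ge>N. I n = I N"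
    proof (cases "\<exists>N. I N = range h")
      case True
      then obtain N where N: "I N = range h" by auto
      have "I n = I N" if "n \<ge> N" for n using mono[OF that] N dich[of n] by auto
      then show ?thesis by blast
    qed (use dich in auto)
  qed
  ultimately have "complex_subalgebra h (range h) \<and> {} \<subseteq> range h \<and> noetherian_subring (range h) \<and>
    countable {1::'f} \<and> range h \<subseteq> module.span (\<lambda>c x. h c * x) {1} \<and>
    (\<forall>T. complex_subalgebra h T \<and> {} \<subseteq> T \<longrightarrow> range h \<subseteq> T)"
    using C.complex_subalgebra_axioms by (auto simp: sc complex_subalgebra_def complex_subalgebra_axioms_def)
  then show ?case by blast
next
  case (insert s S)
  obtain R B where R: "complex_subalgebra h R" "S \<subseteq> R" "noetherian_subring R"
    "countable B" "R \<subseteq> module.span (\<lambda>c x. h c * x) B"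
    "\<forall>T. complex_subalgebra h T \<and> S \<subseteq> T \<longrightarrow> R \<subseteq> T"
    using insert.IH by (elim exE conjE)
  interpret R: complex_subalgebra h R by fact
  have sc: "R.scale = (\<lambda>c x. h c * x)" by (auto simp: R.scale_def fun_eq_iff)
  interpret A: field_subring "adjoin R s" by (rule R.field_subring_adjoin)
  have A: "complex_subalgebra h (adjoin R s)"
    by unfold_locales (use R.range_subset R.subset_adjoin in auto)
  obtain B' where B': "countable B'" "adjoin R s \<subseteq> module.span (\<lambda>c x. h c * x) B'"
    using R.countable_span_adjoin[of B s] R(4,5) by (auto simp: sc)
  have "adjoin R s \<subseteq> T" if T: "complex_subalgebra h T" "insert s S \<subseteq> T" for T
  proof
    interpret T: complex_subalgebra h T by fact
    fix x assume "x \<in> adjoin R s"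
    then obtain p where p: "x = poly p s" "\<And>i. coeff p i \<in> R" by (auto simp: adjoin_def)
    then show "x \<in> T" using R(6)[rule_format, of T] T
      by (auto simp: poly_altdef intro!: T.sum_closed T.mult_closed T.power_closed)
  qed
  moreover have "insert s S \<subseteq> adjoin R s" using R(2) R.subset_adjoin[of s] by auto
  ultimately have "complex_subalgebra h (adjoin R s) \<and> insert s S \<subseteq> adjoin R s \<and>
    noetherian_subring (adjoin R s) \<and> countable B' \<and>
    adjoin R s \<subseteq> module.span (\<lambda>c x. h c * x) B' \<and>
    (\<forall>T. complex_subalgebra h T \<and> insert s S \<subseteq> T \<longrightarrow> adjoin R s \<subseteq> T)"
    using A B' R.noetherian_adjoin[OF R(3)] by simp
  then show ?case by (intro exI)
qed

section \<open>Smooth affine curves\<close>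

locale smooth_curve =
  fixes \<iota> :: "complex \<Rightarrow> 'k::field" and A0 :: "'k set"
  assumes smooth: "smooth_affine_curve \<iota> A0"
begin

sublocale complex_scalars \<iota>
  by unfold_locales (use smooth in \<open>simp add: smooth_affine_curve_def\<close>)

lemma finite_generation: "\<exists>S. finite S \<and> A0 = generate_ring ring_of_type_algebra (range \<iota> \<union> S)"
  and fraction_set_eq [simp]: "fraction_set A0 = UNIV"
  and dimension_pos: "\<exists>P. primeideal P (subring_of_field A0) \<and> P \<noteq> {0}"
  and dimension_le_1:
    "\<And>P. primeideal P (subring_of_field A0) \<Longrightarrow> P \<noteq> {0} \<Longrightarrow> maximalideal P (subring_of_field A0)"
  and exists_uniformizer: "\<And>p. p \<in> closed_points A0 \<Longrightarrow> \<exists>t. uniformizer A0 p t"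
  using smooth by (auto simp: smooth_affine_curve_def)

lemma field_subring_A0: "field_subring A0"
proof -
  let ?K = "ring_of_type_algebra :: 'k ring"
  obtain S where S: "A0 = generate_ring ?K (range \<iota> \<union> S)" using finite_generation by auto
  interpret K: ring ?K using ring_from_type_algebra .
  have minus: "\<ominus>\<^bsub>?K\<^esub> x = - x" for x
    by (rule K.minus_equality) (auto simp: ring_of_type_algebra_def)
  show ?thesis
  proof
    show "1 \<in> A0" using generate_ring.one[of ?K] S by (simp add: ring_of_type_algebra_def)
    fix x y assume xy: "x \<in> A0" "y \<in> A0"
    have "x \<oplus>\<^bsub>?K\<^esub> (\<ominus>\<^bsub>?K\<^esub> y) \<in> A0"
      using xy unfolding S by (intro generate_ring.eng_add generate_ring.a_inv)
    then show "x - y \<in> A0" unfolding minus by (simp add: ring_of_type_algebra_def)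
    have "x \<otimes>\<^bsub>?K\<^esub> y \<in> A0" using xy unfolding S by (rule generate_ring.eng_mult)
    then show "x * y \<in> A0" by (simp add: ring_of_type_algebra_def)
  qed
qed

sublocale field_subring A0 by (rule field_subring_A0)

sublocale complex_subalgebra \<iota> A0
proof
  show "range \<iota> \<subseteq> A0" using finite_generation by (auto intro: generate_ring.incl)
qed

lemma scalar_closed: "\<iota> c \<in> A0"
  using range_subset by auto

lemma noetherian: "noetherian_subring A0"
  and countable_dimension: "\<exists>B. countable B \<and> A0 \<subseteq> module.span scale B"
proof -
  let ?K = "ring_of_type_algebra :: 'k ring"
  obtain S where S: "finite S" "A0 = generate_ring ?K (range \<iota> \<union> S)" using finite_generation by auto
  obtain R B where R: "complex_subalgebra \<iota> R" "S \<subseteq> R" "noetherian_subring R"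
    "countable B" "R \<subseteq> module.span (\<lambda>c x. \<iota> c * x) B"
    "\<forall>T. complex_subalgebra \<iota> T \<and> S \<subseteq> T \<longrightarrow> R \<subseteq> T"
    using finitely_generated_subalgebra[OF S(1)] by (elim exE conjE)
  have "S \<subseteq> A0" using S(2) by (auto intro: generate_ring.incl)
  then have "R \<subseteq> A0" using R(6) complex_subalgebra_axioms by blast
  moreover have "A0 \<subseteq> R"
  proof
    interpret R: complex_subalgebra \<iota> R by fact
    interpret K: ring ?K using ring_from_type_algebra .
    have minus: "\<ominus>\<^bsub>?K\<^esub> x = - x" for x
      by (rule K.minus_equality) (auto simp: ring_of_type_algebra_def)
    fix x assume "x \<in> A0"
    then show "x \<in> R"
      unfolding S(2)
    proof (induction rule: generate_ring.induct)
      case (a_inv h)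
      then show ?case unfolding minus by (intro R.uminus_closed)
    qed (use R.range_subset R(2) in
      \<open>auto simp: ring_of_type_algebra_def R.one_closed R.add_closed R.mult_closed\<close>)
  qed
  ultimately have "R = A0" by blast
  then show "noetherian_subring A0" "\<exists>B. countable B \<and> A0 \<subseteq> module.span scale B"
    using R(3-5) by (auto simp: scale_def[abs_def])
qed

lemma closed_points_iff: "p \<in> closed_points A0 \<longleftrightarrow> primeideal p (subring_of_field A0) \<and> p \<noteq> {0}"
proof
  assume "p \<in> closed_points A0"
  then have p: "maximalideal p (subring_of_field A0)" by (simp add: closed_points_def)
  have "p \<noteq> {0}"
  proof
    assume p0: "p = {0}"
    obtain P where P: "primeideal P (subring_of_field A0)" "P \<noteq> {0}" using dimension_pos by auto
    note PD = idealD[OF primeidealD(1)[OF P(1)]]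
    obtain x where x: "x \<in> P" "x \<noteq> 0" using P(2) PD(2) by blast
    then obtain y where "y \<in> A0" "x * y - 1 \<in> {0}"
      using p p0 PD(1) unfolding maximalideal_iff by blast
    then have "1 \<in> P" using PD(4)[OF x(1), of y] by (simp add: mult.commute)
    then show False using primeidealD(2)[OF P(1)] by simp
  qed
  then show "primeideal p (subring_of_field A0) \<and> p \<noteq> {0}"
    using maximalideal_imp_primeideal[OF p] by simp
qed (use dimension_le_1 in \<open>simp add: closed_points_def\<close>)

lemma closed_point_primeideal: "p \<in> closed_points A0 \<Longrightarrow> primeideal p (subring_of_field A0)"
  by (simp add: closed_points_iff)

lemma closed_point_maximalideal: "p \<in> closed_points A0 \<Longrightarrow> maximalideal p (subring_of_field A0)"
  by (simp add: closed_points_def)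

lemma closed_point_subset: "p \<in> closed_points A0 \<Longrightarrow> p \<subseteq> A0"
  using idealD(1) primeidealD(1) closed_point_primeideal by blast

text \<open>The local ring \<open>Q\<close> has a principal maximal ideal, so
  \<open>order_at t\<close> is a valuation as soon as no nonzero element is divisible by all powers
  of \<open>t\<close>. Elements of \<open>Q\<close> outside the maximal ideal are units, which
  identifies the valuation ring with \<open>Q\<close>.\<close>

lemma local_ring_dvr:
  assumes p: "p \<in> closed_points A0" and t: "uniformizer A0 p t"
  shows "\<exists>w. valuation_on UNIV w \<and> w t = 1 \<and> t \<noteq> 0 \<and> (\<forall>x\<in>A0 - {0}. w x \<ge> 0) \<and>
    p = {x \<in> A0. x = 0 \<or> w x > 0} \<and> (\<forall>x. x \<noteq> 0 \<longrightarrow> w x \<ge> 0 \<longrightarrow> (\<exists>s\<in>A0 - p. s * x \<in> A0))"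
proof -
  define Q where "Q = local_ring A0 p"
  note P = closed_point_primeideal[OF p]
  note pD = idealD[OF primeidealD(1)[OF P]]
  have one: "1 \<in> A0 - p" using one_closed primeidealD(2)[OF P] by simp
  have s0: "s \<noteq> 0" if "s \<in> A0 - p" for s using that pD(2) by auto
  have mS: "s * s' \<in> A0 - p" if "s \<in> A0 - p" "s' \<in> A0 - p" for s s'
    using that primeidealD(3)[OF P] mult_closed by blast
  interpret Q: field_subring Q
  proof
    show "1 \<in> Q" using one unfolding Q_def local_ring_def
      by (intro CollectI exI[of _ 1]) auto
    fix x y assume "x \<in> Q" "y \<in> Q"
    then obtain a s b u where *: "x = a / s" "a \<in> A0" "s \<in> A0 - p" "y = b / u" "b \<in> A0" "u \<in> A0 - p"
      by (auto simp: Q_def local_ring_def)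
    have "x - y = (a * u - b * s) / (s * u)" "x * y = (a * b) / (s * u)"
      using * s0[OF *(3)] s0[OF *(6)] by (auto simp: field_simps)
    moreover have "a * u - b * s \<in> A0" "a * b \<in> A0" using * by (auto intro: diff_closed mult_closed)
    ultimately show "x - y \<in> Q" "x * y \<in> Q"
      using mS[OF *(3,6)] unfolding Q_def local_ring_def by blast+
  qed
  have AQ: "A0 \<subseteq> Q"
  proof
    fix x assume "x \<in> A0"
    then show "x \<in> Q" using one unfolding Q_def local_ring_def
      by (intro CollectI exI[of _ x] exI[of _ 1]) auto
  qed
  have fQ: "fraction_set Q = UNIV"
    using fraction_set_eq AQ unfolding fraction_set_def by blast
  have tQ_eq: "(\<lambda>x. t * x) ` Q = local_maximal_ideal A0 p"
    using t by (simp add: uniformizer_def Q_def)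
  have lmax_iff: "a / s \<in> local_maximal_ideal A0 p \<longleftrightarrow> a \<in> p" if as: "a \<in> A0" "s \<in> A0 - p" for a s
  proof
    assume "a / s \<in> local_maximal_ideal A0 p"
    then obtain b u where *: "a / s = b / u" "b \<in> p" "u \<in> A0 - p" by (auto simp: local_maximal_ideal_def)
    then have "a * u = s * b" using s0[OF as(2)] s0[OF *(3)] by (simp add: frac_eq_eq mult.commute)
    then have "a * u \<in> p" using pD(4)[OF *(2), of s] as by simp
    then show "a \<in> p" using primeidealD(3)[OF P, of a u] as * by auto
  qed (use as in \<open>auto simp: local_maximal_ideal_def\<close>)
  have max_iff: "x \<in> (\<lambda>x. t * x) ` Q \<longleftrightarrow> x \<in> p" if "x \<in> A0" for x
    unfolding tQ_eq using lmax_iff[OF that one] by simp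
  have tQ: "t \<in> Q"
  proof -
    have "t * 1 \<in> (\<lambda>x. t * x) ` Q" using Q.one_closed by blast
    then have "t \<in> local_maximal_ideal A0 p" using tQ_eq by simp
    then show ?thesis using pD(1) unfolding local_maximal_ideal_def Q_def local_ring_def by blast
  qed
  have t0: "t \<noteq> 0"
  proof
    assume "t = 0"
    then have "p \<subseteq> {0}" using max_iff pD(1) by auto
    then show False using p pD(2) by (auto simp: closed_points_iff)
  qed
  have prime: "x \<in> (\<lambda>y. t * y) ` Q \<or> y \<in> (\<lambda>y. t * y) ` Q"
    if xy: "x \<in> Q" "y \<in> Q" "x * y \<in> (\<lambda>y. t * y) ` Q" for x y
  proof -
    obtain a s b u where *: "x = a / s" "a \<in> A0" "s \<in> A0 - p" "y = b / u" "b \<in> A0" "u \<in> A0 - p"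
      using xy by (auto simp: Q_def local_ring_def)
    have "(a * b) / (s * u) \<in> local_maximal_ideal A0 p" using xy * unfolding tQ_eq by simp
    then have "a * b \<in> p" using lmax_iff[OF _ mS[OF *(3,6)]] * mult_closed by blast
    then show ?thesis using primeidealD(3)[OF P *(2,5)] lmax_iff * unfolding tQ_eq by blast
  qed
  have unit: "inverse x \<in> Q" if x: "x \<in> Q" "x \<notin> (\<lambda>y. t * y) ` Q" for x
  proof -
    obtain a s where *: "x = a / s" "a \<in> A0" "s \<in> A0 - p" using x by (auto simp: Q_def local_ring_def)
    then have "a \<notin> p" using x lmax_iff unfolding tQ_eq by blast
    moreover have "inverse x = s / a" using * by simp
    ultimately show ?thesis using * unfolding Q_def local_ring_def by blast
  qed
  text \<open>The intersection of the powers of the maximal ideal is a prime strictly below it, hence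
    zero because the curve is one-dimensional.\<close>
  define I where "I = {x \<in> A0. \<forall>n. x \<in> (\<lambda>y. t ^ n * y) ` Q}"
  have decomp: "\<exists>n y. y \<in> Q \<and> y \<notin> (\<lambda>y. t * y) ` Q \<and> x = t ^ n * y" if "x \<in> A0" "x \<notin> I" for x
  proof -
    have "\<exists>n. x \<notin> (\<lambda>y. t ^ n * y) ` Q" "x \<in> Q" using that AQ by (auto simp: I_def)
    then show ?thesis using Q.order_at_decomp[of x t] by metis
  qed
  have "I = {0}"
  proof (rule ccontr)
    assume "I \<noteq> {0}"
    have zI: "0 \<in> I" using zero_closed Q.zero_closed by (auto simp: I_def image_iff)
    have idI: "ideal I (subring_of_field A0)"
    proof (rule idealI)
      show "I \<subseteq> A0" by (auto simp: I_def)
      fix x assume x: "x \<in> I"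
      show "x + y \<in> I" if y: "y \<in> I" for y
        unfolding I_def
      proof (intro CollectI conjI allI)
        show "x + y \<in> A0" using x y add_closed by (auto simp: I_def)
        fix n
        obtain a b where "x = t ^ n * a" "a \<in> Q" "y = t ^ n * b" "b \<in> Q"
          using x y unfolding I_def by blast
        then have "x + y = t ^ n * (a + b)" "a + b \<in> Q"
          using Q.add_closed by (auto simp: algebra_simps)
        then show "x + y \<in> (\<lambda>y. t ^ n * y) ` Q" by blast
      qed
      show "r * x \<in> I" if r: "r \<in> A0" for r
        unfolding I_def
      proof (intro CollectI conjI allI)
        show "r * x \<in> A0" using x r mult_closed by (auto simp: I_def)
        fix n
        obtain a where "x = t ^ n * a" "a \<in> Q" using x unfolding I_def by blast
        then have "r * x = t ^ n * (r * a)" "r * a \<in> Q"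
          using Q.mult_closed r AQ by auto
        then show "r * x \<in> (\<lambda>y. t ^ n * y) ` Q" by blast
      qed
    qed (rule zI)
    have Ip: "I \<subseteq> p"
    proof
      fix x assume "x \<in> I"
      then have "x \<in> A0" "x \<in> (\<lambda>y. t ^ 1 * y) ` Q" unfolding I_def by blast+
      then show "x \<in> p" using max_iff by simp
    qed
    have "primeideal I (subring_of_field A0)"
      unfolding primeideal_iff
    proof (intro conjI ballI impI)
      show "1 \<notin> I" using Ip one by auto
      fix x y assume xy: "x \<in> A0" "y \<in> A0" "x * y \<in> I"
      show "x \<in> I \<or> y \<in> I"
      proof (rule ccontr)
        assume "\<not> ?thesis"
        then obtain n k x' y' where *: "x' \<in> Q" "x' \<notin> (\<lambda>y. t * y) ` Q" "x = t ^ n * x'"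
          "y' \<in> Q" "y' \<notin> (\<lambda>y. t * y) ` Q" "y = t ^ k * y'" using decomp xy by meson
        have "x * y \<in> (\<lambda>y. t ^ Suc (n + k) * y) ` Q" using xy(3) unfolding I_def by blast
        then obtain z where z: "z \<in> Q" "x * y = t ^ Suc (n + k) * z" by auto
        then have "t ^ (n + k) * (x' * y') = t ^ (n + k) * (t * z)"
          using * by (simp add: power_add algebra_simps)
        then have "x' * y' = t * z" using t0 by simp
        then show False using prime[OF *(1,4)] * z(1) by blast
      qed
    qed (rule idI)
    then have m: "maximalideal I (subring_of_field A0)" using dimension_le_1 \<open>I \<noteq> {0}\<close> by blast
    have "p \<subseteq> I"
    proof (intro subsetI, rule ccontr)
      fix x assume x: "x \<in> p" "x \<notin> I"
      then have "x \<in> A0 - I" using pD(1) by auto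
      then obtain y where y: "y \<in> A0" "x * y - 1 \<in> I" using m unfolding maximalideal_iff by meson
      then have "y * x - (x * y - 1) \<in> p" using pD(6)[OF pD(4)[OF x(1) y(1)]] Ip by blast
      then show False using one by (simp add: mult.commute)
    qed
    \<comment> \<open>Now \<open>p = I\<close>, so every element of \<open>p\<close> is divisible by
      \<open>t ^ 2\<close> in \<open>Q\<close>. Applied to the numerator of \<open>t = a / s\<close>
      this makes \<open>s\<close> divisible by \<open>t\<close>, so \<open>s\<close> would lie in
      \<open>p\<close>.\<close>
    have "t \<in> (\<lambda>x. t * x) ` Q" using Q.one_closed by (auto intro: image_eqI[of _ _ 1])
    then obtain a s where as: "t = a / s" "a \<in> p" "s \<in> A0 - p"
      unfolding tQ_eq local_maximal_ideal_def by auto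
    then have "a \<in> (\<lambda>y. t ^ 2 * y) ` Q" using \<open>p \<subseteq> I\<close> unfolding I_def by blast
    then obtain z where z: "z \<in> Q" "a = t ^ 2 * z" by auto
    have "s * t = t ^ 2 * z" using z as s0[OF as(3)] by simp
    then have "s = t * z" using t0 by (simp add: power2_eq_square)
    then have "s \<in> p" using max_iff[of s] z as by blast
    then show False using as by simp
  qed
  have sep: "\<exists>n. x \<notin> (\<lambda>y. t ^ n * y) ` Q" if x: "x \<in> Q" "x \<noteq> 0" for x
  proof -
    obtain a s where *: "x = a / s" "a \<in> A0" "s \<in> A0 - p" using x by (auto simp: Q_def local_ring_def)
    then have "a \<notin> I" using \<open>I = {0}\<close> x by auto
    then obtain n where n: "a \<notin> (\<lambda>y. t ^ n * y) ` Q" using * unfolding I_def by blast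
    have "x \<notin> (\<lambda>y. t ^ n * y) ` Q"
    proof
      assume "x \<in> (\<lambda>y. t ^ n * y) ` Q"
      then obtain y where "y \<in> Q" "x = t ^ n * y" by auto
      then have "a = t ^ n * (s * y)" "s * y \<in> Q"
        using * s0[OF *(3)] AQ Q.mult_closed by (auto simp: field_simps)
      then show False using n by blast
    qed
    then show ?thesis by blast
  qed
  have val: "valuation_on Q (Q.order_at t)"
    using tQ t0 prime sep by (rule Q.valuation_on_order_at)
  define w where "w = extend_valuation Q (Q.order_at t)"
  have valw: "valuation_on UNIV w"
    using Q.valuation_on_extend_valuation[OF val] fQ by (simp add: w_def)
  have weq: "w x = Q.order_at t x" if "x \<in> Q" "x \<noteq> 0" for x
    using Q.extend_valuation_eq[OF val that] by (simp add: w_def)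
  have nonneg: "w x \<ge> 0" if "x \<in> Q" "x \<noteq> 0" for x
    using weq[OF that] by (simp add: Q.order_at_def)
  have one_notin: "1 \<notin> (\<lambda>x. t * x) ` Q" using max_iff[OF one_closed] one by simp
  have wt: "w t = 1"
    using weq[OF tQ t0] Q.order_at_eqI[OF t0 tQ Q.one_closed one_notin, of t 1] by simp
  have pos_iff: "w x > 0 \<longleftrightarrow> x \<in> p" if x: "x \<in> A0" "x \<noteq> 0" for x
  proof -
    obtain n y where y: "Q.order_at t x = int n" "y \<in> Q" "y \<notin> (\<lambda>y. t * y) ` Q" "x = t ^ n * y"
      using Q.order_at_decomp[of x t] sep[of x] x AQ by blast
    show ?thesis
    proof (cases n)
      case 0
      then show ?thesis using y weq[of x] x AQ max_iff[of x] by auto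
    next
      case (Suc k)
      then have "x = t * (t ^ k * y)" "t ^ k * y \<in> Q"
        using y tQ Q.mult_closed Q.power_closed by auto
      then have "x \<in> p" using max_iff[OF x(1)] by blast
      then show ?thesis using y weq[of x] x AQ Suc by auto
    qed
  qed
  have "\<exists>s\<in>A0 - p. s * x \<in> A0" if x: "x \<noteq> 0" "w x \<ge> 0" for x
  proof -
    have "x \<in> fraction_set Q" using fQ by simp
    then obtain a b where ab: "x = a / b" "a \<in> Q" "b \<in> Q" "b \<noteq> 0" by (rule Q.fraction_setE)
    have "a \<noteq> 0" using x ab by auto
    obtain n a' where a: "Q.order_at t a = int n" "a' \<in> Q" "a' \<notin> (\<lambda>y. t * y) ` Q" "a = t ^ n * a'"
      using Q.order_at_decomp[of a t] sep[of a] ab \<open>a \<noteq> 0\<close> by blast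
    obtain k b' where b: "Q.order_at t b = int k" "b' \<in> Q" "b' \<notin> (\<lambda>y. t * y) ` Q" "b = t ^ k * b'"
      using Q.order_at_decomp[of b t] sep[of b] ab by blast
    have "x * b = a" using ab by simp
    then have "w x + w b = w a" using valuation_on_mult[OF valw, of x b] x ab by simp
    then have "k \<le> n" using x(2) weq[of a] weq[of b] a b ab \<open>a \<noteq> 0\<close> by simp
    then have "t ^ n = t ^ k * t ^ (n - k)" by (simp flip: power_add)
    then have "x = t ^ (n - k) * a' * inverse b'"
      using ab a b t0 by (simp add: field_simps)
    moreover have "inverse b' \<in> Q" using unit b by blast
    ultimately have "x \<in> Q" using a(2) tQ by (simp add: Q.mult_closed Q.power_closed)
    then obtain a s where "x = a / s" "a \<in> A0" "s \<in> A0 - p" by (auto simp: Q_def local_ring_def)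
    then show ?thesis using s0 by (intro bexI[of _ s]) auto
  qed
  moreover have "p = {x \<in> A0. x = 0 \<or> w x > 0}" using pos_iff pD(1,2) by auto
  ultimately show ?thesis using valw wt t0 nonneg AQ by blast
qed

text \<open>At nonzero arguments \<open>valuation_at\<close> agrees with the valuation from
  \<open>local_ring_dvr\<close>, so its properties carry over one by one.\<close>

lemma
  assumes p: "p \<in> closed_points A0"
  shows valuation_at_valuation: "valuation_on UNIV (valuation_at A0 p)"
    and valuation_at_normalized: "\<exists>t. t \<noteq> 0 \<and> valuation_at A0 p t = 1"
    and valuation_at_nonneg: "\<And>x. x \<in> A0 \<Longrightarrow> x \<noteq> 0 \<Longrightarrow> valuation_at A0 p x \<ge> 0"
    and closed_point_eq: "p = {x \<in> A0. x = 0 \<or> valuation_at A0 p x > 0}"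
    and valuation_at_localize:
      "\<And>x. x \<noteq> 0 \<Longrightarrow> valuation_at A0 p x \<ge> 0 \<Longrightarrow> \<exists>s\<in>A0 - p. s * x \<in> A0"
    and uniformizer_valuation_at:
      "\<And>t. uniformizer A0 p t \<longleftrightarrow> t \<noteq> 0 \<and> valuation_at A0 p t = 1"
proof -
  obtain t where "uniformizer A0 p t" using exists_uniformizer[OF p] by auto
  then obtain w where w: "valuation_on UNIV w" "w t = 1" "t \<noteq> 0" "\<forall>x\<in>A0 - {0}. w x \<ge> 0"
    "p = {x \<in> A0. x = 0 \<or> w x > 0}" "\<forall>x. x \<noteq> 0 \<longrightarrow> w x \<ge> 0 \<longrightarrow> (\<exists>s\<in>A0 - p. s * x \<in> A0)"
    using local_ring_dvr[OF p] by blast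
  have eq: "valuation_at A0 p x = w x" if "x \<noteq> 0" for x
    by (rule valuation_at_eq[where v = w]) (use w that in auto)
  show "valuation_on UNIV (valuation_at A0 p)"
    using w(1) eq unfolding valuation_on_def by simp
  show "\<exists>t. t \<noteq> 0 \<and> valuation_at A0 p t = 1" using w eq by metis
  show "\<And>x. x \<in> A0 \<Longrightarrow> x \<noteq> 0 \<Longrightarrow> valuation_at A0 p x \<ge> 0" using w eq by simp
  have "x = 0 \<or> valuation_at A0 p x > 0 \<longleftrightarrow> x = 0 \<or> w x > 0" for x
    using eq[of x] by (cases "x = 0") auto
  then show "p = {x \<in> A0. x = 0 \<or> valuation_at A0 p x > 0}" by (simp only: w(5)[symmetric])
  show "\<And>x. x \<noteq> 0 \<Longrightarrow> valuation_at A0 p x \<ge> 0 \<Longrightarrow> \<exists>s\<in>A0 - p. s * x \<in> A0" using w eq by simp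
  show "\<And>t. uniformizer A0 p t \<longleftrightarrow> t \<noteq> 0 \<and> valuation_at A0 p t = 1"
    by (subst uniformizer_iff[where v = w]) (use w eq in auto)
qed

text \<open>A zero or pole of a fraction is a point containing its numerator or its denominator, and
  there are finitely many maximal ideals over each.\<close>

lemma finite_valuation_nonzero:
  assumes x: "x \<noteq> 0"
  shows "finite {p \<in> closed_points A0. valuation_at A0 p x \<noteq> 0}"
proof -
  have "x \<in> fraction_set A0" by simp
  then obtain a b where ab: "x = a / b" "a \<in> A0" "b \<in> A0" "b \<noteq> 0" by (rule fraction_setE)
  then have "a \<noteq> 0" using x by auto
  have fin: "finite {p \<in> closed_points A0. f \<in> p}" if "f \<in> A0" "f \<noteq> 0" for f
    using finite_maximalideals_over[OF noetherian dimension_le_1 that] by (simp add: closed_points_def)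
  have "{p \<in> closed_points A0. valuation_at A0 p x \<noteq> 0} \<subseteq>
      {p \<in> closed_points A0. a \<in> p} \<union> {p \<in> closed_points A0. b \<in> p}"
  proof safe
    fix p assume p: "p \<in> closed_points A0" "valuation_at A0 p x \<noteq> 0" "b \<notin> p"
    have "x * b = a" using ab by simp
    then have "valuation_at A0 p x + valuation_at A0 p b = valuation_at A0 p a"
      using valuation_on_mult[OF valuation_at_valuation[OF p(1)], of x b] x ab by simp
    moreover have "valuation_at A0 p b = 0"
      using closed_point_eq[OF p(1)] p(3) valuation_at_nonneg[OF p(1) ab(3,4)] ab by force
    moreover have "valuation_at A0 p a \<ge> 0" using valuation_at_nonneg[OF p(1) ab(2)] \<open>a \<noteq> 0\<close> .
    ultimately have "valuation_at A0 p a > 0" using p(2) by linarith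
    then have "a \<in> {x \<in> A0. x = 0 \<or> valuation_at A0 p x > 0}" using ab by simp
    then show "a \<in> p" using closed_point_eq[OF p(1)] by simp
  qed
  then show ?thesis using fin[of a] fin[of b] ab \<open>a \<noteq> 0\<close> by (meson finite_subset finite_UnI)
qed

lemma closed_points_incomparable:
  assumes pq: "p \<in> closed_points A0" "q \<in> closed_points A0" "p \<noteq> q"
  shows "\<exists>s\<in>q. s \<notin> p"
proof (rule ccontr)
  assume "\<not> ?thesis"
  then have sub: "q \<subseteq> p" by auto
  then obtain x where x: "x \<in> p" "x \<notin> q" using pq by auto
  note pD = idealD[OF primeidealD(1)[OF closed_point_primeideal[OF pq(1)]]]
  obtain y where y: "y \<in> A0" "x * y - 1 \<in> q"
    using closed_point_maximalideal[OF pq(2)] x pD(1) unfolding maximalideal_iff by blast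
  then have "y * x - (x * y - 1) \<in> p" using pD(6)[OF pD(4)[OF x(1) y(1)]] sub by blast
  then show False
    using primeidealD(2)[OF closed_point_primeideal[OF pq(1)]] by (simp add: mult.commute)
qed

sublocale C: krull_family A0 "closed_points A0" "valuation_at A0"
proof
  fix p assume p: "p \<in> closed_points A0"
  show "valuation_on (fraction_set A0) (valuation_at A0 p)" using valuation_at_valuation[OF p] by simp
  show "\<exists>t\<in>fraction_set A0 - {0}. valuation_at A0 p t = 1" using valuation_at_normalized[OF p] by auto
  fix q assume q: "q \<in> closed_points A0" "p \<noteq> q"
  then obtain s where s: "s \<in> q" "s \<notin> p" using closed_points_incomparable[OF p q(1)] by auto
  have "s \<in> A0" using closed_point_subset[OF q(1)] s by auto
  moreover have "s \<noteq> 0" using s idealD(2)[OF primeidealD(1)[OF closed_point_primeideal[OF p]]] by auto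
  moreover have "valuation_at A0 p s = 0"
  proof -
    have "s \<notin> {x \<in> A0. x = 0 \<or> valuation_at A0 p x > 0}" using s(2) closed_point_eq[OF p] by simp
    then show ?thesis using \<open>s \<in> A0\<close> valuation_at_nonneg[OF p \<open>s \<in> A0\<close> \<open>s \<noteq> 0\<close>] by auto
  qed
  moreover have "valuation_at A0 q s > 0"
  proof -
    have "s \<in> {x \<in> A0. x = 0 \<or> valuation_at A0 q x > 0}" using s(1) closed_point_eq[OF q(1)] by simp
    then show ?thesis using \<open>s \<noteq> 0\<close> by auto
  qed
  ultimately show "\<exists>s\<in>A0 - {0}. valuation_at A0 p s = 0 \<and> valuation_at A0 q s > 0" by blast
next
  fix x assume "x \<in> fraction_set A0 - {0}"
  then have x0: "x \<noteq> 0" by simp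
  show "finite {p \<in> closed_points A0. valuation_at A0 p x \<noteq> 0}"
    using finite_valuation_nonzero[OF x0] .
  show "x \<in> A0 \<longleftrightarrow> (\<forall>p\<in>closed_points A0. valuation_at A0 p x \<ge> 0)"
  proof
    assume nonneg: "\<forall>p\<in>closed_points A0. valuation_at A0 p x \<ge> 0"
    \<comment> \<open>The ideal of denominators of \<open>x\<close>. As \<open>x\<close> is regular
      at every point, no maximal ideal contains \<open>D\<close>; hence 1 is in
      \<open>D\<close>.\<close>
    define D where "D = {s \<in> A0. s * x \<in> A0}"
    have D: "ideal D (subring_of_field A0)"
      by (rule idealI)
        (auto simp: D_def zero_closed distrib_right mult.assoc intro: add_closed mult_closed)
    show "x \<in> A0"
    proof (rule ccontr)
      assume "x \<notin> A0"
      then have "1 \<notin> D" by (simp add: D_def)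
      then obtain M where M: "maximalideal M (subring_of_field A0)" "D \<subseteq> M"
        using noetherian_exists_maximalideal[OF noetherian D] by auto
      then have "M \<in> closed_points A0" by (simp add: closed_points_def)
      then obtain s where "s \<in> A0 - M" "s * x \<in> A0"
        using valuation_at_localize[of M x] nonneg x0 by blast
      then show False using M(2) by (auto simp: D_def)
    qed
  qed (use valuation_at_nonneg x0 in blast)
qed

lemma center_eq: "p \<in> closed_points A0 \<Longrightarrow> C.center p = p"
  using closed_point_eq[of p] by (simp add: C.center_def)

lemma height_one_primes_A0: "height_one_primes A0 = closed_points A0"
  using C.height_one_primes_eq center_eq by (simp add: image_def)

end

section \<open>Calculation with the valuations of the curve\<close>

context smooth_curve
begin

abbreviation v :: "'k set \<Rightarrow> 'k \<Rightarrow> int" where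
  "v \<equiv> valuation_at A0"

lemma field_subring_UNIV: "field_subring (UNIV :: 'k set)"
  by unfold_locales auto

lemma v_mult: "p \<in> closed_points A0 \<Longrightarrow> x \<noteq> 0 \<Longrightarrow> y \<noteq> 0 \<Longrightarrow> v p (x * y) = v p x + v p y"
  using valuation_on_mult[OF valuation_at_valuation] by simp

lemma v_one [simp]: "p \<in> closed_points A0 \<Longrightarrow> v p 1 = 0"
  using field_subring.valuation_on_one[OF field_subring_UNIV valuation_at_valuation] by simp

lemma v_inverse: "p \<in> closed_points A0 \<Longrightarrow> x \<noteq> 0 \<Longrightarrow> v p (inverse x) = - v p x"
  using v_mult[of p x "inverse x"] by simp

lemma v_power: "p \<in> closed_points A0 \<Longrightarrow> x \<noteq> 0 \<Longrightarrow> v p (x ^ n) = int n * v p x"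
  using field_subring.valuation_on_power[OF field_subring_UNIV valuation_at_valuation] by simp

lemma v_power_int: "p \<in> closed_points A0 \<Longrightarrow> x \<noteq> 0 \<Longrightarrow> v p (x powi n) = n * v p x"
  by (cases "n \<ge> 0") (auto simp: power_int_def v_power v_inverse)

text \<open>The inequality between values with 0 treated as having infinite value; it avoids case
  distinctions at 0 in sums.\<close>

definition vge :: "'k set \<Rightarrow> int \<Rightarrow> 'k \<Rightarrow> bool" where
  "vge p k x \<longleftrightarrow> x = 0 \<or> v p x \<ge> k"

lemma vge_0 [simp]: "vge p k 0"
  by (simp add: vge_def)

lemma vge_mono: "vge p k x \<Longrightarrow> l \<le> k \<Longrightarrow> vge p l x"
  by (auto simp: vge_def)

lemma vge_mult: "p \<in> closed_points A0 \<Longrightarrow> vge p k x \<Longrightarrow> vge p l y \<Longrightarrow> vge p (k + l) (x * y)"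
  by (cases "x = 0"; cases "y = 0") (auto simp: vge_def v_mult)

lemma vge_sum:
  assumes "p \<in> closed_points A0" "\<And>i. i \<in> I \<Longrightarrow> vge p k (f i)"
  shows "vge p k (sum f I)"
  using field_subring.valuation_on_sum[OF field_subring_UNIV valuation_at_valuation[OF assms(1)], of I f k]
    assms(2) by (auto simp: vge_def)

lemma vge_add:
  assumes "p \<in> closed_points A0" "vge p k x" "vge p k y"
  shows "vge p k (x + y)"
  using vge_sum[OF assms(1), of "{True, False}" k "\<lambda>b. if b then x else y"] assms(2,3) by auto

lemma vge_uminus: "p \<in> closed_points A0 \<Longrightarrow> vge p k x \<Longrightarrow> vge p k (- x)"
  using field_subring.valuation_on_uminus[OF field_subring_UNIV valuation_at_valuation, of p x]
  by (cases "x = 0") (auto simp: vge_def)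

lemma vge_diff: "p \<in> closed_points A0 \<Longrightarrow> vge p k x \<Longrightarrow> vge p k y \<Longrightarrow> vge p k (x - y)"
  using vge_add[of p k x "- y"] vge_uminus[of p k y] by simp

lemma v_add_eq: "p \<in> closed_points A0 \<Longrightarrow> x \<noteq> 0 \<Longrightarrow> vge p (v p x + 1) y \<Longrightarrow> x + y \<noteq> 0 \<and> v p (x + y) = v p x"
  by (rule field_subring.valuation_on_add_eq[OF field_subring_UNIV valuation_at_valuation])
    (auto simp: vge_def)

lemma v_sum_term:
  assumes "p \<in> closed_points A0" "sum f I \<noteq> 0"
  shows "\<exists>i\<in>I. f i \<noteq> 0 \<and> v p (f i) \<le> v p (sum f I)"
proof (rule ccontr)
  assume "\<not> ?thesis"
  then have "v p (sum f I) < v p (f i)" if "i \<in> I" "f i \<noteq> 0" for i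
    using that by (meson not_le)
  then have "vge p (v p (sum f I) + 1) (f i)" if "i \<in> I" for i
    using that unfolding vge_def by (metis add1_zle_eq)
  then have "vge p (v p (sum f I) + 1) (sum f I)" by (rule vge_sum[OF assms(1)])
  then show False using assms(2) by (simp add: vge_def)
qed

lemma vge_A0: "p \<in> closed_points A0 \<Longrightarrow> x \<in> A0 \<Longrightarrow> vge p 0 x"
  using valuation_at_nonneg by (auto simp: vge_def)

lemma vge_1_iff:
  assumes "p \<in> closed_points A0" "x \<in> A0"
  shows "vge p 1 x \<longleftrightarrow> x \<in> p"
proof -
  have "x \<in> p \<longleftrightarrow> x \<in> {x \<in> A0. x = 0 \<or> v p x > 0}"
    by (rule arg_cong[OF closed_point_eq[OF assms(1)]])
  then show ?thesis using assms(2) by (auto simp: vge_def)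
qed

lemma v_eq_0: "p \<in> closed_points A0 \<Longrightarrow> s \<in> A0 - p \<Longrightarrow> s \<noteq> 0 \<and> v p s = 0"
  using vge_1_iff[of p s] vge_A0[of p s] by (auto simp: vge_def)

lemma vge_0E:
  assumes "p \<in> closed_points A0" "vge p 0 x"
  obtains s where "s \<in> A0 - p" "s * x \<in> A0"
proof (cases "x = 0")
  case True
  have "1 \<in> A0 - p"
    using one_closed primeidealD(2)[OF closed_point_primeideal[OF assms(1)]] by simp
  then show ?thesis using that[of 1] True zero_closed by simp
next
  case False
  then show ?thesis
    using valuation_at_localize[OF assms(1) False] assms(2) that by (auto simp: vge_def)
qed

lemma vge_1E:
  assumes p: "p \<in> closed_points A0" and "vge p 1 x"
  obtains s where "s \<in> A0 - p" "s * x \<in> p"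
proof -
  obtain s where s: "s \<in> A0 - p" "s * x \<in> A0" using vge_0E[OF p, of x] vge_mono[OF assms(2)] by auto
  have "vge p (0 + 1) (s * x)" using vge_mult[OF p vge_A0[OF p] assms(2)] s by blast
  then show ?thesis using vge_1_iff[OF p s(2)] s that by simp
qed

lemma v_scalar: "p \<in> closed_points A0 \<Longrightarrow> c \<noteq> 0 \<Longrightarrow> v p (\<iota> c) = 0"
  using v_eq_0[of p "\<iota> c"] primeideal_no_scalar[OF closed_point_primeideal] scalar_closed by auto

lemma residue_exists_A0: "p \<in> closed_points A0 \<Longrightarrow> x \<in> A0 \<Longrightarrow> \<exists>r. x - \<iota> r \<in> p"
  using residue_exists closed_point_maximalideal countable_dimension by metis

text \<open>The residue field is the field of scalars also for the local ring: if \<open>s\<close>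
  clears the denominator of \<open>x\<close>, then \<open>r\<close> is the residue of
  \<open>s x\<close> divided by the residue of \<open>s\<close>. It is unique since a nonzero scalar
  has value 0.\<close>

lemma residue_ex1:
  assumes p: "p \<in> closed_points A0" and x: "vge p 0 x"
  shows "\<exists>!r. vge p 1 (x - \<iota> r)"
proof (rule ex_ex1I)
  obtain s where s: "s \<in> A0 - p" "s * x \<in> A0" using vge_0E[OF p x] .
  obtain a b where ab: "s * x - \<iota> a \<in> p" "s - \<iota> b \<in> p"
    using residue_exists_A0[OF p] s by (metis DiffD1)
  note pD = idealD[OF primeidealD(1)[OF closed_point_primeideal[OF p]]]
  have "b \<noteq> 0" using ab(2) s by auto
  define r where "r = a / b"
  have "\<iota> a = \<iota> r * \<iota> b" using \<open>b \<noteq> 0\<close> by (simp add: r_def hom_mult[symmetric])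
  then have "s * (x - \<iota> r) = (s * x - \<iota> a) - \<iota> r * (s - \<iota> b)" by (simp add: algebra_simps)
  also have "\<dots> \<in> p" using pD(6)[OF ab(1) pD(4)[OF ab(2) scalar_closed]] .
  finally have sp: "s * (x - \<iota> r) \<in> p" .
  then have "vge p 1 (s * (x - \<iota> r))" using vge_1_iff[OF p] pD(1) by auto
  then have "vge p 1 (x - \<iota> r)" using v_eq_0[OF p s(1)] v_mult[OF p, of s "x - \<iota> r"]
    by (cases "x - \<iota> r = 0") (auto simp: vge_def)
  then show "\<exists>r. vge p 1 (x - \<iota> r)" by blast
next
  fix r r' assume "vge p 1 (x - \<iota> r)" "vge p 1 (x - \<iota> r')"
  then have "vge p 1 ((x - \<iota> r') - (x - \<iota> r))" using vge_diff[OF p] by blast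
  then have "vge p 1 (\<iota> (r - r'))" by (simp add: hom_diff)
  then show "r = r'" using v_scalar[OF p, of "r - r'"] by (cases "r = r'") (auto simp: vge_def)
qed

text \<open>Start from a power of a uniformizer at \<open>p\<close>. At the finitely many other
  points where its value is nonzero or the bound is positive, correct it by an element of
  \<open>A0\<close> that is a unit at \<open>p\<close>.\<close>

lemma exists_with_valuation:
  assumes p: "p \<in> closed_points A0" and fin: "finite {q \<in> closed_points A0. E q > 0}"
  shows "\<exists>f. f \<noteq> 0 \<and> v p f = n \<and> (\<forall>q\<in>closed_points A0 - {p}. v q f \<ge> E q)"
proof -
  obtain t where t: "t \<noteq> 0" "v p t = 1" using valuation_at_normalized[OF p] by auto
  define f0 where "f0 = t powi n"
  have f0: "f0 \<noteq> 0" "v p f0 = n" using t v_power_int[OF p t(1)] by (auto simp: f0_def)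
  define T where "T = {q \<in> closed_points A0 - {p}. E q > 0 \<or> v q f0 \<noteq> 0}"
  have "T \<subseteq> {q \<in> closed_points A0. E q > 0} \<union> {q \<in> closed_points A0. v q f0 \<noteq> 0}"
    by (auto simp: T_def)
  then have "finite T" using fin finite_valuation_nonzero[OF f0(1)] by (meson finite_UnI finite_subset)
  then obtain s where s: "s \<in> A0 - {0}" "v p s = 0" "\<And>q. q \<in> T \<Longrightarrow> v q s \<ge> E q - v q f0"
    using C.family_approximation[OF p, of T "\<lambda>q. E q - v q f0"] by (auto simp: T_def)
  have "v q (s * f0) \<ge> E q" if q: "q \<in> closed_points A0 - {p}" for q
  proof -
    have "v q (s * f0) = v q s + v q f0" using v_mult q s f0 by auto
    moreover have "v q s \<ge> 0" using valuation_at_nonneg q s by auto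
    ultimately show ?thesis using s(3)[of q] q by (cases "q \<in> T") (auto simp: T_def)
  qed
  moreover have "v p (s * f0) = n" using v_mult[OF p, of s f0] s f0 by simp
  ultimately show ?thesis using s(1) f0(1) by (intro exI[of _ "s * f0"]) auto
qed

end

section \<open>Laurent polynomials and their monomial valuations\<close>

definition laurent_polys :: "'k::field fls set" where
  "laurent_polys = {F. finite {n. fls_nth F n \<noteq> 0}}"

text \<open>Summation over the support of \<open>F\<close>, instead of an interval of degrees,
  leaves only terms with a nonzero first factor, as the estimates of valuations require.\<close>

lemma laurent_times_nth:
  assumes "F \<in> laurent_polys"
  shows "fls_nth (F * G) n = (\<Sum>i\<in>{i. fls_nth F i \<noteq> 0}. fls_nth F i * fls_nth G (n - i))"
  unfolding fls_times_nth(2)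
proof (rule sum.mono_neutral_cong)
  fix i assume "i \<in> {i. fls_nth F i \<noteq> 0} - {fls_subdegree F..n - fls_subdegree G}"
  then have "fls_nth F i \<noteq> 0" "i < fls_subdegree F \<or> n - i < fls_subdegree G" by auto
  then show "fls_nth F i * fls_nth G (n - i) = 0"
    using fls_eq0_below_subdegree[of i F] fls_eq0_below_subdegree[of "n - i" G] by auto
qed (use assms in \<open>auto simp: laurent_polys_def\<close>)

lemma laurent_polys_finite: "F \<in> laurent_polys \<Longrightarrow> finite {n. fls_nth F n \<noteq> 0}"
  by (simp add: laurent_polys_def)

interpretation laurent: field_subring "laurent_polys :: 'k::field fls set"
proof
  show "1 \<in> (laurent_polys :: 'k fls set)"
    by (auto simp: laurent_polys_def intro: finite_subset[of _ "{0}"])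
  fix F G :: "'k fls" assume FG: "F \<in> laurent_polys" "G \<in> laurent_polys"
  have "{n. fls_nth (F - G) n \<noteq> 0} \<subseteq> {n. fls_nth F n \<noteq> 0} \<union> {n. fls_nth G n \<noteq> 0}" by auto
  then show "F - G \<in> laurent_polys" using FG unfolding laurent_polys_def
    by (metis (mono_tags) finite_UnI finite_subset mem_Collect_eq)
  have "{n. fls_nth (F * G) n \<noteq> 0} \<subseteq>
    (\<lambda>(i, j). i + j) ` ({n. fls_nth F n \<noteq> 0} \<times> {n. fls_nth G n \<noteq> 0})"
  proof
    fix n assume "n \<in> {n. fls_nth (F * G) n \<noteq> 0}"
    then have "(\<Sum>i\<in>{i. fls_nth F i \<noteq> 0}. fls_nth F i * fls_nth G (n - i)) \<noteq> 0"
      using laurent_times_nth[OF FG(1)] by auto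
    then obtain i where "fls_nth F i \<noteq> 0" "fls_nth G (n - i) \<noteq> 0"
      using sum.not_neutral_contains_not_neutral by force
    then show "n \<in> (\<lambda>(i, j). i + j) ` ({n. fls_nth F n \<noteq> 0} \<times> {n. fls_nth G n \<noteq> 0})"
      by (intro image_eqI[of _ _ "(i, n - i)"]) auto
  qed
  moreover have "finite ((\<lambda>(i, j). i + j) ` ({n. fls_nth F n \<noteq> 0} \<times> {n. fls_nth G n \<noteq> 0}))"
    using FG by (auto simp: laurent_polys_def)
  ultimately show "F * G \<in> laurent_polys"
    using finite_subset unfolding laurent_polys_def by blast
qed

definition fls_monom :: "'k::field \<Rightarrow> int \<Rightarrow> 'k fls" where
  "fls_monom f n = fls_const f * fls_X_intpow n"

lemma fls_nth_monom [simp]: "fls_nth (fls_monom f n) k = (if k = n then f else 0)"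
  by (simp add: fls_monom_def)

lemma fls_monom_laurent [simp]: "fls_monom f n \<in> laurent_polys"
  by (auto simp: laurent_polys_def intro: finite_subset[of _ "{n}"])

lemma fls_monom_mult: "fls_monom f n * fls_monom g k = fls_monom (f * g) (n + k)"
proof -
  have "fls_monom f n * fls_monom g k =
      fls_const f * fls_const g * (fls_X_intpow n * fls_X_intpow k)"
    by (simp add: fls_monom_def mult_ac)
  then show ?thesis by (simp only: fls_X_intpow_times_fls_X_intpow fls_const_mult_const fls_monom_def)
qed

lemma fls_const_eq_monom: "fls_const f = fls_monom f 0"
  by (simp add: fls_monom_def)

lemma fls_monom_1_0 [simp]: "fls_monom 1 0 = 1"
  using fls_const_eq_monom[of 1] by simp

lemma fls_monom_power: "fls_monom f n ^ k = fls_monom (f ^ k) (int k * n)"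
  by (induction k) (auto simp: fls_monom_mult algebra_simps)

lemma fls_monom_eq_0_iff [simp]: "fls_monom f n = 0 \<longleftrightarrow> f = 0"
  by (auto simp: fls_eq_iff)

lemma laurent_eq_sum:
  assumes "F \<in> laurent_polys"
  shows "F = (\<Sum>i\<in>{i. fls_nth F i \<noteq> 0}. fls_monom (fls_nth F i) i)"
proof (rule fls_eqI)
  fix n
  have nth_sum: "fls_nth (sum f I) n = (\<Sum>i\<in>I. fls_nth (f i) n)" for f :: "int \<Rightarrow> 'a fls" and I
    by (induction I rule: infinite_finite_induct) auto
  show "fls_nth F n = fls_nth (\<Sum>i\<in>{i. fls_nth F i \<noteq> 0}. fls_monom (fls_nth F i) i) n"
    unfolding nth_sum using laurent_polys_finite[OF assms] by (simp add: sum.delta)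
qed

context smooth_curve
begin

definition gauss_val :: "'k set \<Rightarrow> int \<Rightarrow> int \<Rightarrow> 'k fls \<Rightarrow> int" where
  "gauss_val p m w F = Min ((\<lambda>i. m * v p (fls_nth F i) + w * i) ` {i. fls_nth F i \<noteq> 0})"

lemma
  assumes F: "F \<in> laurent_polys" "F \<noteq> 0"
  shows gauss_val_ge_iff:
      "k \<le> gauss_val p m w F \<longleftrightarrow> (\<forall>i. fls_nth F i \<noteq> 0 \<longrightarrow> k \<le> m * v p (fls_nth F i) + w * i)"
    and gauss_val_attained:
      "\<exists>i. fls_nth F i \<noteq> 0 \<and> gauss_val p m w F = m * v p (fls_nth F i) + w * i"
proof -
  let ?S = "(\<lambda>i. m * v p (fls_nth F i) + w * i) ` {i. fls_nth F i \<noteq> 0}"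
  have S: "finite ?S" "?S \<noteq> {}"
    using laurent_polys_finite[OF F(1)] F(2) by (auto simp: fls_eq_iff)
  show "k \<le> gauss_val p m w F \<longleftrightarrow> (\<forall>i. fls_nth F i \<noteq> 0 \<longrightarrow> k \<le> m * v p (fls_nth F i) + w * i)"
    unfolding gauss_val_def using S by (subst Min_ge_iff) auto
  show "\<exists>i. fls_nth F i \<noteq> 0 \<and> gauss_val p m w F = m * v p (fls_nth F i) + w * i"
    using Min_in[OF S] unfolding gauss_val_def by auto
qed

lemma gauss_val_le:
  "F \<in> laurent_polys \<Longrightarrow> fls_nth F i \<noteq> 0 \<Longrightarrow> gauss_val p m w F \<le> m * v p (fls_nth F i) + w * i"
  using gauss_val_ge_iff[of F "gauss_val p m w F" p m w] by (cases "F = 0") auto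

lemma gauss_val_monom: "f \<noteq> 0 \<Longrightarrow> gauss_val p m w (fls_monom f n) = m * v p f + w * n"
  using gauss_val_attained[OF fls_monom_laurent, of f n p m w] by (auto split: if_splits)

text \<open>Gauss's lemma for the monomial valuation with weights \<open>m\<close> on \<open>v p\<close> and \<open>w\<close> on \<open>u\<close>:
  the product of the first coefficients at which the minima for \<open>F\<close> and \<open>G\<close> are attained
  dominates its coefficient of \<open>F * G\<close>.\<close>

lemma valuation_gauss_val:
  assumes p: "p \<in> closed_points A0" and m: "m > 0"
  shows "valuation_on laurent_polys (gauss_val p m w)"
  unfolding valuation_on_def
proof (intro conjI ballI impI)
  fix F G :: "'k fls" assume "F \<in> laurent_polys - {0}" "G \<in> laurent_polys - {0}"
  then have F: "F \<in> laurent_polys" "F \<noteq> 0" and G: "G \<in> laurent_polys" "G \<noteq> 0" by auto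
  define k where "k = gauss_val p m w F"
  define l where "l = gauss_val p m w G"
  define SF where "SF = {i. fls_nth F i \<noteq> 0 \<and> k = m * v p (fls_nth F i) + w * i}"
  define SG where "SG = {i. fls_nth G i \<noteq> 0 \<and> l = m * v p (fls_nth G i) + w * i}"
  have SF: "finite SF" "SF \<noteq> {}"
    using gauss_val_attained[OF F] laurent_polys_finite[OF F(1)] by (auto simp: SF_def k_def)
  have SG: "finite SG" "SG \<noteq> {}"
    using gauss_val_attained[OF G] laurent_polys_finite[OF G(1)] by (auto simp: SG_def l_def)
  define i0 where "i0 = Min SF"
  define j0 where "j0 = Min SG"
  have i0: "fls_nth F i0 \<noteq> 0" "k = m * v p (fls_nth F i0) + w * i0"
    using Min_in[OF SF] by (auto simp: i0_def SF_def)
  have j0: "fls_nth G j0 \<noteq> 0" "l = m * v p (fls_nth G j0) + w * j0"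
    using Min_in[OF SG] by (auto simp: j0_def SG_def)
  have geF: "k \<le> m * v p (fls_nth F i) + w * i" if "fls_nth F i \<noteq> 0" for i
    using gauss_val_le[OF F(1) that] by (simp add: k_def)
  have geG: "l \<le> m * v p (fls_nth G i) + w * i" if "fls_nth G i \<noteq> 0" for i
    using gauss_val_le[OF G(1) that] by (simp add: l_def)
  have gtF: "k < m * v p (fls_nth F i) + w * i" if "fls_nth F i \<noteq> 0" "i < i0" for i
    using geF[OF that(1)] Min_le[OF SF(1), of i] that unfolding i0_def SF_def
    by (metis (mono_tags, lifting) less_le mem_Collect_eq not_less)
  have gtG: "l < m * v p (fls_nth G i) + w * i" if "fls_nth G i \<noteq> 0" "i < j0" for i
    using geG[OF that(1)] Min_le[OF SG(1), of i] that unfolding j0_def SG_def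
    by (metis (mono_tags, lifting) less_le mem_Collect_eq not_less)
  have FG: "F * G \<in> laurent_polys" "F * G \<noteq> 0" using F G laurent.mult_closed by auto
  define n where "n = i0 + j0"
  define c where "c = (\<lambda>i. fls_nth F i * fls_nth G (n - i))"
  have c0: "c i0 \<noteq> 0" "m * v p (c i0) + w * n = k + l"
    using i0 j0 by (auto simp: c_def n_def v_mult[OF p] algebra_simps)
  have "vge p (v p (c i0) + 1) (c i)" if i: "i \<noteq> i0" for i
  proof (cases "c i = 0")
    case False
    then have nz: "fls_nth F i \<noteq> 0" "fls_nth G (n - i) \<noteq> 0" by (auto simp: c_def)
    have "m * v p (c i) + w * n =
        (m * v p (fls_nth F i) + w * i) + (m * v p (fls_nth G (n - i)) + w * (n - i))"
      using nz by (simp add: c_def v_mult[OF p] algebra_simps)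
    moreover have "i < i0 \<or> n - i < j0" using i by (auto simp: n_def)
    ultimately have "m * v p (c i) + w * n > k + l"
      using gtF[OF nz(1)] gtG[OF nz(2)] geF[OF nz(1)] geG[OF nz(2)] by linarith
    then have "m * v p (c i) > m * v p (c i0)" using c0 by linarith
    then show ?thesis using m by (simp add: vge_def)
  qed simp
  then have rest: "vge p (v p (c i0) + 1) (sum c ({i. fls_nth F i \<noteq> 0} - {i0}))"
    by (intro vge_sum[OF p]) auto
  have "fls_nth (F * G) n = c i0 + sum c ({i. fls_nth F i \<noteq> 0} - {i0})"
    unfolding laurent_times_nth[OF F(1)] c_def
    by (rule sum.remove) (use laurent_polys_finite[OF F(1)] i0 in auto)
  then have "fls_nth (F * G) n \<noteq> 0" "v p (fls_nth (F * G) n) = v p (c i0)"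
    using v_add_eq[OF p c0(1) rest] by auto
  then have le: "gauss_val p m w (F * G) \<le> k + l"
    using gauss_val_le[OF FG(1), of n p m w] c0 by simp
  have "k + l \<le> m * v p (fls_nth (F * G) j) + w * j" if j: "fls_nth (F * G) j \<noteq> 0" for j
  proof -
    obtain i where i: "fls_nth F i * fls_nth G (j - i) \<noteq> 0"
      "v p (fls_nth F i * fls_nth G (j - i)) \<le> v p (fls_nth (F * G) j)"
      using v_sum_term[OF p, of "\<lambda>i. fls_nth F i * fls_nth G (j - i)" "{i. fls_nth F i \<noteq> 0}"] j
      unfolding laurent_times_nth[OF F(1)] by blast
    then have nz: "fls_nth F i \<noteq> 0" "fls_nth G (j - i) \<noteq> 0" by auto
    have "k + l \<le> (m * v p (fls_nth F i) + w * i) + (m * v p (fls_nth G (j - i)) + w * (j - i))"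
      using geF[OF nz(1)] geG[OF nz(2)] by linarith
    also have "\<dots> = m * v p (fls_nth F i * fls_nth G (j - i)) + w * j"
      using nz by (simp add: v_mult[OF p] algebra_simps)
    also have "\<dots> \<le> m * v p (fls_nth (F * G) j) + w * j" using i(2) m by simp
    finally show ?thesis .
  qed
  then have "k + l \<le> gauss_val p m w (F * G)" using gauss_val_ge_iff[OF FG] by blast
  then show "gauss_val p m w (F * G) = gauss_val p m w F + gauss_val p m w G"
    using le by (simp add: k_def l_def)
  assume ne: "F + G \<noteq> 0"
  have FG': "F + G \<in> laurent_polys" using F G laurent.add_closed by auto
  have "min k l \<le> m * v p (fls_nth (F + G) i) + w * i" if i: "fls_nth (F + G) i \<noteq> 0" for i
  proof -
    define g where "g b = (if b then fls_nth F i else fls_nth G i)" for b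
    have sum: "sum g {True, False} = fls_nth (F + G) i" by (simp add: g_def)
    obtain b where b: "g b \<noteq> 0" "v p (g b) \<le> v p (fls_nth (F + G) i)"
      using v_sum_term[OF p, of g "{True, False}"] i unfolding sum by blast
    then have "min k l \<le> m * v p (g b) + w * i"
      using geF[of i] geG[of i] by (cases b) (auto simp: g_def)
    also have "\<dots> \<le> m * v p (fls_nth (F + G) i) + w * i" using b(2) m by (simp add: mult_left_mono)
    finally show ?thesis .
  qed
  then show "min (gauss_val p m w F) (gauss_val p m w G) \<le> gauss_val p m w (F + G)"
    using gauss_val_ge_iff[OF FG' ne] by (simp add: k_def l_def)
qed

end

section \<open>Valuations of the function field over its constants\<close>

definition fls_of_poly :: "'k::field poly \<Rightarrow> 'k fls" where
  "fls_of_poly g = fps_to_fls (fps_of_poly g)"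

lemma fls_of_poly_0 [simp]: "fls_of_poly 0 = 0"
  and fls_of_poly_1 [simp]: "fls_of_poly 1 = 1"
  and fls_of_poly_add: "fls_of_poly (f + g) = fls_of_poly f + fls_of_poly g"
  and fls_of_poly_diff: "fls_of_poly (f - g) = fls_of_poly f - fls_of_poly g"
  and fls_of_poly_mult: "fls_of_poly (f * g) = fls_of_poly f * fls_of_poly g"
  and fls_of_poly_eq_iff [simp]: "fls_of_poly f = fls_of_poly g \<longleftrightarrow> f = g"
  by (simp_all add: fls_of_poly_def fps_of_poly_add fps_of_poly_diff fps_of_poly_mult
      fls_times_fps_to_fls fps_of_poly_eq_iff)

lemma fls_of_poly_eq_0_iff [simp]: "fls_of_poly g = 0 \<longleftrightarrow> g = 0"
  using fls_of_poly_eq_iff[of g 0] by simp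

lemma fls_nth_of_poly [simp]:
  "fls_nth (fls_of_poly g) n = (if n < 0 then 0 else coeff g (nat n))"
  by (simp add: fls_of_poly_def)

lemma fls_of_poly_power: "fls_of_poly (g ^ n) = fls_of_poly g ^ n"
  by (induction n) (auto simp: fls_of_poly_mult)

lemma fls_of_poly_sum: "fls_of_poly (sum f I) = (\<Sum>i\<in>I. fls_of_poly (f i))"
  by (induction I rule: infinite_finite_induct) (auto simp: fls_of_poly_add)

lemma fls_of_poly_monom: "fls_of_poly (monom c n) = fls_monom c (int n)"
  by (rule fls_eqI) auto

lemma fls_of_poly_laurent [simp]: "fls_of_poly g \<in> laurent_polys"
proof -
  have "{n. fls_nth (fls_of_poly g) n \<noteq> 0} \<subseteq> int ` {..degree g}"
  proof
    fix n assume "n \<in> {n. fls_nth (fls_of_poly g) n \<noteq> 0}"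
    then have "n \<ge> 0" "coeff g (nat n) \<noteq> 0" by (auto split: if_splits)
    then show "n \<in> int ` {..degree g}" using le_degree by (intro image_eqI[of _ _ "nat n"]) auto
  qed
  then show ?thesis unfolding laurent_polys_def using finite_subset by blast
qed

lemma laurent_poly_shift:
  assumes F: "F \<in> laurent_polys"
  obtains g N where "F = fls_of_poly g * fls_monom 1 (- int N)"
proof -
  let ?S = "{i. fls_nth F i \<noteq> 0}"
  define N where "N = nat (Max (insert 0 (uminus ` ?S)))"
  have N: "i + int N \<ge> 0" if "i \<in> ?S" for i
  proof -
    have "- i \<le> Max (insert 0 (uminus ` ?S))"
      using that laurent_polys_finite[OF F] by (intro Max_ge) auto
    then show ?thesis by (simp add: N_def)
  qed
  define g where "g = (\<Sum>i\<in>?S. monom (fls_nth F i) (nat (i + int N)))"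
  have "fls_of_poly g * fls_monom 1 (- int N) = (\<Sum>i\<in>?S. fls_monom (fls_nth F i) i)"
    unfolding g_def fls_of_poly_sum sum_distrib_right
    by (rule sum.cong) (use N in \<open>auto simp: fls_of_poly_monom fls_monom_mult\<close>)
  then show ?thesis using that[of g N] laurent_eq_sum[OF F] by simp
qed

interpretation polys: field_subring "range fls_of_poly :: 'k::field fls set"
proof
  show "1 \<in> (range fls_of_poly :: 'k fls set)" using fls_of_poly_1 by (metis rangeI)
  fix x y :: "'k fls" assume "x \<in> range fls_of_poly" "y \<in> range fls_of_poly"
  then show "x - y \<in> range fls_of_poly" "x * y \<in> range fls_of_poly"
    by (auto simp flip: fls_of_poly_diff fls_of_poly_mult)
qed

text \<open>A power of \<open>u\<close> turns a Laurent polynomial into a polynomial, so both rings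
  have the fraction field \<open>K(u)\<close> inside the Laurent series. The divisor theory of
  \<open>K[u]\<close> thereby serves for \<open>K[u, 1/u]\<close>.\<close>

lemma fraction_set_polys: "fraction_set (range fls_of_poly) = fraction_set (laurent_polys :: 'k::field fls set)"
proof (intro equalityI subsetI)
  fix x :: "'k fls" assume "x \<in> fraction_set (range fls_of_poly)"
  then obtain a b where "x = fls_of_poly a / fls_of_poly b" "fls_of_poly b \<noteq> 0"
    by (auto elim!: polys.fraction_setE)
  then show "x \<in> fraction_set laurent_polys"
    using laurent.fraction_setI[of "fls_of_poly a" "fls_of_poly b"] by simp
next
  fix x :: "'k fls" assume "x \<in> fraction_set laurent_polys"
  then obtain F G where FG: "x = F / G" "F \<in> laurent_polys" "G \<in> laurent_polys"
    by (auto elim!: laurent.fraction_setE)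
  have "F \<in> fraction_set (range fls_of_poly)" if F: "F \<in> laurent_polys" for F :: "'k fls"
  proof -
    obtain g N where g: "F = fls_of_poly g * fls_monom 1 (- int N)" using laurent_poly_shift[OF F] .
    have "fls_monom 1 (- int N) * fls_monom 1 (int N) = (1 :: 'k fls)" by (simp add: fls_monom_mult)
    then have "F * fls_of_poly (monom 1 N) = fls_of_poly g"
      by (simp add: g fls_of_poly_monom mult.assoc)
    moreover have "fls_of_poly (monom (1 :: 'k) N) \<noteq> 0" by (simp add: monom_eq_0_iff)
    ultimately have "F = fls_of_poly g / fls_of_poly (monom 1 N)" by (simp add: eq_divide_eq)
    then show ?thesis using polys.fraction_setI[of "fls_of_poly g" "fls_of_poly (monom 1 N)"]
      by (simp add: monom_eq_0_iff)
  qed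
  then show "x \<in> fraction_set (range fls_of_poly)"
    using FG polys.divide_fraction_set by blast
qed

text \<open>The leading coefficient 1 selects one generator of each nonzero prime of
  \<open>K[u]\<close>, so that different indices give different valuations.\<close>

definition monic_irreducibles :: "'k::field poly set" where
  "monic_irreducibles = {g. irreducible g \<and> lead_coeff g = 1}"

definition horizontal :: "'k::field poly set" where
  "horizontal = monic_irreducibles - {[:0, 1:]}"

definition poly_val :: "'k::field poly \<Rightarrow> 'k fls \<Rightarrow> int" where
  "poly_val g = extend_valuation (range fls_of_poly)
     (field_subring.order_at (range fls_of_poly) (fls_of_poly g))"

lemma monic_irreducible_dvd_eq:
  assumes g: "g \<in> monic_irreducibles" and h: "h \<in> monic_irreducibles" and "g dvd h"
  shows "g = h"
proof -
  obtain c where c: "h = g * c" using assms(3) by (auto simp: dvd_def)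
  have "\<not> is_unit g" "irreducible h" using g h by (auto simp: monic_irreducibles_def irreducible_def)
  then have "is_unit c" using c irreducibleD by blast
  then obtain a where a: "c = [:a:]" by (metis is_unit_poly_iff)
  have "lead_coeff h = lead_coeff g * lead_coeff c" unfolding c by (rule lead_coeff_mult)
  then have "a = 1" using a g h by (simp add: monic_irreducibles_def)
  then show ?thesis using a c by simp
qed

text \<open>A divisor of least positive degree cannot be factored further; scaling makes it
  monic.\<close>

lemma exists_monic_irreducible_factor:
  fixes b :: "'k::field poly"
  assumes "degree b > 0"
  shows "\<exists>g\<in>monic_irreducibles. g dvd b"
proof -
  define P where "P g \<longleftrightarrow> g dvd b \<and> degree g > 0" for g
  obtain g0 where g0: "P g0" "\<And>h. P h \<Longrightarrow> degree g0 \<le> degree h"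
    using ex_has_least_nat[of P b degree] assms by (auto simp: P_def)
  define c where "c = inverse (lead_coeff g0)"
  have c: "c \<noteq> 0" using g0(1) by (auto simp: c_def P_def)
  define g where "g = smult c g0"
  have Pg: "P g" "degree g = degree g0" "lead_coeff g = 1"
    using c g0(1) by (auto simp: g_def P_def smult_dvd_iff c_def)
  have "irreducible g"
  proof (rule irreducibleI)
    show "g \<noteq> 0" using Pg by auto
    then show "\<not> is_unit g" using Pg by (auto simp: P_def is_unit_iff_degree)
    fix x y assume xy: "g = x * y"
    show "is_unit x \<or> is_unit y"
    proof (rule ccontr)
      assume "\<not> ?thesis"
      moreover have nz: "x \<noteq> 0" "y \<noteq> 0" using xy \<open>g \<noteq> 0\<close> by auto
      ultimately have "degree x > 0" "degree y > 0" by (auto simp: is_unit_iff_degree)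
      moreover have "degree g = degree x + degree y" using xy nz by (simp add: degree_mult_eq)
      moreover have "x dvd b" using xy Pg(1) unfolding P_def by (meson dvd_trans dvd_triv_left)
      ultimately show False using g0(2)[of x] Pg(2) by (auto simp: P_def)
    qed
  qed
  then show ?thesis using Pg by (auto simp: P_def monic_irreducibles_def)
qed

text \<open>Induction on the degree: after division by one factor \<open>g\<close>, any other monic
  irreducible divisor divides the quotient or equals \<open>g\<close>.\<close>

lemma finite_monic_irreducible_divisors:
  fixes a :: "'k::field poly"
  assumes "a \<noteq> 0"
  shows "finite {g \<in> monic_irreducibles. g dvd a}"
  using assms
proof (induction "degree a" arbitrary: a rule: less_induct)
  case less
  show ?case
  proof (cases "\<exists>g\<in>monic_irreducibles. g dvd a")
    case True
    then obtain g b where g: "g \<in> monic_irreducibles" "a = g * b" by (auto simp: dvd_def)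
    have nz: "g \<noteq> 0" "b \<noteq> 0" using g less(2) by auto
    have "degree g > 0" using g nz(1) by (auto simp: monic_irreducibles_def irreducible_def is_unit_iff_degree)
    then have fin: "finite {g \<in> monic_irreducibles. g dvd b}"
      using less(1)[of b] nz g by (auto simp: degree_mult_eq)
    have "{h \<in> monic_irreducibles. h dvd a} \<subseteq> insert g {g \<in> monic_irreducibles. g dvd b}"
    proof
      fix h assume h: "h \<in> {h \<in> monic_irreducibles. h dvd a}"
      then have "prime_elem h" by (auto simp: monic_irreducibles_def intro: field_poly_irreducible_imp_prime)
      then have "h dvd g \<or> h dvd b" using h g by (auto simp: prime_elem_dvd_mult_iff)
      then show "h \<in> insert g {g \<in> monic_irreducibles. g dvd b}"
        using monic_irreducible_dvd_eq[of h g] h g by auto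
    qed
    then show ?thesis using fin finite_subset by blast
  next
    case False
    then have "{g \<in> monic_irreducibles. g dvd a} = {}" by blast
    then show ?thesis by (metis finite.emptyI)
  qed
qed

text \<open>Irreducible polynomials over a field are prime, and a power of \<open>g\<close> beyond
  the degree of \<open>a\<close> cannot divide \<open>a\<close>; these are the two conditions of
  \<open>valuation_on_order_at\<close>.\<close>

lemma
  assumes g: "g \<in> monic_irreducibles"
  shows valuation_poly_val: "valuation_on (fraction_set laurent_polys) (poly_val g)"
    and poly_val_of_poly_nonneg: "\<And>a. a \<noteq> 0 \<Longrightarrow> poly_val g (fls_of_poly a) \<ge> 0"
    and poly_val_pos_iff: "\<And>a. a \<noteq> 0 \<Longrightarrow> poly_val g (fls_of_poly a) > 0 \<longleftrightarrow> g dvd a"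
    and poly_val_self: "poly_val g (fls_of_poly g) = 1"
proof -
  let ?R = "range fls_of_poly :: 'a fls set"
  let ?t = "fls_of_poly g"
  have ideal_iff: "fls_of_poly a \<in> (\<lambda>y. fls_of_poly b * y) ` ?R \<longleftrightarrow> b dvd a" for a b
    by (auto simp: image_iff dvd_def simp flip: fls_of_poly_mult)
  have g0: "g \<noteq> 0" "prime_elem g" "degree g > 0"
    using g by (auto simp: monic_irreducibles_def irreducible_def is_unit_iff_degree
        intro: field_poly_irreducible_imp_prime)
  have t: "?t \<in> ?R" "?t \<noteq> 0" using g0 by auto
  have val: "valuation_on ?R (polys.order_at ?t)"
  proof (rule polys.valuation_on_order_at[OF t])
    fix x y :: "'a fls" assume xy: "x \<in> ?R" "y \<in> ?R" "x * y \<in> (\<lambda>y. ?t * y) ` ?R"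
    then obtain a b where ab: "x = fls_of_poly a" "y = fls_of_poly b" by auto
    have "g dvd a * b" using xy(3) ideal_iff unfolding ab by (simp flip: fls_of_poly_mult)
    then show "x \<in> (\<lambda>y. ?t * y) ` ?R \<or> y \<in> (\<lambda>y. ?t * y) ` ?R"
      using g0(2) unfolding ab ideal_iff by (simp add: prime_elem_dvd_mult_iff)
  next
    fix x :: "'a fls" assume "x \<in> ?R" "x \<noteq> 0"
    then obtain a where a: "x = fls_of_poly a" "a \<noteq> 0" by auto
    define n where "n = Suc (degree a)"
    have "\<not> g ^ n dvd a"
    proof
      assume "g ^ n dvd a"
      then have "degree (g ^ n) \<le> degree a" using a(2) dvd_imp_degree_le by blast
      moreover have "degree (g ^ n) = n * degree g" using g0(1) by (simp add: degree_power_eq)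
      moreover have "n * 1 \<le> n * degree g" using g0(3) by (intro mult_left_mono) auto
      ultimately show False by (simp add: n_def)
    qed
    then show "\<exists>n. x \<notin> (\<lambda>y. ?t ^ n * y) ` ?R"
      using ideal_iff[of a "g ^ n"] unfolding a fls_of_poly_power by blast
  qed
  have eq: "poly_val g (fls_of_poly a) = polys.order_at ?t (fls_of_poly a)" if "a \<noteq> 0" for a
    unfolding poly_val_def by (rule polys.extend_valuation_eq[OF val]) (use that in auto)
  show "valuation_on (fraction_set laurent_polys) (poly_val g)"
    using polys.valuation_on_extend_valuation[OF val] by (simp add: poly_val_def fraction_set_polys)
  show nonneg: "poly_val g (fls_of_poly a) \<ge> 0" if "a \<noteq> 0" for a
    unfolding eq[OF that] by (simp add: polys.order_at_def)
  have not1: "\<not> g dvd 1" using g0(1,3) by (simp add: is_unit_iff_degree)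
  show self: "poly_val g (fls_of_poly g) = 1"
    using polys.order_at_eqI[OF t(2,1) polys.one_closed, of ?t 1] ideal_iff[of 1 g] not1 eq[OF g0(1)]
    by auto
  show "poly_val g (fls_of_poly a) > 0 \<longleftrightarrow> g dvd a" if a: "a \<noteq> 0" for a
  proof
    assume "g dvd a"
    then obtain b where b: "a = g * b" "b \<noteq> 0" using a by (auto simp: dvd_def)
    have "poly_val g (fls_of_poly a) = poly_val g (fls_of_poly g) + poly_val g (fls_of_poly b)"
      using valuation_on_mult[OF val, of ?t "fls_of_poly b"] b g0(1) a
      by (simp add: eq fls_of_poly_mult[symmetric])
    then show "poly_val g (fls_of_poly a) > 0" using self nonneg[OF b(2)] by simp
  next
    assume pos: "poly_val g (fls_of_poly a) > 0"
    show "g dvd a"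
    proof (rule ccontr)
      assume "\<not> g dvd a"
      then have "polys.order_at ?t (fls_of_poly a) = int 0"
        by (intro polys.order_at_eqI[OF t(2,1), of "fls_of_poly a"]) (auto simp: ideal_iff)
      then show False using pos eq[OF a] by simp
    qed
  qed
qed

text \<open>\<open>g\<close> divides neither a nonzero constant nor \<open>u\<close>, the latter
  because \<open>u\<close> itself is excluded from \<open>horizontal\<close>. Negative exponents are
  reached by multiplying with a power of \<open>u\<close>.\<close>

lemma poly_val_monom:
  assumes g: "g \<in> horizontal" and "f \<noteq> 0"
  shows "poly_val g (fls_monom f n) = 0"
proof -
  have gm: "g \<in> monic_irreducibles" "g \<noteq> [:0, 1:]" using g by (auto simp: horizontal_def)
  note val = valuation_poly_val[OF gm(1)]
  have inF: "fls_monom f n \<in> fraction_set laurent_polys" for f :: 'a and n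
    using laurent.subset_fraction_set by auto
  have pos: "poly_val g (fls_monom f (int n)) = 0" if "f \<noteq> 0" for n f
  proof (rule ccontr)
    assume "poly_val g (fls_monom f (int n)) \<noteq> 0"
    then have "poly_val g (fls_of_poly (monom f n)) > 0"
      using poly_val_of_poly_nonneg[OF gm(1), of "monom f n"] that
      by (simp add: fls_of_poly_monom monom_eq_0_iff)
    then have dvd: "g dvd monom f n"
      using poly_val_pos_iff[OF gm(1), of "monom f n"] that by (simp add: monom_eq_0_iff)
    have pr: "prime_elem g" using gm by (auto simp: monic_irreducibles_def intro: field_poly_irreducible_imp_prime)
    have "monom f n = [:f:] * [:0, 1:] ^ n"
      by (simp add: monom_altdef)
    then have "g dvd [:f:] \<or> g dvd [:0, 1:]"
      using dvd pr prime_elem_dvd_mult_iff prime_elem_dvd_power by metis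
    moreover have "\<not> g dvd [:f:]"
    proof
      assume "g dvd [:f:]"
      moreover have "is_unit [:f:]" using that by (simp add: is_unit_const_poly_iff dvd_field_iff)
      ultimately have "is_unit g" by (rule dvd_trans)
      then show False using pr by (auto simp: prime_elem_def)
    qed
    moreover have "[:0, 1:] \<in> (monic_irreducibles :: 'a poly set)"
      by (auto simp: monic_irreducibles_def intro: irreducible_linear_field_poly)
    ultimately show False using monic_irreducible_dvd_eq[OF gm(1)] gm(2) by blast
  qed
  have "fls_monom f n * fls_monom 1 (int (nat (- n))) = fls_monom f (int (nat n))"
    by (cases "n \<ge> 0") (auto simp: fls_monom_mult)
  moreover have "poly_val g (fls_monom f n * fls_monom 1 (int (nat (- n)))) =
      poly_val g (fls_monom f n) + poly_val g (fls_monom 1 (int (nat (- n))))"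
    using assms(2) by (intro valuation_on_mult[OF val] inF) auto
  ultimately show ?thesis using pos[of f "nat n"] pos[of 1 "nat (- n)"] assms(2) by simp
qed

lemma poly_val_laurent_nonneg:
  assumes g: "g \<in> horizontal" and F: "F \<in> laurent_polys" "F \<noteq> 0"
  shows "poly_val g F \<ge> 0"
proof -
  have gm: "g \<in> monic_irreducibles" using g by (auto simp: horizontal_def)
  obtain a N where a: "F = fls_of_poly a * fls_monom 1 (- int N)" using laurent_poly_shift[OF F(1)] .
  have "a \<noteq> 0" using a F by auto
  have "poly_val g F = poly_val g (fls_of_poly a) + poly_val g (fls_monom 1 (- int N))"
    unfolding a using \<open>a \<noteq> 0\<close> laurent.subset_fraction_set
    by (intro valuation_on_mult[OF valuation_poly_val[OF gm]]) auto
  then show ?thesis using poly_val_monom[OF g, of 1] poly_val_of_poly_nonneg[OF gm \<open>a \<noteq> 0\<close>] by simp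
qed

lemma fraction_set_laurentE:
  assumes "x \<in> fraction_set laurent_polys"
  obtains a b where "x = fls_of_poly a / fls_of_poly b" "b \<noteq> 0"
  using assms unfolding fraction_set_polys[symmetric] by (auto elim!: polys.fraction_setE)

lemma poly_val_divide:
  assumes "g \<in> monic_irreducibles" "a \<noteq> 0" "b \<noteq> 0"
  shows "poly_val g (fls_of_poly a / fls_of_poly b) = poly_val g (fls_of_poly a) - poly_val g (fls_of_poly b)"
proof -
  have "fls_of_poly a = fls_of_poly a / fls_of_poly b * fls_of_poly b" using assms by simp
  then have "poly_val g (fls_of_poly a) =
      poly_val g (fls_of_poly a / fls_of_poly b) + poly_val g (fls_of_poly b)"
    using valuation_on_mult[OF valuation_poly_val[OF assms(1)], of "fls_of_poly a / fls_of_poly b" "fls_of_poly b"]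
      assms laurent.fraction_setI[of "fls_of_poly a" "fls_of_poly b"]
      subsetD[OF laurent.subset_fraction_set fls_of_poly_laurent[of b]] by simp
  then show ?thesis by simp
qed

lemma finite_poly_val_nonzero:
  assumes "x \<in> fraction_set laurent_polys" "x \<noteq> 0"
  shows "finite {g \<in> horizontal. poly_val g x \<noteq> 0}"
proof -
  obtain a b where x: "x = fls_of_poly a / fls_of_poly b" "b \<noteq> 0"
    using fraction_set_laurentE[OF assms(1)] .
  have "a \<noteq> 0" using x assms(2) by auto
  have "{g \<in> horizontal. poly_val g x \<noteq> 0} \<subseteq>
    {g \<in> monic_irreducibles. g dvd a} \<union> {g \<in> monic_irreducibles. g dvd b}"
  proof
    fix g assume g: "g \<in> {g \<in> horizontal. poly_val g x \<noteq> 0}"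
    then have gm: "g \<in> monic_irreducibles" by (auto simp: horizontal_def)
    have "poly_val g (fls_of_poly a) > 0 \<or> poly_val g (fls_of_poly b) > 0"
      using poly_val_of_poly_nonneg[OF gm, of a] poly_val_of_poly_nonneg[OF gm, of b]
        poly_val_divide[OF gm, of a b] g x \<open>a \<noteq> 0\<close> by auto
    then show "g \<in> {g \<in> monic_irreducibles. g dvd a} \<union> {g \<in> monic_irreducibles. g dvd b}"
      using poly_val_pos_iff[OF gm] gm x \<open>a \<noteq> 0\<close> by auto
  qed
  then show ?thesis
    using finite_monic_irreducible_divisors[OF x(2)] finite_monic_irreducible_divisors[OF \<open>a \<noteq> 0\<close>]
      finite_subset by blast
qed

text \<open>Induction on the degree of the denominator. An irreducible factor other than
  \<open>u\<close> must divide the numerator too and cancels.\<close>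

lemma laurent_if_poly_val_nonneg:
  assumes "x \<in> fraction_set laurent_polys" "x \<noteq> 0" "\<And>g. g \<in> horizontal \<Longrightarrow> poly_val g x \<ge> 0"
  shows "x \<in> laurent_polys"
proof -
  have "fls_of_poly a / fls_of_poly b \<in> laurent_polys"
    if "b \<noteq> 0" "a \<noteq> 0" "\<And>g. g \<in> horizontal \<Longrightarrow> poly_val g (fls_of_poly a / fls_of_poly b) \<ge> 0"
    for a b :: "'a poly"
    using that
  proof (induction "degree b" arbitrary: a b rule: less_induct)
    case less
    show ?case
    proof (cases "degree b > 0")
      case False
      then have "degree b = 0" by simp
      then obtain c where b: "b = [:c:]" by (rule degree_eq_zeroE)
      then have c: "b = [:c:]" "c \<noteq> 0" using less(2) by auto
      have "fls_of_poly (smult (inverse c) a) * fls_of_poly b = fls_of_poly a"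
        using c by (simp flip: fls_of_poly_mult)
      then have "fls_of_poly a / fls_of_poly b = fls_of_poly (smult (inverse c) a)"
        using less(2) by (simp add: divide_eq_eq)
      then show ?thesis by simp
    next
      case True
      then obtain g b' where g: "g \<in> monic_irreducibles" "b = g * b'"
        using exists_monic_irreducible_factor[of b] by (auto simp: dvd_def)
      have nz: "g \<noteq> 0" "b' \<noteq> 0" using g less(2) by auto
      have "degree g > 0" using g nz(1) by (auto simp: monic_irreducibles_def irreducible_def is_unit_iff_degree)
      then have deg: "degree b' < degree b" using g nz by (simp add: degree_mult_eq)
      show ?thesis
      proof (cases "g = [:0, 1:]")
        \<comment> \<open>The factor \<open>u\<close> is a unit of the Laurent polynomials: it is
          moved to the other side and divided out again afterwards.\<close>
        case True
        then have X: "fls_of_poly g = fls_monom 1 1"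
          using fls_of_poly_monom[of 1 1] by (simp add: monom_altdef)
        have "fls_of_poly a / fls_of_poly b' = fls_of_poly a / fls_of_poly b * fls_monom 1 1"
          using nz by (simp add: g(2) fls_of_poly_mult X)
        moreover have "poly_val h (fls_of_poly a / fls_of_poly b * fls_monom 1 1) \<ge> 0"
          if h: "h \<in> horizontal" for h
        proof -
          have "poly_val h (fls_of_poly a / fls_of_poly b * fls_monom 1 1) =
              poly_val h (fls_of_poly a / fls_of_poly b) + poly_val h (fls_monom 1 1)"
            by (rule valuation_on_mult[OF valuation_poly_val])
              (use h less(2,3) laurent.fraction_setI[of "fls_of_poly a" "fls_of_poly b"]
                laurent.subset_fraction_set in \<open>auto simp: horizontal_def\<close>)
          then show ?thesis using less(4)[OF h] poly_val_monom[OF h, of 1] by simp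
        qed
        ultimately have "fls_of_poly a / fls_of_poly b * fls_monom 1 1 \<in> laurent_polys"
          using less(1)[OF deg nz(2) less(3)] by simp
        then have "fls_of_poly a / fls_of_poly b * fls_monom 1 1 * fls_monom 1 (- 1) \<in> laurent_polys"
          using laurent.mult_closed fls_monom_laurent by blast
        then show ?thesis by (simp add: mult.assoc fls_monom_mult)
      next
        case False
        then have h: "g \<in> horizontal" using g by (simp add: horizontal_def)
        have "poly_val g (fls_of_poly b) > 0" using poly_val_pos_iff[OF g(1) less(2)] g by simp
        then have "poly_val g (fls_of_poly a) > 0"
          using less(4)[OF h] poly_val_divide[OF g(1) less(3,2)] by simp
        then obtain a' where a': "a = g * a'" using poly_val_pos_iff[OF g(1) less(3)] by (auto simp: dvd_def)
        then have "fls_of_poly a / fls_of_poly b = fls_of_poly a' / fls_of_poly b'"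
          using g nz by (simp add: fls_of_poly_mult)
        then show ?thesis using less(1)[OF deg nz(2), of a'] less(3,4) a' by auto
      qed
    qed
  qed
  then show ?thesis using assms fraction_set_laurentE[OF assms(1)] by (metis div_0 fls_of_poly_0)
qed

text \<open>\<open>u\<close> is prime in \<open>K[u]\<close>, so the factors \<open>u\<close> of the
  power can be removed one at a time, each from \<open>a\<close> or from \<open>b\<close>.\<close>

lemma monom_if_mult_eq_X_power:
  fixes a b :: "'k::field poly"
  assumes "a * b = [:0, 1:] ^ n"
  shows "\<exists>c i. c \<noteq> 0 \<and> a = monom c i"
  using assms
proof (induction n arbitrary: a b)
  case 0
  then have "is_unit a" by (metis dvd_triv_left power_0)
  then obtain c where "a = [:c:]" "c \<noteq> 0" by (auto simp: is_unit_poly_iff dvd_field_iff)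
  then show ?case by (intro exI[of _ c] exI[of _ 0]) (simp add: monom_0)
next
  case (Suc n)
  have "prime_elem ([:0, 1:] :: 'k poly)"
    by (intro field_poly_irreducible_imp_prime irreducible_linear_field_poly) simp
  moreover have "[:0, 1:] dvd a * b" unfolding Suc(2) power_Suc by (rule dvd_triv_left)
  ultimately consider "[:0, 1:] dvd a" | "[:0, 1:] dvd b" by (auto simp: prime_elem_dvd_mult_iff)
  then show ?case
  proof cases
    case 1
    then obtain a' where a': "a = [:0, 1:] * a'" by (auto simp: dvd_def)
    have "[:0, 1:] * (a' * b) = [:0, 1:] * [:0, 1:] ^ n" using Suc(2) unfolding a' power_Suc by (simp only: mult.assoc)
    then have "a' * b = [:0, 1:] ^ n" unfolding mult_cancel_left by simp
    then obtain c i where "c \<noteq> 0" "a' = monom c i" using Suc(1) by blast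
    then show ?thesis unfolding a'
      by (intro exI[of _ c] exI[of _ "Suc i"]) (simp add: monom_Suc)
  next
    case 2
    then obtain b' where b': "b = [:0, 1:] * b'" by (auto simp: dvd_def)
    have "[:0, 1:] * (a * b') = [:0, 1:] * [:0, 1:] ^ n"
      using Suc(2) unfolding b' power_Suc by (simp only: mult.left_commute)
    then have "a * b' = [:0, 1:] ^ n" unfolding mult_cancel_left by simp
    then show ?thesis using Suc(1) by blast
  qed
qed

text \<open>Both \<open>x\<close> and its inverse are Laurent polynomials by
  \<open>laurent_if_poly_val_nonneg\<close>, so up to powers of \<open>u\<close> they are two
  polynomials whose product is a power of \<open>u\<close>.\<close>

lemma monom_if_poly_val_zero:
  assumes x: "x \<in> fraction_set laurent_polys" "x \<noteq> 0" "\<And>g. g \<in> horizontal \<Longrightarrow> poly_val g x = 0"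
  shows "\<exists>f n. f \<noteq> 0 \<and> x = fls_monom f n"
proof -
  have xi: "inverse x \<in> fraction_set laurent_polys" using laurent.inverse_fraction_set x(1) .
  have "poly_val g (inverse x) = 0" if g: "g \<in> horizontal" for g
  proof -
    have gm: "g \<in> monic_irreducibles" using g by (auto simp: horizontal_def)
    have "poly_val g (x * inverse x) = poly_val g x + poly_val g (inverse x)"
      using valuation_on_mult[OF valuation_poly_val[OF gm] x(1) xi] x(2) by simp
    then show ?thesis using x(2,3) g poly_val_monom[OF g, of 1 0] by simp
  qed
  then have "inverse x \<in> laurent_polys" using laurent_if_poly_val_nonneg[OF xi] x(2) by simp
  moreover have "x \<in> laurent_polys" using laurent_if_poly_val_nonneg[OF x(1,2)] x(3) by simp
  ultimately obtain a b N M where ab: "x = fls_of_poly a * fls_monom 1 (- int N)"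
    "inverse x = fls_of_poly b * fls_monom 1 (- int M)" using laurent_poly_shift by metis
  have "(fls_of_poly a * fls_monom 1 (- int N)) * (fls_of_poly b * fls_monom 1 (- int M)) = 1"
    using x(2) ab by (metis right_inverse)
  then have "(fls_of_poly a * fls_monom 1 (- int N)) * (fls_of_poly b * fls_monom 1 (- int M)) *
      (fls_monom 1 (int N) * fls_monom 1 (int M)) = fls_monom 1 (int N) * fls_monom 1 (int M)" by simp
  then have "fls_of_poly (a * b) * ((fls_monom 1 (- int N) * fls_monom 1 (int N)) *
      (fls_monom 1 (- int M) * fls_monom 1 (int M))) = fls_monom 1 (int N) * fls_monom 1 (int M)"
    by (simp only: fls_of_poly_mult mult_ac)
  then have "fls_of_poly (a * b) = fls_of_poly (monom 1 (N + M))"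
    by (simp add: fls_monom_mult fls_of_poly_monom)
  then have "a * b = [:0, 1:] ^ (N + M)" unfolding fls_of_poly_eq_iff by (simp add: monom_altdef)
  then obtain c i where "c \<noteq> 0" "a = monom c i" using monom_if_mult_eq_X_power by blast
  then show ?thesis using ab(1)
    by (intro exI[of _ c] exI[of _ "int i - int N"]) (simp add: fls_of_poly_monom fls_monom_mult)
qed

section \<open>The graded algebra\<close>

definition num :: "rat \<Rightarrow> int" where "num d = fst (quotient_of d)"
definition den :: "rat \<Rightarrow> int" where "den d = snd (quotient_of d)"

lemma den_pos [simp]: "den d > 0"
  using quotient_of_denom_pos[of d "num d" "den d"] by (simp add: num_def den_def)

lemma den_simps [simp]: "den d \<ge> 0" "\<not> den d \<le> 0" "\<not> den d < 0" "den d \<noteq> 0"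
  using den_pos[of d] by linarith+

lemma num_den_coprime: "coprime (num d) (den d)"
  using quotient_of_coprime[of d "num d" "den d"] by (simp add: num_def den_def)

lemma num_div_den: "of_int (num d) / of_int (den d) = d"
  using quotient_of_div[of d "num d" "den d"] by (simp add: num_def den_def)

lemma of_int_num: "(of_int (num d) :: rat) = of_int (den d) * d"
  using num_div_den[of d] den_pos[of d] by (simp add: field_simps)

lemma num_den_eqI: "d = of_int a / of_int b \<Longrightarrow> b > 0 \<Longrightarrow> coprime a b \<Longrightarrow> num d = a \<and> den d = b"
  using quotient_of_unique[of d] by (metis Fract_of_int_quotient den_def fst_conv num_def
    quotient_of_Fract snd_conv normalize_stable)

lemma den_mult_add_num:
  "(of_int (den d * k + num d * n) :: rat) = of_int (den d) * (of_int k + of_int n * d)"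
  by (simp add: of_int_num algebra_simps)

text \<open>Clearing the positive denominator turns the rational condition that defines the graded
  pieces into one on an integer valued weight.\<close>

lemma weight_nonneg_iff: "den d * k + num d * n \<ge> 0 \<longleftrightarrow> of_int k + of_int n * d \<ge> 0"
proof -
  have "den d * k + num d * n \<ge> 0 \<longleftrightarrow> (of_int (den d * k + num d * n) :: rat) \<ge> 0"
    by (simp only: of_int_0_le_iff)
  also have "\<dots> \<longleftrightarrow> of_int k + of_int n * d \<ge> 0"
    unfolding den_mult_add_num by (simp add: zero_le_mult_iff)
  finally show ?thesis .
qed

lemma weight_pos_iff: "den d * k + num d * n > 0 \<longleftrightarrow> of_int k + of_int n * d > 0"
proof -
  have "den d * k + num d * n > 0 \<longleftrightarrow> (of_int (den d * k + num d * n) :: rat) > 0"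
    by (simp only: of_int_0_less_iff)
  also have "\<dots> \<longleftrightarrow> of_int k + of_int n * d > 0"
    unfolding den_mult_add_num by (simp add: zero_less_mult_iff)
  finally show ?thesis .
qed

lemma num_0 [simp]: "num 0 = 0" and den_0 [simp]: "den 0 = 1"
  by (simp_all add: num_def den_def)

locale dpd_surface = smooth_curve \<iota> A0 for \<iota> :: "complex \<Rightarrow> 'k::field" and A0 :: "'k set" +
  fixes Dp Dm :: "'k set \<Rightarrow>\<^sub>0 rat"
  assumes nonpos: "p \<in> closed_points A0 \<Longrightarrow> Poly_Mapping.lookup Dp p + Poly_Mapping.lookup Dm p \<le> 0"
begin

abbreviation A :: "'k fls set" where
  "A \<equiv> DPD_algebra A0 Dp Dm"

text \<open>The primes of height one of \<open>A\<close> over \<open>p\<close> belong to the slopes \<open>d \<in> slopes p\<close>: writing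
  \<open>d = w / m\<close> in lowest terms, the valuation is the monomial one with \<open>v(t) = m\<close>, \<open>v(u) = w\<close>.\<close>

definition slopes :: "'k set \<Rightarrow> rat set" where
  "slopes p = {Poly_Mapping.lookup Dp p, - Poly_Mapping.lookup Dm p}"

definition vertical :: "('k set \<times> rat) set" where
  "vertical = (SIGMA p:closed_points A0. slopes p)"

definition vert_val :: "'k set \<times> rat \<Rightarrow> 'k fls \<Rightarrow> int" where
  "vert_val j = extend_valuation laurent_polys (gauss_val (fst j) (den (snd j)) (num (snd j)))"

lemma finite_special: "finite {p. slopes p \<noteq> {0}}"
proof (rule finite_subset)
  show "{p. slopes p \<noteq> {0}} \<subseteq> Poly_Mapping.keys Dp \<union> Poly_Mapping.keys Dm"
    by (auto simp: slopes_def in_keys_iff)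
qed simp

lemma slopes_finite [simp]: "finite (slopes p)"
  by (simp add: slopes_def)

lemma valuation_vert_laurent:
  assumes "(p, d) \<in> vertical" shows "valuation_on laurent_polys (gauss_val p (den d) (num d))"
  by (rule valuation_gauss_val) (use assms in \<open>auto simp: vertical_def\<close>)

lemma vert_val_laurent:
  assumes "(p, d) \<in> vertical" "F \<in> laurent_polys" "F \<noteq> 0"
  shows "vert_val (p, d) F = gauss_val p (den d) (num d) F"
  using laurent.extend_valuation_eq[OF valuation_vert_laurent[OF assms(1)] assms(2,3)]
  by (simp add: vert_val_def)

lemma valuation_vert_val:
  assumes "j \<in> vertical" shows "valuation_on (fraction_set laurent_polys) (vert_val j)"
  using laurent.valuation_on_extend_valuation[OF valuation_vert_laurent[of "fst j" "snd j"]] assms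
  by (simp add: vert_val_def)

lemma vert_val_monom:
  "(p, d) \<in> vertical \<Longrightarrow> f \<noteq> 0 \<Longrightarrow> vert_val (p, d) (fls_monom f n) = den d * v p f + num d * n"
  by (simp add: vert_val_laurent gauss_val_monom)

lemma vert_val_ge_iff:
  assumes "(p, d) \<in> vertical" "F \<in> laurent_polys" "F \<noteq> 0"
  shows "k \<le> vert_val (p, d) F \<longleftrightarrow>
    (\<forall>n. fls_nth F n \<noteq> 0 \<longrightarrow> k \<le> den d * v p (fls_nth F n) + num d * n)"
  using gauss_val_ge_iff[OF assms(2,3)] vert_val_laurent[OF assms] by simp

lemma floor_slope: "k + \<lfloor>r\<rfloor> \<ge> 0 \<longleftrightarrow> of_int k + (r :: rat) \<ge> 0"
proof -
  have "k + \<lfloor>r\<rfloor> \<ge> 0 \<longleftrightarrow> - k \<le> \<lfloor>r\<rfloor>" by linarith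
  also have "\<dots> \<longleftrightarrow> of_int k + r \<ge> 0" unfolding le_floor_iff of_int_minus by linarith
  finally show ?thesis .
qed

text \<open>For \<open>n \<ge> 0\<close> the slope \<open>- Dm p\<close> gives a weaker condition than \<open>Dp p\<close>, and conversely for
  \<open>n \<le> 0\<close>, because \<open>Dp p + Dm p \<le> 0\<close>.\<close>

lemma graded_coeffs_iff:
  assumes "f \<noteq> 0"
  shows "f \<in> graded_coeffs A0 Dp Dm n \<longleftrightarrow>
    (\<forall>p\<in>closed_points A0. \<forall>d\<in>slopes p. of_int (v p f) + of_int n * d \<ge> 0)"
proof -
  have "(v p f + (if n \<ge> 0 then \<lfloor>of_int n * Poly_Mapping.lookup Dp p\<rfloor>
      else \<lfloor>of_int (- n) * Poly_Mapping.lookup Dm p\<rfloor>) \<ge> 0) \<longleftrightarrow>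
      (\<forall>d\<in>slopes p. of_int (v p f) + of_int n * d \<ge> 0)" if p: "p \<in> closed_points A0" for p
  proof (cases "n \<ge> 0")
    case True
    have "of_int n * Poly_Mapping.lookup Dp p \<le> of_int n * (- Poly_Mapping.lookup Dm p)"
      using nonpos[OF p] True by (intro mult_left_mono) auto
    then show ?thesis using True by (auto simp: floor_slope slopes_def)
  next
    case False
    have "of_int n * (- Poly_Mapping.lookup Dm p) \<le> of_int n * Poly_Mapping.lookup Dp p"
      using nonpos[OF p] False by (intro mult_left_mono_neg) auto
    then show ?thesis using False by (auto simp: floor_slope slopes_def)
  qed
  then show ?thesis using assms by (simp add: graded_coeffs_def global_sections_def)
qed

lemma zero_graded_coeffs [simp]: "0 \<in> graded_coeffs A0 Dp Dm n"
  by (simp add: graded_coeffs_def global_sections_def)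

text \<open>A monomial valuation is a minimum over the coefficients, so its nonnegativity can be
  tested degree by degree, exactly as membership in \<open>A\<close>.\<close>

lemma mem_A_iff_vert_val:
  assumes F: "F \<in> laurent_polys" "F \<noteq> 0"
  shows "F \<in> A \<longleftrightarrow> (\<forall>j\<in>vertical. vert_val j F \<ge> 0)"
proof -
  have "F \<in> A \<longleftrightarrow> (\<forall>n. fls_nth F n \<noteq> 0 \<longrightarrow> fls_nth F n \<in> graded_coeffs A0 Dp Dm n)"
    using F(1) zero_graded_coeffs by (auto simp: DPD_algebra_def laurent_polys_def) (metis zero_graded_coeffs)
  also have "\<dots> \<longleftrightarrow> (\<forall>n. fls_nth F n \<noteq> 0 \<longrightarrow>
      (\<forall>p\<in>closed_points A0. \<forall>d\<in>slopes p. den d * v p (fls_nth F n) + num d * n \<ge> 0))"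
    using graded_coeffs_iff by (simp add: weight_nonneg_iff)
  also have "\<dots> \<longleftrightarrow> (\<forall>j\<in>vertical. vert_val j F \<ge> 0)"
  proof
    assume *: "\<forall>n. fls_nth F n \<noteq> 0 \<longrightarrow>
      (\<forall>p\<in>closed_points A0. \<forall>d\<in>slopes p. den d * v p (fls_nth F n) + num d * n \<ge> 0)"
    show "\<forall>j\<in>vertical. vert_val j F \<ge> 0"
    proof
      fix j assume j: "j \<in> vertical"
      obtain p d where pd: "j = (p, d)" by (cases j)
      then have "p \<in> closed_points A0" "d \<in> slopes p" using j by (auto simp: vertical_def)
      then show "vert_val j F \<ge> 0" using * vert_val_ge_iff[of p d F 0] j F pd by blast
    qed
  next
    assume *: "\<forall>j\<in>vertical. vert_val j F \<ge> 0"
    show "\<forall>n. fls_nth F n \<noteq> 0 \<longrightarrow>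
      (\<forall>p\<in>closed_points A0. \<forall>d\<in>slopes p. den d * v p (fls_nth F n) + num d * n \<ge> 0)"
    proof (intro allI impI ballI)
      fix n p d assume "fls_nth F n \<noteq> 0" "p \<in> closed_points A0" "d \<in> slopes p"
      moreover from this have j: "(p, d) \<in> vertical" by (auto simp: vertical_def)
      ultimately show "den d * v p (fls_nth F n) + num d * n \<ge> 0"
        using * vert_val_ge_iff[OF j F, of 0] by blast
    qed
  qed
  finally show ?thesis .
qed

lemma A_laurent: "A \<subseteq> laurent_polys"
  by (auto simp: DPD_algebra_def laurent_polys_def)

lemma zero_A: "0 \<in> A"
  by (auto simp: DPD_algebra_def)

lemma monom_A_iff:
  assumes "f \<noteq> 0"
  shows "fls_monom f n \<in> A \<longleftrightarrow> (\<forall>p\<in>closed_points A0. \<forall>d\<in>slopes p. den d * v p f + num d * n \<ge> 0)"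
  using mem_A_iff_vert_val[OF fls_monom_laurent, of f n] assms vert_val_monom
  by (auto simp: vertical_def)

lemma monom_0_A: "f \<in> A0 \<Longrightarrow> fls_monom f 0 \<in> A"
  using valuation_at_nonneg zero_A fls_monom_eq_0_iff[of "0 :: 'k" 0]
  by (cases "f = 0") (auto simp: monom_A_iff simp del: fls_monom_eq_0_iff)

text \<open>Closure under products is multiplicativity of the monomial valuations; no product of
  graded pieces has to be examined.\<close>

lemma field_subring_A: "field_subring A"
proof
  show "1 \<in> A" using monom_0_A[OF one_closed] by simp
  fix F G assume FG: "F \<in> A" "G \<in> A"
  then have L: "F \<in> laurent_polys" "G \<in> laurent_polys" using A_laurent by auto
  have val: "valuation_on laurent_polys (vert_val j)" if "j \<in> vertical" for j
    using valuation_on_subset[OF valuation_vert_val[OF that] laurent.subset_fraction_set] .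
  have nonneg: "vert_val j F \<ge> 0" if "j \<in> vertical" "F \<in> A" "F \<noteq> 0" for j F
    using mem_A_iff_vert_val[of F] that A_laurent by auto
  show "F * G \<in> A"
  proof (cases "F = 0 \<or> G = 0")
    case False
    have "vert_val j (F * G) \<ge> 0" if j: "j \<in> vertical" for j
      using valuation_on_mult[OF val[OF j] L] False nonneg[OF j] FG by simp
    then show ?thesis using mem_A_iff_vert_val[OF laurent.mult_closed[OF L]] False by simp
  qed (use zero_A in auto)
  show "F - G \<in> A"
  proof (cases "F - G = 0")
    case False
    have "vert_val j (F - G) \<ge> 0" if j: "j \<in> vertical" for j
    proof -
      have "vert_val j (\<Sum>b\<in>{True, False}. if b then F else - G) \<ge> 0"
        by (rule laurent.valuation_on_sum[OF val[OF j]])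
          (use L FG False nonneg[OF j] laurent.valuation_on_uminus[OF val[OF j]] laurent.uminus_closed in \<open>auto split: if_splits\<close>)
      then show ?thesis by simp
    qed
    then show ?thesis using mem_A_iff_vert_val[OF laurent.diff_closed[OF L]] False by simp
  qed (use zero_A in auto)
qed

sublocale A: field_subring A by (rule field_subring_A)

text \<open>Outside the special points and the zeros and poles of the finitely many coefficients,
  the slope is 0 and every coefficient has value 0.\<close>

lemma finite_vert_laurent:
  assumes "F \<in> laurent_polys" "F \<noteq> 0"
  shows "finite {j \<in> vertical. vert_val j F \<noteq> 0}"
proof -
  let ?P = "{p. slopes p \<noteq> {0}} \<union>
    (\<Union>i\<in>{i. fls_nth F i \<noteq> 0}. {p \<in> closed_points A0. v p (fls_nth F i) \<noteq> 0})"
  have "{j \<in> vertical. vert_val j F \<noteq> 0} \<subseteq> (SIGMA p:?P. slopes p)"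
  proof
    fix j assume "j \<in> {j \<in> vertical. vert_val j F \<noteq> 0}"
    then obtain p d where j: "j = (p, d)" "(p, d) \<in> vertical" "vert_val (p, d) F \<noteq> 0" by (cases j) auto
    have p: "p \<in> closed_points A0" "d \<in> slopes p" using j by (auto simp: vertical_def)
    have "p \<in> ?P"
    proof (rule ccontr)
      assume np: "p \<notin> ?P"
      then have "d = 0" using p by auto
      obtain i where "fls_nth F i \<noteq> 0" "gauss_val p (den d) (num d) F = den d * v p (fls_nth F i) + num d * i"
        using gauss_val_attained[OF assms] by blast
      then show False using np p(1) \<open>d = 0\<close> j(3) vert_val_laurent[OF j(2) assms] by auto
    qed
    then show "j \<in> (SIGMA p:?P. slopes p)" using j p by auto
  qed
  moreover have "finite (SIGMA p:?P. slopes p)"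
    using finite_special laurent_polys_finite[OF assms(1)] finite_valuation_nonzero
    by (intro finite_SigmaI finite_UnI finite_UN_I) auto
  ultimately show ?thesis using finite_subset by blast
qed

lemma exists_with_lower_bounds:
  assumes "finite {q \<in> closed_points A0. E q > 0}"
  shows "\<exists>f. f \<noteq> 0 \<and> (\<forall>q\<in>closed_points A0. v q f \<ge> E q)"
proof (cases "closed_points A0 = {}")
  case False
  then obtain p where p: "p \<in> closed_points A0" by auto
  obtain f where "f \<noteq> 0" "v p f = E p" "\<forall>q\<in>closed_points A0 - {p}. E q \<le> v q f"
    using exists_with_valuation[OF p assms, of "E p"] by blast
  then have "f \<noteq> 0 \<and> (\<forall>q\<in>closed_points A0. v q f \<ge> E q)" by (metis Diff_iff order_refl singletonD)
  then show ?thesis by blast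
qed (auto intro: exI[of _ 1])

text \<open>A function on the curve with zeros of high enough order at the finitely many points
  concerned multiplies \<open>F\<close> into \<open>A\<close>. Hence \<open>A\<close> has the
  fraction field \<open>K(u)\<close>.\<close>

lemma clear_denominators:
  assumes "F \<in> laurent_polys" "F \<noteq> 0"
  shows "\<exists>c. c \<noteq> 0 \<and> fls_monom c 0 \<in> A \<and> fls_monom c 0 * F \<in> A"
proof -
  \<comment> \<open>The sum of absolute values dominates the pole order for each slope over
    \<open>q\<close>, and it vanishes at almost all points.\<close>
  define E where "E q = (\<Sum>d\<in>slopes q. \<bar>vert_val (q, d) F\<bar>)" for q
  have "{q \<in> closed_points A0. E q > 0} \<subseteq> fst ` {j \<in> vertical. vert_val j F \<noteq> 0}"
  proof
    fix q assume q: "q \<in> {q \<in> closed_points A0. E q > 0}"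
    then obtain d where "d \<in> slopes q" "vert_val (q, d) F \<noteq> 0"
      unfolding E_def by (metis (mono_tags, lifting) abs_0 less_irrefl mem_Collect_eq sum.neutral)
    then show "q \<in> fst ` {j \<in> vertical. vert_val j F \<noteq> 0}"
      using q by (force simp: vertical_def)
  qed
  then have "finite {q \<in> closed_points A0. E q > 0}"
    using finite_vert_laurent[OF assms] finite_subset by blast
  then obtain c where c: "c \<noteq> 0" "\<And>q. q \<in> closed_points A0 \<Longrightarrow> v q c \<ge> E q"
    using exists_with_lower_bounds by metis
  have E: "E q \<ge> 0" "d \<in> slopes q \<Longrightarrow> E q \<ge> - vert_val (q, d) F" for q d
  proof -
    show "E q \<ge> 0" by (simp add: E_def sum_nonneg)
    assume "d \<in> slopes q"
    then have "\<bar>vert_val (q, d) F\<bar> \<le> E q" unfolding E_def by (intro member_le_sum) auto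
    then show "E q \<ge> - vert_val (q, d) F" by linarith
  qed
  have ge: "vert_val (q, d) (fls_monom c 0) \<ge> E q" if "(q, d) \<in> vertical" for q d
  proof -
    have "1 * v q c \<le> den d * v q c" using c(2)[of q] E(1)[of q] that den_pos[of d]
      by (intro mult_right_mono) (auto simp: vertical_def simp del: den_pos)
    then show ?thesis using vert_val_monom[OF that c(1), of 0] c(2)[of q] that by (auto simp: vertical_def)
  qed
  have "vert_val j (fls_monom c 0) \<ge> 0" if "j \<in> vertical" for j
    using ge[of "fst j" "snd j"] E(1)[of "fst j"] that by auto
  then have "fls_monom c 0 \<in> A" using mem_A_iff_vert_val[of "fls_monom c 0"] c by simp
  moreover have "vert_val j (fls_monom c 0 * F) \<ge> 0" if j: "j \<in> vertical" for j
  proof -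
    have "vert_val j (fls_monom c 0 * F) = vert_val j (fls_monom c 0) + vert_val j F"
      using laurent.subset_fraction_set assms c by (intro valuation_on_mult[OF valuation_vert_val[OF j]]) auto
    moreover have "snd j \<in> slopes (fst j)" using j by (auto simp: vertical_def)
    ultimately show ?thesis using ge[of "fst j" "snd j"] E(2)[of "snd j" "fst j"] j by simp
  qed
  then have "fls_monom c 0 * F \<in> A"
    using mem_A_iff_vert_val[OF laurent.mult_closed[OF fls_monom_laurent assms(1)], of c 0] c assms by simp
  ultimately show ?thesis using c by blast
qed

lemma fraction_set_A: "fraction_set A = fraction_set laurent_polys"
proof (intro equalityI subsetI)
  fix x :: "'k fls" assume "x \<in> fraction_set A"
  then show "x \<in> fraction_set laurent_polys"
    using A_laurent by (auto elim!: A.fraction_setE intro!: laurent.fraction_setI)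
next
  fix x :: "'k fls" assume "x \<in> fraction_set laurent_polys"
  then obtain F G where FG: "x = F / G" "F \<in> laurent_polys" "G \<in> laurent_polys"
    by (auto elim!: laurent.fraction_setE)
  have "F \<in> fraction_set A" if F: "F \<in> laurent_polys" for F :: "'k fls"
  proof (cases "F = 0")
    case False
    then obtain c where c: "c \<noteq> 0" "fls_monom c 0 \<in> A" "fls_monom c 0 * F \<in> A"
      using clear_denominators[OF F] by auto
    then have "F = (fls_monom c 0 * F) / fls_monom c 0" by simp
    then show ?thesis using A.fraction_setI[OF c(3,2)] c(1) by simp
  qed (use zero_A A.subset_fraction_set in auto)
  then show "x \<in> fraction_set A" using FG A.divide_fraction_set by blast
qed

lemma finite_vert:
  assumes x: "x \<in> fraction_set laurent_polys" "x \<noteq> 0"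
  shows "finite {j \<in> vertical. vert_val j x \<noteq> 0}"
proof -
  obtain F G where FG: "x = F / G" "F \<in> laurent_polys" "G \<in> laurent_polys" "G \<noteq> 0"
    using x(1) by (auto elim!: laurent.fraction_setE)
  have "F \<noteq> 0" using x FG by auto
  have "{j \<in> vertical. vert_val j x \<noteq> 0} \<subseteq>
      {j \<in> vertical. vert_val j F \<noteq> 0} \<union> {j \<in> vertical. vert_val j G \<noteq> 0}"
  proof safe
    fix p d assume j: "(p, d) \<in> vertical" "vert_val (p, d) x \<noteq> 0" "vert_val (p, d) G = 0" "vert_val (p, d) F = 0"
    have "F = x * G" using FG by simp
    then have "vert_val (p, d) F = vert_val (p, d) x + vert_val (p, d) G"
      using valuation_on_mult[OF valuation_vert_val[OF j(1)], of x G] x FG laurent.subset_fraction_set by auto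
    then show False using j by simp
  qed
  then show ?thesis using finite_vert_laurent FG \<open>F \<noteq> 0\<close> by (meson finite_UnI finite_subset)
qed

text \<open>The value of \<open>f\<close> at \<open>p\<close> is dictated by weight 0 for the slope
  \<open>d\<close>. For another slope \<open>d'\<close> over \<open>p\<close> the weight is then a
  positive multiple of \<open>k (d' - d)\<close>, nonnegative by assumption; at other points the
  order of \<open>f\<close> is chosen large enough.\<close>

lemma homogeneous_unit:
  assumes p: "p \<in> closed_points A0" "d \<in> slopes p"
    and k: "\<And>d'. d' \<in> slopes p \<Longrightarrow> of_int k * (d' - d) \<ge> 0"
  shows "\<exists>f. f \<noteq> 0 \<and> v p f = - k * num d \<and> fls_monom f (k * den d) \<in> A"
proof -
  define n where "n = k * den d"
  define E where "E q = (\<Sum>d\<in>slopes q. \<bar>num d * n\<bar>)" for q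
  have "{q \<in> closed_points A0. E q > 0} \<subseteq> {p. slopes p \<noteq> {0}}" by (auto simp: E_def)
  then have "finite {q \<in> closed_points A0. E q > 0}" using finite_special finite_subset by blast
  then obtain f where f: "f \<noteq> 0" "v p f = - k * num d" "\<And>q. q \<in> closed_points A0 - {p} \<Longrightarrow> v q f \<ge> E q"
    using exists_with_valuation[OF p(1), of E "- k * num d"] by blast
  have "den d' * v q f + num d' * n \<ge> 0" if q: "q \<in> closed_points A0" "d' \<in> slopes q" for q d'
  proof (cases "q = p")
    case True
    have "of_int (v p f) + of_int n * d' = of_int (den d) * (of_int k * (d' - d))"
      using of_int_num[of d] by (simp add: f(2) n_def algebra_simps)
    then show ?thesis
      unfolding weight_nonneg_iff True using k[of d'] q True by simp
  next
    case False
    have "\<bar>num d' * n\<bar> \<le> E q" unfolding E_def using q by (intro member_le_sum) auto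
    then have "v q f \<ge> \<bar>num d' * n\<bar>" using f(3)[of q] q False by auto
    moreover have "1 * v q f \<le> den d' * v q f"
      using calculation den_pos[of d'] by (intro mult_right_mono) (auto simp del: den_pos)
    ultimately show ?thesis by linarith
  qed
  then have "fls_monom f n \<in> A" using monom_A_iff[OF f(1)] by simp
  then show ?thesis using f unfolding n_def by blast
qed

text \<open>Over different points a function on the curve separates. Over the same point the two
  slopes are separated by a homogeneous element that is a unit for \<open>d\<close>; its weight for
  \<open>d'\<close> has the sign of the degree times \<open>d' - d\<close>.\<close>

lemma separate_vertical:
  assumes j: "j \<in> vertical" "j' \<in> vertical" "j \<noteq> j'"
  shows "\<exists>s\<in>A - {0}. vert_val j s = 0 \<and> vert_val j' s > 0"
proof -
  obtain p d q d' where pd: "j = (p, d)" "j' = (q, d')" by (cases j; cases j')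
  have p: "p \<in> closed_points A0" "d \<in> slopes p" "q \<in> closed_points A0" "d' \<in> slopes q"
    using j pd by (auto simp: vertical_def)
  show ?thesis
  proof (cases "p = q")
    case False
    then obtain s where s: "s \<in> A0 - {0}" "v p s = 0" "v q s > 0"
      using C.separated[OF p(1,3)] by auto
    show ?thesis
      by (rule bexI[of _ "fls_monom s 0"])
        (use s pd vert_val_monom j monom_0_A in \<open>auto simp: zero_less_mult_iff\<close>)
  next
    case True
    then have "d \<noteq> d'" using j pd by auto
    then have slopes: "slopes p = {d, d'}" using p True by (auto simp: slopes_def)
    \<comment> \<open>The sign of the degree is chosen so that the weight for \<open>d'\<close>
      becomes positive.\<close>
    define k :: int where "k = (if d < d' then 1 else - 1)"
    have "of_int k * (d'' - d) \<ge> 0" if "d'' \<in> slopes p" for d''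
      using that slopes \<open>d \<noteq> d'\<close> by (auto simp: k_def)
    then obtain f where f: "f \<noteq> 0" "v p f = - k * num d" "fls_monom f (k * den d) \<in> A"
      using homogeneous_unit[OF p(1,2)] by blast
    have "of_int (v p f) + of_int (k * den d) * d' = of_int (den d) * (of_int k * (d' - d))"
      using of_int_num[of d] by (simp add: f(2) algebra_simps)
    also have "\<dots> > 0" using \<open>d \<noteq> d'\<close> by (cases "d < d'") (auto simp: k_def)
    finally have "vert_val j' (fls_monom f (k * den d)) > 0"
      using vert_val_monom[of q d' f] f(1) pd j True weight_pos_iff by simp
    moreover have "vert_val j (fls_monom f (k * den d)) = 0"
      using vert_val_monom[of p d f] f pd j by simp
    ultimately show ?thesis using f by (intro bexI[of _ "fls_monom f (k * den d)"]) auto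
  qed
qed

text \<open>A uniformizer has value \<open>den d\<close> and \<open>u\<close> has value
  \<open>num d\<close>; these are coprime, so every integer is a combination of them. In particular
  the valuations are normalized.\<close>

lemma exists_monom_with_vert_val:
  assumes "(p, d) \<in> vertical"
  shows "\<exists>f n. f \<noteq> 0 \<and> vert_val (p, d) (fls_monom f n) = r"
proof -
  have p: "p \<in> closed_points A0" using assms by (auto simp: vertical_def)
  obtain a b where "a * num d + b * den d = gcd (num d) (den d)" using bezout_int by blast
  then have ab: "a * num d + b * den d = 1" using num_den_coprime[of d] by simp
  obtain t where t: "t \<noteq> 0" "v p t = 1" using valuation_at_normalized[OF p] by auto
  have "vert_val (p, d) (fls_monom (t powi (b * r)) (a * r)) = den d * (b * r) + num d * (a * r)"
    using vert_val_monom[OF assms, of "t powi (b * r)" "a * r"] v_power_int[OF p t(1)] t by simp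
  also have "\<dots> = (a * num d + b * den d) * r" by (simp add: algebra_simps)
  finally show ?thesis using ab t(1) by (intro exI[of _ "t powi (b * r)"] exI[of _ "a * r"]) simp
qed

definition J :: "('k set \<times> rat + 'k poly) set" where
  "J = Inl ` vertical \<union> Inr ` horizontal"

definition val :: "'k set \<times> rat + 'k poly \<Rightarrow> 'k fls \<Rightarrow> int" where
  "val = case_sum vert_val poly_val"

lemma val_simps [simp]: "val (Inl j) = vert_val j" "val (Inr g) = poly_val g"
  by (simp_all add: val_def)

lemma in_fraction_set_laurent: "F \<in> laurent_polys \<Longrightarrow> F \<in> fraction_set laurent_polys"
  using laurent.subset_fraction_set by auto

lemma horizontal_monic: "g \<in> horizontal \<Longrightarrow> g \<in> monic_irreducibles" "g \<in> horizontal \<Longrightarrow> g \<noteq> 0"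
  by (auto simp: horizontal_def monic_irreducibles_def)

lemma poly_val_mult:
  "g \<in> horizontal \<Longrightarrow> x \<in> fraction_set laurent_polys \<Longrightarrow> y \<in> fraction_set laurent_polys \<Longrightarrow>
    x \<noteq> 0 \<Longrightarrow> y \<noteq> 0 \<Longrightarrow> poly_val g (x * y) = poly_val g x + poly_val g y"
  using valuation_on_mult[OF valuation_poly_val[OF horizontal_monic(1)]] .

lemma vert_val_mult:
  "j \<in> vertical \<Longrightarrow> x \<in> fraction_set laurent_polys \<Longrightarrow> y \<in> fraction_set laurent_polys \<Longrightarrow>
    x \<noteq> 0 \<Longrightarrow> y \<noteq> 0 \<Longrightarrow> vert_val j (x * y) = vert_val j x + vert_val j y"
  using valuation_on_mult[OF valuation_vert_val] .

text \<open>Multiply the polynomial \<open>g\<close> by a monomial to obtain value 0 at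
  \<open>j\<close>; monomials do not change the value at \<open>g\<close>. The product may have
  poles along finitely many other vertical primes.\<close>

lemma separate_vertical_horizontal:
  assumes j: "j \<in> vertical" and g: "g \<in> horizontal"
  shows "\<exists>s\<in>A - {0}. vert_val j s = 0 \<and> poly_val g s > 0"
proof -
  obtain f n where f: "f \<noteq> 0" "vert_val j (fls_monom f n) = - vert_val j (fls_of_poly g)"
    using exists_monom_with_vert_val[of "fst j" "snd j"] j by force
  define F where "F = fls_of_poly g * fls_monom f n"
  have F: "F \<in> laurent_polys" "F \<noteq> 0" unfolding F_def using horizontal_monic(2)[OF g] f by (auto intro!: laurent.mult_closed)
  have Fj: "vert_val j F = 0"
    unfolding F_def using f horizontal_monic(2)[OF g]
    by (subst vert_val_mult[OF j]) (auto intro: in_fraction_set_laurent)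
  have Fg: "poly_val g F = 1"
    unfolding F_def using f horizontal_monic[OF g] poly_val_self[of g] poly_val_monom[OF g f(1)]
    by (subst poly_val_mult[OF g]) (auto intro: in_fraction_set_laurent)
  \<comment> \<open>The poles of \<open>F\<close>, to be cancelled by an element of \<open>A\<close>
    that has value 0 at \<open>j\<close>.\<close>
  define T where "T = {k \<in> vertical. vert_val k F < 0}"
  have T: "finite T" "j \<notin> T" "T \<subseteq> vertical"
    using finite_vert_laurent[OF F] Fj by (auto simp: T_def elim!: rev_finite_subset)
  have "valuation_on A (vert_val k)" if "k \<in> insert j T" for k
    using valuation_on_subset[OF valuation_vert_val, of k A] that j T A_laurent in_fraction_set_laurent by blast
  moreover have "vert_val k x \<ge> 0" if "k \<in> vertical" "x \<in> A - {0}" for k x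
    using mem_A_iff_vert_val[of x] that A_laurent by auto
  ultimately obtain s where s: "s \<in> A - {0}" "vert_val j s = 0" "\<And>k. k \<in> T \<Longrightarrow> vert_val k s \<ge> - vert_val k F"
    using A.approximation[of j T vert_val "\<lambda>k. - vert_val k F"] separate_vertical[OF j] T by blast
  have sL: "s \<in> laurent_polys" using s A_laurent by auto
  have nn: "vert_val k s \<ge> 0" if "k \<in> vertical" for k
    using mem_A_iff_vert_val[of s] that s sL by auto
  have "vert_val k (s * F) \<ge> 0" if k: "k \<in> vertical" for k
    using vert_val_mult[OF k in_fraction_set_laurent[OF sL] in_fraction_set_laurent[OF F(1)]]
      s(1) F(2) s(3)[of k] nn[OF k] k
    by (cases "k \<in> T") (simp, simp add: T_def)
  then have "s * F \<in> A" using mem_A_iff_vert_val[OF laurent.mult_closed[OF sL F(1)]] F s by simp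
  moreover have "vert_val j (s * F) = 0"
    using vert_val_mult[OF j in_fraction_set_laurent[OF sL] in_fraction_set_laurent[OF F(1)]] s F Fj
    by simp
  moreover have "poly_val g (s * F) > 0"
    using poly_val_mult[OF g in_fraction_set_laurent[OF sL] in_fraction_set_laurent[OF F(1)]] s F Fg
      poly_val_laurent_nonneg[OF g sL] by simp
  ultimately show ?thesis using s F by (intro bexI[of _ "s * F"]) auto
qed

text \<open>Two separations remain. A nonzero function vanishing at a point is a unit for every
  horizontal valuation, and a polynomial from \<open>horizontal\<close> is a unit for every other
  one; a constant factor brings it into \<open>A\<close>.\<close>

sublocale K: krull_family A J val
proof
  note FL = fraction_set_A
  fix j assume j: "j \<in> J"
  show "valuation_on (fraction_set A) (val j)"
    using j valuation_vert_val valuation_poly_val[OF horizontal_monic(1)] by (auto simp: J_def FL)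
  show "\<exists>t\<in>fraction_set A - {0}. val j t = 1"
  proof (cases j)
    case (Inl pd)
    then obtain f n where "f \<noteq> 0" "vert_val pd (fls_monom f n) = 1"
      using j exists_monom_with_vert_val[of "fst pd" "snd pd" 1] by (auto simp: J_def)
    then show ?thesis using Inl
      by (intro bexI[of _ "fls_monom f n"]) (auto simp: FL intro: in_fraction_set_laurent)
  next
    case (Inr g)
    then show ?thesis using j horizontal_monic[of g] poly_val_self[of g]
      by (intro bexI[of _ "fls_of_poly g"]) (auto simp: FL J_def intro: in_fraction_set_laurent)
  qed
  fix j' assume j': "j' \<in> J" "j \<noteq> j'"
  show "\<exists>s\<in>A - {0}. val j s = 0 \<and> val j' s > 0"
  proof (cases j)
    case jl: (Inl pd)
    show ?thesis
    proof (cases j')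
      case (Inl pd')
      then show ?thesis using separate_vertical[of pd pd'] j j' jl by (auto simp: J_def)
    next
      case (Inr g)
      then show ?thesis using separate_vertical_horizontal[of pd g] j j' jl by (auto simp: J_def)
    qed
  next
    case jr: (Inr g)
    then have g: "g \<in> horizontal" using j by (auto simp: J_def)
    show ?thesis
    proof (cases j')
      case (Inl pd)
      then have pd: "pd \<in> vertical" "fst pd \<in> closed_points A0" using j' by (auto simp: J_def vertical_def)
      obtain s where s: "s \<in> A0 - {0}" "v (fst pd) s > 0"
      proof -
        obtain s where "s \<in> fst pd" "s \<noteq> 0"
          using C.center_nonzero[OF pd(2)] center_eq[OF pd(2)]
            idealD(2)[OF primeidealD(1)[OF closed_point_primeideal[OF pd(2)]]] by auto
        moreover from this have "s \<in> A0" using closed_point_subset[OF pd(2)] by auto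
        ultimately show ?thesis using that vge_1_iff[OF pd(2), of s] by (auto simp: vge_def)
      qed
      then have "vert_val pd (fls_monom s 0) > 0"
        using vert_val_monom[of "fst pd" "snd pd" s 0] pd by (simp add: zero_less_mult_iff)
      then show ?thesis using s jr Inl poly_val_monom[OF g] monom_0_A
        by (intro bexI[of _ "fls_monom s 0"]) auto
    next
      case (Inr h)
      then have h: "h \<in> horizontal" "h \<noteq> g" using j' jr by (auto simp: J_def)
      note hm = horizontal_monic[OF h(1)] and gm = horizontal_monic[OF g]
      obtain c where c: "c \<noteq> 0" "fls_monom c 0 \<in> A" "fls_monom c 0 * fls_of_poly h \<in> A"
        using clear_denominators[of "fls_of_poly h"] hm by auto
      have "poly_val g (fls_of_poly h) = 0"
        using poly_val_pos_iff[OF gm(1) hm(2)] poly_val_of_poly_nonneg[OF gm(1) hm(2)]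
          monic_irreducible_dvd_eq[OF gm(1) hm(1)] h(2) by auto
      moreover have "poly_val k (fls_monom c 0 * fls_of_poly h) = poly_val k (fls_of_poly h)"
        if "k \<in> horizontal" for k
        using poly_val_mult[OF that, of "fls_monom c 0" "fls_of_poly h"] c hm
          poly_val_monom[OF that c(1)] in_fraction_set_laurent[OF fls_monom_laurent, of c 0]
          in_fraction_set_laurent[OF fls_of_poly_laurent, of h] by simp
      ultimately show ?thesis
        using c jr Inr poly_val_self[OF hm(1)] g h hm
        by (intro bexI[of _ "fls_monom c 0 * fls_of_poly h"]) auto
    qed
  qed
next
  fix x assume "x \<in> fraction_set A - {0}"
  then have x: "x \<in> fraction_set laurent_polys" "x \<noteq> 0" by (auto simp: fraction_set_A)
  have "{j \<in> J. val j x \<noteq> 0} = Inl ` {j \<in> vertical. vert_val j x \<noteq> 0} \<union>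
      Inr ` {g \<in> horizontal. poly_val g x \<noteq> 0}" by (auto simp: J_def)
  then show "finite {j \<in> J. val j x \<noteq> 0}"
    using finite_vert[OF x] finite_poly_val_nonzero[OF x] by simp
  show "x \<in> A \<longleftrightarrow> (\<forall>j\<in>J. val j x \<ge> 0)"
  proof
    assume xA: "x \<in> A"
    then have "x \<in> laurent_polys" using A_laurent by auto
    then show "\<forall>j\<in>J. val j x \<ge> 0"
      using poly_val_laurent_nonneg x(2) xA mem_A_iff_vert_val[of x] by (auto simp: J_def)
  next
    assume *: "\<forall>j\<in>J. val j x \<ge> 0"
    have "poly_val g x \<ge> 0" if "g \<in> horizontal" for g
      using *[rule_format, of "Inr g"] that by (simp add: J_def)
    then have "x \<in> laurent_polys" by (rule laurent_if_poly_val_nonneg[OF x])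
    moreover have "vert_val j x \<ge> 0" if "j \<in> vertical" for j
      using *[rule_format, of "Inl j"] that by (simp add: J_def)
    ultimately show "x \<in> A" using mem_A_iff_vert_val[of x] x(2) by blast
  qed
qed

end

section \<open>Orbits in the fibers\<close>

lemma fls_monom_diff: "fls_monom (f - g) n = fls_monom f n - fls_monom g n"
  by (rule fls_eqI) auto

lemma fls_monom_0 [simp]: "fls_monom 0 n = 0"
  by simp

text \<open>The torus acts on \<open>zeta\<close> through a nonzero power of its parameter;
  surjectivity of this power gives transitivity on the points of an orbit.\<close>

lemma exists_complex_power_int_root:
  assumes "z \<noteq> 0" "n \<noteq> 0"
  shows "\<exists>l::complex. l \<noteq> 0 \<and> l powi n = z"
proof -
  have *: "\<exists>l::complex. l \<noteq> 0 \<and> l ^ k = z" if "k > 0" "z \<noteq> 0" for z k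
  proof -
    have "\<exists>l. l ^ k = z" using that(1) by (rule nth_root_exists)
    then obtain l where "l ^ k = z" by blast
    then show ?thesis using that by (intro exI[of _ l]) (auto simp: zero_power)
  qed
  show ?thesis
  proof (cases "n > 0")
    case True
    then show ?thesis using *[of "nat n" z] assms by (auto simp: power_int_def)
  next
    case False
    then obtain l where "l \<noteq> 0" "l ^ nat (- n) = inverse z" using *[of "nat (- n)" "inverse z"] assms by auto
    then show ?thesis using False assms(2)
      by (intro exI[of _ l]) (auto simp: power_int_def power_inverse)
  qed
qed

section \<open>The torus action on the graded algebra\<close>

context dpd_surface
begin

lemma complex_scalars_const: "complex_scalars (\<lambda>c. fls_monom (\<iota> c) 0)"
  by unfold_locales
    (auto intro!: ring_hom_memI fls_eqI simp: ring_of_type_algebra_def hom_mult hom_add fls_monom_mult)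

sublocale S: complex_subalgebra "\<lambda>c. fls_monom (\<iota> c) 0" A
proof -
  interpret S: complex_scalars "\<lambda>c. fls_monom (\<iota> c) 0" by (rule complex_scalars_const)
  show "complex_subalgebra (\<lambda>c. fls_monom (\<iota> c) 0) A"
    by unfold_locales (auto simp: scalar_closed monom_0_A)
qed

lemma A_coeff_monom: "F \<in> A \<Longrightarrow> fls_monom (fls_nth F i) i \<in> A"
  by (auto simp: DPD_algebra_def)

lemma vertical_mem_J: "p \<in> closed_points A0 \<Longrightarrow> d \<in> slopes p \<Longrightarrow> Inl (p, d) \<in> J"
  by (auto simp: J_def vertical_def)

text \<open>The vertical primes are homogeneous ideals: being a minimum, the value is positive iff
  it is so for each coefficient.\<close>

lemma vertical_center_coeff:
  assumes "(p, d) \<in> vertical" "F \<in> A"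
  shows "F \<in> K.center (Inl (p, d)) \<longleftrightarrow>
    (\<forall>i. fls_nth F i \<noteq> 0 \<longrightarrow> den d * v p (fls_nth F i) + num d * i > 0)"
proof (cases "F = 0")
  case False
  then show ?thesis
    using assms A_laurent vert_val_ge_iff[OF assms(1), of F 1]
    by (auto simp: K.center_def int_one_le_iff_zero_less)
qed (use assms in \<open>auto simp: K.center_def\<close>)

lemma contraction_const: "contraction A0 M = {f \<in> A0. fls_monom f 0 \<in> M}"
  by (simp add: contraction_def fls_const_eq_monom)

lemma homogeneous_part_eq: "homogeneous_part A0 Dp Dm n = {fls_monom f n | f. fls_monom f n \<in> A}"
proof -
  have "f \<in> graded_coeffs A0 Dp Dm n \<longleftrightarrow> fls_monom f n \<in> A" for f
  proof
    assume "fls_monom f n \<in> A"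
    then have "fls_nth (fls_monom f n) n \<in> graded_coeffs A0 Dp Dm n" unfolding DPD_algebra_def by blast
    then show "f \<in> graded_coeffs A0 Dp Dm n" by simp
  next
    assume "f \<in> graded_coeffs A0 Dp Dm n"
    then show "fls_monom f n \<in> A"
      using fls_monom_laurent[of f n] by (auto simp: DPD_algebra_def laurent_polys_def)
  qed
  then show ?thesis by (auto simp: homogeneous_part_def fls_monom_def)
qed

text \<open>The automorphism of \<open>A\<close> that induces \<open>torus_act\<close> on ideals
  when \<open>l \<noteq> 0\<close>. As a finite sum it is a Laurent polynomial by
  construction.\<close>

definition torus_map :: "complex \<Rightarrow> 'k fls \<Rightarrow> 'k fls" where
  "torus_map l F = (\<Sum>i\<in>{i. fls_nth F i \<noteq> 0}. fls_monom (\<iota> l powi i * fls_nth F i) i)"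

lemma fls_nth_sum: "fls_nth (sum f I) n = (\<Sum>i\<in>I. fls_nth (f i) n)"
  by (induction I rule: infinite_finite_induct) auto

lemma torus_map_nth:
  "F \<in> laurent_polys \<Longrightarrow> fls_nth (torus_map l F) n = \<iota> l powi n * fls_nth F n"
  by (simp add: torus_map_def fls_nth_sum sum.delta laurent_polys_finite)

lemma torus_map_laurent: "torus_map l F \<in> laurent_polys"
  unfolding torus_map_def by (intro laurent.sum_closed) auto

lemma v_torus: "p \<in> closed_points A0 \<Longrightarrow> l \<noteq> 0 \<Longrightarrow> f \<noteq> 0 \<Longrightarrow> v p (\<iota> l powi n * f) = v p f"
  using v_mult[of p "\<iota> l powi n" f] v_power_int[of p "\<iota> l" n] v_scalar[of p l] by simp

lemma torus_map_A:
  assumes "F \<in> A" "l \<noteq> 0"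
  shows "torus_map l F \<in> A"
  unfolding torus_map_def
proof (rule A.sum_closed)
  fix i assume i: "i \<in> {i. fls_nth F i \<noteq> 0}"
  then have "fls_monom (fls_nth F i) i \<in> A" using A_coeff_monom assms by blast
  then show "fls_monom (\<iota> l powi i * fls_nth F i) i \<in> A"
    using i assms(2) monom_A_iff[of "fls_nth F i" i] monom_A_iff[of "\<iota> l powi i * fls_nth F i" i]
    by (auto simp: v_torus)
qed

lemma torus_map_mult:
  assumes "F \<in> laurent_polys" "G \<in> laurent_polys" "l \<noteq> 0"
  shows "torus_map l (F * G) = torus_map l F * torus_map l G"
proof (rule fls_eqI)
  fix n
  have supp: "{i. fls_nth (torus_map l F) i \<noteq> 0} = {i. fls_nth F i \<noteq> 0}"
    using assms by (auto simp: torus_map_nth)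
  have "\<iota> l powi n * (fls_nth F i * fls_nth G (n - i)) =
      (\<iota> l powi i * fls_nth F i) * (\<iota> l powi (n - i) * fls_nth G (n - i))" for i
  proof -
    have "\<iota> l powi n = \<iota> l powi i * \<iota> l powi (n - i)"
      using assms(3) by (simp flip: power_int_add)
    then show ?thesis by simp
  qed
  then show "fls_nth (torus_map l (F * G)) n = fls_nth (torus_map l F * torus_map l G) n"
    unfolding torus_map_nth[OF laurent.mult_closed[OF assms(1,2)]] laurent_times_nth[OF assms(1)]
      laurent_times_nth[OF torus_map_laurent] supp
    by (simp only: sum_distrib_left torus_map_nth[OF assms(1)] torus_map_nth[OF assms(2)])
qed

lemma torus_map_diff:
  assumes "F \<in> laurent_polys" "G \<in> laurent_polys"
  shows "torus_map l (F - G) = torus_map l F - torus_map l G"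
  by (rule fls_eqI)
    (use assms laurent.diff_closed[OF assms] in \<open>simp add: torus_map_nth right_diff_distrib\<close>)

lemma torus_map_inverse:
  assumes "F \<in> laurent_polys" "l \<noteq> 0"
  shows "torus_map l (torus_map (inverse l) F) = F"
proof (rule fls_eqI)
  fix n
  have "\<iota> l powi n * \<iota> (inverse l) powi n = 1"
    using assms(2) by (simp add: power_int_mult_distrib[symmetric] hom_mult[symmetric])
  then show "fls_nth (torus_map l (torus_map (inverse l) F)) n = fls_nth F n"
    using assms by (simp add: torus_map_nth torus_map_laurent flip: mult.assoc)
qed

lemma torus_map_power:
  assumes "F \<in> laurent_polys" "l \<noteq> 0"
  shows "torus_map l (F ^ n) = torus_map l F ^ n"
proof (induction n)
  case 0
  show ?case
    by (rule fls_eqI) (auto simp: torus_map_nth[OF laurent.one_closed])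
next
  case (Suc n)
  then show ?case using torus_map_mult[OF assms(1) laurent.power_closed[OF assms(1)] assms(2)] by simp
qed

lemma torus_act_eq: "M \<subseteq> A \<Longrightarrow> l \<noteq> 0 \<Longrightarrow> torus_act \<iota> A l M = torus_map l ` M"
proof (intro equalityI subsetI)
  fix F assume M: "M \<subseteq> A" "l \<noteq> 0" "F \<in> torus_act \<iota> A l M"
  then obtain G where G: "G \<in> M" "\<And>n. fls_nth F n = \<iota> l powi n * fls_nth G n"
    by (auto simp: torus_act_def)
  then have "F = torus_map l G" using M A_laurent by (intro fls_eqI) (auto simp: torus_map_nth)
  then show "F \<in> torus_map l ` M" using G by blast
next
  fix F assume M: "M \<subseteq> A" "l \<noteq> 0" "F \<in> torus_map l ` M"
  then obtain G where G: "G \<in> M" "F = torus_map l G" by blast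
  then have "F \<in> A" "\<And>n. fls_nth F n = \<iota> l powi n * fls_nth G n"
    using torus_map_A[of G l] M A_laurent by (auto intro: torus_map_nth)
  then show "F \<in> torus_act \<iota> A l M" using G(1) unfolding torus_act_def by blast
qed

end

text \<open>\<open>zeta\<close> is homogeneous of the smallest degree with sign \<open>\<sigma>\<close> in which \<open>A\<close> has elements not
  in the prime \<open>P\<close> of slope \<open>d\<close>, and \<open>A / P\<close> becomes \<open>\<complex>[zeta, 1/zeta]\<close> after inverting \<open>zeta\<close>. The points of
  the fiber where \<open>zeta\<close> does not vanish are therefore the \<open>point z\<close>, given by \<open>zeta = z\<close>.\<close>

locale orbit_chart = dpd_surface +
  fixes p :: "'a set" and d :: rat and \<sigma> :: int and c :: 'a
  assumes p: "p \<in> closed_points A0" and d: "d \<in> slopes p" and sign: "\<sigma> = 1 \<or> \<sigma> = - 1"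
    and c0: "c \<noteq> 0" and vc: "v p c = - \<sigma> * num d" and zeta_closed: "fls_monom c (\<sigma> * den d) \<in> A"
begin

definition zeta :: "'a fls" where "zeta = fls_monom c (\<sigma> * den d)"

abbreviation P :: "'a fls set" where "P \<equiv> K.center (Inl (p, d))"

lemma sign_sq: "\<sigma> * \<sigma> = 1" "\<sigma> * (\<sigma> * k) = k"
  using sign by auto

lemma pd: "(p, d) \<in> vertical"
  using p d by (auto simp: vertical_def)

lemma zeta_A: "zeta \<in> A"
  using zeta_closed by (simp add: zeta_def)

lemma zeta_power: "zeta ^ n = fls_monom (c ^ n) (\<sigma> * int n * den d)"
  by (simp add: zeta_def fls_monom_power algebra_simps)

lemma prime_P: "primeideal P (subring_of_field A)"
  using K.center_prime[OF vertical_mem_J[OF p d]] .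

lemmas ideal_P = A.idealD[OF A.primeidealD(1)[OF prime_P]]

text \<open>The powers of \<open>zeta\<close> lie in distinct degrees, since \<open>\<sigma>\<close>
  and \<open>den d\<close> are nonzero; nothing can cancel.\<close>

lemma heval_zeta_nth:
  "fls_nth (S.heval \<rho> zeta) (\<sigma> * int n * den d) = \<iota> (coeff \<rho> n) * c ^ n"
proof -
  have "\<sigma> \<noteq> 0" using sign by auto
  have "S.heval \<rho> zeta = (\<Sum>i\<le>degree \<rho>. fls_monom (\<iota> (coeff \<rho> i) * c ^ i) (\<sigma> * int i * den d))"
  proof -
    have "\<rho> = (\<Sum>i\<le>degree \<rho>. monom (coeff \<rho> i) i)" by (rule poly_as_sum_of_monoms[symmetric])
    then have "S.heval \<rho> zeta = S.heval (\<Sum>i\<le>degree \<rho>. monom (coeff \<rho> i) i) zeta" by simp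
    then show ?thesis by (simp add: S.heval_sum S.heval_monom zeta_power fls_monom_mult)
  qed
  then show ?thesis using \<open>\<sigma> \<noteq> 0\<close> by (simp add: fls_nth_sum coeff_eq_0)
qed

text \<open>\<open>zeta\<close> is transcendental over the scalars modulo \<open>P\<close>: each
  nonzero term of the polynomial has weight exactly 0, whereas elements of \<open>P\<close> have
  positive weight in every degree.\<close>

lemma heval_zeta_in_P: "S.heval \<rho> zeta \<in> P \<longleftrightarrow> \<rho> = 0"
proof
  assume *: "S.heval \<rho> zeta \<in> P"
  show "\<rho> = 0"
  proof (rule ccontr)
    assume "\<rho> \<noteq> 0"
    define n where "n = degree \<rho>"
    have nz: "coeff \<rho> n \<noteq> 0" using \<open>\<rho> \<noteq> 0\<close> by (simp add: n_def)
    then have "v p (\<iota> (coeff \<rho> n) * c ^ n) = int n * v p c"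
      using v_mult[OF p] v_scalar[OF p] v_power[OF p] c0 by simp
    moreover have "den d * v p (\<iota> (coeff \<rho> n) * c ^ n) + num d * (\<sigma> * int n * den d) > 0"
    proof -
      have "S.heval \<rho> zeta \<in> A" using * ideal_P(1) by blast
      moreover have "fls_nth (S.heval \<rho> zeta) (\<sigma> * int n * den d) \<noteq> 0"
        using nz c0 by (simp add: heval_zeta_nth)
      ultimately show ?thesis
        using vertical_center_coeff[OF pd, of "S.heval \<rho> zeta"] * heval_zeta_nth[of \<rho> n] by metis
    qed
    ultimately show False using vc by (simp add: algebra_simps)
  qed
qed (simp add: ideal_P(2))

text \<open>After inverting \<open>zeta\<close> modulo \<open>P\<close>, the element
  \<open>F\<close> equals the polynomial in \<open>zeta\<close> divided by \<open>zeta ^ N\<close>.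
  The denominator is not normalized, so \<open>N\<close> may be enlarged freely.\<close>

definition rep :: "'a fls \<Rightarrow> nat \<Rightarrow> complex poly \<Rightarrow> bool" where
  "rep F N \<rho> \<longleftrightarrow> zeta ^ N * F - S.heval \<rho> zeta \<in> P"

lemma rep_0: "F \<in> P \<Longrightarrow> rep F 0 0"
  by (simp add: rep_def)

lemma rep_zeta: "rep zeta 0 [:0, 1:]"
  by (simp add: rep_def S.heval_pCons ideal_P(2))

lemma rep_1: "rep 1 0 1"
  by (simp add: rep_def ideal_P(2))

lemma rep_mult_zeta:
  assumes "rep F N \<rho>" shows "rep F (N + k) ([:0, 1:] ^ k * \<rho>)"
proof -
  have "S.heval ([:0, 1:] ^ k) zeta = zeta ^ k"
    using S.heval_monom[of 1 k zeta] by (simp add: monom_altdef)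
  then have "zeta ^ (N + k) * F - S.heval ([:0, 1:] ^ k * \<rho>) zeta = zeta ^ k * (zeta ^ N * F - S.heval \<rho> zeta)"
    by (simp add: S.heval_mult power_add algebra_simps)
  then show ?thesis
    using ideal_P(4)[OF assms[unfolded rep_def] A.power_closed[OF zeta_A, of k]] by (simp add: rep_def)
qed

lemma rep_add:
  assumes "rep F N \<rho>" "rep G k \<tau>"
  shows "rep (F + G) (N + k) ([:0, 1:] ^ k * \<rho> + [:0, 1:] ^ N * \<tau>)"
proof -
  have "zeta ^ (N + k) * (F + G) - S.heval ([:0, 1:] ^ k * \<rho> + [:0, 1:] ^ N * \<tau>) zeta =
      (zeta ^ (N + k) * F - S.heval ([:0, 1:] ^ k * \<rho>) zeta) +
      (zeta ^ (k + N) * G - S.heval ([:0, 1:] ^ N * \<tau>) zeta)"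
    unfolding S.heval_add add.commute[of k N] by (simp add: distrib_left)
  then show ?thesis
    using ideal_P(3)[OF rep_mult_zeta[OF assms(1), of k, unfolded rep_def]
        rep_mult_zeta[OF assms(2), of N, unfolded rep_def]] by (simp only: rep_def)
qed

lemma rep_mult:
  assumes "rep F N \<rho>" "rep G k \<tau>" "F \<in> A"
  shows "rep (F * G) (N + k) (\<rho> * \<tau>)"
proof -
  have "zeta ^ (N + k) * (F * G) - S.heval (\<rho> * \<tau>) zeta =
      S.heval \<tau> zeta * (zeta ^ N * F - S.heval \<rho> zeta) +
      (zeta ^ N * F) * (zeta ^ k * G - S.heval \<tau> zeta)"
    by (simp add: S.heval_mult power_add algebra_simps)
  moreover have "zeta ^ N * F \<in> A" using A.mult_closed A.power_closed zeta_A assms(3) by blast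
  ultimately show ?thesis
    using assms ideal_P(3,4) S.heval_closed[OF zeta_A] unfolding rep_def by metis
qed

text \<open>The difference of the two numerators over a common denominator is a polynomial in
  \<open>zeta\<close> that lies in \<open>P\<close>, hence zero.\<close>

lemma rep_unique:
  assumes "rep F N \<rho>" "rep F k \<tau>"
  shows "[:0, 1:] ^ k * \<rho> = [:0, 1:] ^ N * \<tau>"
proof -
  have "(zeta ^ (N + k) * F - S.heval ([:0, 1:] ^ N * \<tau>) zeta) -
      (zeta ^ (N + k) * F - S.heval ([:0, 1:] ^ k * \<rho>) zeta) \<in> P"
    using ideal_P(6)[OF rep_mult_zeta[OF assms(2), of N, unfolded rep_def]
        rep_mult_zeta[OF assms(1), of k, unfolded rep_def]] by (simp only: add.commute)
  then have "S.heval ([:0, 1:] ^ k * \<rho> - [:0, 1:] ^ N * \<tau>) zeta \<in> P" by (simp add: S.heval_diff)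
  then show ?thesis using heval_zeta_in_P by simp
qed

text \<open>A homogeneous element outside \<open>P\<close> is a possibly negative power of
  \<open>zeta\<close> times a function that is a unit at \<open>p\<close>. Modulo \<open>P\<close>
  this function may be replaced by its residue, a complex number.\<close>

lemma exists_rep_monom:
  assumes "fls_monom f i \<in> A"
  shows "\<exists>N \<rho>. rep (fls_monom f i) N \<rho>"
proof (cases "fls_monom f i \<in> P")
  case False
  then have f: "f \<noteq> 0" using ideal_P(2) by auto
  have "den d * v p f + num d * i \<ge> 0" using assms monom_A_iff[OF f] p d by blast
  moreover have "\<not> den d * v p f + num d * i > 0"
    using False vertical_center_coeff[OF pd assms] f by (auto split: if_splits)
  ultimately have eq: "den d * v p f + num d * i = 0" by linarith
  \<comment> \<open>Weight 0 and coprimality force \<open>den d\<close> to divide the degree, so the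
    degree is that of an integral power of \<open>zeta\<close>.\<close>
  then have "den d dvd num d * i" by (metis add.commute dvd_add_right_iff dvd_triv_left dvd_0_right)
  then have "den d dvd i" using num_den_coprime[of d] by (simp add: coprime_commute coprime_dvd_mult_right_iff)
  then obtain n where "i = den d * n" by (auto simp: dvd_def)
  then have i: "i = \<sigma> * (\<sigma> * n) * den d" using sign_sq by simp
  define k where "k = \<sigma> * n"
  have "v p f = - k * \<sigma> * num d"
  proof -
    have "den d * (v p f + k * \<sigma> * num d) = 0" using eq i by (simp add: k_def algebra_simps)
    then show ?thesis by simp
  qed
  \<comment> \<open>The quotient by the power \<open>k\<close> of \<open>zeta\<close>; its value at
    \<open>p\<close> is 0 and its residue \<open>r\<close> is the coefficient sought.\<close>
  define g where "g = f * c powi (- k)"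
  have g: "g \<noteq> 0" "v p g = 0"
    using f c0 v_mult[OF p f, of "c powi (- k)"] v_power_int[OF p c0, of "- k"] vc \<open>v p f = _\<close>
    by (auto simp: g_def)
  obtain r where r: "vge p 1 (g - \<iota> r)" using residue_ex1[OF p, of g] g by (auto simp: vge_def)
  \<comment> \<open>As \<open>k\<close> may be negative, \<open>zeta ^ N\<close> is multiplied in to
    make the exponent \<open>l = k + N\<close> nonnegative.\<close>
  define N where "N = nat (- k)"
  define l where "l = nat (k + int N)"
  have l: "int l = k + int N" by (simp add: l_def N_def)
  have fg: "f * c ^ N = g * c ^ l"
  proof -
    have "g * c ^ l = f * (c powi (- k) * c powi (int l))" by (simp add: g_def)
    also have "c powi (- k) * c powi (int l) = c powi (int N)"
      using c0 l by (simp flip: power_int_add)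
    finally show ?thesis by simp
  qed
  have "zeta ^ N * fls_monom f i = fls_monom (g * c ^ l) (\<sigma> * int l * den d)"
    unfolding zeta_power fls_monom_mult using i fg l by (simp add: k_def algebra_simps)
  then have eqx: "zeta ^ N * fls_monom f i - S.heval (monom r l) zeta =
      fls_monom ((g - \<iota> r) * c ^ l) (\<sigma> * int l * den d)"
    by (simp add: S.heval_monom zeta_power fls_monom_mult fls_monom_diff[symmetric] left_diff_distrib)
  have inA: "fls_monom ((g - \<iota> r) * c ^ l) (\<sigma> * int l * den d) \<in> A"
    unfolding eqx[symmetric]
    using A.mult_closed[OF A.power_closed[OF zeta_A] assms] S.heval_closed[OF zeta_A] by (rule A.diff_closed)
  have "fls_monom ((g - \<iota> r) * c ^ l) (\<sigma> * int l * den d) \<in> P"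
    unfolding vertical_center_coeff[OF pd inA]
  proof (intro allI impI)
    fix j assume "fls_nth (fls_monom ((g - \<iota> r) * c ^ l) (\<sigma> * int l * den d)) j \<noteq> 0"
    then have j: "j = \<sigma> * int l * den d" "g - \<iota> r \<noteq> 0" by (auto split: if_splits)
    have "v p ((g - \<iota> r) * c ^ l) \<ge> 1 - int l * \<sigma> * num d"
      using v_mult[OF p j(2), of "c ^ l"] v_power[OF p c0, of l] vc c0 r j(2)
      by (simp add: vge_def algebra_simps)
    then have "den d * v p ((g - \<iota> r) * c ^ l) \<ge> den d * (1 - int l * \<sigma> * num d)"
      by (intro mult_left_mono) auto
    then show "den d * v p (fls_nth (fls_monom ((g - \<iota> r) * c ^ l) (\<sigma> * int l * den d)) j) + num d * j > 0"
      using j den_pos[of d] by (simp add: algebra_simps del: den_pos)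
  qed
  then show ?thesis using eqx unfolding rep_def by metis
qed (use rep_0 in blast)

lemma exists_rep:
  assumes "F \<in> A"
  shows "\<exists>N \<rho>. rep F N \<rho>"
proof -
  have "\<exists>N \<rho>. rep (\<Sum>i\<in>I. fls_monom (fls_nth F i) i) N \<rho>" for I
  proof (induction I rule: infinite_finite_induct)
    case (insert i I)
    then show ?case using rep_add exists_rep_monom[OF A_coeff_monom[OF assms, of i]] by fastforce
  qed (use rep_0[OF ideal_P(2)] in auto)
  then show ?thesis using laurent_eq_sum[of F] A_laurent assms by (metis subsetD)
qed

text \<open>The kernel of the evaluation of \<open>A / P\<close> at \<open>zeta = z\<close>. For
  \<open>z \<noteq> 0\<close> the choice of the representation does not matter, because a power of
  \<open>z\<close> can be cancelled.\<close>

definition point :: "complex \<Rightarrow> 'a fls set" where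
  "point z = {F \<in> A. \<exists>N \<rho>. rep F N \<rho> \<and> poly \<rho> z = 0}"

lemma point_iff:
  assumes "z \<noteq> 0" "F \<in> A" "rep F N \<rho>"
  shows "F \<in> point z \<longleftrightarrow> poly \<rho> z = 0"
proof
  assume "F \<in> point z"
  then obtain k \<tau> where "rep F k \<tau>" "poly \<tau> z = 0" by (auto simp: point_def)
  then have "poly ([:0, 1:] ^ k * \<rho>) z = 0" using rep_unique[OF assms(3)] by simp
  then show "poly \<rho> z = 0" using assms(1) by simp
qed (use assms in \<open>auto simp: point_def\<close>)

lemma P_subset_point: "P \<subseteq> point z"
proof
  fix F assume "F \<in> P"
  then have "F \<in> A" "rep F 0 0" using ideal_P(1) rep_0 by auto
  then show "F \<in> point z" unfolding point_def by (auto intro!: exI[of _ 0])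
qed

lemma ideal_point: "ideal (point z) (subring_of_field A)"
proof (rule A.idealI)
  show "point z \<subseteq> A" by (auto simp: point_def)
  show "0 \<in> point z" using P_subset_point ideal_P(2) by auto
  fix F assume "F \<in> point z"
  then obtain N \<rho> where F: "F \<in> A" "rep F N \<rho>" "poly \<rho> z = 0" by (auto simp: point_def)
  show "F + G \<in> point z" if "G \<in> point z" for G
  proof -
    obtain k \<tau> where "G \<in> A" "rep G k \<tau>" "poly \<tau> z = 0" using \<open>G \<in> point z\<close> by (auto simp: point_def)
    then show ?thesis using rep_add[OF F(2)] F A.add_closed unfolding point_def by fastforce
  qed
  show "G * F \<in> point z" if "G \<in> A" for G
  proof -
    obtain k \<tau> where "rep G k \<tau>" using exists_rep[OF \<open>G \<in> A\<close>] by blast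
    then show ?thesis
      using rep_mult[OF _ F(2) that] F A.mult_closed[OF that F(1)] unfolding point_def by fastforce
  qed
qed

text \<open>Modulo \<open>point z\<close> the inverse of \<open>F\<close> is \<open>zeta ^ N\<close>
  divided by the nonzero number \<open>poly \<rho> z\<close>: the product with \<open>F\<close> is
  represented by a polynomial taking the value 1 at \<open>z\<close>.\<close>

lemma maximalideal_point:
  assumes "z \<noteq> 0"
  shows "maximalideal (point z) (subring_of_field A)"
  unfolding A.maximalideal_iff
proof (intro conjI ballI)
  show "ideal (point z) (subring_of_field A)" by (rule ideal_point)
  show "1 \<notin> point z" using point_iff[OF assms A.one_closed rep_1] by simp
  fix F assume F: "F \<in> A - point z"
  then obtain N \<rho> where r: "rep F N \<rho>" using exists_rep by blast
  then have nz: "poly \<rho> z \<noteq> 0" using point_iff[OF assms _ r] F by auto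
  define a where "a = inverse (poly \<rho> z)"
  define y where "y = fls_monom (\<iota> a) 0 * zeta ^ N"
  have y: "y \<in> A" unfolding y_def by (intro A.mult_closed A.power_closed zeta_A monom_0_A scalar_closed)
  have "F * y - 1 - S.heval (smult a \<rho> - 1) zeta = fls_monom (\<iota> a) 0 * (zeta ^ N * F - S.heval \<rho> zeta)"
    by (simp add: y_def S.heval_diff S.heval_smult algebra_simps)
  then have "F * y - 1 - S.heval (smult a \<rho> - 1) zeta \<in> P"
    using ideal_P(4)[OF r[unfolded rep_def] monom_0_A[OF scalar_closed]] by simp
  then have "rep (F * y - 1) 0 (smult a \<rho> - 1)" by (simp add: rep_def)
  moreover have "poly (smult a \<rho> - 1) z = 0" using nz by (simp add: a_def)
  moreover have "F * y - 1 \<in> A" using F y A.diff_closed A.mult_closed A.one_closed by auto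
  ultimately show "\<exists>y\<in>A. F * y - 1 \<in> point z" using y unfolding point_def by blast
qed

lemma zeta_notin_point: "z \<noteq> 0 \<Longrightarrow> zeta \<notin> point z"
  using point_iff[OF _ zeta_A rep_zeta] by simp

lemma const_in_P: "f \<in> p \<Longrightarrow> fls_monom f 0 \<in> P"
proof -
  assume f: "f \<in> p"
  then have fA: "f \<in> A0" using closed_point_subset[OF p] by auto
  then have "vge p 1 f" using vge_1_iff[OF p fA] f by simp
  then show ?thesis
    using vertical_center_coeff[OF pd monom_0_A[OF fA]] by (auto simp: vge_def zero_less_mult_iff split: if_splits)
qed

lemma contraction_point:
  assumes "z \<noteq> 0"
  shows "contraction A0 (point z) = p"
proof (intro equalityI subsetI)
  fix f assume "f \<in> p"
  then show "f \<in> contraction A0 (point z)"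
    using const_in_P P_subset_point closed_point_subset[OF p] by (auto simp: contraction_const)
next
  fix f assume "f \<in> contraction A0 (point z)"
  then have f: "f \<in> A0" "fls_monom f 0 \<in> point z" by (auto simp: contraction_const)
  obtain r where r: "f - \<iota> r \<in> p" using residue_exists_A0[OF p f(1)] by auto
  have "rep (fls_monom f 0) 0 [:r:]"
    using const_in_P[OF r] by (simp add: rep_def S.heval_pCons fls_monom_diff)
  then have "poly [:r:] z = 0" using point_iff[OF assms monom_0_A[OF f(1)]] f(2) by blast
  then have "r = 0" by simp
  then show "f \<in> p" using r by simp
qed

lemma point_in_fiber: "z \<noteq> 0 \<Longrightarrow> point z \<in> fiber A0 A p"
  using maximalideal_point contraction_point by (simp add: fiber_def closed_points_def)

lemma fiberD:
  assumes "M \<in> fiber A0 A p"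
  shows "maximalideal M (subring_of_field A)" "primeideal M (subring_of_field A)" "M \<subseteq> A"
    "\<And>f. f \<in> A0 \<Longrightarrow> fls_monom f 0 \<in> M \<longleftrightarrow> f \<in> p"
proof -
  show max: "maximalideal M (subring_of_field A)" using assms by (simp add: fiber_def closed_points_def)
  show pr: "primeideal M (subring_of_field A)" using A.maximalideal_imp_primeideal[OF max] .
  show "M \<subseteq> A" using A.idealD(1)[OF A.primeidealD(1)[OF pr]] .
  show "\<And>f. f \<in> A0 \<Longrightarrow> fls_monom f 0 \<in> M \<longleftrightarrow> f \<in> p"
    using assms by (auto simp: fiber_def contraction_const)
qed

text \<open>\<open>g\<close> lies only in the local ring at \<open>p\<close>, so
  \<open>fls_monom g 0\<close> need not be in \<open>A\<close>. A denominator \<open>s\<close>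
  outside \<open>p\<close> repairs this and, being outside \<open>M\<close>, can be removed again by
  primality.\<close>

lemma fiber_product_mem:
  assumes M: "M \<in> fiber A0 A p" and xy: "x \<in> A" "y \<in> A" and eq: "x * y = fls_monom g 0 * z"
    and z: "z \<in> A" and g: "vge p 1 g \<or> vge p 0 g \<and> z \<in> M"
  shows "x \<in> M \<or> y \<in> M"
proof -
  note MD = fiberD[OF M] and iM = A.idealD[OF A.primeidealD(1)[OF fiberD(2)[OF M]]]
  have "\<exists>s\<in>A0 - p. fls_monom (s * g) 0 * z \<in> M"
    using g
  proof
    assume "vge p 1 g"
    then obtain s where s: "s \<in> A0 - p" "s * g \<in> p" by (rule vge_1E[OF p])
    then have "fls_monom (s * g) 0 \<in> M" using MD(4) closed_point_subset[OF p] by blast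
    then have "z * fls_monom (s * g) 0 \<in> M" using iM(4)[OF _ z] by blast
    then show ?thesis using s(1) by (metis mult.commute)
  next
    assume "vge p 0 g \<and> z \<in> M"
    then obtain s where s: "s \<in> A0 - p" "s * g \<in> A0" "z \<in> M" using vge_0E[OF p, of g] by blast
    then show ?thesis using iM(4)[OF s(3) monom_0_A[OF s(2)]] by auto
  qed
  then obtain s where s: "s \<in> A0 - p" "fls_monom (s * g) 0 * z \<in> M" by auto
  have "fls_monom s 0 * (x * y) = fls_monom (s * g) 0 * z"
    unfolding eq by (simp add: fls_monom_mult flip: mult.assoc)
  then have "fls_monom s 0 * (x * y) \<in> M" using s by simp
  moreover have "fls_monom s 0 \<in> A - M" using MD(4) s monom_0_A by auto
  ultimately have "x * y \<in> M" using A.primeidealD(3)[OF MD(2)] A.mult_closed[OF xy] by blast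
  then show ?thesis using A.primeidealD(3)[OF MD(2) xy] by blast
qed

text \<open>Raised to the power \<open>den d\<close>, a homogeneous element becomes a power of \<open>zeta\<close> times a function
  on the curve, up to moving the power of \<open>zeta\<close> to the other side.\<close>

lemma P_subset_fiber_point:
  assumes M: "M \<in> fiber A0 A p" and zeta: "zeta \<notin> M"
  shows "P \<subseteq> M"
proof
  note MD = fiberD[OF M] and iM = A.idealD[OF A.primeidealD(1)[OF fiberD(2)[OF M]]]
  fix F assume F: "F \<in> P"
  then have FA: "F \<in> A" using ideal_P(1) by auto
  have monom: "fls_monom g i \<in> M" if g: "g \<noteq> 0" "fls_monom g i \<in> A" "den d * v p g + num d * i > 0" for g i
  proof -
    define m where "m = nat (den d)"
    have m: "int m = den d" by (simp add: m_def)
    define y where "y = g ^ m * c powi (- (\<sigma> * i))"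
    have vy: "v p y = den d * v p g + num d * i"
      using v_mult[OF p, of "g ^ m" "c powi (- (\<sigma> * i))"] g(1) c0 v_power[OF p g(1), of m]
        v_power_int[OF p c0, of "- (\<sigma> * i)"] m vc sign_sq by (simp add: y_def algebra_simps)
    then have y: "vge p 1 y" using g(3) by (simp add: vge_def)
    have gm: "g ^ m = y * c powi (\<sigma> * i)"
      using c0 by (simp add: y_def mult.assoc flip: power_int_add)
    have xm: "fls_monom g i ^ m \<in> A" using A.power_closed g by blast
    have "fls_monom g i ^ m \<in> M"
    proof (cases "\<sigma> * i \<ge> 0")
      case True
      have "fls_monom g i ^ m * 1 = fls_monom y 0 * zeta ^ nat (\<sigma> * i)"
        using True m gm by (simp add: fls_monom_power zeta_power fls_monom_mult power_int_def sign_sq algebra_simps)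
      then show ?thesis
        using fiber_product_mem[OF M xm A.one_closed _ A.power_closed[OF zeta_A]] y
          A.primeidealD(2)[OF MD(2)] by blast
    next
      case False
      have "y = g ^ m * c ^ nat (- (\<sigma> * i))" using False by (simp add: y_def power_int_def)
      then have "fls_monom g i ^ m * zeta ^ nat (- (\<sigma> * i)) = fls_monom y 0 * 1"
        using False m by (simp add: fls_monom_power zeta_power fls_monom_mult sign_sq algebra_simps)
      then have "fls_monom g i ^ m \<in> M \<or> zeta ^ nat (- (\<sigma> * i)) \<in> M"
        using fiber_product_mem[OF M xm A.power_closed[OF zeta_A] _ A.one_closed] y by blast
      then show ?thesis using A.primeideal_powerD[OF MD(2) zeta_A] zeta by blast
    qed
    then show ?thesis using A.primeideal_powerD[OF MD(2) g(2)] by blast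
  qed
  have sum_M: "sum f I \<in> M" if "\<And>i. i \<in> I \<Longrightarrow> f i \<in> M" for f :: "int \<Rightarrow> 'a fls" and I
    using that by (induction I rule: infinite_finite_induct) (auto intro: iM)
  have "fls_monom (fls_nth F i) i \<in> M" if "fls_nth F i \<noteq> 0" for i
    using monom[OF that A_coeff_monom[OF FA]] vertical_center_coeff[OF pd FA] F that by blast
  then have "(\<Sum>i\<in>{i. fls_nth F i \<noteq> 0}. fls_monom (fls_nth F i) i) \<in> M" by (intro sum_M) simp
  then show "F \<in> M" using laurent_eq_sum[OF subsetD[OF A_laurent FA]] by simp
qed

text \<open>The power \<open>den d\<close> of a homogeneous element of degree \<open>n\<close> is a
  function regular at \<open>p\<close> times the power \<open>\<sigma> n\<close> of
  \<open>zeta\<close>. This exponent is positive, so vanishing of \<open>zeta\<close> at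
  \<open>M\<close> would force the element to vanish there.\<close>

lemma zeta_notin_if_homogeneous_notin:
  assumes M: "M \<in> fiber A0 A p" and F: "fls_monom f n \<in> A" "fls_monom f n \<notin> M" and n: "\<sigma> * n > 0"
  shows "zeta \<notin> M"
proof
  note MD = fiberD[OF M] and iM = A.idealD[OF A.primeidealD(1)[OF fiberD(2)[OF M]]]
  assume zeta: "zeta \<in> M"
  have f: "f \<noteq> 0" using F iM(2) by auto
  define m where "m = nat (den d)"
  have m: "int m = den d" by (simp add: m_def)
  define y where "y = f ^ m * c powi (- (\<sigma> * n))"
  have "v p y = den d * v p f + num d * n"
    using v_mult[OF p, of "f ^ m" "c powi (- (\<sigma> * n))"] f c0 v_power[OF p f, of m]
      v_power_int[OF p c0, of "- (\<sigma> * n)"] m vc sign_sq by (simp add: y_def algebra_simps)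
  then have y: "vge p 0 y" using F(1) monom_A_iff[OF f] p d by (auto simp: vge_def)
  have fm: "f ^ m = y * c powi (\<sigma> * n)"
    using c0 by (simp add: y_def mult.assoc flip: power_int_add)
  have "zeta ^ nat (\<sigma> * n) = zeta ^ (nat (\<sigma> * n) - 1) * zeta"
    using n by (cases "nat (\<sigma> * n)") (auto simp: mult.commute)
  then have "zeta ^ nat (\<sigma> * n) \<in> M" using iM(4)[OF zeta A.power_closed[OF zeta_A]] by metis
  moreover have "fls_monom f n ^ m * 1 = fls_monom y 0 * zeta ^ nat (\<sigma> * n)"
    using n m fm by (simp add: fls_monom_power zeta_power fls_monom_mult power_int_def sign_sq algebra_simps)
  ultimately have "fls_monom f n ^ m \<in> M \<or> 1 \<in> M"
    using fiber_product_mem[OF M A.power_closed[OF F(1)] A.one_closed _ A.power_closed[OF zeta_A]] y by blast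
  then show False
    using A.primeideal_powerD[OF MD(2) F(1)] F(2) A.primeidealD(2)[OF MD(2)] by blast
qed

text \<open>\<open>M\<close> contains \<open>P\<close>, so it suffices to find the complex value
  \<open>z\<close> of \<open>zeta\<close> at \<open>M\<close>; then \<open>point z\<close> lies in
  \<open>M\<close>, and both are maximal.\<close>

lemma fiber_point_eq:
  assumes M: "M \<in> fiber A0 A p" and zeta: "zeta \<notin> M"
  shows "\<exists>z. z \<noteq> 0 \<and> M = point z"
proof -
  note MD = fiberD[OF M] and iM = A.idealD[OF A.primeidealD(1)[OF fiberD(2)[OF M]]]
  have PM: "P \<subseteq> M" using P_subset_fiber_point[OF M zeta] .
  have "\<exists>z. zeta - fls_monom (\<iota> z) 0 \<in> M"
  proof (cases "zeta - 1 \<in> M")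
    case True
    then show ?thesis by (intro exI[of _ 1]) simp
  next
    case False
    have "zeta - 1 \<in> A" using zeta_A A.one_closed A.diff_closed by blast
    then obtain y where y: "y \<in> A" "(zeta - 1) * y - 1 \<in> M"
      using MD(1) False unfolding A.maximalideal_iff by blast
    \<comment> \<open>Representing an inverse \<open>y\<close> of \<open>zeta - 1\<close> modulo
      \<open>M\<close> gives the algebraic equation
      \<open>(zeta - 1) \<rho>(zeta) = zeta ^ N\<close> modulo \<open>M\<close>. It is not trivial,
      since the difference of the two sides at 1 is \<open>- 1\<close>.\<close>
    obtain N \<rho> where r: "rep y N \<rho>" using exists_rep[OF y(1)] by auto
    have "(zeta - 1) * (zeta ^ N * y - S.heval \<rho> zeta) \<in> M"
      using iM(4)[OF _ \<open>zeta - 1 \<in> A\<close>] r PM unfolding rep_def by blast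
    moreover have "zeta ^ N * ((zeta - 1) * y - 1) \<in> M" using iM(4)[OF y(2) A.power_closed[OF zeta_A]] .
    ultimately have "zeta ^ N * ((zeta - 1) * y - 1) - (zeta - 1) * (zeta ^ N * y - S.heval \<rho> zeta) \<in> M"
      using iM(6) by blast
    moreover have "zeta ^ N * ((zeta - 1) * y - 1) - (zeta - 1) * (zeta ^ N * y - S.heval \<rho> zeta) =
        S.heval ([:- 1, 1:] * \<rho> - monom 1 N) zeta"
    proof -
      have eq: "S.heval [:- 1, 1:] zeta = zeta - 1"
        using S.hom_uminus[of 1] by (simp add: S.heval_pCons)
      show ?thesis unfolding S.heval_diff S.heval_mult S.heval_monom eq by (simp add: algebra_simps)
    qed
    moreover have "poly ([:- 1, 1:] * \<rho> - monom 1 N) 1 \<noteq> 0" by (simp add: poly_monom)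
    then have "[:- 1, 1:] * \<rho> - monom 1 N \<noteq> 0" by (metis poly_0)
    ultimately show ?thesis using S.root_of_heval_in_prime[OF MD(2) zeta_A] by metis
  qed
  then obtain z where l: "zeta - fls_monom (\<iota> z) 0 \<in> M" by auto
  have "z \<noteq> 0" using l zeta by auto
  have sub: "point z \<subseteq> M"
  proof
    fix F assume "F \<in> point z"
    then obtain N \<rho> where F: "F \<in> A" "rep F N \<rho>" "poly \<rho> z = 0" by (auto simp: point_def)
    then obtain \<rho>' where \<rho>': "\<rho> = [:- z, 1:] * \<rho>'" by (auto simp: poly_eq_0_iff_dvd dvd_def)
    have "fls_monom (- \<iota> z) 0 = - fls_monom (\<iota> z) 0" using fls_monom_diff[of 0 "\<iota> z" 0] by simp
    then have "S.heval \<rho> zeta = S.heval \<rho>' zeta * (zeta - fls_monom (\<iota> z) 0)"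
      unfolding \<rho>' S.heval_mult by (simp add: S.heval_pCons hom_uminus)
    then have "S.heval \<rho> zeta \<in> M" using iM(4)[OF l S.heval_closed[OF zeta_A]] by simp
    then have "zeta ^ N * F - S.heval \<rho> zeta + S.heval \<rho> zeta \<in> M"
      using iM(3) F(2) PM unfolding rep_def by blast
    then have "zeta ^ N * F \<in> M" by simp
    then have "zeta ^ N \<in> M \<or> F \<in> M"
      using A.primeidealD(3)[OF MD(2) A.power_closed[OF zeta_A] F(1)] by blast
    then show "F \<in> M" using A.primeideal_powerD[OF MD(2) zeta_A] zeta by blast
  qed
  have "M \<subseteq> point z"
  proof (rule ccontr)
    assume "\<not> M \<subseteq> point z"
    then obtain x where x: "x \<in> M" "x \<notin> point z" by auto
    then have "x \<in> A - point z" using MD(3) by auto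
    then obtain y where y: "y \<in> A" "x * y - 1 \<in> point z"
      using maximalideal_point[OF \<open>z \<noteq> 0\<close>] unfolding A.maximalideal_iff by meson
    have "y * x - (x * y - 1) \<in> M" using iM(6)[OF iM(4)[OF x(1) y(1)]] y(2) sub by blast
    then show False using A.primeidealD(2)[OF MD(2)] by (simp add: mult.commute)
  qed
  then show ?thesis using sub \<open>z \<noteq> 0\<close> by blast
qed

text \<open>A polynomial vanishing at all nonzero complex numbers is 0; then
  \<open>zeta ^ N * F\<close> is in \<open>P\<close>, and \<open>zeta\<close> is not.\<close>

lemma vanishing_ideal_points: "vanishing_ideal A (point ` (- {0})) = P"
proof (intro equalityI subsetI)
  fix F assume "F \<in> P"
  then show "F \<in> vanishing_ideal A (point ` (- {0}))"
    using P_subset_point ideal_P(1) by (auto simp: vanishing_ideal_def)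
next
  fix F assume "F \<in> vanishing_ideal A (point ` (- {0}))"
  then have F: "F \<in> A" "\<And>z. z \<noteq> 0 \<Longrightarrow> F \<in> point z" by (auto simp: vanishing_ideal_def)
  obtain N \<rho> where r: "rep F N \<rho>" using exists_rep[OF F(1)] by auto
  have "poly \<rho> z = 0" if "z \<noteq> 0" for z using point_iff[OF that F(1) r] F(2)[OF that] by simp
  then have "- {0} \<subseteq> {z. poly \<rho> z = 0}" by auto
  moreover have "infinite (- {0 :: complex})" by (simp add: Compl_eq_Diff_UNIV infinite_UNIV_char_0)
  ultimately have "\<rho> = 0" using poly_roots_finite finite_subset by blast
  then have "zeta ^ N * F \<in> P" using r by (simp add: rep_def)
  then have "zeta ^ N \<in> P \<or> F \<in> P"
    using A.primeidealD(3)[OF prime_P A.power_closed[OF zeta_A] F(1)] by blast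
  moreover have "zeta \<notin> P" using zeta_notin_point[of 1] P_subset_point by auto
  ultimately show "F \<in> P" using A.primeideal_powerD[OF prime_P zeta_A] by blast
qed

lemma torus_map_P: "l \<noteq> 0 \<Longrightarrow> F \<in> P \<Longrightarrow> torus_map l F \<in> P"
proof -
  assume l: "l \<noteq> 0" and F: "F \<in> P"
  have FA: "F \<in> A" "F \<in> laurent_polys" using F ideal_P(1) A_laurent by auto
  show ?thesis
    using vertical_center_coeff[OF pd FA(1)] F vertical_center_coeff[OF pd torus_map_A[OF FA(1) l]] FA l
    by (auto simp: torus_map_nth v_torus[OF p])
qed

lemma torus_map_zeta: "torus_map l zeta = fls_monom (\<iota> (l powi (\<sigma> * den d))) 0 * zeta"
proof -
  have *: "\<iota> (l ^ n) = \<iota> l ^ n" for n by (induction n) (auto simp: hom_mult)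
  have "\<iota> (l powi n) = \<iota> l powi n" for n
    by (cases "n \<ge> 0") (auto simp: power_int_def * hom_inverse power_inverse)
  then show ?thesis
    using fls_monom_laurent[of c "\<sigma> * den d"] by (intro fls_eqI) (simp add: zeta_def torus_map_nth fls_monom_mult)
qed

lemma torus_map_heval:
  assumes l: "l \<noteq> 0"
  shows "torus_map l (S.heval \<rho> zeta) = S.heval (pcompose \<rho> [:0, l powi (\<sigma> * den d):]) zeta"
proof (induction \<rho>)
  case 0
  then show ?case by (simp add: torus_map_def)
next
  case (pCons a \<rho>)
  have L: "zeta \<in> laurent_polys" "S.heval \<rho> zeta \<in> laurent_polys"
    using zeta_A S.heval_closed[OF zeta_A] A_laurent by auto
  \<comment> \<open>The sum is written as a difference with \<open>- zeta\<close>, the form to which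
    \<open>torus_map_diff\<close> applies.\<close>
  have "torus_map l (fls_monom (\<iota> a) 0 - (- zeta) * S.heval \<rho> zeta) =
      torus_map l (fls_monom (\<iota> a) 0) - torus_map l (- zeta) * torus_map l (S.heval \<rho> zeta)"
    using L l by (simp only: torus_map_diff torus_map_mult fls_monom_laurent laurent.mult_closed
        laurent.uminus_closed not_False_eq_True)
  moreover have "torus_map l (fls_monom (\<iota> a) 0) = fls_monom (\<iota> a) 0"
    by (rule fls_eqI) (auto simp: torus_map_nth)
  moreover have "torus_map l (- zeta) = - torus_map l zeta"
    by (rule fls_eqI) (simp add: torus_map_nth[OF laurent.uminus_closed[OF L(1)]] torus_map_nth[OF L(1)])
  ultimately show ?case using pCons
    by (simp add: S.heval_pCons pcompose_pCons S.heval_add S.heval_mult torus_map_zeta mult_ac del: mult_pCons_left)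
qed

text \<open>The torus scales \<open>zeta\<close> by \<open>a = l powi (\<sigma> * den d)\<close>. So
  the representing polynomial is composed with multiplication by \<open>a\<close>, which moves its
  root from \<open>z\<close> to \<open>z / a\<close>; the factor \<open>a ^ N\<close> from the
  denominator is a scalar.\<close>

lemma torus_map_point:
  assumes l: "l \<noteq> 0" and F: "F \<in> point z"
  shows "torus_map l F \<in> point (z / l powi (\<sigma> * den d))"
proof -
  define a where "a = l powi (\<sigma> * den d)"
  have a: "a \<noteq> 0" using l by (simp add: a_def)
  obtain N \<rho> where r: "F \<in> A" "rep F N \<rho>" "poly \<rho> z = 0" using F by (auto simp: point_def)
  have L: "zeta ^ N \<in> laurent_polys" "F \<in> laurent_polys" "S.heval \<rho> zeta \<in> laurent_polys"
    using A.power_closed[OF zeta_A] r(1) S.heval_closed[OF zeta_A] A_laurent by auto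
  have "torus_map l (zeta ^ N * F - S.heval \<rho> zeta) \<in> P"
    using torus_map_P[OF l] r(2) by (simp add: rep_def)
  moreover have "torus_map l (zeta ^ N * F - S.heval \<rho> zeta) =
      (fls_monom (\<iota> a) 0 * zeta) ^ N * torus_map l F - S.heval (pcompose \<rho> [:0, a:]) zeta"
    using l subsetD[OF A_laurent zeta_A]
    by (simp add: torus_map_diff[OF laurent.mult_closed[OF L(1,2)] L(3)] torus_map_mult[OF L(1,2)]
        torus_map_power torus_map_zeta torus_map_heval a_def)
  ultimately have *: "(fls_monom (\<iota> a) 0 * zeta) ^ N * torus_map l F - S.heval (pcompose \<rho> [:0, a:]) zeta \<in> P"
    by simp
  define b where "b = inverse a ^ N"
  have "b * a ^ N = 1" using a by (simp add: b_def flip: power_mult_distrib)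
  have aN: "fls_monom (\<iota> a) 0 ^ N = fls_monom (\<iota> (a ^ N)) 0"
    by (induction N) (auto simp: fls_monom_mult hom_mult)
  have "fls_monom (\<iota> b) 0 * fls_monom (\<iota> a) 0 ^ N = 1"
    unfolding aN using \<open>b * a ^ N = 1\<close> by (simp add: fls_monom_mult hom_mult[symmetric])
  then have "fls_monom (\<iota> b) 0 * ((fls_monom (\<iota> a) 0 * zeta) ^ N * torus_map l F - S.heval (pcompose \<rho> [:0, a:]) zeta) =
      zeta ^ N * torus_map l F - S.heval (smult b (pcompose \<rho> [:0, a:])) zeta"
    by (simp add: S.heval_smult power_mult_distrib right_diff_distrib flip: mult.assoc)
  then have "rep (torus_map l F) N (smult b (pcompose \<rho> [:0, a:]))"
    using ideal_P(4)[OF * monom_0_A[OF scalar_closed, of b]] by (simp add: rep_def)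
  moreover have "poly (smult b (pcompose \<rho> [:0, a:])) (z / a) = 0"
    using r(3) a by (simp add: poly_pcompose)
  ultimately show ?thesis using torus_map_A[OF r(1) l] unfolding point_def a_def by blast
qed

lemma torus_act_point:
  assumes l: "l \<noteq> 0"
  shows "torus_act \<iota> A l (point z) = point (z / l powi (\<sigma> * den d))"
proof -
  have sub: "point z \<subseteq> A" for z by (auto simp: point_def)
  have "point (z / l powi (\<sigma> * den d)) \<subseteq> torus_map l ` point z"
  proof
    fix F assume F: "F \<in> point (z / l powi (\<sigma> * den d))"
    have "torus_map (inverse l) F \<in> point (z / l powi (\<sigma> * den d) / inverse l powi (\<sigma> * den d))"
      using torus_map_point[OF _ F, of "inverse l"] l by simp
    moreover have "z / l powi (\<sigma> * den d) / inverse l powi (\<sigma> * den d) = z"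
      using l by (simp add: power_int_inverse)
    ultimately have "torus_map (inverse l) F \<in> point z" by simp
    moreover have "F = torus_map l (torus_map (inverse l) F)"
      using torus_map_inverse[of F l] subsetD[OF A_laurent subsetD[OF sub F]] l by simp
    ultimately show "F \<in> torus_map l ` point z" by blast
  qed
  moreover have "torus_map l ` point z \<subseteq> point (z / l powi (\<sigma> * den d))"
    using torus_map_point[OF l] by blast
  ultimately show ?thesis unfolding torus_act_eq[OF sub l] by (rule subset_antisym[rotated])
qed

text \<open>\<open>l powi (\<sigma> * den d)\<close> takes every nonzero complex value, so the
  action on the nonzero values of \<open>zeta\<close> is transitive.\<close>

lemma torus_orbit_point:
  assumes "z \<noteq> 0"
  shows "torus_orbit \<iota> A (point z) = point ` (- {0})"
proof (intro equalityI subsetI)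
  fix M assume "M \<in> torus_orbit \<iota> A (point z)"
  then obtain l where l: "l \<noteq> 0" "M = torus_act \<iota> A l (point z)" by (auto simp: torus_orbit_def)
  then show "M \<in> point ` (- {0})" using torus_act_point[OF l(1)] assms by auto
next
  fix M assume "M \<in> point ` (- {0})"
  then obtain \<mu> where \<mu>: "\<mu> \<noteq> 0" "M = point \<mu>" by auto
  have "\<sigma> * den d \<noteq> 0" using sign by auto
  then obtain l where l: "l \<noteq> 0" "l powi (\<sigma> * den d) = z / \<mu>"
    using exists_complex_power_int_root[of "z / \<mu>" "\<sigma> * den d"] assms \<mu>(1) by auto
  then have "M = torus_act \<iota> A l (point z)" using torus_act_point[OF l(1)] \<mu> assms by simp
  then show "M \<in> torus_orbit \<iota> A (point z)" using l(1) by (auto simp: torus_orbit_def)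
qed

text \<open>For the uniqueness demanded by \<open>THE\<close>: an orbit in the fiber on which some
  homogeneous element of the right sign does not vanish passes through a point where
  \<open>zeta\<close> does not vanish, hence consists of the points \<open>point z\<close>.\<close>

lemma orbit_over_eq:
  assumes N: "\<And>n. n \<in> N \<longleftrightarrow> \<sigma> * n > 0"
  shows "orbit_over \<iota> A0 Dp Dm N p = point ` (- {0})"
  unfolding orbit_over_def
proof (rule the_equality)
  have "\<sigma> * den d \<in> N" using N by (simp add: sign_sq)
  moreover have "zeta \<in> homogeneous_part A0 Dp Dm (\<sigma> * den d)"
    unfolding homogeneous_part_eq zeta_def using zeta_closed by blast
  moreover have "zeta \<notin> point 1" using zeta_notin_point by simp
  moreover have "point 1 \<in> point ` (- {0})" by (intro imageI) simp
  moreover have "point 1 \<in> fiber A0 A p" "point ` (- {0}) = torus_orbit \<iota> A (point 1)"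
    using point_in_fiber torus_orbit_point by simp_all
  ultimately show "(\<exists>M\<in>fiber A0 A p. point ` (- {0}) = torus_orbit \<iota> A M) \<and>
      (\<exists>n\<in>N. \<exists>F\<in>homogeneous_part A0 Dp Dm n. \<exists>M\<in>point ` (- {0}). F \<notin> M)" by blast
next
  fix \<Omega> assume "(\<exists>M\<in>fiber A0 A p. \<Omega> = torus_orbit \<iota> A M) \<and>
      (\<exists>n\<in>N. \<exists>F\<in>homogeneous_part A0 Dp Dm n. \<exists>M\<in>\<Omega>. F \<notin> M)"
  then obtain M n F M' where *: "M \<in> fiber A0 A p" "\<Omega> = torus_orbit \<iota> A M" "n \<in> N"
    "F \<in> homogeneous_part A0 Dp Dm n" "M' \<in> \<Omega>" "F \<notin> M'" by blast
  note MD = fiberD[OF *(1)] and iM = A.idealD[OF A.primeidealD(1)[OF fiberD(2)[OF *(1)]]]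
  obtain f where f: "F = fls_monom f n" "fls_monom f n \<in> A" using *(4) unfolding homogeneous_part_eq by blast
  obtain l where l: "l \<noteq> 0" "M' = torus_map l ` M"
    using *(2,5) torus_act_eq[OF MD(3)] by (auto simp: torus_orbit_def)
  \<comment> \<open>\<open>F\<close> is an eigenvector of the torus, so its vanishing at
    \<open>M\<close> would carry over to the translate \<open>M'\<close>.\<close>
  have "fls_monom f n \<notin> M"
  proof
    assume fM: "fls_monom f n \<in> M"
    define b where "b = inverse l powi n"
    have *: "\<iota> (x ^ k) = \<iota> x ^ k" for x k by (induction k) (auto simp: hom_mult)
    have hp: "\<iota> (x powi k) = \<iota> x powi k" for x k
      by (cases "k \<ge> 0") (auto simp: power_int_def * hom_inverse power_inverse)
    have "fls_monom (\<iota> b * f) n \<in> M"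
      using iM(4)[OF fM monom_0_A[OF scalar_closed, of b]] by (simp add: fls_monom_mult)
    moreover have "torus_map l (fls_monom (\<iota> b * f) n) = F"
      unfolding f(1)
    proof (rule fls_eqI)
      have "\<iota> l powi n * \<iota> b = 1"
        using l(1) by (simp add: b_def hp power_int_mult_distrib[symmetric] hom_mult[symmetric])
      then show "fls_nth (torus_map l (fls_monom (\<iota> b * f) n)) k = fls_nth (fls_monom f n) k" for k
        by (auto simp: torus_map_nth simp flip: mult.assoc)
    qed
    ultimately show False using \<open>F \<notin> M'\<close> l(2) by blast
  qed
  then have "zeta \<notin> M" using zeta_notin_if_homogeneous_notin[OF *(1) f(2)] N *(3) by blast
  then obtain z where "z \<noteq> 0" "M = point z" using fiber_point_eq[OF *(1)] by blast
  then show "\<Omega> = point ` (- {0})" using *(2) torus_orbit_point by simp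
qed

end

section \<open>The orbit closures as vertical primes\<close>

context dpd_surface
begin

text \<open>The condition on slopes says that \<open>d\<close> is the smallest slope over
  \<open>p\<close> for \<open>\<sigma> = 1\<close> and the largest for
  \<open>\<sigma> = - 1\<close>. It is what puts \<open>zeta\<close>, of weight 0 for
  \<open>d\<close>, into \<open>A\<close>.\<close>

lemma orbit_chart_exists:
  assumes p: "p \<in> closed_points A0" and d: "d \<in> slopes p" and s: "\<sigma> = 1 \<or> \<sigma> = - 1"
    and k: "\<And>d'. d' \<in> slopes p \<Longrightarrow> of_int \<sigma> * (d' - d) \<ge> 0"
  obtains c where "orbit_chart \<iota> A0 Dp Dm p d \<sigma> c"
proof -
  obtain c where "c \<noteq> 0" "v p c = - \<sigma> * num d" "fls_monom c (\<sigma> * den d) \<in> A"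
    using homogeneous_unit[OF p d k] by blast
  then have "orbit_chart \<iota> A0 Dp Dm p d \<sigma> c"
    using p d s dpd_surface_axioms by (simp add: orbit_chart_def orbit_chart_axioms_def)
  then show ?thesis using that by blast
qed

text \<open>By \<open>nonpos\<close> the smaller slope is \<open>Dp p\<close>, which therefore
  carries the chart of positive degree; \<open>- Dm p\<close> carries that of negative
  degree.\<close>

lemma curve_Op_eq:
  assumes p: "p \<in> closed_points A0"
  shows "curve_Op \<iota> A0 Dp Dm p = K.center (Inl (p, Poly_Mapping.lookup Dp p))"
proof -
  let ?d = "Poly_Mapping.lookup Dp p"
  have "of_int 1 * (d' - ?d) \<ge> 0" if "d' \<in> slopes p" for d'
    using that nonpos[OF p] by (auto simp: slopes_def)
  then obtain c where c: "orbit_chart \<iota> A0 Dp Dm p ?d 1 c"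
    using orbit_chart_exists[OF p, of ?d 1] by (auto simp: slopes_def)
  interpret orbit_chart \<iota> A0 Dp Dm p ?d 1 c by (rule c)
  show ?thesis
    using orbit_over_eq[of "{0<..}"] vanishing_ideal_points by (simp add: curve_Op_def)
qed

lemma curve_Om_eq:
  assumes p: "p \<in> closed_points A0"
  shows "curve_Om \<iota> A0 Dp Dm p = K.center (Inl (p, - Poly_Mapping.lookup Dm p))"
proof -
  let ?d = "- Poly_Mapping.lookup Dm p"
  have "of_int (- 1) * (d' - ?d) \<ge> 0" if "d' \<in> slopes p" for d'
    using that nonpos[OF p] by (auto simp: slopes_def)
  then obtain c where c: "orbit_chart \<iota> A0 Dp Dm p ?d (- 1) c"
    using orbit_chart_exists[OF p, of ?d "- 1"] by (auto simp: slopes_def)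
  interpret orbit_chart \<iota> A0 Dp Dm p ?d "- 1" c by (rule c)
  show ?thesis
    using orbit_over_eq[of "{..<0}"] vanishing_ideal_points by (simp add: curve_Om_def)
qed

text \<open>With a single slope there are charts of both signs. The product of the two
  \<open>zeta\<close> has degree 0 and value 0 at \<open>p\<close>, so neither vanishes on the
  fiber, and \<open>P\<close> lies in every point of the fiber.\<close>

lemma curve_O_eq:
  assumes p: "p \<in> closed_points A0" and eq: "Poly_Mapping.lookup Dp p = - Poly_Mapping.lookup Dm p"
  shows "curve_O A0 Dp Dm p = K.center (Inl (p, Poly_Mapping.lookup Dp p))"
proof -
  let ?d = "Poly_Mapping.lookup Dp p"
  have sl: "slopes p = {?d}" using eq by (auto simp: slopes_def)
  obtain c where c: "orbit_chart \<iota> A0 Dp Dm p ?d 1 c"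
    using orbit_chart_exists[OF p, of ?d 1] sl by auto
  obtain c' where c': "orbit_chart \<iota> A0 Dp Dm p ?d (- 1) c'"
    using orbit_chart_exists[OF p, of ?d "- 1"] sl by auto
  interpret orbit_chart \<iota> A0 Dp Dm p ?d 1 c by (rule c)
  interpret neg: orbit_chart \<iota> A0 Dp Dm p ?d "- 1" c' by (rule c')
  have "P \<subseteq> M" if M: "M \<in> fiber A0 A p" for M
  proof (rule P_subset_fiber_point[OF M])
    note MD = fiberD[OF M] and iM = A.idealD[OF A.primeidealD(1)[OF fiberD(2)[OF M]]]
    show "zeta \<notin> M"
    proof
      assume "zeta \<in> M"
      then have "neg.zeta * zeta \<in> M" using iM(4) neg.zeta_A by blast
      then have "fls_monom (c' * c) 0 \<in> M" by (simp add: zeta_def neg.zeta_def fls_monom_mult)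
      moreover have "1 * 1 = fls_monom (inverse (c' * c)) 0 * fls_monom (c' * c) 0"
      proof -
        have "inverse (c' * c) * (c' * c) = 1" by (rule left_inverse) (use c0 neg.c0 in simp)
        then show ?thesis unfolding fls_monom_mult by (simp only: fls_monom_1_0 add_0 mult_1)
      qed
      moreover have "vge p 0 (inverse (c' * c))"
        using v_inverse[OF p, of "c' * c"] v_mult[OF p neg.c0 c0] vc neg.vc c0 neg.c0 by (simp add: vge_def)
      ultimately have "1 \<in> M"
        using fiber_product_mem[OF M A.one_closed A.one_closed] MD(3) by blast
      then show False using A.primeidealD(2)[OF MD(2)] by simp
    qed
  qed
  moreover have "vanishing_ideal A (fiber A0 A p) \<subseteq> vanishing_ideal A (point ` (- {0}))"
    using point_in_fiber by (auto simp: vanishing_ideal_def)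
  ultimately show ?thesis
    using vanishing_ideal_points ideal_P(1) by (auto simp: curve_O_def vanishing_ideal_def)
qed

end

section \<open>Class groups\<close>

lemma keys_sum_subset:
  fixes f :: "'i \<Rightarrow> ('b \<Rightarrow>\<^sub>0 int)"
  shows "(\<And>i. i \<in> I \<Longrightarrow> Poly_Mapping.keys (f i) \<subseteq> S) \<Longrightarrow> Poly_Mapping.keys (sum f I) \<subseteq> S"
proof (induction I rule: infinite_finite_induct)
  case (insert i I)
  then show ?case using keys_add[of "f i" "sum f I"] by fastforce
qed auto

lemma keys_plus_subset:
  fixes D E :: "'b \<Rightarrow>\<^sub>0 int"
  shows "Poly_Mapping.keys D \<subseteq> S \<Longrightarrow> Poly_Mapping.keys E \<subseteq> S \<Longrightarrow> Poly_Mapping.keys (D + E) \<subseteq> S"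
  using keys_add[of D E] by blast

lemma keys_diff_subset:
  fixes D E :: "'b \<Rightarrow>\<^sub>0 int"
  shows "Poly_Mapping.keys D \<subseteq> S \<Longrightarrow> Poly_Mapping.keys E \<subseteq> S \<Longrightarrow> Poly_Mapping.keys (D - E) \<subseteq> S"
  using keys_diff[of D E] by blast

lemma keys_cmul_subset: "Poly_Mapping.keys D \<subseteq> S \<Longrightarrow> Poly_Mapping.keys (frag_cmul k D) \<subseteq> S"
  using keys_cmul[of k D] by blast

lemma keys_frag_of_subset: "s \<in> S \<Longrightarrow> Poly_Mapping.keys (frag_of s) \<subseteq> S"
  by simp

lemmas keys_subsets = keys_sum_subset keys_plus_subset keys_diff_subset keys_cmul_subset keys_frag_of_subset

section \<open>Divisors and class group of a Krull family\<close>

context krull_family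
begin

definition divisor :: "'f \<Rightarrow> ('f set \<Rightarrow>\<^sub>0 int)" where
  "divisor x = Abs_poly_mapping (\<lambda>P. if P \<in> height_one_primes R then valuation_at R P x else 0)"

lemma lookup_divisor:
  assumes x: "x \<in> fraction_set R - {0}"
  shows "Poly_Mapping.lookup (divisor x) P = (if P \<in> height_one_primes R then valuation_at R P x else 0)"
proof -
  have "{P. (if P \<in> height_one_primes R then valuation_at R P x else 0) \<noteq> 0} \<subseteq>
      center ` {j \<in> J. v j x \<noteq> 0}"
    using valuation_at_center[OF _ x] by (auto simp: height_one_primes_eq split: if_splits)
  then have "finite {P. (if P \<in> height_one_primes R then valuation_at R P x else 0) \<noteq> 0}"
    using finite_support[OF x] finite_subset by blast
  then show ?thesis by (simp add: divisor_def)
qed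

lemma lookup_divisor_center:
  assumes "x \<in> fraction_set R - {0}" "j \<in> J"
  shows "Poly_Mapping.lookup (divisor x) (center j) = v j x"
  using assms valuation_at_center[of j x] by (simp add: lookup_divisor height_one_primes_eq)

lemma keys_divisor: "x \<in> fraction_set R - {0} \<Longrightarrow> Poly_Mapping.keys (divisor x) \<subseteq> height_one_primes R"
  by (auto simp: in_keys_iff lookup_divisor split: if_splits)

lemma divisor_eqI:
  assumes "Poly_Mapping.keys D \<subseteq> height_one_primes R" "Poly_Mapping.keys E \<subseteq> height_one_primes R"
    "\<And>j. j \<in> J \<Longrightarrow> Poly_Mapping.lookup D (center j) = Poly_Mapping.lookup E (center j)"
  shows "D = E"
proof (rule poly_mapping_eqI)
  fix P
  show "Poly_Mapping.lookup D P = Poly_Mapping.lookup E P"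
  proof (cases "P \<in> height_one_primes R")
    case True
    then show ?thesis using assms(3) by (auto simp: height_one_primes_eq)
  next
    case False
    then have "P \<notin> Poly_Mapping.keys D" "P \<notin> Poly_Mapping.keys E" using assms by auto
    then show ?thesis by (simp add: in_keys_iff)
  qed
qed

lemma divisor_divide:
  assumes "x \<in> fraction_set R - {0}" "y \<in> fraction_set R - {0}"
  shows "divisor (x / y) = divisor x - divisor y"
proof (rule divisor_eqI)
  have xy: "x / y \<in> fraction_set R - {0}" using assms divide_fraction_set by auto
  show "Poly_Mapping.keys (divisor (x / y)) \<subseteq> height_one_primes R" using keys_divisor[OF xy] .
  show "Poly_Mapping.keys (divisor x - divisor y) \<subseteq> height_one_primes R"
    by (intro keys_diff_subset keys_divisor assms)
  show "\<And>j. j \<in> J \<Longrightarrow> Poly_Mapping.lookup (divisor (x / y)) (center j) =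
      Poly_Mapping.lookup (divisor x - divisor y) (center j)"
    using assms xy by (simp add: lookup_divisor_center lookup_minus valuation_divide)
qed

lemma principal_divisors_eq: "principal_divisors R = divisor ` (fraction_set R - {0})"
proof (intro equalityI subsetI)
  fix D assume "D \<in> principal_divisors R"
  then obtain x where x: "Poly_Mapping.keys D \<subseteq> height_one_primes R" "x \<in> fraction_set R - {0}"
    "\<And>P. P \<in> height_one_primes R \<Longrightarrow> Poly_Mapping.lookup D P = valuation_at R P x"
    by (auto simp: principal_divisors_def)
  have "D = divisor x"
    by (rule divisor_eqI) (use x keys_divisor[OF x(2)] in \<open>auto simp: lookup_divisor height_one_primes_eq\<close>)
  then show "D \<in> divisor ` (fraction_set R - {0})" using x by blast
next
  fix D assume "D \<in> divisor ` (fraction_set R - {0})"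
  then obtain x where x: "D = divisor x" "x \<in> fraction_set R - {0}" by blast
  then show "D \<in> principal_divisors R"
    using keys_divisor[OF x(2)] unfolding principal_divisors_def
    by (intro CollectI conjI bexI[of _ x]) (auto simp: lookup_divisor)
qed

lemma principal_divisors_keys:
  "D \<in> principal_divisors R \<Longrightarrow> Poly_Mapping.keys D \<subseteq> height_one_primes R"
  by (simp add: principal_divisors_def)

lemma zero_principal: "0 \<in> principal_divisors R"
proof -
  have "1 \<in> fraction_set R - {0}" using F.one_closed by simp
  then show ?thesis using divisor_divide[of 1 1] unfolding principal_divisors_eq by auto
qed

lemma principal_diff:
  assumes "D \<in> principal_divisors R" "E \<in> principal_divisors R"
  shows "D - E \<in> principal_divisors R"
proof -
  obtain x y where "D = divisor x" "x \<in> fraction_set R - {0}" "E = divisor y" "y \<in> fraction_set R - {0}"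
    using assms unfolding principal_divisors_eq by blast
  then show ?thesis using divisor_divide[of x y] divide_fraction_set[of x y]
    unfolding principal_divisors_eq by (intro image_eqI[of _ _ "x / y"]) auto
qed

lemma principal_uminus: "D \<in> principal_divisors R \<Longrightarrow> - D \<in> principal_divisors R"
  using principal_diff[OF zero_principal] by fastforce

lemma principal_add: "D \<in> principal_divisors R \<Longrightarrow> E \<in> principal_divisors R \<Longrightarrow> D + E \<in> principal_divisors R"
  using principal_diff[OF _ principal_uminus] by fastforce

lemma subgroup_principal: "subgroup (principal_divisors R) (divisor_group R)"
proof (rule group.subgroupI)
  show "principal_divisors R \<subseteq> carrier (divisor_group R)" using principal_divisors_keys by auto
qed (use zero_principal principal_uminus principal_add principal_divisors_keys in \<open>auto simp: inv_free_Abelian_group\<close>)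

lemma normal_principal: "principal_divisors R \<lhd> divisor_group R"
  using comm_group.normal_iff_subgroup[OF abelian_free_Abelian_group] subgroup_principal by blast

lemma comm_group_class_group: "comm_group (class_group R)"
  unfolding class_group_def
  using comm_group.abelian_FactGroup[OF abelian_free_Abelian_group subgroup_principal] .

lemma carrier_class_group:
  "carrier (class_group R) = divisor_class R ` {D. Poly_Mapping.keys D \<subseteq> height_one_primes R}"
  by (auto simp: class_group_def carrier_FactGroup divisor_class_def)

lemma divisor_class_mult:
  assumes "Poly_Mapping.keys D \<subseteq> height_one_primes R" "Poly_Mapping.keys E \<subseteq> height_one_primes R"
  shows "divisor_class R D \<otimes>\<^bsub>class_group R\<^esub> divisor_class R E = divisor_class R (D + E)"
  unfolding divisor_class_def class_group_def mult_FactGroup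
  using normal.rcos_sum[OF normal_principal, of D E] assms by simp

lemma divisor_class_eq_Collect: "divisor_class R D = {h + D | h. h \<in> principal_divisors R}"
  by (auto simp: divisor_class_def r_coset_def)

lemma divisor_class_eq_iff: "divisor_class R D = divisor_class R E \<longleftrightarrow> D - E \<in> principal_divisors R"
proof
  assume eq: "divisor_class R D = divisor_class R E"
  have "D = 0 + D" by simp
  then have "D \<in> divisor_class R D" unfolding divisor_class_eq_Collect
    using zero_principal by (intro CollectI exI[of _ 0] conjI)
  then have "D \<in> divisor_class R E" using eq by simp
  then show "D - E \<in> principal_divisors R" by (auto simp: divisor_class_eq_Collect)
next
  have sub: "divisor_class R D \<subseteq> divisor_class R E" if "D - E \<in> principal_divisors R" for D E
  proof
    fix c assume "c \<in> divisor_class R D"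
    then obtain h where h: "c = h + D" "h \<in> principal_divisors R" by (auto simp: divisor_class_eq_Collect)
    then have "c = (h + (D - E)) + E" "h + (D - E) \<in> principal_divisors R" using principal_add that by auto
    then show "c \<in> divisor_class R E" unfolding divisor_class_eq_Collect by blast
  qed
  assume "D - E \<in> principal_divisors R"
  then show "divisor_class R D = divisor_class R E"
    using sub[of D E] sub[of E D] principal_uminus[of "D - E"] by auto
qed

lemma one_class_group: "\<one>\<^bsub>class_group R\<^esub> = divisor_class R 0"
  by (simp add: class_group_def divisor_class_eq_Collect)

end

lemma lookup_frag_extend:
  "Poly_Mapping.lookup (frag_extend b c) P =
    (\<Sum>i\<in>Poly_Mapping.keys c. Poly_Mapping.lookup c i * Poly_Mapping.lookup (b i) P)"
  by (simp add: frag_extend_def lookup_sum)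

section \<open>Pullback of divisors from the curve\<close>

context dpd_surface
begin

lemma contraction_vertical_center:
  assumes j: "(q, d) \<in> vertical"
  shows "contraction A0 (K.center (Inl (q, d))) = q"
proof -
  have q: "q \<in> closed_points A0" using j by (auto simp: vertical_def)
  have "fls_monom f 0 \<in> K.center (Inl (q, d)) \<longleftrightarrow> f \<in> q" if f: "f \<in> A0" for f
  proof -
    have "fls_monom f 0 \<in> K.center (Inl (q, d)) \<longleftrightarrow> vge q 1 f"
      using vertical_center_coeff[OF j monom_0_A[OF f]]
      by (auto simp: vge_def zero_less_mult_iff split: if_splits)
    then show ?thesis using vge_1_iff[OF q f] by simp
  qed
  then show ?thesis using closed_point_subset[OF q] by (auto simp: contraction_const)
qed

text \<open>Nonzero constants are units along a horizontal prime, so it lies over no closed point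
  and never occurs in a pullback.\<close>

lemma contraction_horizontal_center:
  assumes g: "g \<in> horizontal"
  shows "contraction A0 (K.center (Inr g)) \<subseteq> {0}"
proof
  fix f assume "f \<in> contraction A0 (K.center (Inr g))"
  then have "fls_monom f 0 = 0 \<or> poly_val g (fls_monom f 0) > 0" by (auto simp: contraction_const K.center_def)
  then show "f \<in> {0}" using poly_val_monom[OF g, of f 0] by (cases "f = 0") auto
qed

lemma lookup_pullback_divisor:
  assumes p: "p \<in> closed_points A0"
  shows "Poly_Mapping.lookup (pullback_divisor A0 A p) P =
    (if P \<in> height_one_primes A \<and> contraction A0 P = p
     then valuation_at A P (fls_const (SOME t. uniformizer A0 p t)) else 0)"
proof -
  let ?f = "\<lambda>P. if P \<in> height_one_primes A \<and> contraction A0 P = p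
     then valuation_at A P (fls_const (SOME t. uniformizer A0 p t)) else 0"
  have "{P. ?f P \<noteq> 0} \<subseteq> (\<lambda>d. K.center (Inl (p, d))) ` slopes p"
  proof
    fix P assume "P \<in> {P. ?f P \<noteq> 0}"
    then have P: "P \<in> height_one_primes A" "contraction A0 P = p" by (auto split: if_splits)
    then obtain j where j: "j \<in> J" "P = K.center j" using K.height_one_primes_eq by auto
    show "P \<in> (\<lambda>d. K.center (Inl (p, d))) ` slopes p"
    proof (cases j)
      case (Inl qd)
      then have "qd \<in> vertical" using j by (auto simp: J_def)
      moreover obtain q d where "qd = (q, d)" by (cases qd)
      ultimately show ?thesis
        using Inl j P(2) contraction_vertical_center[of q d] by (auto simp: vertical_def)
    next
      case (Inr g)
      then have "p \<subseteq> {0}" using j P(2) contraction_horizontal_center by (auto simp: J_def)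
      moreover have "0 \<in> p" using idealD(2) primeidealD(1) closed_point_primeideal[OF p] by blast
      ultimately show ?thesis using p by (auto simp: closed_points_iff)
    qed
  qed
  then have "finite {P. ?f P \<noteq> 0}" using finite_subset slopes_finite by blast
  then show ?thesis by (simp add: pullback_divisor_def)
qed

lemma keys_pullback_divisor:
  "p \<in> closed_points A0 \<Longrightarrow> Poly_Mapping.keys (pullback_divisor A0 A p) \<subseteq> height_one_primes A"
  by (auto simp: in_keys_iff lookup_pullback_divisor split: if_splits)

lemma center_height_one: "j \<in> J \<Longrightarrow> K.center j \<in> height_one_primes A"
  using K.height_one_primes_eq by auto

text \<open>The chosen uniformizer, viewed in degree 0, has monomial value \<open>den d\<close>: the
  multiplicity of the curve in the fiber.\<close>

lemma lookup_pullback_vertical: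
  assumes p: "p \<in> closed_points A0" and j: "(q, d) \<in> vertical"
  shows "Poly_Mapping.lookup (pullback_divisor A0 A p) (K.center (Inl (q, d))) = (if q = p then den d else 0)"
proof (cases "q = p")
  case True
  define t where "t = (SOME t. uniformizer A0 p t)"
  have "uniformizer A0 p t" unfolding t_def using exists_uniformizer[OF p] by (rule someI_ex)
  then have t: "t \<noteq> 0" "v p t = 1" using uniformizer_valuation_at[OF p] by auto
  have jJ: "Inl (q, d) \<in> J" using j by (auto simp: J_def)
  have "fls_monom t 0 \<in> fraction_set A - {0}"
    using t by (auto simp: fraction_set_A intro: in_fraction_set_laurent)
  then have "valuation_at A (K.center (Inl (q, d))) (fls_const t) = den d"
    using K.valuation_at_center[OF jJ] t vert_val_monom[OF j t(1), of 0] True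
    by (simp add: fls_const_eq_monom)
  then show ?thesis
    using True lookup_pullback_divisor[OF p] contraction_vertical_center[OF j] center_height_one[OF jJ]
    by (simp add: t_def)
next
  case False
  then show ?thesis using lookup_pullback_divisor[OF p] contraction_vertical_center[OF j] by simp
qed

lemma lookup_pullback_horizontal:
  assumes p: "p \<in> closed_points A0" and g: "g \<in> horizontal"
  shows "Poly_Mapping.lookup (pullback_divisor A0 A p) (K.center (Inr g)) = 0"
proof -
  have "contraction A0 (K.center (Inr g)) \<noteq> p"
  proof
    assume "contraction A0 (K.center (Inr g)) = p"
    then have "p \<subseteq> {0}" using contraction_horizontal_center[OF g] by simp
    moreover have "0 \<in> p" using idealD(2) primeidealD(1) closed_point_primeideal[OF p] by blast
    ultimately show False using p by (auto simp: closed_points_iff)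
  qed
  then show ?thesis by (simp add: lookup_pullback_divisor[OF p])
qed

lemma lookup_divisor_monom:
  assumes "f \<noteq> 0"
  shows "(q, d) \<in> vertical \<Longrightarrow>
      Poly_Mapping.lookup (K.divisor (fls_monom f n)) (K.center (Inl (q, d))) = den d * v q f + num d * n"
    and "g \<in> horizontal \<Longrightarrow> Poly_Mapping.lookup (K.divisor (fls_monom f n)) (K.center (Inr g)) = 0"
proof -
  have F: "fls_monom f n \<in> fraction_set A - {0}"
    using assms by (auto simp: fraction_set_A intro: in_fraction_set_laurent)
  show "(q, d) \<in> vertical \<Longrightarrow>
      Poly_Mapping.lookup (K.divisor (fls_monom f n)) (K.center (Inl (q, d))) = den d * v q f + num d * n"
    using K.lookup_divisor_center[OF F, of "Inl (q, d)"] vert_val_monom[OF _ assms]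
    by (auto simp: J_def)
  show "g \<in> horizontal \<Longrightarrow> Poly_Mapping.lookup (K.divisor (fls_monom f n)) (K.center (Inr g)) = 0"
    using K.lookup_divisor_center[OF F, of "Inr g"] poly_val_monom[OF _ assms]
    by (auto simp: J_def)
qed

lemma divisor_eqI_A:
  assumes "Poly_Mapping.keys D \<subseteq> height_one_primes A" "Poly_Mapping.keys E \<subseteq> height_one_primes A"
    "\<And>q d. (q, d) \<in> vertical \<Longrightarrow>
      Poly_Mapping.lookup D (K.center (Inl (q, d))) = Poly_Mapping.lookup E (K.center (Inl (q, d)))"
    "\<And>g. g \<in> horizontal \<Longrightarrow>
      Poly_Mapping.lookup D (K.center (Inr g)) = Poly_Mapping.lookup E (K.center (Inr g))"
  shows "D = E"
  by (rule K.divisor_eqI) (use assms in \<open>auto simp: J_def\<close>)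

definition pullback :: "('k set \<Rightarrow>\<^sub>0 int) \<Rightarrow> ('k fls set \<Rightarrow>\<^sub>0 int)" where
  "pullback = frag_extend (pullback_divisor A0 A)"

lemma keys_pullback:
  "Poly_Mapping.keys c \<subseteq> closed_points A0 \<Longrightarrow> Poly_Mapping.keys (pullback c) \<subseteq> height_one_primes A"
  using keys_frag_extend[of "pullback_divisor A0 A" c] keys_pullback_divisor
  unfolding pullback_def by blast

lemma lookup_pullback:
  assumes c: "Poly_Mapping.keys c \<subseteq> closed_points A0"
  shows "(q, d) \<in> vertical \<Longrightarrow>
      Poly_Mapping.lookup (pullback c) (K.center (Inl (q, d))) = den d * Poly_Mapping.lookup c q"
    and "g \<in> horizontal \<Longrightarrow> Poly_Mapping.lookup (pullback c) (K.center (Inr g)) = 0"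
proof -
  assume j: "(q, d) \<in> vertical"
  have "Poly_Mapping.lookup (pullback c) (K.center (Inl (q, d))) =
      (\<Sum>i\<in>Poly_Mapping.keys c. if i = q then den d * Poly_Mapping.lookup c q else 0)"
    unfolding pullback_def lookup_frag_extend
  proof (rule sum.cong[OF refl])
    fix i assume "i \<in> Poly_Mapping.keys c"
    then have "i \<in> closed_points A0" using c by blast
    then show "Poly_Mapping.lookup c i * Poly_Mapping.lookup (pullback_divisor A0 A i) (K.center (Inl (q, d))) =
        (if i = q then den d * Poly_Mapping.lookup c q else 0)"
      by (cases "i = q") (simp_all add: lookup_pullback_vertical[OF _ j])
  qed
  then show "Poly_Mapping.lookup (pullback c) (K.center (Inl (q, d))) = den d * Poly_Mapping.lookup c q"
    by (auto simp: in_keys_iff)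
next
  assume g: "g \<in> horizontal"
  show "Poly_Mapping.lookup (pullback c) (K.center (Inr g)) = 0"
    unfolding pullback_def lookup_frag_extend
    by (rule sum.neutral) (use c lookup_pullback_horizontal[OF _ g] in auto)
qed

text \<open>Pulling back the divisor of \<open>f\<close> gives the divisor of \<open>f\<close> as an
  element of degree 0. So the pullback descends to divisor classes.\<close>

lemma pullback_principal:
  assumes "c \<in> principal_divisors A0"
  shows "pullback c \<in> principal_divisors A"
proof -
  obtain f where f: "f \<noteq> 0" "c = C.divisor f" using assms unfolding C.principal_divisors_eq by auto
  have ck: "Poly_Mapping.keys c \<subseteq> closed_points A0"
    using C.principal_divisors_keys[OF assms] height_one_primes_A0 by simp
  have F: "fls_monom f 0 \<in> fraction_set A - {0}"
    using f by (auto simp: fraction_set_A intro: in_fraction_set_laurent)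
  have "pullback c = K.divisor (fls_monom f 0)"
  proof (rule divisor_eqI_A[OF keys_pullback[OF ck] K.keys_divisor[OF F]])
    fix q d assume j: "(q, d) \<in> vertical"
    then have q: "q \<in> closed_points A0" by (auto simp: vertical_def)
    have "Poly_Mapping.lookup c q = v q f"
      using C.lookup_divisor_center[of f q] f q center_eq by simp
    then show "Poly_Mapping.lookup (pullback c) (K.center (Inl (q, d))) =
        Poly_Mapping.lookup (K.divisor (fls_monom f 0)) (K.center (Inl (q, d)))"
      using lookup_pullback(1)[OF ck j] lookup_divisor_monom(1)[OF f(1) j] by simp
  next
    fix g :: "'k poly" assume "g \<in> horizontal"
    then show "Poly_Mapping.lookup (pullback c) (K.center (Inr g)) =
        Poly_Mapping.lookup (K.divisor (fls_monom f 0)) (K.center (Inr g))"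
      using lookup_pullback(2)[OF ck] lookup_divisor_monom(2)[OF f(1)] by simp
  qed
  then show ?thesis using F unfolding K.principal_divisors_eq by blast
qed

end

section \<open>The presentation of the class group by orbit closures\<close>

locale dpd_presentation = dpd_surface \<iota> A0 Dp Dm
  for \<iota> :: "complex \<Rightarrow> 'k::field" and A0 :: "'k set" and Dp Dm :: "'k set \<Rightarrow>\<^sub>0 rat" +
  fixes as bs :: "'k set set" and e m ep mp em mm :: "'k set \<Rightarrow> int"
  assumes as: "as = a_points A0 Dp Dm"
    and bs: "bs = b_points A0 Dp Dm"
    and a_coeffs: "\<And>a. a \<in> as \<Longrightarrow> m a > 0 \<and> gcd (e a) (m a) = 1
      \<and> Poly_Mapping.lookup Dp a = - (of_int (e a) / of_int (m a))
      \<and> Poly_Mapping.lookup Dm a = of_int (e a) / of_int (m a)"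
    and bp_coeffs: "\<And>b. b \<in> bs \<Longrightarrow> mp b > 0 \<and> gcd (ep b) (mp b) = 1
      \<and> Poly_Mapping.lookup Dp b = - (of_int (ep b) / of_int (mp b))"
    and bm_coeffs: "\<And>b. b \<in> bs \<Longrightarrow> mm b < 0 \<and> gcd (em b) (mm b) = 1
      \<and> Poly_Mapping.lookup Dm b = of_int (em b) / of_int (mm b)"
begin

lemma as_slope:
  assumes "a \<in> as"
  shows "a \<in> closed_points A0" "slopes a = {Poly_Mapping.lookup Dp a}"
    "num (Poly_Mapping.lookup Dp a) = - e a" "den (Poly_Mapping.lookup Dp a) = m a"
    "Poly_Mapping.lookup Dp a = - Poly_Mapping.lookup Dm a"
proof -
  show "a \<in> closed_points A0" "slopes a = {Poly_Mapping.lookup Dp a}"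
    "Poly_Mapping.lookup Dp a = - Poly_Mapping.lookup Dm a"
    using assms as by (auto simp: a_points_def slopes_def)
  have "Poly_Mapping.lookup Dp a = of_int (- e a) / of_int (m a)" "m a > 0" "coprime (- e a) (m a)"
    using a_coeffs[OF assms] by (auto simp: coprime_iff_gcd_eq_1)
  then show "num (Poly_Mapping.lookup Dp a) = - e a" "den (Poly_Mapping.lookup Dp a) = m a"
    using num_den_eqI by blast+
qed

text \<open>In lowest terms the slopes are \<open>(- ep b) / mp b\<close> and
  \<open>em b / (- mm b)\<close>; the sign change in the second is due to \<open>mm b < 0\<close>.
  They differ because the sum of the divisors is negative at \<open>b\<close>, so two primes lie
  over \<open>b\<close>.\<close>

lemma bs_slope:
  assumes "b \<in> bs"
  shows "b \<in> closed_points A0" "slopes b = {Poly_Mapping.lookup Dp b, - Poly_Mapping.lookup Dm b}"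
    "num (Poly_Mapping.lookup Dp b) = - ep b" "den (Poly_Mapping.lookup Dp b) = mp b"
    "num (- Poly_Mapping.lookup Dm b) = em b" "den (- Poly_Mapping.lookup Dm b) = - mm b"
    "Poly_Mapping.lookup Dp b \<noteq> - Poly_Mapping.lookup Dm b"
proof -
  show "b \<in> closed_points A0" "slopes b = {Poly_Mapping.lookup Dp b, - Poly_Mapping.lookup Dm b}"
    "Poly_Mapping.lookup Dp b \<noteq> - Poly_Mapping.lookup Dm b"
    using assms bs by (auto simp: b_points_def slopes_def)
  have "Poly_Mapping.lookup Dp b = of_int (- ep b) / of_int (mp b)" "mp b > 0" "coprime (- ep b) (mp b)"
    using bp_coeffs[OF assms] by (auto simp: coprime_iff_gcd_eq_1)
  then show "num (Poly_Mapping.lookup Dp b) = - ep b" "den (Poly_Mapping.lookup Dp b) = mp b"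
    using num_den_eqI by blast+
  have "- Poly_Mapping.lookup Dm b = of_int (em b) / of_int (- mm b)" "- mm b > 0" "coprime (em b) (- mm b)"
    using bm_coeffs[OF assms] by (auto simp: coprime_iff_gcd_eq_1)
  then show "num (- Poly_Mapping.lookup Dm b) = em b" "den (- Poly_Mapping.lookup Dm b) = - mm b"
    using num_den_eqI by blast+
qed

text \<open>Outside \<open>bs\<close> the sum of the two coefficients is 0, and outside
  \<open>as\<close> they are then both 0.\<close>

lemma other_slope:
  assumes "p \<in> closed_points A0" "p \<notin> as" "p \<notin> bs"
  shows "slopes p = {0}"
  using assms nonpos[of p] unfolding as bs a_points_def b_points_def slopes_def by force

lemma as_bs_disjoint: "a \<in> as \<Longrightarrow> a \<notin> bs"
  using as_slope(5) bs_slope(7) by blast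

lemma finite_as: "finite as" and finite_bs: "finite bs"
proof -
  have "p \<in> {p. slopes p \<noteq> {0}}" if "p \<in> as \<union> bs" for p
    using that by (auto simp: as bs a_points_def b_points_def slopes_def)
  then have "as \<union> bs \<subseteq> {p. slopes p \<noteq> {0}}" by blast
  then have "finite (as \<union> bs)" using finite_special finite_subset by blast
  then show "finite as" "finite bs" by auto
qed

definition symbols :: "'k set orbit_symbol set" where
  "symbols = SymO ` as \<union> SymOp ` bs \<union> SymOm ` bs"

primrec symbol_slope :: "'k set orbit_symbol \<Rightarrow> 'k set \<times> rat" where
  "symbol_slope (SymO p) = (p, Poly_Mapping.lookup Dp p)"
| "symbol_slope (SymOp p) = (p, Poly_Mapping.lookup Dp p)"
| "symbol_slope (SymOm p) = (p, - Poly_Mapping.lookup Dm p)"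

definition curve :: "'k set orbit_symbol \<Rightarrow> 'k fls set" where
  "curve s = K.center (Inl (symbol_slope s))"

lemma symbol_slope_vertical: "s \<in> symbols \<Longrightarrow> symbol_slope s \<in> vertical"
  using as_slope bs_slope by (auto simp: symbols_def vertical_def)

lemma inj_symbol_slope: "inj_on symbol_slope symbols"
proof (rule inj_onI)
  fix s s' assume "s \<in> symbols" "s' \<in> symbols" "symbol_slope s = symbol_slope s'"
  then show "s = s'" using as_bs_disjoint bs_slope(7) bs_slope(7)[THEN not_sym] by (auto simp: symbols_def)
qed

lemma curve_eq_center_iff:
  assumes "s \<in> symbols" "j \<in> vertical"
  shows "curve s = K.center (Inl j) \<longleftrightarrow> symbol_slope s = j"
  using K.inj_on_center assms symbol_slope_vertical[OF assms(1)]
  by (auto simp: curve_def inj_on_def J_def)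

lemma curve_neq_horizontal: "s \<in> symbols \<Longrightarrow> g \<in> horizontal \<Longrightarrow> curve s \<noteq> K.center (Inr g)"
  using inj_onD[OF K.inj_on_center, of "Inl (symbol_slope s)" "Inr g"] symbol_slope_vertical[of s]
  by (auto simp: curve_def J_def)

lemma curve_height_one: "s \<in> symbols \<Longrightarrow> curve s \<in> height_one_primes A"
  using center_height_one symbol_slope_vertical by (auto simp: curve_def J_def)

text \<open>The second alternative is the prime over an ordinary point, which has no symbol because
  it is the full pullback of that point.\<close>

lemma vertical_cases:
  assumes "(q, d) \<in> vertical"
  obtains s where "s \<in> symbols" "symbol_slope s = (q, d)" | "q \<notin> as" "q \<notin> bs" "d = 0"
proof -
  have q: "q \<in> closed_points A0" "d \<in> slopes q" using assms by (auto simp: vertical_def)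
  consider "q \<in> as" | "q \<in> bs" | "q \<notin> as" "q \<notin> bs" by blast
  then show ?thesis
  proof cases
    case 1
    then have "SymO q \<in> symbols" "symbol_slope (SymO q) = (q, d)" using q as_slope(2) by (auto simp: symbols_def)
    then show ?thesis using that(1) by blast
  next
    case 2
    then consider "d = Poly_Mapping.lookup Dp q" | "d = - Poly_Mapping.lookup Dm q"
      using q bs_slope(2) by auto
    then show ?thesis
    proof cases
      case 1
      then show ?thesis using that(1)[of "SymOp q"] \<open>q \<in> bs\<close> by (auto simp: symbols_def)
    next
      case 2
      then show ?thesis using that(1)[of "SymOm q"] \<open>q \<in> bs\<close> by (auto simp: symbols_def)
    qed
  next
    case 3
    then show ?thesis using that(2) q other_slope by auto
  qed
qed

definition curve_divisor :: "('k set orbit_symbol \<Rightarrow>\<^sub>0 int) \<Rightarrow> ('k fls set \<Rightarrow>\<^sub>0 int)" where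
  "curve_divisor = frag_extend (\<lambda>s. frag_of (curve s))"

lemma keys_curve_divisor:
  "Poly_Mapping.keys x \<subseteq> symbols \<Longrightarrow> Poly_Mapping.keys (curve_divisor x) \<subseteq> height_one_primes A"
  using keys_frag_extend[of "\<lambda>s. frag_of (curve s)" x] curve_height_one
  unfolding curve_divisor_def by fastforce

lemma lookup_curve_divisor:
  assumes x: "Poly_Mapping.keys x \<subseteq> symbols"
  shows "s \<in> symbols \<Longrightarrow>
      Poly_Mapping.lookup (curve_divisor x) (K.center (Inl (symbol_slope s))) = Poly_Mapping.lookup x s"
    and "(q, d) \<in> vertical \<Longrightarrow> q \<notin> as \<Longrightarrow> q \<notin> bs \<Longrightarrow>
      Poly_Mapping.lookup (curve_divisor x) (K.center (Inl (q, d))) = 0"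
    and "g \<in> horizontal \<Longrightarrow> Poly_Mapping.lookup (curve_divisor x) (K.center (Inr g)) = 0"
proof -
  assume s: "s \<in> symbols"
  have "curve t = curve s \<longleftrightarrow> t = s" if "t \<in> symbols" for t
    using curve_eq_center_iff[OF that symbol_slope_vertical[OF s]] inj_symbol_slope that s
    by (auto simp: curve_def inj_on_def)
  then have "Poly_Mapping.lookup (curve_divisor x) (curve s) =
      (\<Sum>t\<in>Poly_Mapping.keys x. if t = s then Poly_Mapping.lookup x s else 0)"
    unfolding curve_divisor_def lookup_frag_extend using x by (intro sum.cong) auto
  then show "Poly_Mapping.lookup (curve_divisor x) (K.center (Inl (symbol_slope s))) = Poly_Mapping.lookup x s"
    unfolding curve_def by (auto simp: in_keys_iff)
next
  assume j: "(q, d) \<in> vertical" "q \<notin> as" "q \<notin> bs"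
  then have "curve t \<noteq> K.center (Inl (q, d))" if "t \<in> symbols" for t
    using curve_eq_center_iff[OF that j(1)] that by (auto simp: symbols_def)
  then show "Poly_Mapping.lookup (curve_divisor x) (K.center (Inl (q, d))) = 0"
    unfolding curve_divisor_def lookup_frag_extend using x by (intro sum.neutral) auto
next
  assume g: "g \<in> horizontal"
  then show "Poly_Mapping.lookup (curve_divisor x) (K.center (Inr g)) = 0"
    unfolding curve_divisor_def lookup_frag_extend using x curve_neq_horizontal
    by (intro sum.neutral) auto
qed

abbreviation G :: "(('k set \<Rightarrow>\<^sub>0 int) set \<times> ('k set orbit_symbol \<Rightarrow>\<^sub>0 int)) monoid" where
  "G \<equiv> free_presentation A0 as bs"

abbreviation relations :: "(('k set \<Rightarrow>\<^sub>0 int) set \<times> ('k set orbit_symbol \<Rightarrow>\<^sub>0 int)) set" where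
  "relations \<equiv> class_relations A0 as bs e m ep mp em mm"

abbreviation N :: "(('k set \<Rightarrow>\<^sub>0 int) set \<times> ('k set orbit_symbol \<Rightarrow>\<^sub>0 int)) set" where
  "N \<equiv> generate G relations"

definition element :: "('k set \<Rightarrow>\<^sub>0 int) \<Rightarrow> ('k set orbit_symbol \<Rightarrow>\<^sub>0 int) \<Rightarrow>
    ('k set \<Rightarrow>\<^sub>0 int) set \<times> ('k set orbit_symbol \<Rightarrow>\<^sub>0 int)" where
  "element c x = (divisor_class A0 c, x)"

definition u_relation :: "'k set orbit_symbol \<Rightarrow>\<^sub>0 int" where
  "u_relation = (\<Sum>a\<in>as. frag_cmul (e a) (frag_of (SymO a)))
    + (\<Sum>b\<in>bs. frag_cmul (ep b) (frag_of (SymOp b)) - frag_cmul (em b) (frag_of (SymOm b)))"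

lemma G_eq: "G = class_group A0 \<times>\<times> free_Abelian_group symbols"
  by (simp add: free_presentation_def symbols_def)

lemma group_G: "group G"
  unfolding G_eq
  using DirProd_group C.comm_group_class_group group_free_Abelian_group comm_group_def by blast

lemma carrier_G:
  "carrier G = {element c x | c x. Poly_Mapping.keys c \<subseteq> closed_points A0 \<and> Poly_Mapping.keys x \<subseteq> symbols}"
  by (auto simp: G_eq C.carrier_class_group height_one_primes_A0 element_def)

lemma element_mult:
  assumes "Poly_Mapping.keys c \<subseteq> closed_points A0" "Poly_Mapping.keys c' \<subseteq> closed_points A0"
  shows "element c x \<otimes>\<^bsub>G\<^esub> element c' x' = element (c + c') (x + x')"
  using C.divisor_class_mult[of c c'] assms by (simp add: G_eq element_def height_one_primes_A0)

lemma one_G: "\<one>\<^bsub>G\<^esub> = element 0 0"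
  by (simp add: G_eq element_def C.one_class_group)

lemma relations_eq:
  "relations = {element (frag_of a) (- frag_cmul (m a) (frag_of (SymO a))) | a. a \<in> as}
    \<union> {element (frag_of b) (- (frag_cmul (mp b) (frag_of (SymOp b)) - frag_cmul (mm b) (frag_of (SymOm b)))) | b. b \<in> bs}
    \<union> {element 0 u_relation}"
  by (simp add: class_relations_def element_def u_relation_def C.one_class_group)

lemma symbols_mem: "a \<in> as \<Longrightarrow> SymO a \<in> symbols" "b \<in> bs \<Longrightarrow> SymOp b \<in> symbols" "b \<in> bs \<Longrightarrow> SymOm b \<in> symbols"
  by (auto simp: symbols_def)

lemma keys_u_relation: "Poly_Mapping.keys u_relation \<subseteq> symbols"
  unfolding u_relation_def by (intro keys_subsets symbols_mem)

definition a_relation :: "'k set \<Rightarrow> 'k set orbit_symbol \<Rightarrow>\<^sub>0 int" where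
  "a_relation a = frag_cmul (m a) (frag_of (SymO a))"

definition b_relation :: "'k set \<Rightarrow> 'k set orbit_symbol \<Rightarrow>\<^sub>0 int" where
  "b_relation b = frag_cmul (mp b) (frag_of (SymOp b)) - frag_cmul (mm b) (frag_of (SymOm b))"

lemma keys_a_relation: "a \<in> as \<Longrightarrow> Poly_Mapping.keys (a_relation a) \<subseteq> symbols"
  unfolding a_relation_def by (intro keys_subsets symbols_mem)

lemma keys_b_relation: "b \<in> bs \<Longrightarrow> Poly_Mapping.keys (b_relation b) \<subseteq> symbols"
  unfolding b_relation_def by (intro keys_subsets symbols_mem)

lemma element_closed:
  "Poly_Mapping.keys c \<subseteq> closed_points A0 \<Longrightarrow> Poly_Mapping.keys x \<subseteq> symbols \<Longrightarrow> element c x \<in> carrier G"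
  unfolding carrier_G by blast

lemma relations_subset: "relations \<subseteq> carrier G"
proof -
  have "element (frag_of a) (- a_relation a) \<in> carrier G" if "a \<in> as" for a
    using keys_a_relation[OF that] as_slope(1)[OF that] by (intro element_closed) auto
  moreover have "element (frag_of b) (- b_relation b) \<in> carrier G" if "b \<in> bs" for b
    using keys_b_relation[OF that] bs_slope(1)[OF that] by (intro element_closed) auto
  moreover have "element 0 u_relation \<in> carrier G"
    using keys_u_relation by (intro element_closed) auto
  ultimately show ?thesis unfolding relations_eq a_relation_def b_relation_def by blast
qed

lemma subgroup_N: "subgroup N G"
  using group.generate_is_subgroup[OF group_G relations_subset] .

text \<open>Keeps a representative \<open>c\<close> and both supports, so that closure properties of
  \<open>N\<close> can be stated additively although \<open>element\<close> contains only the class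
  of \<open>c\<close>.\<close>

definition in_N :: "('k set \<Rightarrow>\<^sub>0 int) \<Rightarrow> ('k set orbit_symbol \<Rightarrow>\<^sub>0 int) \<Rightarrow> bool" where
  "in_N c x \<longleftrightarrow> Poly_Mapping.keys c \<subseteq> closed_points A0 \<and> Poly_Mapping.keys x \<subseteq> symbols \<and> element c x \<in> N"

lemma in_N_0: "in_N 0 0"
  using subgroup.one_closed[OF subgroup_N] one_G by (simp add: in_N_def)

lemma in_N_add: "in_N c x \<Longrightarrow> in_N c' x' \<Longrightarrow> in_N (c + c') (x + x')"
  using subgroup.m_closed[OF subgroup_N, of "element c x" "element c' x'"] element_mult[of c c' x x'] keys_plus_subset
  unfolding in_N_def by metis

lemma in_N_uminus:
  assumes "in_N c x" shows "in_N (- c) (- x)"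
proof -
  interpret G: group G by (rule group_G)
  have k: "Poly_Mapping.keys c \<subseteq> closed_points A0" "Poly_Mapping.keys x \<subseteq> symbols" "element c x \<in> N"
    using assms by (auto simp: in_N_def)
  have c: "element c x \<in> carrier G" "element (- c) (- x) \<in> carrier G"
    using k by (auto intro!: element_closed)
  have "element (- c) (- x) \<otimes>\<^bsub>G\<^esub> element c x = \<one>\<^bsub>G\<^esub>"
    using k by (simp add: element_mult one_G)
  then have "inv\<^bsub>G\<^esub> (element c x) = element (- c) (- x)" using c by (simp add: G.inv_equality)
  then show ?thesis using subgroup.m_inv_closed[OF subgroup_N k(3)] k by (simp add: in_N_def)
qed

lemma in_N_cmul:
  assumes "in_N c x" shows "in_N (frag_cmul k c) (frag_cmul k x)"
proof -
  have nat: "in_N (frag_cmul (int n) c) (frag_cmul (int n) x)" for n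
  proof (induction n)
    case (Suc n)
    then show ?case using in_N_add[OF assms Suc] by (simp add: frag_cmul_distrib)
  qed (use in_N_0 in simp)
  show ?thesis
    by (cases k rule: int_cases2) (use nat in_N_uminus[OF nat] in auto)
qed

lemma in_N_sum:
  "(\<And>i. i \<in> I \<Longrightarrow> in_N (f i) (g i)) \<Longrightarrow> in_N (sum f I) (sum g I)"
  by (induction I rule: infinite_finite_induct) (auto intro: in_N_0 in_N_add)

lemma in_N_relations:
  "a \<in> as \<Longrightarrow> in_N (frag_of a) (- a_relation a)"
  "b \<in> bs \<Longrightarrow> in_N (frag_of b) (- b_relation b)"
  "in_N 0 u_relation"
proof -
  have incl: "r \<in> N" if "r \<in> relations" for r using generate.incl[OF that] .
  have mem: "a \<in> as \<Longrightarrow> element (frag_of a) (- a_relation a) \<in> relations"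
    "b \<in> bs \<Longrightarrow> element (frag_of b) (- b_relation b) \<in> relations"
    "element 0 u_relation \<in> relations"
    unfolding relations_eq a_relation_def b_relation_def by blast+
  show "a \<in> as \<Longrightarrow> in_N (frag_of a) (- a_relation a)"
    using keys_a_relation[of a] as_slope(1)[of a] incl[OF mem(1)] by (simp add: in_N_def)
  show "b \<in> bs \<Longrightarrow> in_N (frag_of b) (- b_relation b)"
    using keys_b_relation[of b] bs_slope(1)[of b] incl[OF mem(2)] by (simp add: in_N_def)
  show "in_N 0 u_relation"
    using keys_u_relation incl[OF mem(3)] by (simp add: in_N_def)
qed

lemma lookup_a_relation:
  "Poly_Mapping.lookup (a_relation a) (SymO q) = (if q = a then m a else 0)"
  "Poly_Mapping.lookup (a_relation a) (SymOp q) = 0"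
  "Poly_Mapping.lookup (a_relation a) (SymOm q) = 0"
  by (auto simp: a_relation_def)

lemma lookup_b_relation:
  "Poly_Mapping.lookup (b_relation b) (SymO q) = 0"
  "Poly_Mapping.lookup (b_relation b) (SymOp q) = (if q = b then mp b else 0)"
  "Poly_Mapping.lookup (b_relation b) (SymOm q) = (if q = b then - mm b else 0)"
  by (auto simp: b_relation_def lookup_minus)

definition total_divisor :: "('k set \<Rightarrow>\<^sub>0 int) \<Rightarrow> ('k set orbit_symbol \<Rightarrow>\<^sub>0 int) \<Rightarrow> ('k fls set \<Rightarrow>\<^sub>0 int)" where
  "total_divisor c x = pullback c + curve_divisor x"

lemma keys_total_divisor:
  "Poly_Mapping.keys c \<subseteq> closed_points A0 \<Longrightarrow> Poly_Mapping.keys x \<subseteq> symbols \<Longrightarrow>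
    Poly_Mapping.keys (total_divisor c x) \<subseteq> height_one_primes A"
  unfolding total_divisor_def by (intro keys_plus_subset keys_pullback keys_curve_divisor)

lemma total_divisor_add: "total_divisor (c + c') (x + x') = total_divisor c x + total_divisor c' x'"
  by (simp add: total_divisor_def pullback_def curve_divisor_def frag_extend_add)

lemma lookup_total_divisor:
  assumes "Poly_Mapping.keys c \<subseteq> closed_points A0" "Poly_Mapping.keys x \<subseteq> symbols"
  shows "a \<in> as \<Longrightarrow> Poly_Mapping.lookup (total_divisor c x) (curve (SymO a)) =
      m a * Poly_Mapping.lookup c a + Poly_Mapping.lookup x (SymO a)"
    and "b \<in> bs \<Longrightarrow> Poly_Mapping.lookup (total_divisor c x) (curve (SymOp b)) =
      mp b * Poly_Mapping.lookup c b + Poly_Mapping.lookup x (SymOp b)"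
    and "b \<in> bs \<Longrightarrow> Poly_Mapping.lookup (total_divisor c x) (curve (SymOm b)) =
      - mm b * Poly_Mapping.lookup c b + Poly_Mapping.lookup x (SymOm b)"
    and "(q, 0) \<in> vertical \<Longrightarrow> q \<notin> as \<Longrightarrow> q \<notin> bs \<Longrightarrow>
      Poly_Mapping.lookup (total_divisor c x) (K.center (Inl (q, 0))) = Poly_Mapping.lookup c q"
    and "g \<in> horizontal \<Longrightarrow> Poly_Mapping.lookup (total_divisor c x) (K.center (Inr g)) = 0"
proof -
  have sym: "Poly_Mapping.lookup (total_divisor c x) (curve s) =
      den (snd (symbol_slope s)) * Poly_Mapping.lookup c (fst (symbol_slope s)) + Poly_Mapping.lookup x s"
    if s: "s \<in> symbols" for s
    using lookup_pullback(1)[OF assms(1), of "fst (symbol_slope s)" "snd (symbol_slope s)"]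
      lookup_curve_divisor(1)[OF assms(2) s] symbol_slope_vertical[OF s]
    by (simp add: total_divisor_def curve_def lookup_add)
  show "a \<in> as \<Longrightarrow> Poly_Mapping.lookup (total_divisor c x) (curve (SymO a)) =
      m a * Poly_Mapping.lookup c a + Poly_Mapping.lookup x (SymO a)"
    using sym[OF symbols_mem(1)] as_slope(4) by simp
  show "b \<in> bs \<Longrightarrow> Poly_Mapping.lookup (total_divisor c x) (curve (SymOp b)) =
      mp b * Poly_Mapping.lookup c b + Poly_Mapping.lookup x (SymOp b)"
    using sym[OF symbols_mem(2)] bs_slope(4) by simp
  show "b \<in> bs \<Longrightarrow> Poly_Mapping.lookup (total_divisor c x) (curve (SymOm b)) =
      - mm b * Poly_Mapping.lookup c b + Poly_Mapping.lookup x (SymOm b)"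
    using sym[OF symbols_mem(3)] bs_slope(6) by simp
  show "(q, 0) \<in> vertical \<Longrightarrow> q \<notin> as \<Longrightarrow> q \<notin> bs \<Longrightarrow>
      Poly_Mapping.lookup (total_divisor c x) (K.center (Inl (q, 0))) = Poly_Mapping.lookup c q"
    using lookup_pullback(1)[OF assms(1)] lookup_curve_divisor(2)[OF assms(2)]
    by (simp add: total_divisor_def lookup_add)
  show "g \<in> horizontal \<Longrightarrow> Poly_Mapping.lookup (total_divisor c x) (K.center (Inr g)) = 0"
    using lookup_pullback(2)[OF assms(1)] lookup_curve_divisor(3)[OF assms(2)]
    by (simp add: total_divisor_def lookup_add)
qed

lemma divisor_eqI_symbols:
  assumes "Poly_Mapping.keys D \<subseteq> height_one_primes A" "Poly_Mapping.keys E \<subseteq> height_one_primes A"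
    "\<And>a. a \<in> as \<Longrightarrow> Poly_Mapping.lookup D (curve (SymO a)) = Poly_Mapping.lookup E (curve (SymO a))"
    "\<And>b. b \<in> bs \<Longrightarrow> Poly_Mapping.lookup D (curve (SymOp b)) = Poly_Mapping.lookup E (curve (SymOp b))"
    "\<And>b. b \<in> bs \<Longrightarrow> Poly_Mapping.lookup D (curve (SymOm b)) = Poly_Mapping.lookup E (curve (SymOm b))"
    "\<And>q. (q, 0) \<in> vertical \<Longrightarrow> q \<notin> as \<Longrightarrow> q \<notin> bs \<Longrightarrow>
      Poly_Mapping.lookup D (K.center (Inl (q, 0))) = Poly_Mapping.lookup E (K.center (Inl (q, 0)))"
    "\<And>g. g \<in> horizontal \<Longrightarrow>
      Poly_Mapping.lookup D (K.center (Inr g)) = Poly_Mapping.lookup E (K.center (Inr g))"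
  shows "D = E"
proof (rule divisor_eqI_A[OF assms(1,2)])
  fix q d assume j: "(q, d) \<in> vertical"
  then show "Poly_Mapping.lookup D (K.center (Inl (q, d))) = Poly_Mapping.lookup E (K.center (Inl (q, d)))"
  proof (cases rule: vertical_cases)
    case (1 s)
    have "Poly_Mapping.lookup D (curve s) = Poly_Mapping.lookup E (curve s)"
      using 1(1) assms(3-5) by (auto simp: symbols_def)
    then show ?thesis using 1(2) by (simp add: curve_def)
  next
    case 2
    then show ?thesis using assms(6) j by simp
  qed
qed (rule assms(7))

lemma lookup_divisor_monom_symbols:
  assumes "f \<noteq> 0"
  shows "a \<in> as \<Longrightarrow> Poly_Mapping.lookup (K.divisor (fls_monom f n)) (curve (SymO a)) = m a * v a f - e a * n"
    and "b \<in> bs \<Longrightarrow> Poly_Mapping.lookup (K.divisor (fls_monom f n)) (curve (SymOp b)) = mp b * v b f - ep b * n"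
    and "b \<in> bs \<Longrightarrow> Poly_Mapping.lookup (K.divisor (fls_monom f n)) (curve (SymOm b)) = - mm b * v b f + em b * n"
    and "(q, 0) \<in> vertical \<Longrightarrow> Poly_Mapping.lookup (K.divisor (fls_monom f n)) (K.center (Inl (q, 0))) = v q f"
  using lookup_divisor_monom(1)[OF assms, of a "Poly_Mapping.lookup Dp a" n]
    lookup_divisor_monom(1)[OF assms, of b "Poly_Mapping.lookup Dp b" n]
    lookup_divisor_monom(1)[OF assms, of b "- Poly_Mapping.lookup Dm b" n]
    lookup_divisor_monom(1)[OF assms, of q 0 n]
    as_slope[of a] bs_slope[of b]
  by (auto simp: curve_def vertical_def)

lemma lookup_u_relation:
  "a \<in> as \<Longrightarrow> Poly_Mapping.lookup u_relation (SymO a) = e a"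
  "b \<in> bs \<Longrightarrow> Poly_Mapping.lookup u_relation (SymOp b) = ep b"
  "b \<in> bs \<Longrightarrow> Poly_Mapping.lookup u_relation (SymOm b) = - em b"
proof -
  have *: "(\<Sum>i\<in>I. f i * (if y = i then 1 else 0)) = (if y \<in> I then f y else 0)" if "finite I"
    for f :: "'k set \<Rightarrow> int" and y I
    using that by (simp add: if_distrib[of "\<lambda>z. _ * z"] cong: if_cong)
  show "a \<in> as \<Longrightarrow> Poly_Mapping.lookup u_relation (SymO a) = e a"
    "b \<in> bs \<Longrightarrow> Poly_Mapping.lookup u_relation (SymOp b) = ep b"
    "b \<in> bs \<Longrightarrow> Poly_Mapping.lookup u_relation (SymOm b) = - em b"
    by (simp_all add: u_relation_def lookup_add lookup_sum lookup_minus * finite_as finite_bs sum_negf)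
qed

text \<open>A principal divisor without horizontal part is the divisor of a homogeneous element
  \<open>f u\<^sup>n\<close>; comparing coefficients, the defect of \<open>c\<close> from being the divisor of \<open>f\<close> is made up by
  the relations at the special points, and \<open>n\<close> by the last relation.\<close>

lemma in_N_if_principal:
  assumes cx: "Poly_Mapping.keys c \<subseteq> closed_points A0" "Poly_Mapping.keys x \<subseteq> symbols"
    and pr: "total_divisor c x \<in> principal_divisors A"
  shows "element c x \<in> N"
proof -
  obtain F where F: "F \<in> fraction_set A - {0}" "total_divisor c x = K.divisor F"
    using pr unfolding K.principal_divisors_eq by blast
  have "poly_val g F = 0" if g: "g \<in> horizontal" for g
    using lookup_total_divisor(5)[OF cx g] K.lookup_divisor_center[OF F(1), of "Inr g"] g F(2)
    by (simp add: J_def)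
  then obtain f n where f: "f \<noteq> 0" "F = fls_monom f n"
    using monom_if_poly_val_zero[of F] F(1) by (auto simp: fraction_set_A)
  have fF: "f \<in> fraction_set A0 - {0}" using f by simp
  have eq: "total_divisor c x = K.divisor (fls_monom f n)" using F f by simp
  define k where "k p = Poly_Mapping.lookup c p - v p f" for p
  have xa: "Poly_Mapping.lookup x (SymO a) = - m a * k a - e a * n" if "a \<in> as" for a
    using lookup_total_divisor(1)[OF cx that] lookup_divisor_monom_symbols(1)[OF f(1) that, of n] eq
    by (simp add: k_def algebra_simps)
  have xp: "Poly_Mapping.lookup x (SymOp b) = - mp b * k b - ep b * n" if "b \<in> bs" for b
    using lookup_total_divisor(2)[OF cx that] lookup_divisor_monom_symbols(2)[OF f(1) that, of n] eq
    by (simp add: k_def algebra_simps)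
  have xm: "Poly_Mapping.lookup x (SymOm b) = mm b * k b + em b * n" if "b \<in> bs" for b
    using lookup_total_divisor(3)[OF cx that] lookup_divisor_monom_symbols(3)[OF f(1) that, of n] eq
    by (simp add: k_def algebra_simps)
  have k0: "k q = 0" if "q \<in> closed_points A0" "q \<notin> as" "q \<notin> bs" for q
  proof -
    have "(q, 0) \<in> vertical" using that other_slope by (auto simp: vertical_def)
    then show ?thesis
      using lookup_total_divisor(4)[OF cx _ that(2,3)] lookup_divisor_monom_symbols(4)[OF f(1)] eq
      by (simp add: k_def)
  qed
  define c' where "c' = (\<Sum>a\<in>as. frag_cmul (k a) (frag_of a)) + (\<Sum>b\<in>bs. frag_cmul (k b) (frag_of b))"
  \<comment> \<open>The coefficient is \<open>- n\<close> because \<open>u_relation\<close> is the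
    divisor of \<open>1/u\<close>, while the divisor at hand is that of \<open>f\<close> times the
    power \<open>n\<close> of \<open>u\<close>.\<close>
  define x' where "x' = (\<Sum>a\<in>as. frag_cmul (k a) (- a_relation a)) + (\<Sum>b\<in>bs. frag_cmul (k b) (- b_relation b))
    + frag_cmul (- n) u_relation"
  have "in_N (c' + frag_cmul (- n) 0) x'"
    unfolding c'_def x'_def by (intro in_N_add in_N_sum in_N_cmul in_N_relations)
  then have N: "in_N c' x'" by simp
  have *: "(\<Sum>i\<in>I. f i * (if y = i then g i else 0)) = (if y \<in> I then f y * g y else 0)" if "finite I"
    for f g :: "'k set \<Rightarrow> int" and y I
    using that by (simp add: if_distrib[of "\<lambda>z. _ * z"] cong: if_cong)
  have "c - C.divisor f = c'"
  proof (rule C.divisor_eqI)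
    show "Poly_Mapping.keys (c - C.divisor f) \<subseteq> height_one_primes A0"
      using cx(1) C.keys_divisor[OF fF] by (intro keys_diff_subset) (auto simp: height_one_primes_A0)
    show "Poly_Mapping.keys c' \<subseteq> height_one_primes A0"
      using N height_one_primes_A0 by (simp add: in_N_def)
    fix q assume q: "q \<in> closed_points A0"
    have "Poly_Mapping.lookup c' q = k q"
      using k0[OF q] as_bs_disjoint[of q]
      by (auto simp: c'_def lookup_add lookup_sum * finite_as finite_bs)
    then show "Poly_Mapping.lookup (c - C.divisor f) (C.center q) = Poly_Mapping.lookup c' (C.center q)"
      using C.lookup_divisor_center[OF fF q] center_eq[OF q] by (simp add: lookup_minus k_def)
  qed
  then have "c - c' = C.divisor f" by (simp add: algebra_simps)
  then have "divisor_class A0 c = divisor_class A0 c'"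
    using fF unfolding C.divisor_class_eq_iff C.principal_divisors_eq by blast
  moreover have "x = x'"
  proof (rule poly_mapping_eqI)
    fix s
    consider a where "s = SymO a" "a \<in> as" | b where "s = SymOp b" "b \<in> bs" | b where "s = SymOm b" "b \<in> bs"
      | "s \<notin> symbols" by (auto simp: symbols_def)
    then show "Poly_Mapping.lookup x s = Poly_Mapping.lookup x' s"
    proof cases
      case 1
      then show ?thesis using xa[OF 1(2)]
        by (simp add: x'_def lookup_a_relation lookup_b_relation lookup_add lookup_sum lookup_u_relation
            mult.assoc[symmetric] * finite_as finite_bs sum_negf)
    next
      case 2
      then show ?thesis using xp[OF 2(2)]
        by (simp add: x'_def lookup_a_relation lookup_b_relation lookup_add lookup_sum lookup_u_relation
            right_diff_distrib mult.assoc[symmetric] * finite_as finite_bs sum_negf)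
    next
      case 3
      then show ?thesis using xm[OF 3(2)]
        by (simp add: x'_def lookup_a_relation lookup_b_relation lookup_add lookup_sum lookup_u_relation
            right_diff_distrib mult.assoc[symmetric] * finite_as finite_bs sum_negf)
    next
      case 4
      then have "s \<notin> Poly_Mapping.keys x" "s \<notin> Poly_Mapping.keys x'" using cx N by (auto simp: in_N_def)
      then show ?thesis by (simp add: in_keys_iff)
    qed
  qed
  ultimately show ?thesis using N by (simp add: in_N_def element_def)
qed

text \<open>The fiber relations vanish already as divisors, since the pullback carries exactly the
  multiplicities \<open>den\<close>. In the last one, \<open>u\<close> has weights
  \<open>- e\<close>, \<open>- ep\<close> and \<open>em\<close> on the three kinds of curves, which
  are opposite to the coefficients of \<open>u_relation\<close>.\<close>

lemma total_divisor_relations: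
  shows "a \<in> as \<Longrightarrow> total_divisor (frag_of a) (- a_relation a) = 0"
    and "b \<in> bs \<Longrightarrow> total_divisor (frag_of b) (- b_relation b) = 0"
    and "total_divisor 0 u_relation = K.divisor (fls_monom 1 (- 1))"
proof -
  assume a: "a \<in> as"
  have k: "Poly_Mapping.keys (frag_of a) \<subseteq> closed_points A0" "Poly_Mapping.keys (- a_relation a) \<subseteq> symbols"
    using keys_a_relation[OF a] as_slope(1)[OF a] by auto
  show "total_divisor (frag_of a) (- a_relation a) = 0"
    by (rule divisor_eqI_symbols[OF keys_total_divisor[OF k]])
      (use a as_bs_disjoint in \<open>auto simp: lookup_total_divisor[OF k] lookup_a_relation\<close>)
next
  assume b: "b \<in> bs"
  have k: "Poly_Mapping.keys (frag_of b) \<subseteq> closed_points A0" "Poly_Mapping.keys (- b_relation b) \<subseteq> symbols"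
    using keys_b_relation[OF b] bs_slope(1)[OF b] by auto
  show "total_divisor (frag_of b) (- b_relation b) = 0"
    by (rule divisor_eqI_symbols[OF keys_total_divisor[OF k]])
      (use b as_bs_disjoint in \<open>auto simp: lookup_total_divisor[OF k] lookup_b_relation\<close>)
next
  have k: "Poly_Mapping.keys 0 \<subseteq> closed_points A0" by simp
  have F: "fls_monom 1 (- 1) \<in> fraction_set A - {0}"
    by (auto simp: fraction_set_A intro: in_fraction_set_laurent)
  have v1: "v q 1 = 0" if "(q, d) \<in> vertical" for q d
    using that by (auto simp: vertical_def)
  show "total_divisor 0 u_relation = K.divisor (fls_monom 1 (- 1))"
    by (rule divisor_eqI_symbols[OF keys_total_divisor[OF k keys_u_relation] K.keys_divisor[OF F]])
      (use as_slope(1) bs_slope(1) v1 in \<open>auto simp: lookup_total_divisor[OF k keys_u_relation]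
        lookup_divisor_monom_symbols lookup_divisor_monom lookup_u_relation\<close>)
qed

text \<open>\<open>\<Phi>\<close> is defined on classes through a chosen representative. Another
  choice changes the total divisor by the pullback of a principal divisor, which is
  principal.\<close>

lemma exists_class_hom:
  obtains \<Phi> where "\<Phi> \<in> hom G (class_group A)"
    "\<And>c x. Poly_Mapping.keys c \<subseteq> closed_points A0 \<Longrightarrow> Poly_Mapping.keys x \<subseteq> symbols \<Longrightarrow>
      \<Phi> (element c x) = divisor_class A (total_divisor c x)"
proof -
  define \<Phi> where "\<Phi> r = divisor_class A (total_divisor
    (SOME c. Poly_Mapping.keys c \<subseteq> closed_points A0 \<and> fst r = divisor_class A0 c) (snd r))"
    for r :: "('k set \<Rightarrow>\<^sub>0 int) set \<times> ('k set orbit_symbol \<Rightarrow>\<^sub>0 int)"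
  have eq: "\<Phi> (element c x) = divisor_class A (total_divisor c x)"
    if c: "Poly_Mapping.keys c \<subseteq> closed_points A0" for c x
  proof -
    define c' where "c' = (SOME c'. Poly_Mapping.keys c' \<subseteq> closed_points A0 \<and> divisor_class A0 c = divisor_class A0 c')"
    have c': "Poly_Mapping.keys c' \<subseteq> closed_points A0 \<and> divisor_class A0 c = divisor_class A0 c'"
      unfolding c'_def by (rule someI[of _ c]) (use c in simp)
    then have "pullback (c' - c) \<in> principal_divisors A"
      using pullback_principal C.divisor_class_eq_iff by metis
    moreover have "total_divisor c' x - total_divisor c x = pullback (c' - c)"
      by (simp add: total_divisor_def pullback_def frag_extend_diff)
    ultimately have "divisor_class A (total_divisor c' x) = divisor_class A (total_divisor c x)"
      unfolding K.divisor_class_eq_iff by simp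
    then show ?thesis by (simp add: \<Phi>_def element_def c'_def)
  qed
  have "\<Phi> \<in> hom G (class_group A)"
  proof (rule homI)
    fix r assume "r \<in> carrier G"
    then obtain c x where r: "r = element c x" "Poly_Mapping.keys c \<subseteq> closed_points A0" "Poly_Mapping.keys x \<subseteq> symbols"
      unfolding carrier_G by blast
    then show "\<Phi> r \<in> carrier (class_group A)"
      using eq keys_total_divisor by (auto simp: K.carrier_class_group)
    fix s assume "s \<in> carrier G"
    then obtain c' x' where s: "s = element c' x'" "Poly_Mapping.keys c' \<subseteq> closed_points A0" "Poly_Mapping.keys x' \<subseteq> symbols"
      unfolding carrier_G by blast
    have "\<Phi> (r \<otimes>\<^bsub>G\<^esub> s) = divisor_class A (total_divisor (c + c') (x + x'))"
      using r s element_mult[OF r(2) s(2)] eq keys_plus_subset[OF r(2) s(2)] by simp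
    also have "\<dots> = \<Phi> r \<otimes>\<^bsub>class_group A\<^esub> \<Phi> s"
      using K.divisor_class_mult[OF keys_total_divisor[OF r(2,3)] keys_total_divisor[OF s(2,3)]] r s eq
      by (simp add: total_divisor_add)
    finally show "\<Phi> (r \<otimes>\<^bsub>G\<^esub> s) = \<Phi> r \<otimes>\<^bsub>class_group A\<^esub> \<Phi> s" .
  qed
  then show ?thesis using that eq by blast
qed

text \<open>The class of \<open>D\<close> is in the image of the homomorphism; stated for divisors
  so that induction over their support applies.\<close>

definition generated :: "('k fls set \<Rightarrow>\<^sub>0 int) \<Rightarrow> bool" where
  "generated D \<longleftrightarrow> (\<exists>c x. Poly_Mapping.keys c \<subseteq> closed_points A0 \<and> Poly_Mapping.keys x \<subseteq> symbols \<and>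
    D - total_divisor c x \<in> principal_divisors A)"

lemma generated_principal: "D \<in> principal_divisors A \<Longrightarrow> generated D"
  unfolding generated_def
  by (intro exI[of _ 0]) (simp add: total_divisor_def pullback_def curve_divisor_def)

lemma generated_diff:
  assumes "generated D" "generated E" shows "generated (D - E)"
proof -
  obtain c x c' x' where cx: "Poly_Mapping.keys c \<subseteq> closed_points A0" "Poly_Mapping.keys x \<subseteq> symbols"
    "D - total_divisor c x \<in> principal_divisors A"
    "Poly_Mapping.keys c' \<subseteq> closed_points A0" "Poly_Mapping.keys x' \<subseteq> symbols"
    "E - total_divisor c' x' \<in> principal_divisors A"
    using assms unfolding generated_def by blast
  have "(D - E) - total_divisor (c - c') (x - x') = (D - total_divisor c x) - (E - total_divisor c' x')"
    by (simp add: total_divisor_def pullback_def curve_divisor_def frag_extend_diff)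
  then have "(D - E) - total_divisor (c - c') (x - x') \<in> principal_divisors A"
    using K.principal_diff[OF cx(3,6)] by (simp only:)
  then show ?thesis unfolding generated_def
    using keys_diff_subset[OF cx(1,4)] keys_diff_subset[OF cx(2,5)] by blast
qed

text \<open>Either the prime belongs to a symbol, or its point has slope 0 only and, as
  \<open>den 0 = 1\<close>, it equals the pullback of that point.\<close>

lemma generated_vertical:
  assumes "j \<in> vertical"
  shows "generated (frag_of (K.center (Inl j)))"
proof -
  obtain q d where j: "j = (q, d)" by (cases j)
  have jv: "(q, d) \<in> vertical" using assms j by simp
  then show ?thesis
  proof (cases rule: vertical_cases)
    case (1 s)
    have "total_divisor 0 (frag_of s) = frag_of (K.center (Inl j))"
      using 1 j by (simp add: total_divisor_def pullback_def curve_divisor_def curve_def)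
    then show ?thesis unfolding generated_def using 1(1) K.zero_principal
      by (intro exI[of _ 0] exI[of _ "frag_of s"]) auto
  next
    case 2
    have q: "q \<in> closed_points A0" using jv by (auto simp: vertical_def)
    have k: "Poly_Mapping.keys (frag_of q) \<subseteq> closed_points A0" "Poly_Mapping.keys 0 \<subseteq> symbols"
      using q by auto
    have inj: "K.center i = K.center i' \<longleftrightarrow> i = i'" if "i \<in> J" "i' \<in> J" for i i'
      using K.inj_on_center that by (auto simp: inj_on_def)
    have jJ: "Inl (q, 0) \<in> J" using jv 2 by (auto simp: J_def)
    have "total_divisor (frag_of q) 0 = frag_of (K.center (Inl (q, 0)))"
    proof (rule divisor_eqI_A[OF keys_total_divisor[OF k]])
      show "Poly_Mapping.keys (frag_of (K.center (Inl (q, 0)))) \<subseteq> height_one_primes A"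
        using center_height_one[OF jJ] by simp
      fix q' d' assume v': "(q', d') \<in> vertical"
      have "q' = q \<Longrightarrow> d' = 0" using v' other_slope[OF q 2(1,2)] by (auto simp: vertical_def)
      then show "Poly_Mapping.lookup (total_divisor (frag_of q) 0) (K.center (Inl (q', d'))) =
          Poly_Mapping.lookup (frag_of (K.center (Inl (q, 0)))) (K.center (Inl (q', d')))"
        using lookup_pullback(1)[OF k(1) v'] inj[OF _ jJ, of "Inl (q', d')"] v'
        by (auto simp: total_divisor_def curve_divisor_def J_def)
    next
      fix g :: "'k poly" assume g: "g \<in> horizontal"
      then show "Poly_Mapping.lookup (total_divisor (frag_of q) 0) (K.center (Inr g)) =
          Poly_Mapping.lookup (frag_of (K.center (Inl (q, 0)))) (K.center (Inr g))"
        using lookup_total_divisor(5)[OF k g] inj[OF _ jJ, of "Inr g"] by (auto simp: J_def)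
    qed
    then show ?thesis unfolding generated_def using k j 2(3) K.zero_principal
      by (intro exI[of _ "frag_of q"] exI[of _ 0]) auto
  qed
qed

text \<open>The polynomial \<open>g\<close> has value 1 at its own prime and 0 at all other
  horizontal ones. Up to its principal divisor the prime is thus a combination of vertical
  primes.\<close>

lemma generated_horizontal:
  assumes g: "g \<in> horizontal"
  shows "generated (frag_of (K.center (Inr g)))"
proof -
  define D where "D = K.divisor (fls_of_poly g)"
  have F: "fls_of_poly g \<in> fraction_set A - {0}"
    using horizontal_monic[OF g] by (auto simp: fraction_set_A intro: in_fraction_set_laurent)
  have gJ: "Inr g \<in> J" using g by (auto simp: J_def)
  have "Poly_Mapping.keys (D - frag_of (K.center (Inr g))) \<subseteq> (\<lambda>j. K.center (Inl j)) ` vertical"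
  proof
    fix P assume P: "P \<in> Poly_Mapping.keys (D - frag_of (K.center (Inr g)))"
    moreover have "Poly_Mapping.keys (D - frag_of (K.center (Inr g))) \<subseteq> height_one_primes A"
      using K.keys_divisor[OF F] center_height_one[OF gJ] unfolding D_def by (intro keys_diff_subset) auto
    ultimately obtain j where j: "j \<in> J" "P = K.center j" using K.height_one_primes_eq by auto
    have nz: "Poly_Mapping.lookup D (K.center j) \<noteq> Poly_Mapping.lookup (frag_of (K.center (Inr g))) (K.center j)"
      using P j by (simp add: in_keys_iff lookup_minus)
    show "P \<in> (\<lambda>j. K.center (Inl j)) ` vertical"
    proof (cases j)
      case (Inl i)
      then show ?thesis using j by (auto simp: J_def)
    next
      case (Inr h)
      then have h: "h \<in> horizontal" using j by (auto simp: J_def)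
      have "Poly_Mapping.lookup D (K.center j) = poly_val h (fls_of_poly g)"
        using K.lookup_divisor_center[OF F j(1)] Inr by (simp add: D_def)
      moreover have "K.center j = K.center (Inr g) \<longleftrightarrow> h = g"
        using K.inj_on_center j(1) gJ Inr by (auto simp: inj_on_def)
      moreover have "poly_val h (fls_of_poly g) = (if h = g then 1 else 0)"
        using poly_val_self[OF horizontal_monic(1)[OF g]]
          poly_val_pos_iff[OF horizontal_monic(1)[OF h] horizontal_monic(2)[OF g]]
          poly_val_of_poly_nonneg[OF horizontal_monic(1)[OF h] horizontal_monic(2)[OF g]]
          monic_irreducible_dvd_eq[OF horizontal_monic(1)[OF h] horizontal_monic(1)[OF g]] by auto
      ultimately show ?thesis using nz by auto
    qed
  qed
  then have "generated (D - frag_of (K.center (Inr g)))"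
  proof (induction rule: frag_induction)
    case zero
    then show ?case using generated_principal K.zero_principal by blast
  next
    case (one P)
    then show ?case using generated_vertical by auto
  next
    case (diff a b)
    then show ?case using generated_diff by blast
  qed
  moreover have "generated D" using generated_principal F unfolding D_def K.principal_divisors_eq by blast
  ultimately have "generated (D - (D - frag_of (K.center (Inr g))))" by (rule generated_diff[rotated])
  then show ?thesis by simp
qed

lemma generated_all:
  assumes "Poly_Mapping.keys D \<subseteq> height_one_primes A"
  shows "generated D"
  using assms
proof (induction rule: frag_induction)
  case zero
  then show ?case using generated_principal K.zero_principal by blast
next
  case (one P)
  then obtain j where "j \<in> J" "P = K.center j" using K.height_one_primes_eq by auto
  then show ?case using generated_vertical generated_horizontal by (auto simp: J_def)
next
  case (diff a b)
  then show ?case using generated_diff by blast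
qed

lemma element_relation_kernel:
  assumes \<Phi>: "\<And>c x. Poly_Mapping.keys c \<subseteq> closed_points A0 \<Longrightarrow> Poly_Mapping.keys x \<subseteq> symbols \<Longrightarrow>
      \<Phi> (element c x) = divisor_class A (total_divisor c x)"
  shows "relations \<subseteq> kernel G (class_group A) \<Phi>"
proof
  fix r assume r: "r \<in> relations"
  have F: "fls_monom 1 (- 1) \<in> fraction_set A - {0}"
    by (auto simp: fraction_set_A intro: in_fraction_set_laurent)
  have one: "divisor_class A D = \<one>\<^bsub>class_group A\<^esub>" if "D \<in> principal_divisors A" for D
    unfolding K.one_class_group K.divisor_class_eq_iff using that by simp
  consider a where "a \<in> as" "r = element (frag_of a) (- a_relation a)"
    | b where "b \<in> bs" "r = element (frag_of b) (- b_relation b)" | "r = element 0 u_relation"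
    using r unfolding relations_eq a_relation_def b_relation_def by blast
  then have "\<Phi> r = \<one>\<^bsub>class_group A\<^esub>"
  proof cases
    case 1
    then show ?thesis
      using \<Phi> keys_a_relation as_slope(1) total_divisor_relations(1) one K.zero_principal by simp
  next
    case 2
    then show ?thesis
      using \<Phi> keys_b_relation bs_slope(1) total_divisor_relations(2) one K.zero_principal by simp
  next
    case 3
    have "K.divisor (fls_monom 1 (- 1)) \<in> principal_divisors A"
      using F unfolding K.principal_divisors_eq by blast
    then show ?thesis using 3 \<Phi>[of 0] keys_u_relation total_divisor_relations(3) one by simp
  qed
  then show "r \<in> kernel G (class_group A) \<Phi>" using r relations_subset by (auto simp: kernel_def)
qed

text \<open>First isomorphism theorem: the kernel is \<open>N\<close> by
  \<open>element_relation_kernel\<close> and \<open>in_N_if_principal\<close>, and surjectivity is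
  \<open>generated_all\<close>. The formula on cosets is kept because the identification of the
  generators rests on it.\<close>

theorem class_group_presentation:
  "\<exists>\<phi> \<in> iso (G Mod N) (class_group A).
    (\<forall>c x. Poly_Mapping.keys c \<subseteq> closed_points A0 \<longrightarrow> Poly_Mapping.keys x \<subseteq> symbols \<longrightarrow>
      \<phi> (N #>\<^bsub>G\<^esub> element c x) = divisor_class A (total_divisor c x))"
proof -
  obtain \<Phi> where hom: "\<Phi> \<in> hom G (class_group A)"
    and \<Phi>: "\<And>c x. Poly_Mapping.keys c \<subseteq> closed_points A0 \<Longrightarrow> Poly_Mapping.keys x \<subseteq> symbols \<Longrightarrow>
      \<Phi> (element c x) = divisor_class A (total_divisor c x)"
    using exists_class_hom by blast
  interpret \<Phi>: group_hom G "class_group A" \<Phi>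
    using hom group_G K.comm_group_class_group by (simp add: group_hom_def group_hom_axioms_def comm_group_def)
  have kernel: "kernel G (class_group A) \<Phi> = N"
  proof (intro equalityI subsetI)
    fix r assume "r \<in> kernel G (class_group A) \<Phi>"
    then have r: "r \<in> carrier G" "\<Phi> r = \<one>\<^bsub>class_group A\<^esub>" by (auto simp: kernel_def)
    then obtain c x where cx: "r = element c x" "Poly_Mapping.keys c \<subseteq> closed_points A0" "Poly_Mapping.keys x \<subseteq> symbols"
      unfolding carrier_G by blast
    have "total_divisor c x \<in> principal_divisors A"
      using r(2) \<Phi>[OF cx(2,3)] K.divisor_class_eq_iff[of "total_divisor c x" 0] cx(1)
      by (simp add: K.one_class_group)
    then show "r \<in> N" using in_N_if_principal cx by blast
  next
    have "N \<subseteq> kernel G (class_group A) \<Phi>"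
      by (rule group.generate_subgroup_incl[OF group_G element_relation_kernel[OF \<Phi>] \<Phi>.subgroup_kernel])
    then show "r \<in> N \<Longrightarrow> r \<in> kernel G (class_group A) \<Phi>" for r by blast
  qed
  have surj: "\<Phi> ` carrier G = carrier (class_group A)"
  proof (intro equalityI subsetI)
    fix Y assume "Y \<in> carrier (class_group A)"
    then obtain D where D: "Y = divisor_class A D" "Poly_Mapping.keys D \<subseteq> height_one_primes A"
      by (auto simp: K.carrier_class_group)
    obtain c x where cx: "Poly_Mapping.keys c \<subseteq> closed_points A0" "Poly_Mapping.keys x \<subseteq> symbols"
      "D - total_divisor c x \<in> principal_divisors A"
      using generated_all[OF D(2)] unfolding generated_def by (elim exE conjE)
    then have "Y = \<Phi> (element c x)" using D \<Phi> K.divisor_class_eq_iff by simp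
    then show "Y \<in> \<Phi> ` carrier G" using cx unfolding carrier_G by blast
  qed (use \<Phi>.hom_closed in auto)
  define \<phi> where "\<phi> S = the_elem (\<Phi> ` S)" for S
  have "\<phi> \<in> iso (G Mod N) (class_group A)"
    using \<Phi>.FactGroup_iso_set[OF surj] kernel by (simp add: \<phi>_def[abs_def])
  moreover have "\<phi> (N #>\<^bsub>G\<^esub> element c x) = divisor_class A (total_divisor c x)"
    if cx: "Poly_Mapping.keys c \<subseteq> closed_points A0" "Poly_Mapping.keys x \<subseteq> symbols" for c x
  proof -
    have r: "element c x \<in> carrier G" using cx unfolding carrier_G by blast
    have "\<Phi> (h \<otimes>\<^bsub>G\<^esub> element c x) = \<Phi> (element c x)" if "h \<in> N" for h
      using that r unfolding kernel[symmetric] kernel_def by simp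
    moreover have "N \<noteq> {}" using subgroup.one_closed[OF subgroup_N] by blast
    ultimately have "\<Phi> ` (N #>\<^bsub>G\<^esub> element c x) = {\<Phi> (element c x)}"
      unfolding r_coset_def by auto
    then show ?thesis using \<Phi>[OF cx] by (simp add: \<phi>_def)
  qed
  ultimately show ?thesis by blast
qed

end

text \<open>The clauses on \<open>\<phi>\<close> prescribe it on the classes of points and on all
  symbols, which generate the group. This makes the isomorphism the geometric one and ties the
  symbols to the orbit closures.\<close>

theorem theorem4p22:
  fixes \<iota> :: "complex \<Rightarrow> 'k::field" and A0 :: "'k set"
    and Dp Dm :: "'k set \<Rightarrow>\<^sub>0 rat"
    and A :: "'k fls set" and as bs :: "'k set set"
    and e m ep mp em mm :: "'k set \<Rightarrow> int"
    and G :: "(('k set \<Rightarrow>\<^sub>0 int) set \<times> ('k set orbit_symbol \<Rightarrow>\<^sub>0 int)) monoid"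
    and N :: "(('k set \<Rightarrow>\<^sub>0 int) set \<times> ('k set orbit_symbol \<Rightarrow>\<^sub>0 int)) set"
  assumes curve: "smooth_affine_curve \<iota> A0"
    and divisors: "Poly_Mapping.keys Dp \<subseteq> closed_points A0"
      "Poly_Mapping.keys Dm \<subseteq> closed_points A0"
    and nonpos: "\<And>p. p \<in> closed_points A0 \<Longrightarrow>
      Poly_Mapping.lookup Dp p + Poly_Mapping.lookup Dm p \<le> 0"
    and A: "A = DPD_algebra A0 Dp Dm"
    and as: "as = a_points A0 Dp Dm"
    and bs: "bs = b_points A0 Dp Dm"
    and a_coeffs: "\<And>a. a \<in> as \<Longrightarrow> m a > 0 \<and> gcd (e a) (m a) = 1
      \<and> Poly_Mapping.lookup Dp a = - (of_int (e a) / of_int (m a))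
      \<and> Poly_Mapping.lookup Dm a = of_int (e a) / of_int (m a)"
    and bp_coeffs: "\<And>b. b \<in> bs \<Longrightarrow> mp b > 0 \<and> gcd (ep b) (mp b) = 1
      \<and> Poly_Mapping.lookup Dp b = - (of_int (ep b) / of_int (mp b))"
    and bm_coeffs: "\<And>b. b \<in> bs \<Longrightarrow> mm b < 0 \<and> gcd (em b) (mm b) = 1
      \<and> Poly_Mapping.lookup Dm b = of_int (em b) / of_int (mm b)"
    and G: "G = free_presentation A0 as bs"
    and N: "N = generate G (class_relations A0 as bs e m ep mp em mm)"
  shows "\<exists>\<phi> \<in> iso (G Mod N) (class_group A).
    (\<forall>p \<in> closed_points A0.
       \<phi> (N #>\<^bsub>G\<^esub> (divisor_class A0 (frag_of p), 0))
         = divisor_class A (pullback_divisor A0 A p)) \<and>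
    (\<forall>a \<in> as. \<phi> (N #>\<^bsub>G\<^esub> (\<one>\<^bsub>class_group A0\<^esub>, frag_of (SymO a)))
         = divisor_class A (frag_of (curve_O A0 Dp Dm a))) \<and>
    (\<forall>b \<in> bs. \<phi> (N #>\<^bsub>G\<^esub> (\<one>\<^bsub>class_group A0\<^esub>, frag_of (SymOp b)))
         = divisor_class A (frag_of (curve_Op \<iota> A0 Dp Dm b))) \<and>
    (\<forall>b \<in> bs. \<phi> (N #>\<^bsub>G\<^esub> (\<one>\<^bsub>class_group A0\<^esub>, frag_of (SymOm b)))
         = divisor_class A (frag_of (curve_Om \<iota> A0 Dp Dm b)))"
proof -
  interpret P: dpd_presentation \<iota> A0 Dp Dm as bs e m ep mp em mm
    by unfold_locales (fact assms)+
  obtain \<phi> where iso: "\<phi> \<in> iso (G Mod N) (class_group A)"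
    and \<phi>: "\<And>c x. Poly_Mapping.keys c \<subseteq> closed_points A0 \<Longrightarrow> Poly_Mapping.keys x \<subseteq> P.symbols \<Longrightarrow>
      \<phi> (N #>\<^bsub>G\<^esub> (divisor_class A0 c, x)) = divisor_class A (P.total_divisor c x)"
    using P.class_group_presentation unfolding A N G P.element_def by blast
  \<comment> \<open>The neutral element is the class of \<open>c = 0\<close>, whose pullback is
    zero, so only the curve of the symbol contributes.\<close>
  have curve_class: "\<phi> (N #>\<^bsub>G\<^esub> (\<one>\<^bsub>class_group A0\<^esub>, frag_of s)) = divisor_class A (frag_of (P.curve s))"
    if "s \<in> P.symbols" for s
    using \<phi>[of 0 "frag_of s"] that
    by (simp add: P.C.one_class_group P.total_divisor_def P.pullback_def P.curve_divisor_def)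
  show ?thesis
  proof (intro bexI[OF _ iso] conjI ballI)
    fix p assume "p \<in> closed_points A0"
    then show "\<phi> (N #>\<^bsub>G\<^esub> (divisor_class A0 (frag_of p), 0)) = divisor_class A (pullback_divisor A0 A p)"
      using \<phi>[of "frag_of p" 0]
      by (simp add: P.total_divisor_def P.pullback_def P.curve_divisor_def A)
  next
    fix a assume "a \<in> as"
    then show "\<phi> (N #>\<^bsub>G\<^esub> (\<one>\<^bsub>class_group A0\<^esub>, frag_of (SymO a))) = divisor_class A (frag_of (curve_O A0 Dp Dm a))"
      using curve_class[OF P.symbols_mem(1)] P.curve_O_eq P.as_slope(1,5) by (simp add: P.curve_def)
  next
    fix b assume "b \<in> bs"
    then show "\<phi> (N #>\<^bsub>G\<^esub> (\<one>\<^bsub>class_group A0\<^esub>, frag_of (SymOp b))) = divisor_class A (frag_of (curve_Op \<iota> A0 Dp Dm b))"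
      using curve_class[OF P.symbols_mem(2)] P.curve_Op_eq P.bs_slope(1) by (simp add: P.curve_def)
  next
    fix b assume "b \<in> bs"
    then show "\<phi> (N #>\<^bsub>G\<^esub> (\<one>\<^bsub>class_group A0\<^esub>, frag_of (SymOm b))) = divisor_class A (frag_of (curve_Om \<iota> A0 Dp Dm b))"
      using curve_class[OF P.symbols_mem(3)] P.curve_Om_eq P.bs_slope(1) by (simp add: P.curve_def)
  qed
qed

end
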